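(* Let $A$ be an operator algebra. The class of all kernel-cokernel pairs in $\mathcal{OM}od_A^\infty$ forms an exact structure on $\mathcal{OM}od_A^\infty$.
   Context: Operator spaces are complete complex matrix normed spaces satisfying Ruan's axioms (equivalently, closed subspaces of $B(H)$, $H$ a Hilbert space). An operator algebra is a closed subalgebra $A$ of some $B(H)$ containing a contractive approximate identity. $\otimes_h$ is the (completed) Haagerup tensor product. A right operator $A$-module is a right $A$-module $E$ that is also an operator space such that the map $E\otimes_h A\to E$ induced by the module action is completely contractive; it is non-degenerate if the linear span of $\{x\cdot a: x\in E, a\in A\}$ is dense in $E$. $\mathcal{OM}od_A^\infty$ is the additive category of non-degenerate right operator $A$-modules with the completely bounded $A$-module maps as morphisms. In an additive category $\mathcal A$, a kernel-cokernel pair is a pair $(\mu,\pi)$ of composable morphisms $K\xrightarrow{\mu}E\xrightarrow{\pi}C$ such that $\mu$ is a kernel of $\pi$ and $\pi$ is a cokernel of $\mu$. Given a class $\mathcal{E}x$ of kernel-cokernel pairs, $\mu$ (resp. $\pi$) is an admissible monomorphism (resp. epimorphism) if $(\mu,\pi)\in\mathcal{E}x$ for some $\pi$ (resp. some $\mu$). An exact structure on $\mathcal A$ is a class $\mathcal{E}x$ of kernel-cokernel pairs, closed under isomorphisms, such that: [E0] every identity morphism is an admissible monomorphism; [E0$^{op}$] every identity morphism is an admissible epimorphism; [E1] admissible monomorphisms are closed under composition; [E1$^{op}$] admissible epimorphisms are closed under composition; [E2] the pushout of an admissible monomorphism along an arbitrary morphism exists and yields an admissible monomorphism; [E2$^{op}$]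 the pullback of an admissible epimorphism along an arbitrary morphism exists and yields an admissible epimorphism. *)

theory Defs
  imports "HOL-Analysis.Analysis" "HOL-Algebra.Module"
begin

section \<open>Additive categories and exact structures\<close>

text \<open>Arrows carry their domain and codomain. \<open>Plus\<close> and \<open>Null\<close> are the addition of parallel
  arrows and the zero arrow between two objects; \<open>Cmp C g f\<close> is ``g after f''.\<close>

record ('o, 'm) category =
  Obj :: "'o set"
  Arr :: "'m set"
  Dom :: "'m \<Rightarrow> 'o"
  Cod :: "'m \<Rightarrow> 'o"
  Idn :: "'o \<Rightarrow> 'm"
  Cmp :: "'m \<Rightarrow> 'm \<Rightarrow> 'm"
  Plus :: "'m \<Rightarrow> 'm \<Rightarrow> 'm"
  Null :: "'o \<Rightarrow> 'o \<Rightarrow> 'm"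

definition Hom :: "('o, 'm, 'z) category_scheme \<Rightarrow> 'o \<Rightarrow> 'o \<Rightarrow> 'm set" where
  "Hom C a b = {f \<in> Arr C. Dom C f = a \<and> Cod C f = b}"

definition is_category :: "('o, 'm, 'z) category_scheme \<Rightarrow> bool" where
  "is_category C \<longleftrightarrow>
     (\<forall>f\<in>Arr C. Dom C f \<in> Obj C \<and> Cod C f \<in> Obj C) \<and>
     (\<forall>a\<in>Obj C. Idn C a \<in> Hom C a a) \<and>
     (\<forall>f\<in>Arr C. \<forall>g\<in>Arr C. Cod C f = Dom C g \<longrightarrow> Cmp C g f \<in> Hom C (Dom C f) (Cod C g)) \<and>
     (\<forall>f\<in>Arr C. Cmp C f (Idn C (Dom C f)) = f \<and> Cmp C (Idn C (Cod C f)) f = f) \<and>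
     (\<forall>f\<in>Arr C. \<forall>g\<in>Arr C. \<forall>h\<in>Arr C. Cod C f = Dom C g \<and> Cod C g = Dom C h \<longrightarrow>
        Cmp C h (Cmp C g f) = Cmp C (Cmp C h g) f)"

definition is_preadditive :: "('o, 'm, 'z) category_scheme \<Rightarrow> bool" where
  "is_preadditive C \<longleftrightarrow> is_category C \<and>
     (\<forall>a\<in>Obj C. \<forall>b\<in>Obj C.
        comm_group \<lparr>carrier = Hom C a b, mult = Plus C, one = Null C a b\<rparr>) \<and>
     (\<forall>a\<in>Obj C. \<forall>b\<in>Obj C. \<forall>c\<in>Obj C. \<forall>f\<in>Hom C a b. \<forall>f'\<in>Hom C a b. \<forall>g\<in>Hom C b c. \<forall>g'\<in>Hom C b c.
        Cmp C g (Plus C f f') = Plus C (Cmp C g f) (Cmp C g f') \<and>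
        Cmp C (Plus C g g') f = Plus C (Cmp C g f) (Cmp C g' f))"

definition is_zero_object :: "('o, 'm, 'z) category_scheme \<Rightarrow> 'o \<Rightarrow> bool" where
  "is_zero_object C z \<longleftrightarrow> z \<in> Obj C \<and>
     (\<forall>a\<in>Obj C. (\<exists>!f. f \<in> Hom C z a) \<and> (\<exists>!f. f \<in> Hom C a z))"

definition is_biproduct ::
  "('o, 'm, 'z) category_scheme \<Rightarrow> 'o \<Rightarrow> 'o \<Rightarrow> 'o \<Rightarrow> 'm \<Rightarrow> 'm \<Rightarrow> 'm \<Rightarrow> 'm \<Rightarrow> bool" where
  "is_biproduct C a b s i j p q \<longleftrightarrow> s \<in> Obj C \<and>
     i \<in> Hom C a s \<and> j \<in> Hom C b s \<and> p \<in> Hom C s a \<and> q \<in> Hom C s b \<and>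
     Cmp C p i = Idn C a \<and> Cmp C q j = Idn C b \<and>
     Cmp C p j = Null C b a \<and> Cmp C q i = Null C a b \<and>
     Plus C (Cmp C i p) (Cmp C j q) = Idn C s"

definition is_additive :: "('o, 'm, 'z) category_scheme \<Rightarrow> bool" where
  "is_additive C \<longleftrightarrow> is_preadditive C \<and> (\<exists>z. is_zero_object C z) \<and>
     (\<forall>a\<in>Obj C. \<forall>b\<in>Obj C. \<exists>s i j p q. is_biproduct C a b s i j p q)"

definition is_iso :: "('o, 'm, 'z) category_scheme \<Rightarrow> 'm \<Rightarrow> bool" where
  "is_iso C f \<longleftrightarrow> f \<in> Arr C \<and>
     (\<exists>g\<in>Hom C (Cod C f) (Dom C f). Cmp C g f = Idn C (Dom C f) \<and> Cmp C f g = Idn C (Cod C f))"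

definition is_kernel :: "('o, 'm, 'z) category_scheme \<Rightarrow> 'm \<Rightarrow> 'm \<Rightarrow> bool" where
  "is_kernel C \<mu> \<pi> \<longleftrightarrow> \<mu> \<in> Arr C \<and> \<pi> \<in> Arr C \<and> Cod C \<mu> = Dom C \<pi> \<and>
     Cmp C \<pi> \<mu> = Null C (Dom C \<mu>) (Cod C \<pi>) \<and>
     (\<forall>f\<in>Arr C. Cod C f = Dom C \<pi> \<and> Cmp C \<pi> f = Null C (Dom C f) (Cod C \<pi>) \<longrightarrow>
        (\<exists>!g. g \<in> Hom C (Dom C f) (Dom C \<mu>) \<and> Cmp C \<mu> g = f))"

definition is_cokernel :: "('o, 'm, 'z) category_scheme \<Rightarrow> 'm \<Rightarrow> 'm \<Rightarrow> bool" where
  "is_cokernel C \<pi> \<mu> \<longleftrightarrow> \<pi> \<in> Arr C \<and> \<mu> \<in> Arr C \<and> Cod C \<mu> = Dom C \<pi> \<and>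
     Cmp C \<pi> \<mu> = Null C (Dom C \<mu>) (Cod C \<pi>) \<and>
     (\<forall>f\<in>Arr C. Dom C f = Cod C \<mu> \<and> Cmp C f \<mu> = Null C (Dom C \<mu>) (Cod C f) \<longrightarrow>
        (\<exists>!g. g \<in> Hom C (Cod C \<pi>) (Cod C f) \<and> Cmp C g \<pi> = f))"

definition kernel_cokernel_pairs :: "('o, 'm, 'z) category_scheme \<Rightarrow> ('m \<times> 'm) set" where
  "kernel_cokernel_pairs C = {(\<mu>, \<pi>). is_kernel C \<mu> \<pi> \<and> is_cokernel C \<pi> \<mu>}"

text \<open>\<open>is_pushout C f g f' g'\<close>: the square \<open>f' \<circ> f = g' \<circ> g\<close> is a pushout of the span \<open>f\<close>, \<open>g\<close>,
  so \<open>g'\<close> is the pushout of \<open>f\<close> along \<open>g\<close>. \<open>is_pullback C f g f' g'\<close>: the square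
  \<open>f \<circ> f' = g \<circ> g'\<close> is a pullback of the cospan \<open>f\<close>, \<open>g\<close>, so \<open>g'\<close> is the pullback of \<open>f\<close>
  along \<open>g\<close>.\<close>

definition is_pushout :: "('o, 'm, 'z) category_scheme \<Rightarrow> 'm \<Rightarrow> 'm \<Rightarrow> 'm \<Rightarrow> 'm \<Rightarrow> bool" where
  "is_pushout C f g f' g' \<longleftrightarrow> {f, g, f', g'} \<subseteq> Arr C \<and>
     Dom C f = Dom C g \<and> Dom C f' = Cod C f \<and> Dom C g' = Cod C g \<and> Cod C f' = Cod C g' \<and>
     Cmp C f' f = Cmp C g' g \<and>
     (\<forall>u\<in>Arr C. \<forall>v\<in>Arr C. Dom C u = Cod C f \<and> Dom C v = Cod C g \<and> Cod C u = Cod C v \<and>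
        Cmp C u f = Cmp C v g \<longrightarrow>
        (\<exists>!w. w \<in> Hom C (Cod C f') (Cod C u) \<and> Cmp C w f' = u \<and> Cmp C w g' = v))"

definition is_pullback :: "('o, 'm, 'z) category_scheme \<Rightarrow> 'm \<Rightarrow> 'm \<Rightarrow> 'm \<Rightarrow> 'm \<Rightarrow> bool" where
  "is_pullback C f g f' g' \<longleftrightarrow> {f, g, f', g'} \<subseteq> Arr C \<and>
     Cod C f = Cod C g \<and> Cod C f' = Dom C f \<and> Cod C g' = Dom C g \<and> Dom C f' = Dom C g' \<and>
     Cmp C f f' = Cmp C g g' \<and>
     (\<forall>u\<in>Arr C. \<forall>v\<in>Arr C. Cod C u = Dom C f \<and> Cod C v = Dom C g \<and> Dom C u = Dom C v \<and>
        Cmp C f u = Cmp C g v \<longrightarrow>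
        (\<exists>!w. w \<in> Hom C (Dom C u) (Dom C f') \<and> Cmp C f' w = u \<and> Cmp C g' w = v))"

definition adm_mono :: "('m \<times> 'm) set \<Rightarrow> 'm \<Rightarrow> bool" where
  "adm_mono \<E> \<mu> \<longleftrightarrow> (\<exists>\<pi>. (\<mu>, \<pi>) \<in> \<E>)"

definition adm_epi :: "('m \<times> 'm) set \<Rightarrow> 'm \<Rightarrow> bool" where
  "adm_epi \<E> \<pi> \<longleftrightarrow> (\<exists>\<mu>. (\<mu>, \<pi>) \<in> \<E>)"

definition iso_closed :: "('o, 'm, 'z) category_scheme \<Rightarrow> ('m \<times> 'm) set \<Rightarrow> bool" where
  "iso_closed C \<E> \<longleftrightarrow>
     (\<forall>(\<mu>, \<pi>)\<in>\<E>. \<forall>\<mu>'\<in>Arr C. \<forall>\<pi>'\<in>Arr C. \<forall>a b c.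
        Cod C \<mu>' = Dom C \<pi>' \<and> is_iso C a \<and> is_iso C b \<and> is_iso C c \<and>
        a \<in> Hom C (Dom C \<mu>) (Dom C \<mu>') \<and> b \<in> Hom C (Cod C \<mu>) (Cod C \<mu>') \<and>
        c \<in> Hom C (Cod C \<pi>) (Cod C \<pi>') \<and>
        Cmp C b \<mu> = Cmp C \<mu>' a \<and> Cmp C c \<pi> = Cmp C \<pi>' b \<longrightarrow> (\<mu>', \<pi>') \<in> \<E>)"

definition exact_structure :: "('o, 'm, 'z) category_scheme \<Rightarrow> ('m \<times> 'm) set \<Rightarrow> bool" where
  "exact_structure C \<E> \<longleftrightarrow> is_additive C \<and> \<E> \<subseteq> kernel_cokernel_pairs C \<and> iso_closed C \<E> \<and>
     (\<forall>a\<in>Obj C. adm_mono \<E> (Idn C a)) \<and>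
     (\<forall>a\<in>Obj C. adm_epi \<E> (Idn C a)) \<and>
     (\<forall>f g. adm_mono \<E> f \<and> adm_mono \<E> g \<and> Cod C f = Dom C g \<longrightarrow> adm_mono \<E> (Cmp C g f)) \<and>
     (\<forall>f g. adm_epi \<E> f \<and> adm_epi \<E> g \<and> Cod C f = Dom C g \<longrightarrow> adm_epi \<E> (Cmp C g f)) \<and>
     (\<forall>\<mu> f. adm_mono \<E> \<mu> \<and> f \<in> Arr C \<and> Dom C f = Dom C \<mu> \<longrightarrow>
        (\<exists>f' \<mu>'. is_pushout C \<mu> f f' \<mu>') \<and>
        (\<forall>f' \<mu>'. is_pushout C \<mu> f f' \<mu>' \<longrightarrow> adm_mono \<E> \<mu>')) \<and>
     (\<forall>\<pi> f. adm_epi \<E> \<pi> \<and> f \<in> Arr C \<and> Cod C f = Cod C \<pi> \<longrightarrow>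
        (\<exists>f' \<pi>'. is_pullback C \<pi> f f' \<pi>') \<and>
        (\<forall>f' \<pi>'. is_pullback C \<pi> f f' \<pi>' \<longrightarrow> adm_epi \<E> \<pi>'))"


section \<open>Operator spaces\<close>

definition complex_ring :: "complex ring" where
  "complex_ring = \<lparr>carrier = UNIV, mult = (*), one = 1, zero = 0, add = (+)\<rparr>"

text \<open>A complex vector space is a \<^const>\<open>module\<close> over \<^term>\<open>complex_ring\<close>. The fields
  \<open>mult\<close> and \<open>one\<close>, inherited from the library record of modules, are irrelevant. An \<open>n \<times> n\<close>
  matrix is a function of two indices, read only at indices below \<open>n\<close>, and \<open>mnorm V n\<close> is the
  norm of \<open>M\<^sub>n(V)\<close>.\<close>

record 'u opspace = "(complex, 'u) module" +
  mnorm :: "nat \<Rightarrow> (nat \<Rightarrow> nat \<Rightarrow> 'u) \<Rightarrow> real"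

definition mats :: "('u, 'z) partial_object_scheme \<Rightarrow> nat \<Rightarrow> nat \<Rightarrow> (nat \<Rightarrow> nat \<Rightarrow> 'u) set" where
  "mats V m n = {x. \<forall>i<m. \<forall>j<n. x i j \<in> carrier V}"

text \<open>Operator norm of an \<open>m \<times> n\<close> matrix of maps, acting from the \<open>n\<close>-fold to the \<open>m\<close>-fold
  Hilbert space direct sum.\<close>

definition amp_norm ::
  "nat \<Rightarrow> nat \<Rightarrow> (nat \<Rightarrow> nat \<Rightarrow> 'a::real_normed_vector \<Rightarrow> 'b::real_normed_vector) \<Rightarrow> real" where
  "amp_norm m n T = (SUP \<xi>\<in>{\<xi>. L2_set (\<lambda>j. norm (\<xi> j)) {..<n} \<le> 1}.
     L2_set (\<lambda>i. norm (\<Sum>j<n. T i j (\<xi> j))) {..<m})"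

definition scalar_norm :: "nat \<Rightarrow> nat \<Rightarrow> (nat \<Rightarrow> nat \<Rightarrow> complex) \<Rightarrow> real" where
  "scalar_norm m n \<alpha> = amp_norm m n (\<lambda>i j z. \<alpha> i j * z)"

text \<open>\<open>\<alpha> x \<beta>\<close> for an \<open>m \<times> m\<close> matrix \<open>x\<close> over \<open>V\<close>, and the block diagonal sum of
  an \<open>m \<times> m\<close> and an \<open>n \<times> n\<close> matrix.\<close>

definition sandwich :: "('u, 'z) opspace_scheme \<Rightarrow> nat \<Rightarrow> (nat \<Rightarrow> nat \<Rightarrow> complex) \<Rightarrow>
    (nat \<Rightarrow> nat \<Rightarrow> 'u) \<Rightarrow> (nat \<Rightarrow> nat \<Rightarrow> complex) \<Rightarrow> nat \<Rightarrow> nat \<Rightarrow> 'u" where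
  "sandwich V m \<alpha> x \<beta> i j =
     (\<Oplus>\<^bsub>V\<^esub>k\<in>{..<m}. \<Oplus>\<^bsub>V\<^esub>l\<in>{..<m}. (\<alpha> i k * \<beta> l j) \<odot>\<^bsub>V\<^esub> x k l)"

definition diag_sum :: "('u, 'z) opspace_scheme \<Rightarrow> nat \<Rightarrow> nat \<Rightarrow>
    (nat \<Rightarrow> nat \<Rightarrow> 'u) \<Rightarrow> (nat \<Rightarrow> nat \<Rightarrow> 'u) \<Rightarrow> nat \<Rightarrow> nat \<Rightarrow> 'u" where
  "diag_sum V m n x y i j =
     (if i < m \<and> j < m then x i j
      else if m \<le> i \<and> i < m + n \<and> m \<le> j \<and> j < m + n then y (i - m) (j - m)
      else \<zero>\<^bsub>V\<^esub>)"

definition vnorm :: "('u, 'z) opspace_scheme \<Rightarrow> 'u \<Rightarrow> real" where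
  "vnorm V x = mnorm V 1 (\<lambda>_ _. x)"

text \<open>The value 0 off the carrier is forced by the library locale \<^locale>\<open>Metric_space\<close>, which
  wants a total nonnegative symmetric function.\<close>

definition vdist :: "('u, 'z) opspace_scheme \<Rightarrow> 'u \<Rightarrow> 'u \<Rightarrow> real" where
  "vdist V x y = (if x \<in> carrier V \<and> y \<in> carrier V then vnorm V (x \<ominus>\<^bsub>V\<^esub> y) else 0)"

locale operator_space = module complex_ring V for V :: "('u, 'z) opspace_scheme" (structure) +
  assumes mnorm_cong:
      "\<lbrakk>x \<in> mats V n n; \<And>i j. \<lbrakk>i < n; j < n\<rbrakk> \<Longrightarrow> x i j = y i j\<rbrakk> \<Longrightarrow> mnorm V n x = mnorm V n y"
    and mnorm_nonneg: "x \<in> mats V n n \<Longrightarrow> 0 \<le> mnorm V n x"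
    and mnorm_eq_0:
      "x \<in> mats V n n \<Longrightarrow> mnorm V n x = 0 \<longleftrightarrow> (\<forall>i<n. \<forall>j<n. x i j = \<zero>\<^bsub>V\<^esub>)"
    and mnorm_scale:
      "x \<in> mats V n n \<Longrightarrow> mnorm V n (\<lambda>i j. c \<odot>\<^bsub>V\<^esub> x i j) = cmod c * mnorm V n x"
    and mnorm_triangle:
      "\<lbrakk>x \<in> mats V n n; y \<in> mats V n n\<rbrakk> \<Longrightarrow>
        mnorm V n (\<lambda>i j. x i j \<oplus>\<^bsub>V\<^esub> y i j) \<le> mnorm V n x + mnorm V n y"
    and ruan_diag:
      "\<lbrakk>x \<in> mats V m m; y \<in> mats V n n\<rbrakk> \<Longrightarrow>
        mnorm V (m + n) (diag_sum V m n x y) = max (mnorm V m x) (mnorm V n y)"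
    and ruan_sandwich:
      "x \<in> mats V m m \<Longrightarrow>
        mnorm V n (sandwich V m \<alpha> x \<beta>) \<le> scalar_norm n m \<alpha> * mnorm V m x * scalar_norm m n \<beta>"
    and complete: "Metric_space.mcomplete (carrier V) (vdist V)"

text \<open>Norm of an \<open>m \<times> n\<close> matrix: pad it with zeros to a square one.\<close>

definition rect_norm :: "('u, 'z) opspace_scheme \<Rightarrow> nat \<Rightarrow> nat \<Rightarrow> (nat \<Rightarrow> nat \<Rightarrow> 'u) \<Rightarrow> real" where
  "rect_norm V m n x =
     mnorm V (max m n) (\<lambda>i j. if i < m \<and> j < n then x i j else \<zero>\<^bsub>V\<^esub>)"

definition linear_map :: "('u, 'y) opspace_scheme \<Rightarrow> ('v, 'z) opspace_scheme \<Rightarrow> ('u \<Rightarrow> 'v) \<Rightarrow> bool" where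
  "linear_map V W f \<longleftrightarrow> f \<in> carrier V \<rightarrow> carrier W \<and>
     (\<forall>x\<in>carrier V. \<forall>y\<in>carrier V. f (x \<oplus>\<^bsub>V\<^esub> y) = f x \<oplus>\<^bsub>W\<^esub> f y) \<and>
     (\<forall>c. \<forall>x\<in>carrier V. f (c \<odot>\<^bsub>V\<^esub> x) = c \<odot>\<^bsub>W\<^esub> f x)"

definition completely_bounded ::
  "('u, 'y) opspace_scheme \<Rightarrow> ('v, 'z) opspace_scheme \<Rightarrow> ('u \<Rightarrow> 'v) \<Rightarrow> bool" where
  "completely_bounded V W f \<longleftrightarrow> linear_map V W f \<and>
     (\<exists>B. \<forall>n. \<forall>x\<in>mats V n n. mnorm W n (\<lambda>i j. f (x i j)) \<le> B * mnorm V n x)"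

definition completely_contractive ::
  "('u, 'y) opspace_scheme \<Rightarrow> ('v, 'z) opspace_scheme \<Rightarrow> ('u \<Rightarrow> 'v) \<Rightarrow> bool" where
  "completely_contractive V W f \<longleftrightarrow> linear_map V W f \<and>
     (\<forall>n. \<forall>x\<in>mats V n n. mnorm W n (\<lambda>i j. f (x i j)) \<le> mnorm V n x)"


section \<open>The Haagerup tensor product\<close>

definition free_space :: "'i set \<Rightarrow> (complex, 'i \<Rightarrow> complex) module" where
  "free_space I = \<lparr>carrier = {t. finite {i. t i \<noteq> 0} \<and> {i. t i \<noteq> 0} \<subseteq> I},
     mult = undefined, one = undefined, zero = (\<lambda>_. 0), add = (\<lambda>s t i. s i + t i),
     smult = (\<lambda>c t i. c * t i)\<rparr>"

definition gen :: "'i \<Rightarrow> 'i \<Rightarrow> complex" where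
  "gen p q = of_bool (q = p)"

text \<open>The subspace of the free space on \<open>V \<times> W\<close> by which one divides to obtain the algebraic
  tensor product.\<close>

definition tensor_null ::
  "('u, 'y) opspace_scheme \<Rightarrow> ('v, 'z) opspace_scheme \<Rightarrow> ('u \<times> 'v \<Rightarrow> complex) set" where
  "tensor_null V W =
     (\<lambda>N. submodule N complex_ring (free_space (carrier V \<times> carrier W))) hull
      ({(\<lambda>q. gen (x \<oplus>\<^bsub>V\<^esub> x', y) q - gen (x, y) q - gen (x', y) q) | x x' y.
           x \<in> carrier V \<and> x' \<in> carrier V \<and> y \<in> carrier W} \<union>
       {(\<lambda>q. gen (x, y \<oplus>\<^bsub>W\<^esub> y') q - gen (x, y) q - gen (x, y') q) | x y y'.
           x \<in> carrier V \<and> y \<in> carrier W \<and> y' \<in> carrier W} \<union>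
       {(\<lambda>q. gen (c \<odot>\<^bsub>V\<^esub> x, y) q - c * gen (x, y) q) | c x y.
           x \<in> carrier V \<and> y \<in> carrier W} \<union>
       {(\<lambda>q. gen (x, c \<odot>\<^bsub>W\<^esub> y) q - c * gen (x, y) q) | c x y.
           x \<in> carrier V \<and> y \<in> carrier W})"

text \<open>Haagerup norm of a matrix \<open>u\<close> over the algebraic tensor product (given by representatives
  in the free space): the infimum of \<open>\<parallel>x\<parallel> \<parallel>y\<parallel>\<close> over all factorisations \<open>u = x \<odot> y\<close> with
  \<open>x \<in> M\<^bsub>n,p\<^esub>(V)\<close>, \<open>y \<in> M\<^bsub>p,n\<^esub>(W)\<close>, where \<open>(x \<odot> y)\<^bsub>ij\<^esub>\<close> is the sum of the
  \<open>x\<^bsub>ik\<^esub> \<otimes> y\<^bsub>kj\<^esub>\<close>.\<close>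

definition haagerup_norm :: "('u, 'y) opspace_scheme \<Rightarrow> ('v, 'z) opspace_scheme \<Rightarrow>
    nat \<Rightarrow> (nat \<Rightarrow> nat \<Rightarrow> 'u \<times> 'v \<Rightarrow> complex) \<Rightarrow> real" where
  "haagerup_norm V W n u = Inf {rect_norm V n p x * rect_norm W p n y | p x y.
     x \<in> mats V n p \<and> y \<in> mats W p n \<and>
     (\<forall>i<n. \<forall>j<n. (\<lambda>q. u i j q - (\<Sum>k<p. gen (x i k, y k j) q)) \<in> tensor_null V W)}"

definition pre_haagerup :: "('u, 'y) opspace_scheme \<Rightarrow> ('v, 'z) opspace_scheme \<Rightarrow>
    ('u \<times> 'v \<Rightarrow> complex) opspace" where
  "pre_haagerup V W =
     module.extend (free_space (carrier V \<times> carrier W)) \<lparr>mnorm = haagerup_norm V W\<rparr>"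

text \<open>Hausdorff completion of a matrix seminormed space: Cauchy sequences modulo null sequences.
  The matrix norms on it are the limits of those of representatives.\<close>

definition cauchy_seqs :: "('u, 'z) opspace_scheme \<Rightarrow> (nat \<Rightarrow> 'u) set" where
  "cauchy_seqs V = {s. (\<forall>k. s k \<in> carrier V) \<and>
     (\<forall>e>0. \<exists>N. \<forall>k\<ge>N. \<forall>l\<ge>N. vnorm V (s k \<ominus>\<^bsub>V\<^esub> s l) < e)}"

definition null_rel :: "('u, 'z) opspace_scheme \<Rightarrow> ((nat \<Rightarrow> 'u) \<times> (nat \<Rightarrow> 'u)) set" where
  "null_rel V = {(s, t). s \<in> cauchy_seqs V \<and> t \<in> cauchy_seqs V \<and>
     (\<lambda>k. vnorm V (s k \<ominus>\<^bsub>V\<^esub> t k)) \<longlonglongrightarrow> 0}"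

definition lim_class :: "('u, 'z) opspace_scheme \<Rightarrow> (nat \<Rightarrow> 'u) \<Rightarrow> (nat \<Rightarrow> 'u) set" where
  "lim_class V s = null_rel V `` {s}"

definition rep :: "'a set \<Rightarrow> 'a" where
  "rep X = (SOME x. x \<in> X)"

definition completion :: "('u, 'z) opspace_scheme \<Rightarrow> (nat \<Rightarrow> 'u) set opspace" where
  "completion V = \<lparr>carrier = cauchy_seqs V // null_rel V,
     mult = undefined, one = undefined,
     zero = lim_class V (\<lambda>_. \<zero>\<^bsub>V\<^esub>),
     add = (\<lambda>X Y. lim_class V (\<lambda>k. rep X k \<oplus>\<^bsub>V\<^esub> rep Y k)),
     smult = (\<lambda>c X. lim_class V (\<lambda>k. c \<odot>\<^bsub>V\<^esub> rep X k)),
     mnorm = (\<lambda>n X. lim (\<lambda>k. mnorm V n (\<lambda>i j. rep (X i j) k)))\<rparr>"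

definition haagerup :: "('u, 'y) opspace_scheme \<Rightarrow> ('v, 'z) opspace_scheme \<Rightarrow>
    (nat \<Rightarrow> 'u \<times> 'v \<Rightarrow> complex) set opspace" where
  "haagerup V W = completion (pre_haagerup V W)"

definition elem_tensor :: "('u, 'y) opspace_scheme \<Rightarrow> ('v, 'z) opspace_scheme \<Rightarrow>
    'u \<Rightarrow> 'v \<Rightarrow> (nat \<Rightarrow> 'u \<times> 'v \<Rightarrow> complex) set" where
  "elem_tensor V W x y = lim_class (pre_haagerup V W) (\<lambda>_. gen (x, y))"


section \<open>Operator algebras\<close>

text \<open>Complex Hilbert spaces. The inner product is linear in its first argument; the real
  inner product, and hence the norm, of the library class is its real part.\<close>

class chilbert_space = real_inner + complete_space +
  fixes cscale :: "complex \<Rightarrow> 'a \<Rightarrow> 'a"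
    and cinner :: "'a \<Rightarrow> 'a \<Rightarrow> complex"
  assumes cscale_add_right: "cscale c (x + y) = cscale c x + cscale c y"
    and cscale_add_left: "cscale (c + d) x = cscale c x + cscale d x"
    and cscale_cscale: "cscale c (cscale d x) = cscale (c * d) x"
    and cscale_of_real: "cscale (complex_of_real r) x = r *\<^sub>R x"
    and cinner_commute: "cinner x y = cnj (cinner y x)"
    and cinner_add_left: "cinner (x + y) z = cinner x z + cinner y z"
    and cinner_scale_left: "cinner (cscale c x) y = c * cinner x y"
    and inner_eq_Re_cinner: "inner x y = Re (cinner x y)"

definition clinear_ops :: "('h::chilbert_space \<Rightarrow>\<^sub>L 'h) set" where
  "clinear_ops = {T. \<forall>c x. blinfun_apply T (cscale c x) = cscale c (blinfun_apply T x)}"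

definition cscale_op :: "complex \<Rightarrow> ('h::chilbert_space \<Rightarrow>\<^sub>L 'h) \<Rightarrow> ('h \<Rightarrow>\<^sub>L 'h)" where
  "cscale_op c T = Blinfun (\<lambda>x. cscale c (blinfun_apply T x))"

text \<open>The approximate identity is a net in \<open>A\<close>; convergence along a net is expressed by the
  filter it generates.\<close>

definition has_contractive_approx_identity :: "('h::chilbert_space \<Rightarrow>\<^sub>L 'h) set \<Rightarrow> bool" where
  "has_contractive_approx_identity A \<longleftrightarrow> (\<exists>F. F \<noteq> bot \<and>
     (\<forall>\<^sub>F e in F. e \<in> A \<and> norm e \<le> 1) \<and>
     (\<forall>a\<in>A. ((\<lambda>e. e o\<^sub>L a) \<longlongrightarrow> a) F \<and> ((\<lambda>e. a o\<^sub>L e) \<longlongrightarrow> a) F))"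

definition operator_algebra :: "('h::chilbert_space \<Rightarrow>\<^sub>L 'h) set \<Rightarrow> bool" where
  "operator_algebra A \<longleftrightarrow> A \<subseteq> clinear_ops \<and> closed A \<and> 0 \<in> A \<and>
     (\<forall>a\<in>A. \<forall>b\<in>A. a + b \<in> A \<and> a o\<^sub>L b \<in> A) \<and> (\<forall>c. \<forall>a\<in>A. cscale_op c a \<in> A) \<and>
     has_contractive_approx_identity A"

definition opspace_of :: "('h::chilbert_space \<Rightarrow>\<^sub>L 'h) set \<Rightarrow> ('h \<Rightarrow>\<^sub>L 'h) opspace" where
  "opspace_of A = \<lparr>carrier = A, mult = (o\<^sub>L), one = id_blinfun, zero = 0, add = (+),
     smult = cscale_op, mnorm = (\<lambda>n a. amp_norm n n (\<lambda>i j. blinfun_apply (a i j)))\<rparr>"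


section \<open>Operator modules\<close>

record ('u, 'a) opmod = "'u opspace" +
  act :: "'u \<Rightarrow> 'a \<Rightarrow> 'u"

definition right_module ::
  "('h::chilbert_space \<Rightarrow>\<^sub>L 'h) set \<Rightarrow> ('u, 'h \<Rightarrow>\<^sub>L 'h) opmod \<Rightarrow> bool" where
  "right_module A E \<longleftrightarrow>
     (\<forall>x\<in>carrier E. \<forall>a\<in>A. act E x a \<in> carrier E) \<and>
     (\<forall>x\<in>carrier E. \<forall>y\<in>carrier E. \<forall>a\<in>A. act E (x \<oplus>\<^bsub>E\<^esub> y) a = act E x a \<oplus>\<^bsub>E\<^esub> act E y a) \<and>
     (\<forall>x\<in>carrier E. \<forall>a\<in>A. \<forall>b\<in>A. act E x (a + b) = act E x a \<oplus>\<^bsub>E\<^esub> act E x b) \<and>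
     (\<forall>c. \<forall>x\<in>carrier E. \<forall>a\<in>A. act E (c \<odot>\<^bsub>E\<^esub> x) a = c \<odot>\<^bsub>E\<^esub> act E x a \<and>
                              act E x (cscale_op c a) = c \<odot>\<^bsub>E\<^esub> act E x a) \<and>
     (\<forall>x\<in>carrier E. \<forall>a\<in>A. \<forall>b\<in>A. act E (act E x a) b = act E x (a o\<^sub>L b))"

definition operator_module ::
  "('h::chilbert_space \<Rightarrow>\<^sub>L 'h) set \<Rightarrow> ('u, 'h \<Rightarrow>\<^sub>L 'h) opmod \<Rightarrow> bool" where
  "operator_module A E \<longleftrightarrow> operator_space E \<and> right_module A E \<and>
     (\<exists>m. completely_contractive (haagerup E (opspace_of A)) E m \<and>
          (\<forall>x\<in>carrier E. \<forall>a\<in>A. m (elem_tensor E (opspace_of A) x a) = act E x a))"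

definition nondegenerate ::
  "('h::chilbert_space \<Rightarrow>\<^sub>L 'h) set \<Rightarrow> ('u, 'h \<Rightarrow>\<^sub>L 'h) opmod \<Rightarrow> bool" where
  "nondegenerate A E \<longleftrightarrow>
     Metric_space.mtopology (carrier E) (vdist E) closure_of
       ((\<lambda>N. submodule N complex_ring E) hull {act E x a | x a. x \<in> carrier E \<and> a \<in> A})
     = carrier E"

definition module_map ::
  "('h::chilbert_space \<Rightarrow>\<^sub>L 'h) set \<Rightarrow> ('u, 'h \<Rightarrow>\<^sub>L 'h) opmod \<Rightarrow> ('u, 'h \<Rightarrow>\<^sub>L 'h) opmod \<Rightarrow>
    ('u \<Rightarrow> 'u) \<Rightarrow> bool" where
  "module_map A E F f \<longleftrightarrow> linear_map E F f \<and> (\<forall>x\<in>carrier E. \<forall>a\<in>A. f (act E x a) = act F (f x) a)"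

text \<open>The category of nondegenerate right operator \<open>A\<close>-modules whose underlying set is contained
  in the type \<open>'u\<close>, which plays the role of a universe. A morphism is a triple (domain, map,
  codomain) whose map is \<^const>\<open>extensional\<close> on the domain, so that equality of
  triples is equality of morphisms.\<close>

type_synonym ('u, 'h) op_arrow =
  "('u, 'h \<Rightarrow>\<^sub>L 'h) opmod \<times> ('u \<Rightarrow> 'u) \<times> ('u, 'h \<Rightarrow>\<^sub>L 'h) opmod"

definition OMod :: "'u itself \<Rightarrow> ('h::chilbert_space \<Rightarrow>\<^sub>L 'h) set \<Rightarrow>
    (('u, 'h \<Rightarrow>\<^sub>L 'h) opmod, ('u, 'h) op_arrow) category" where
  "OMod _ A = \<lparr>
     Obj = {E. operator_module A E \<and> nondegenerate A E},
     Arr = {(E, f, F). operator_module A E \<and> nondegenerate A E \<and>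
                       operator_module A F \<and> nondegenerate A F \<and>
                       f \<in> extensional (carrier E) \<and>
                       module_map A E F f \<and> completely_bounded E F f},
     Dom = (\<lambda>(E, f, F). E),
     Cod = (\<lambda>(E, f, F). F),
     Idn = (\<lambda>E. (E, \<lambda>x\<in>carrier E. x, E)),
     Cmp = (\<lambda>(F', g, G) (E, f, F). (E, compose (carrier E) g f, G)),
     Plus = (\<lambda>(E, f, F) (E', g, F'). (E, \<lambda>x\<in>carrier E. f x \<oplus>\<^bsub>F\<^esub> g x, F)),
     Null = (\<lambda>E F. (E, \<lambda>x\<in>carrier E. \<zero>\<^bsub>F\<^esub>, F))\<rparr>"

end

theory Submission
  imports Defs
begin

text \<open>
  All categorical assertions are reduced to inequalities between norms of matrices. Once this is done, the
  category behaves like that of Banach spaces and bounded maps, with every estimate made uniformly over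
  all sizes of matrices.

  The first reduction concerns objects. An operator module is defined through a complete contraction on
  the completed Haagerup tensor product \<open>E \<otimes>\<^sub>h A\<close>. Complete contractions from a completion into a
  complete space are the same as complete contractions from the space itself
  (\<open>completely_contractive_extend\<close>, \<open>completely_contractive_restrict\<close>), provided that the norm of the latter
  is a seminorm at every matrix level; for the Haagerup norm the point is the triangle inequality
  (\<open>haagerup_norm_triangle\<close>). As this norm is an infimum of products \<open>\<parallel>x\<parallel> \<parallel>a\<parallel>\<close> over factorisations, the
  condition becomes \<open>\<parallel>x a\<parallel> \<le> \<parallel>x\<parallel> \<parallel>a\<parallel>\<close> for products of rectangular matrices
  (\<open>operator_module_iff\<close>). Nondegeneracy becomes the convergence of \<open>x e\<close> to \<open>x\<close> along the approximate
  identity of \<open>A\<close> (\<open>nondegenerate_iff\<close>). In this form both conditions are inherited by closed submodules of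
  a direct sum and by quotients by closed submodules. The new modules must have their elements in the
  given universe: a coset is represented by one of its elements, and a pair is encoded by an injection of
  the square of the universe into itself, which exists if the universe is infinite, whereas all modules in
  a finite universe are zero.

  The second reduction concerns morphisms. An admissible monomorphism is a map that is bounded below at
  all matrix levels by a common constant (\<open>adm_mono_iff\<close>), and an admissible epimorphism is a map along
  which matrices lift with control of their norms by a common constant (\<open>adm_epi_iff\<close>). Both classes
  contain the identities and are closed under composition. The range of a map \<open>\<mu>\<close> of the first
  kind is complete, hence closed, and is the kernel of the quotient map that it defines. The pushout of
  \<open>\<mu>\<close> along \<open>f\<close> is the quotient of the direct sum by the elements \<open>(\<mu> k, - f k)\<close>, and a
  direct estimate shows that it is again bounded below (\<open>pushout_exists\<close>). The pullback of \<open>\<pi>\<close> along \<open>f\<close>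
  consists of the pairs \<open>(x, d)\<close> with \<open>\<pi> x = f d\<close>; lifting \<open>d\<close> amounts to lifting \<open>f d\<close> along
  \<open>\<pi>\<close> (\<open>pullback_exists\<close>).
\<close>

section \<open>Complex vector spaces with explicit carriers\<close>

lemma complex_ring_simps [simp]:
  "carrier complex_ring = UNIV"
  "\<one>\<^bsub>complex_ring\<^esub> = 1"
  "\<zero>\<^bsub>complex_ring\<^esub> = 0"
  "a \<otimes>\<^bsub>complex_ring\<^esub> b = a * b"
  "a \<oplus>\<^bsub>complex_ring\<^esub> b = a + b"
  by (simp_all add: complex_ring_def)

lemma cring_complex_ring: "cring complex_ring"
proof (intro cringI abelian_groupI)
  show "\<exists>y\<in>carrier complex_ring. y \<oplus>\<^bsub>complex_ring\<^esub> x = \<zero>\<^bsub>complex_ring\<^esub>" for x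
    by (auto intro!: exI[of _ "- x"])
qed (unfold_locales, auto simp: algebra_simps)

lemma a_inv_complex_ring [simp]: "\<ominus>\<^bsub>complex_ring\<^esub> a = - a"
proof -
  interpret cring complex_ring by (rule cring_complex_ring)
  show ?thesis
    using minus_equality[of "- a" a] by simp
qed

locale complex_module = module complex_ring V for V :: "('u, 'z) opspace_scheme" (structure)
begin

lemma smult_closed' [simp, intro]: "x \<in> carrier V \<Longrightarrow> c \<odot> x \<in> carrier V"
  using smult_closed[of c x] by simp

lemma minus_one_smult: "x \<in> carrier V \<Longrightarrow> (- 1) \<odot> x = \<ominus> x"
  using smult_l_minus[of 1 x] smult_one[of x] by simp

lemma smult_zero_left [simp]: "x \<in> carrier V \<Longrightarrow> 0 \<odot> x = \<zero>"
  using smult_l_null[of x] by simp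

lemma smult_zero_right [simp]: "c \<odot> \<zero> = \<zero>"
  using smult_r_null[of c] by simp

lemma smult_add_left: "x \<in> carrier V \<Longrightarrow> (a + b) \<odot> x = a \<odot> x \<oplus> b \<odot> x"
  using smult_l_distr[of a b x] by simp

lemma smult_add_right: "x \<in> carrier V \<Longrightarrow> y \<in> carrier V \<Longrightarrow> c \<odot> (x \<oplus> y) = c \<odot> x \<oplus> c \<odot> y"
  using smult_r_distr[of c x y] by simp

lemma smult_smult: "x \<in> carrier V \<Longrightarrow> a \<odot> (b \<odot> x) = (a * b) \<odot> x"
  using smult_assoc1[of a b x] by simp

lemma one_smult [simp]: "x \<in> carrier V \<Longrightarrow> 1 \<odot> x = x"
  using smult_one[of x] by simp

lemma diff_eq_zero_iff: "x \<in> carrier V \<Longrightarrow> y \<in> carrier V \<Longrightarrow> x \<ominus> y = \<zero> \<longleftrightarrow> x = y"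
  by (metis M.r_neg M.minus_eq M.add.inv_equality M.a_inv_closed M.minus_minus)

lemma diff_self [simp]: "x \<in> carrier V \<Longrightarrow> x \<ominus> x = \<zero>"
  by (simp add: diff_eq_zero_iff)

lemma diff_zero [simp]: "x \<in> carrier V \<Longrightarrow> x \<ominus> \<zero> = x"
  by (simp add: M.minus_eq)

lemma diff_add_cancel [simp]: "x \<in> carrier V \<Longrightarrow> y \<in> carrier V \<Longrightarrow> (x \<ominus> y) \<oplus> y = x"
  by (simp add: M.minus_eq M.a_assoc M.l_neg)

lemma diff_add_cancel' [simp]: "x \<in> carrier V \<Longrightarrow> y \<in> carrier V \<Longrightarrow> y \<oplus> (x \<ominus> y) = x"
  by (metis diff_add_cancel M.a_comm M.minus_closed)

lemma add_diff_cancel [simp]: "x \<in> carrier V \<Longrightarrow> y \<in> carrier V \<Longrightarrow> (x \<oplus> y) \<ominus> y = x"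
  by (simp add: M.minus_eq M.a_assoc M.r_neg)

lemma diff_add_diff:
  "x \<in> carrier V \<Longrightarrow> y \<in> carrier V \<Longrightarrow> z \<in> carrier V \<Longrightarrow> (x \<ominus> y) \<oplus> (y \<ominus> z) = x \<ominus> z"
  by (simp add: M.minus_eq M.a_assoc M.r_neg2 M.r_neg1)

lemma add_diff_add:
  "\<lbrakk>x \<in> carrier V; y \<in> carrier V; x' \<in> carrier V; y' \<in> carrier V\<rbrakk> \<Longrightarrow>
   (x \<oplus> y) \<ominus> (x' \<oplus> y') = (x \<ominus> x') \<oplus> (y \<ominus> y')"
  by (simp add: M.minus_eq M.minus_add M.a_ac)

lemma smult_diff: "x \<in> carrier V \<Longrightarrow> y \<in> carrier V \<Longrightarrow> c \<odot> (x \<ominus> y) = c \<odot> x \<ominus> c \<odot> y"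
  using smult_r_minus[of c y] by (simp add: M.minus_eq smult_add_right)

lemma diff_swap: "x \<in> carrier V \<Longrightarrow> y \<in> carrier V \<Longrightarrow> \<ominus> (x \<ominus> y) = y \<ominus> x"
  by (simp add: M.minus_eq M.minus_add M.a_comm)

lemma finsum_single:
  assumes "k0 \<in> K" "finite K" "\<And>k. k \<in> K \<Longrightarrow> k \<noteq> k0 \<Longrightarrow> f k = \<zero>" "f k0 \<in> carrier V"
  shows "(\<Oplus>k\<in>K. f k) = f k0"
proof -
  have "(\<Oplus>k\<in>K. f k) = (\<Oplus>k\<in>K. if k0 = k then f k0 else \<zero>)"
    using assms by (intro M.finsum_cong') auto
  also have "\<dots> = f k0"
    using M.finsum_singleton[of k0 K "\<lambda>_. f k0"] assms by simp
  finally show ?thesis .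
qed

lemma sandwich_closed [simp, intro]:
  "x \<in> mats V m m \<Longrightarrow> sandwich V m \<alpha> x \<beta> i j \<in> carrier V"
  unfolding sandwich_def mats_def by (intro M.finsum_closed Pi_I) auto

lemma sandwich_cong:
  assumes "x \<in> mats V m m" "\<And>i j. i < m \<Longrightarrow> j < m \<Longrightarrow> x i j = y i j"
  shows "sandwich V m \<alpha> x \<beta> = sandwich V m \<alpha> y \<beta>"
  using assms unfolding sandwich_def mats_def
  by (intro ext M.finsum_cong' refl Pi_I M.finsum_closed) auto

text \<open>The matrix norms give access to a matrix only through sandwiches. In those that are evaluated below the
  supports of the factors are so sparse that at most one term of the double sum survives.\<close>

lemma sandwich_single:
  assumes x: "x \<in> mats V m m" and k0: "k0 < m" "l0 < m"
    and z: "\<And>k l. k < m \<Longrightarrow> l < m \<Longrightarrow> (k, l) \<noteq> (k0, l0) \<Longrightarrow> \<alpha> i k * \<beta> l j = 0 \<or> x k l = \<zero>"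
  shows "sandwich V m \<alpha> x \<beta> i j = (\<alpha> i k0 * \<beta> l0 j) \<odot> x k0 l0"
proof -
  have xc: "k < m \<Longrightarrow> l < m \<Longrightarrow> x k l \<in> carrier V" for k l
    using x by (auto simp: mats_def)
  have zero: "(\<alpha> i k * \<beta> l j) \<odot> x k l = \<zero>" if "k < m" "l < m" "(k, l) \<noteq> (k0, l0)" for k l
    using z[OF that] xc[OF that(1,2)] by auto
  have "(\<Oplus>l\<in>{..<m}. (\<alpha> i k * \<beta> l j) \<odot> x k l) = (if k = k0 then (\<alpha> i k0 * \<beta> l0 j) \<odot> x k0 l0 else \<zero>)"
    if "k < m" for k
  proof (cases "k = k0")
    case True
    then show ?thesis
      using k0 xc zero that by (simp, intro finsum_single) auto
  next
    case False
    have "(\<Oplus>l\<in>{..<m}. (\<alpha> i k * \<beta> l j) \<odot> x k l) = \<zero>"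
      by (rule M.add.finprod_one_eqI) (use zero False that in auto)
    then show ?thesis
      using False by simp
  qed
  then have "sandwich V m \<alpha> x \<beta> i j = (\<Oplus>k\<in>{..<m}. if k = k0 then (\<alpha> i k0 * \<beta> l0 j) \<odot> x k0 l0 else \<zero>)"
    unfolding sandwich_def using k0 xc by (intro M.finsum_cong') auto
  also have "\<dots> = (\<alpha> i k0 * \<beta> l0 j) \<odot> x k0 l0"
    using k0 xc finsum_single[of k0 "{..<m}" "\<lambda>k. if k = k0 then (\<alpha> i k0 * \<beta> l0 j) \<odot> x k0 l0 else \<zero>"]
    by auto
  finally show ?thesis .
qed

lemma sandwich_zero:
  assumes x: "x \<in> mats V m m"
    and z: "\<And>k l. k < m \<Longrightarrow> l < m \<Longrightarrow> \<alpha> i k * \<beta> l j = 0 \<or> x k l = \<zero>"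
  shows "sandwich V m \<alpha> x \<beta> i j = \<zero>"
proof -
  have "(\<alpha> i k * \<beta> l j) \<odot> x k l = \<zero>" if "k < m" "l < m" for k l
    using z[OF that] x that by (auto simp: mats_def)
  then show ?thesis
    unfolding sandwich_def by (intro M.add.finprod_one_eqI) auto
qed

end

lemma matsI [intro]: "(\<And>i j. i < m \<Longrightarrow> j < n \<Longrightarrow> x i j \<in> carrier V) \<Longrightarrow> x \<in> mats V m n"
  by (auto simp: mats_def)

lemma matsD: "x \<in> mats V m n \<Longrightarrow> i < m \<Longrightarrow> j < n \<Longrightarrow> x i j \<in> carrier V"
  by (auto simp: mats_def)

subsection \<open>Linear maps\<close>

locale linear_between = V: complex_module V + W: complex_module W
  for V :: "('u, 'y) opspace_scheme" and W :: "('v, 'z) opspace_scheme" and f :: "'u \<Rightarrow> 'v" +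
  assumes lin: "linear_map V W f"
begin

lemma closed [simp, intro]: "x \<in> carrier V \<Longrightarrow> f x \<in> carrier W"
  using lin by (auto simp: linear_map_def)

lemma add: "x \<in> carrier V \<Longrightarrow> y \<in> carrier V \<Longrightarrow> f (x \<oplus>\<^bsub>V\<^esub> y) = f x \<oplus>\<^bsub>W\<^esub> f y"
  using lin by (auto simp: linear_map_def)

lemma smult: "x \<in> carrier V \<Longrightarrow> f (c \<odot>\<^bsub>V\<^esub> x) = c \<odot>\<^bsub>W\<^esub> f x"
  using lin by (auto simp: linear_map_def)

lemma zero [simp]: "f \<zero>\<^bsub>V\<^esub> = \<zero>\<^bsub>W\<^esub>"
  using smult[of "\<zero>\<^bsub>V\<^esub>" 0] by simp

lemma minus: "x \<in> carrier V \<Longrightarrow> f (\<ominus>\<^bsub>V\<^esub> x) = \<ominus>\<^bsub>W\<^esub> f x"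
  using smult[of x "-1"] by (simp add: V.minus_one_smult W.minus_one_smult)

lemma diff: "x \<in> carrier V \<Longrightarrow> y \<in> carrier V \<Longrightarrow> f (x \<ominus>\<^bsub>V\<^esub> y) = f x \<ominus>\<^bsub>W\<^esub> f y"
  by (simp add: V.M.minus_eq W.M.minus_eq add minus)

lemma finsum: "finite K \<Longrightarrow> g \<in> K \<rightarrow> carrier V \<Longrightarrow> f (\<Oplus>\<^bsub>V\<^esub>k\<in>K. g k) = (\<Oplus>\<^bsub>W\<^esub>k\<in>K. f (g k))"
  by (induction K rule: finite_induct) (simp_all add: Pi_iff add)

lemma mats [simp, intro]: "x \<in> mats V m n \<Longrightarrow> (\<lambda>i j. f (x i j)) \<in> mats W m n"
  by (auto simp: mats_def)

lemma sandwich: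
  assumes "x \<in> mats V m m"
  shows "f (sandwich V m \<alpha> x \<beta> i j) = sandwich W m \<alpha> (\<lambda>k l. f (x k l)) \<beta> i j"
proof -
  have "f (sandwich V m \<alpha> x \<beta> i j) = (\<Oplus>\<^bsub>W\<^esub>k\<in>{..<m}. f (\<Oplus>\<^bsub>V\<^esub>l\<in>{..<m}. (\<alpha> i k * \<beta> l j) \<odot>\<^bsub>V\<^esub> x k l))"
    unfolding sandwich_def using assms by (intro finsum) (auto simp: mats_def intro!: V.M.finsum_closed)
  also have "\<dots> = sandwich W m \<alpha> (\<lambda>k l. f (x k l)) \<beta> i j"
    unfolding sandwich_def
  proof (intro W.M.finsum_cong' refl Pi_I)
    fix k assume k: "k \<in> {..<m}"
    have "f (\<Oplus>\<^bsub>V\<^esub>l\<in>{..<m}. (\<alpha> i k * \<beta> l j) \<odot>\<^bsub>V\<^esub> x k l) = (\<Oplus>\<^bsub>W\<^esub>l\<in>{..<m}. f ((\<alpha> i k * \<beta> l j) \<odot>\<^bsub>V\<^esub> x k l))"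
      using assms k by (intro finsum) (auto simp: mats_def)
    also have "\<dots> = (\<Oplus>\<^bsub>W\<^esub>l\<in>{..<m}. (\<alpha> i k * \<beta> l j) \<odot>\<^bsub>W\<^esub> f (x k l))"
      using assms k by (intro W.M.finsum_cong' refl Pi_I) (auto simp: mats_def smult)
    finally show "f (\<Oplus>\<^bsub>V\<^esub>l\<in>{..<m}. (\<alpha> i k * \<beta> l j) \<odot>\<^bsub>V\<^esub> x k l) = (\<Oplus>\<^bsub>W\<^esub>l\<in>{..<m}. (\<alpha> i k * \<beta> l j) \<odot>\<^bsub>W\<^esub> f (x k l))" .
    show "(\<Oplus>\<^bsub>W\<^esub>l\<in>{..<m}. (\<alpha> i k * \<beta> l j) \<odot>\<^bsub>W\<^esub> f (x k l)) \<in> carrier W"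
      using assms k by (intro W.M.finsum_closed) (auto simp: mats_def)
  qed
  finally show ?thesis .
qed

end

section \<open>Operator norms of matrices of maps\<close>

text \<open>The norm is a supremum of reals, so that nothing can be said about it without a bound. The sum of the
  norms of the entries is one.\<close>

lemma amp_norm_bdd_above:
  fixes T :: "nat \<Rightarrow> nat \<Rightarrow> 'a::real_normed_vector \<Rightarrow> 'b::real_normed_vector"
  assumes "\<And>i j. i < m \<Longrightarrow> j < n \<Longrightarrow> bounded_linear (T i j)"
  shows "bdd_above ((\<lambda>\<xi>. L2_set (\<lambda>i. norm (\<Sum>j<n. T i j (\<xi> j))) {..<m}) `
           {\<xi>. L2_set (\<lambda>j. norm (\<xi> j)) {..<n} \<le> 1})"
proof (intro bdd_aboveI2)
  fix \<xi> :: "nat \<Rightarrow> 'a" assume "\<xi> \<in> {\<xi>. L2_set (\<lambda>j. norm (\<xi> j)) {..<n} \<le> 1}"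
  then have *: "L2_set (\<lambda>j. norm (\<xi> j)) {..<n} \<le> 1"
    by simp
  have \<xi>: "norm (\<xi> j) \<le> 1" if "j < n" for j
    using order_trans[OF member_le_L2_set *] that by simp
  have "L2_set (\<lambda>i. norm (\<Sum>j<n. T i j (\<xi> j))) {..<m} \<le> (\<Sum>i<m. norm (\<Sum>j<n. T i j (\<xi> j)))"
    by (intro L2_set_le_sum) auto
  also have "\<dots> \<le> (\<Sum>i<m. \<Sum>j<n. onorm (T i j))"
  proof (intro sum_mono order_trans[OF norm_sum])
    fix i j assume ij: "i \<in> {..<m}" "j \<in> {..<n}"
    then have bl: "bounded_linear (T i j)" using assms by auto
    have "norm (T i j (\<xi> j)) \<le> onorm (T i j) * norm (\<xi> j)"
      by (rule onorm[OF bl])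
    also have "\<dots> \<le> onorm (T i j)"
      using \<xi>[of j] ij onorm_pos_le[OF bl] by (simp add: mult_left_le)
    finally show "norm (T i j (\<xi> j)) \<le> onorm (T i j)" .
  qed
  finally show "L2_set (\<lambda>i. norm (\<Sum>j<n. T i j (\<xi> j))) {..<m} \<le> (\<Sum>i<m. \<Sum>j<n. onorm (T i j))" .
qed

lemma amp_norm_nonneg:
  fixes T :: "nat \<Rightarrow> nat \<Rightarrow> 'a::real_normed_vector \<Rightarrow> 'b::real_normed_vector"
  assumes "\<And>i j. i < m \<Longrightarrow> j < n \<Longrightarrow> bounded_linear (T i j)"
  shows "0 \<le> amp_norm m n T"
proof -
  have "0 \<le> L2_set (\<lambda>i. norm (\<Sum>j<n. T i j (0::'a))) {..<m}"
    by (rule L2_set_nonneg)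
  also have "\<dots> \<le> amp_norm m n T"
    unfolding amp_norm_def
  proof (rule cSUP_upper)
    show "(\<lambda>_. 0 :: 'a) \<in> {\<xi>. L2_set (\<lambda>j. norm (\<xi> j)) {..<n} \<le> 1}"
      by (simp add: L2_set_def)
  qed (rule amp_norm_bdd_above[OF assms])
  finally show ?thesis .
qed

lemma amp_norm_apply:
  assumes bl: "\<And>i j. i < m \<Longrightarrow> j < n \<Longrightarrow> bounded_linear (T i j)"
  shows "L2_set (\<lambda>i. norm (\<Sum>j<n. T i j (\<xi> j))) {..<m} \<le> amp_norm m n T * L2_set (\<lambda>j. norm (\<xi> j)) {..<n}"
proof (cases "L2_set (\<lambda>j. norm (\<xi> j)) {..<n} = 0")
  case True
  then have \<xi>: "\<xi> j = 0" if "j < n" for j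
    using that by (auto simp: L2_set_eq_0_iff)
  have "(\<Sum>j<n. T i j (\<xi> j)) = 0" if "i < m" for i
    using that by (intro sum.neutral ballI) (simp add: \<xi> linear_simps(3)[OF bl])
  then have "L2_set (\<lambda>i. norm (\<Sum>j<n. T i j (\<xi> j))) {..<m} = 0"
    by (subst L2_set_eq_0_iff) auto
  then show ?thesis
    unfolding True by simp
next
  case False
  define r where "r = L2_set (\<lambda>j. norm (\<xi> j)) {..<n}"
  have r: "r > 0"
    using False by (simp add: r_def less_le)
  have scale: "L2_set (\<lambda>i. norm (\<Sum>j<n. T i j ((1 / r) *\<^sub>R \<xi> j))) {..<m}
      = L2_set (\<lambda>i. norm (\<Sum>j<n. T i j (\<xi> j))) {..<m} / r"
  proof -
    have "(\<Sum>j<n. T i j ((1 / r) *\<^sub>R \<xi> j)) = (1 / r) *\<^sub>R (\<Sum>j<n. T i j (\<xi> j))" if "i < m" for i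
      using that by (simp add: linear_simps(5)[OF bl] scaleR_sum_right)
    then have "L2_set (\<lambda>i. norm (\<Sum>j<n. T i j ((1 / r) *\<^sub>R \<xi> j))) {..<m}
        = L2_set (\<lambda>i. (1 / r) * norm (\<Sum>j<n. T i j (\<xi> j))) {..<m}"
      using r by (intro L2_set_cong) auto
    also have "\<dots> = (1 / r) * L2_set (\<lambda>i. norm (\<Sum>j<n. T i j (\<xi> j))) {..<m}"
      using r by (subst L2_set_right_distrib) auto
    finally show ?thesis by simp
  qed
  have "L2_set (\<lambda>j. norm ((1 / r) *\<^sub>R \<xi> j)) {..<n} = L2_set (\<lambda>j. (1 / r) * norm (\<xi> j)) {..<n}"
    using r by (intro L2_set_cong) auto
  also have "\<dots> = (1 / r) * L2_set (\<lambda>j. norm (\<xi> j)) {..<n}"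
    using r by (intro L2_set_right_distrib[symmetric]) auto
  finally have "L2_set (\<lambda>j. norm ((1 / r) *\<^sub>R \<xi> j)) {..<n} = (1 / r) * r"
    by (simp only: r_def)
  then have "(\<lambda>j. (1 / r) *\<^sub>R \<xi> j) \<in> {\<xi>. L2_set (\<lambda>j. norm (\<xi> j)) {..<n} \<le> 1}"
    using r by simp
  then have "L2_set (\<lambda>i. norm (\<Sum>j<n. T i j ((1 / r) *\<^sub>R \<xi> j))) {..<m} \<le> amp_norm m n T"
    unfolding amp_norm_def by (rule cSUP_upper[OF _ amp_norm_bdd_above[OF bl]])
  then have "L2_set (\<lambda>i. norm (\<Sum>j<n. T i j (\<xi> j))) {..<m} / r \<le> amp_norm m n T"
    unfolding scale .
  then show ?thesis
    using r by (simp add: r_def[symmetric] pos_divide_le_eq)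
qed

lemma amp_norm_le:
  fixes T :: "nat \<Rightarrow> nat \<Rightarrow> 'a::real_normed_vector \<Rightarrow> 'b::real_normed_vector"
  assumes "0 \<le> B" "\<And>\<xi>. L2_set (\<lambda>i. norm (\<Sum>j<n. T i j (\<xi> j))) {..<m} \<le> B * L2_set (\<lambda>j. norm (\<xi> j)) {..<n}"
  shows "amp_norm m n T \<le> B"
  unfolding amp_norm_def
proof (rule cSUP_least)
  have "L2_set (\<lambda>j. norm (0 :: 'a)) {..<n} \<le> 1"
    by (simp add: L2_set_def)
  then show "{\<xi> :: nat \<Rightarrow> 'a. L2_set (\<lambda>j. norm (\<xi> j)) {..<n} \<le> 1} \<noteq> {}"
    unfolding Collect_empty_eq not_all not_not by (rule exI[of _ "\<lambda>_. 0"])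
next
  fix \<xi> :: "nat \<Rightarrow> 'a" assume "\<xi> \<in> {\<xi>. L2_set (\<lambda>j. norm (\<xi> j)) {..<n} \<le> 1}"
  then have "B * L2_set (\<lambda>j. norm (\<xi> j)) {..<n} \<le> B"
    using assms(1) by (simp add: mult_left_le)
  then show "L2_set (\<lambda>i. norm (\<Sum>j<n. T i j (\<xi> j))) {..<m} \<le> B"
    by (rule order_trans[OF assms(2)])
qed

lemma scalar_norm_nonneg [simp]: "0 \<le> scalar_norm m n \<alpha>"
  unfolding scalar_norm_def by (intro amp_norm_nonneg bounded_linear_mult_right)

text \<open>If the supports of the rows are disjoint, different rows read different coordinates of a vector,
  so that the Cauchy--Schwarz inequalities of the single rows add up to a bound of the whole matrix.\<close>

lemma scalar_norm_le_disjoint_rows: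
  assumes B: "0 \<le> B"
    and uniq: "\<And>i i' j. \<lbrakk>i < m; i' < m; j < n; \<alpha> i j \<noteq> 0; \<alpha> i' j \<noteq> 0\<rbrakk> \<Longrightarrow> i = i'"
    and row: "\<And>i. i < m \<Longrightarrow> (\<Sum>j<n. (cmod (\<alpha> i j))\<^sup>2) \<le> B\<^sup>2"
  shows "scalar_norm m n \<alpha> \<le> B"
  unfolding scalar_norm_def
proof (rule amp_norm_le[OF B])
  fix \<xi> :: "nat \<Rightarrow> complex"
  define S where "S i = {j. j < n \<and> \<alpha> i j \<noteq> 0}" for i
  have row': "(norm (\<Sum>j<n. \<alpha> i j * \<xi> j))\<^sup>2 \<le> B\<^sup>2 * (\<Sum>j\<in>S i. (norm (\<xi> j))\<^sup>2)" if "i < m" for i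
  proof -
    have "(\<Sum>j<n. \<alpha> i j * \<xi> j) = (\<Sum>j\<in>S i. \<alpha> i j * \<xi> j)"
      by (intro sum.mono_neutral_right) (auto simp: S_def)
    then have "norm (\<Sum>j<n. \<alpha> i j * \<xi> j) \<le> (\<Sum>j\<in>S i. \<bar>cmod (\<alpha> i j)\<bar> * \<bar>norm (\<xi> j)\<bar>)"
      by (auto intro!: order_trans[OF norm_sum] simp: norm_mult)
    also have "\<dots> \<le> L2_set (\<lambda>j. cmod (\<alpha> i j)) (S i) * L2_set (\<lambda>j. norm (\<xi> j)) (S i)"
      by (rule L2_set_mult_ineq)
    finally have "(norm (\<Sum>j<n. \<alpha> i j * \<xi> j))\<^sup>2 \<le> (L2_set (\<lambda>j. cmod (\<alpha> i j)) (S i) * L2_set (\<lambda>j. norm (\<xi> j)) (S i))\<^sup>2"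
      by (intro power_mono) auto
    also have "\<dots> = (\<Sum>j\<in>S i. (cmod (\<alpha> i j))\<^sup>2) * (\<Sum>j\<in>S i. (norm (\<xi> j))\<^sup>2)"
      by (simp add: L2_set_def power_mult_distrib sum_nonneg)
    also have "(\<Sum>j\<in>S i. (cmod (\<alpha> i j))\<^sup>2) = (\<Sum>j<n. (cmod (\<alpha> i j))\<^sup>2)"
      by (intro sum.mono_neutral_left) (auto simp: S_def)
    also have "\<dots> * (\<Sum>j\<in>S i. (norm (\<xi> j))\<^sup>2) \<le> B\<^sup>2 * (\<Sum>j\<in>S i. (norm (\<xi> j))\<^sup>2)"
      by (intro mult_right_mono row that sum_nonneg) auto
    finally show ?thesis .
  qed
  have disj: "i < m \<Longrightarrow> i' < m \<Longrightarrow> i \<noteq> i' \<Longrightarrow> S i \<inter> S i' = {}" for i i'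
    using uniq by (auto simp: S_def)
  have "(\<Sum>i<m. (norm (\<Sum>j<n. \<alpha> i j * \<xi> j))\<^sup>2) \<le> B\<^sup>2 * (\<Sum>i<m. \<Sum>j\<in>S i. (norm (\<xi> j))\<^sup>2)"
    unfolding sum_distrib_left[of _ _ "{..<m}"] by (intro sum_mono row') auto
  also have "(\<Sum>i<m. \<Sum>j\<in>S i. (norm (\<xi> j))\<^sup>2) = (\<Sum>j\<in>(\<Union>i\<in>{..<m}. S i). (norm (\<xi> j))\<^sup>2)"
    by (rule sum.UNION_disjoint[symmetric]) (auto simp: S_def dest: uniq)
  also have "\<dots> \<le> (\<Sum>j<n. (norm (\<xi> j))\<^sup>2)"
    by (intro sum_mono2) (auto simp: S_def)
  finally have "sqrt (\<Sum>i<m. (norm (\<Sum>j<n. \<alpha> i j * \<xi> j))\<^sup>2) \<le> sqrt (B\<^sup>2 * (\<Sum>j<n. (norm (\<xi> j))\<^sup>2))"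
    by (simp add: mult_left_mono)
  then show "L2_set (\<lambda>i. norm (\<Sum>j<n. \<alpha> i j * \<xi> j)) {..<m} \<le> B * L2_set (\<lambda>j. norm (\<xi> j)) {..<n}"
    using B by (simp add: L2_set_def real_sqrt_mult)
qed

section \<open>Matrix seminorms and Ruan's axioms\<close>

text \<open>This is what the completion of a space needs of its matrix norms. It is weaker than Ruan's axioms
  and also holds of the algebraic Haagerup tensor product, where it is easier to verify.\<close>

locale matrix_seminormed = complex_module V for V :: "('u, 'z) opspace_scheme" (structure) +
  assumes sn_cong:
      "\<lbrakk>x \<in> mats V n n; \<And>i j. \<lbrakk>i < n; j < n\<rbrakk> \<Longrightarrow> x i j = y i j\<rbrakk> \<Longrightarrow> mnorm V n x = mnorm V n y"
    and sn_nonneg: "x \<in> mats V n n \<Longrightarrow> 0 \<le> mnorm V n x"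
    and sn_scale: "x \<in> mats V n n \<Longrightarrow> mnorm V n (\<lambda>i j. c \<odot> x i j) \<le> cmod c * mnorm V n x"
    and sn_triangle: "\<lbrakk>x \<in> mats V n n; y \<in> mats V n n\<rbrakk> \<Longrightarrow>
        mnorm V n (\<lambda>i j. x i j \<oplus> y i j) \<le> mnorm V n x + mnorm V n y"
    and sn_unit_matrix: "v \<in> carrier V \<Longrightarrow>
        mnorm V n (\<lambda>i j. if i = k \<and> j = l then v else \<zero>) \<le> vnorm V v"
begin

lemma vnorm_nonneg [simp]: "x \<in> carrier V \<Longrightarrow> 0 \<le> vnorm V x"
  unfolding vnorm_def by (rule sn_nonneg) auto

lemma vnorm_triangle: "x \<in> carrier V \<Longrightarrow> y \<in> carrier V \<Longrightarrow> vnorm V (x \<oplus> y) \<le> vnorm V x + vnorm V y"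
  unfolding vnorm_def by (rule sn_triangle) auto

lemma vnorm_scale: "x \<in> carrier V \<Longrightarrow> vnorm V (c \<odot> x) \<le> cmod c * vnorm V x"
  unfolding vnorm_def by (rule sn_scale) auto

lemma sn_uminus: 
  assumes "x \<in> mats V n n" shows "mnorm V n (\<lambda>i j. \<ominus> x i j) = mnorm V n x"
proof -
  have le: "mnorm V n (\<lambda>i j. \<ominus> y i j) \<le> mnorm V n y" if "y \<in> mats V n n" for y
  proof -
    have "mnorm V n (\<lambda>i j. \<ominus> y i j) = mnorm V n (\<lambda>i j. (-1) \<odot> y i j)"
      using that by (intro sn_cong) (auto simp: mats_def minus_one_smult)
    also have "\<dots> \<le> mnorm V n y"
      using sn_scale[OF that, of "-1"] by simp
    finally show ?thesis .
  qed
  have "mnorm V n x = mnorm V n (\<lambda>i j. \<ominus> (\<ominus> x i j))"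
    using assms by (intro sn_cong) (auto simp: mats_def)
  also have "\<dots> \<le> mnorm V n (\<lambda>i j. \<ominus> x i j)"
    using assms by (intro le) (auto simp: mats_def)
  finally show ?thesis
    using le[OF assms] by simp
qed

lemma vnorm_uminus: "x \<in> carrier V \<Longrightarrow> vnorm V (\<ominus> x) = vnorm V x"
  unfolding vnorm_def by (rule sn_uminus) auto

lemma vnorm_zero [simp]: "vnorm V \<zero> = 0"
  using vnorm_scale[of \<zero> 0] vnorm_nonneg[of \<zero>] by (intro antisym) auto

lemma vnorm_diff_commute: "x \<in> carrier V \<Longrightarrow> y \<in> carrier V \<Longrightarrow> vnorm V (x \<ominus> y) = vnorm V (y \<ominus> x)"
  using vnorm_uminus[of "x \<ominus> y"] by (simp add: diff_swap)

lemma vnorm_diff_triangle: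
  "\<lbrakk>x \<in> carrier V; y \<in> carrier V; z \<in> carrier V\<rbrakk> \<Longrightarrow> vnorm V (x \<ominus> z) \<le> vnorm V (x \<ominus> y) + vnorm V (y \<ominus> z)"
  using vnorm_triangle[of "x \<ominus> y" "y \<ominus> z"] by (simp add: diff_add_diff)

lemma sn_zero: "mnorm V n (\<lambda>_ _. \<zero>) = 0"
  using sn_scale[of "\<lambda>_ _. \<zero>" n 0] sn_nonneg[of "\<lambda>_ _. \<zero>" n] by (auto simp: mats_def)

lemma sn_le_sum:
  assumes x: "x \<in> mats V n n"
  shows "mnorm V n x \<le> (\<Sum>i<n. \<Sum>j<n. vnorm V (x i j))"
proof -
  have "mnorm V n (\<lambda>i j. if (i, j) \<in> S then x i j else \<zero>) \<le> (\<Sum>(i, j)\<in>S. vnorm V (x i j))"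
    if "finite S" "S \<subseteq> {..<n} \<times> {..<n}" for S
    using that
  proof (induction S rule: finite_induct)
    case empty
    then show ?case by (simp add: sn_zero)
  next
    case (insert p S)
    obtain k l where p: "p = (k, l)" by (cases p)
    then have kl: "x k l \<in> carrier V" using insert.prems x by (auto simp: mats_def)
    have "mnorm V n (\<lambda>i j. if (i, j) \<in> insert p S then x i j else \<zero>) =
        mnorm V n (\<lambda>i j. (if i = k \<and> j = l then x k l else \<zero>) \<oplus> (if (i, j) \<in> S then x i j else \<zero>))"
      using insert.hyps x kl by (intro sn_cong) (auto simp: p mats_def)
    also have "\<dots> \<le> mnorm V n (\<lambda>i j. if i = k \<and> j = l then x k l else \<zero>) +
        mnorm V n (\<lambda>i j. if (i, j) \<in> S then x i j else \<zero>)"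
      using x kl by (intro sn_triangle) (auto simp: mats_def)
    also have "\<dots> \<le> vnorm V (x k l) + (\<Sum>(i, j)\<in>S. vnorm V (x i j))"
      using sn_unit_matrix[OF kl] insert by (intro add_mono) auto
    finally show ?case
      using insert.hyps by (simp add: p)
  qed
  from this[of "{..<n} \<times> {..<n}"]
  have "mnorm V n (\<lambda>i j. if (i, j) \<in> {..<n} \<times> {..<n} then x i j else \<zero>) \<le> (\<Sum>i<n. \<Sum>j<n. vnorm V (x i j))"
    by (simp add: sum.cartesian_product)
  moreover have "mnorm V n x = mnorm V n (\<lambda>i j. if (i, j) \<in> {..<n} \<times> {..<n} then x i j else \<zero>)"
    by (rule sn_cong[OF x]) auto
  ultimately show ?thesis by simp
qed

lemma sn_le_add_diff:
  assumes "x \<in> mats V n n" "y \<in> mats V n n"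
  shows "mnorm V n x \<le> mnorm V n y + mnorm V n (\<lambda>i j. x i j \<ominus> y i j)"
proof -
  have "mnorm V n x = mnorm V n (\<lambda>i j. y i j \<oplus> (x i j \<ominus> y i j))"
    using assms by (intro sn_cong) (auto simp: mats_def)
  also have "\<dots> \<le> mnorm V n y + mnorm V n (\<lambda>i j. x i j \<ominus> y i j)"
    using assms by (intro sn_triangle) (auto simp: mats_def)
  finally show ?thesis .
qed

lemma sn_diff_le_sum:
  assumes "x \<in> mats V n n" "y \<in> mats V n n"
  shows "\<bar>mnorm V n x - mnorm V n y\<bar> \<le> (\<Sum>i<n. \<Sum>j<n. vnorm V (x i j \<ominus> y i j))"
proof -
  have d: "(\<lambda>i j. x i j \<ominus> y i j) \<in> mats V n n" "(\<lambda>i j. y i j \<ominus> x i j) \<in> mats V n n"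
    using assms by (auto simp: mats_def)
  have "mnorm V n x \<le> mnorm V n y + (\<Sum>i<n. \<Sum>j<n. vnorm V (x i j \<ominus> y i j))"
    using sn_le_add_diff[OF assms] sn_le_sum[OF d(1)] by simp
  moreover have "mnorm V n y \<le> mnorm V n x + (\<Sum>i<n. \<Sum>j<n. vnorm V (y i j \<ominus> x i j))"
    using sn_le_add_diff[OF assms(2,1)] sn_le_sum[OF d(2)] by simp
  moreover have "(\<Sum>i<n. \<Sum>j<n. vnorm V (y i j \<ominus> x i j)) = (\<Sum>i<n. \<Sum>j<n. vnorm V (x i j \<ominus> y i j))"
    using assms by (intro sum.cong refl) (auto simp: mats_def vnorm_diff_commute)
  ultimately show ?thesis by linarith
qed

end

text \<open>Ruan's axioms alone, so that they can be used before completeness is established.\<close>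

locale normed_matrices = complex_module V for V :: "('u, 'z) opspace_scheme" (structure) +
  assumes nm_cong:
      "\<lbrakk>x \<in> mats V n n; \<And>i j. \<lbrakk>i < n; j < n\<rbrakk> \<Longrightarrow> x i j = y i j\<rbrakk> \<Longrightarrow> mnorm V n x = mnorm V n y"
    and nm_nonneg: "x \<in> mats V n n \<Longrightarrow> 0 \<le> mnorm V n x"
    and nm_eq_0: "x \<in> mats V n n \<Longrightarrow> mnorm V n x = 0 \<longleftrightarrow> (\<forall>i<n. \<forall>j<n. x i j = \<zero>)"
    and nm_scale: "x \<in> mats V n n \<Longrightarrow> mnorm V n (\<lambda>i j. c \<odot> x i j) = cmod c * mnorm V n x"
    and nm_triangle: "\<lbrakk>x \<in> mats V n n; y \<in> mats V n n\<rbrakk> \<Longrightarrow>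
        mnorm V n (\<lambda>i j. x i j \<oplus> y i j) \<le> mnorm V n x + mnorm V n y"
    and nm_diag: "\<lbrakk>x \<in> mats V m m; y \<in> mats V n n\<rbrakk> \<Longrightarrow>
        mnorm V (m + n) (diag_sum V m n x y) = max (mnorm V m x) (mnorm V n y)"
    and nm_sandwich: "x \<in> mats V m m \<Longrightarrow>
        mnorm V n (sandwich V m \<alpha> x \<beta>) \<le> scalar_norm n m \<alpha> * mnorm V m x * scalar_norm m n \<beta>"
begin

lemma nm_sandwich_le:
  assumes "x \<in> mats V m m" "scalar_norm n m \<alpha> \<le> a" "scalar_norm m n \<beta> \<le> b"
  shows "mnorm V n (sandwich V m \<alpha> x \<beta>) \<le> a * mnorm V m x * b"
proof -
  have "0 \<le> a" using assms(2) scalar_norm_nonneg order_trans by blast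
  have "scalar_norm n m \<alpha> * mnorm V m x * scalar_norm m n \<beta> \<le> a * mnorm V m x * b"
    using assms nm_nonneg \<open>0 \<le> a\<close> by (intro mult_mono) auto
  then show ?thesis
    using nm_sandwich[OF assms(1), of n \<alpha> \<beta>] by linarith
qed

text \<open>Selecting, moving and deleting rows and columns are sandwiches with partial permutation matrices.\<close>

lemma nm_partial_reindex:
  assumes x: "x \<in> mats V m m"
    and \<sigma>: "\<And>i. i < n \<Longrightarrow> P i \<Longrightarrow> \<sigma> i < m" "inj_on \<sigma> {i. i < n \<and> P i}"
    and \<tau>: "\<And>i. i < n \<Longrightarrow> Q i \<Longrightarrow> \<tau> i < m" "inj_on \<tau> {i. i < n \<and> Q i}"
  shows "mnorm V n (\<lambda>i j. if P i \<and> Q j then x (\<sigma> i) (\<tau> j) else \<zero>) \<le> mnorm V m x"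
proof -
  define \<alpha> :: "nat \<Rightarrow> nat \<Rightarrow> complex" where "\<alpha> i k = of_bool (P i \<and> k = \<sigma> i)" for i k
  define \<beta> :: "nat \<Rightarrow> nat \<Rightarrow> complex" where "\<beta> l j = of_bool (Q j \<and> l = \<tau> j)" for l j
  have "scalar_norm n m \<alpha> \<le> 1"
  proof (rule scalar_norm_le_disjoint_rows)
    fix i assume "i < n"
    have "(\<Sum>k<m. (cmod (\<alpha> i k))\<^sup>2) \<le> (\<Sum>k<m. if k = \<sigma> i then 1 else 0)"
      by (intro sum_mono) (auto simp: \<alpha>_def)
    then show "(\<Sum>k<m. (cmod (\<alpha> i k))\<^sup>2) \<le> 1\<^sup>2"
      by (auto split: if_splits)
  qed (use \<sigma> in \<open>auto simp: \<alpha>_def inj_on_def\<close>)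
  moreover have "scalar_norm m n \<beta> \<le> 1"
  proof (rule scalar_norm_le_disjoint_rows)
    fix l assume "l < m"
    define J where "J = {j. j < n \<and> Q j \<and> l = \<tau> j}"
    have "card J \<le> 1"
      using \<tau>(2) by (subst card_le_Suc0_iff_eq[unfolded One_nat_def[symmetric]]) (auto simp: J_def inj_on_def)
    moreover have "(\<Sum>j<n. (cmod (\<beta> l j))\<^sup>2) = (\<Sum>j\<in>J. 1)"
      by (intro sum.mono_neutral_cong_right) (auto simp: \<beta>_def J_def)
    ultimately show "(\<Sum>j<n. (cmod (\<beta> l j))\<^sup>2) \<le> 1\<^sup>2" by simp
  qed (auto simp: \<beta>_def)
  ultimately have "mnorm V n (sandwich V m \<alpha> x \<beta>) \<le> 1 * mnorm V m x * 1"
    by (rule nm_sandwich_le[OF x])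
  moreover have "mnorm V n (sandwich V m \<alpha> x \<beta>) = mnorm V n (\<lambda>i j. if P i \<and> Q j then x (\<sigma> i) (\<tau> j) else \<zero>)"
  proof (rule nm_cong)
    fix i j assume ij: "i < n" "j < n"
    show "sandwich V m \<alpha> x \<beta> i j = (if P i \<and> Q j then x (\<sigma> i) (\<tau> j) else \<zero>)"
    proof (cases "P i \<and> Q j")
      case True
      then have "\<sigma> i < m" "\<tau> j < m" using \<sigma> \<tau> ij by auto
      then have "sandwich V m \<alpha> x \<beta> i j = (\<alpha> i (\<sigma> i) * \<beta> (\<tau> j) j) \<odot> x (\<sigma> i) (\<tau> j)"
        using True by (intro sandwich_single x) (auto simp: \<alpha>_def \<beta>_def)
      then show ?thesis
        using True matsD[OF x \<open>\<sigma> i < m\<close> \<open>\<tau> j < m\<close>] by (simp add: \<alpha>_def \<beta>_def)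
    next
      case False
      then show ?thesis
        by (subst sandwich_zero[OF x]) (auto simp: \<alpha>_def \<beta>_def)
    qed
  qed (use x in auto)
  ultimately show ?thesis by simp
qed

lemma vnorm_entry_le:
  assumes "x \<in> mats V n n" "i < n" "j < n"
  shows "vnorm V (x i j) \<le> mnorm V n x"
  using nm_partial_reindex[of x n 1 "\<lambda>_. True" "\<lambda>_. i" "\<lambda>_. True" "\<lambda>_. j"] assms
  by (auto simp: vnorm_def inj_on_def)

lemma nm_unit_matrix_le:
  assumes "v \<in> carrier V"
  shows "mnorm V n (\<lambda>i j. if i = k \<and> j = l then v else \<zero>) \<le> vnorm V v"
  unfolding vnorm_def
  using nm_partial_reindex[of "\<lambda>_ _. v" 1 n "\<lambda>i. i = k" "\<lambda>_. 0" "\<lambda>j. j = l" "\<lambda>_. 0"] assms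
  by (auto simp: inj_on_def mats_def)

end

sublocale normed_matrices \<subseteq> matrix_seminormed V
  by unfold_locales (auto intro: nm_cong nm_nonneg nm_triangle nm_unit_matrix_le simp: nm_scale)

context normed_matrices begin

lemma vnorm_eq_0: "x \<in> carrier V \<Longrightarrow> vnorm V x = 0 \<longleftrightarrow> x = \<zero>"
  unfolding vnorm_def by (subst nm_eq_0) auto

lemma Metric_space_vdist: "Metric_space (carrier V) (vdist V)"
proof
  show "0 \<le> vdist V x y" for x y
    by (simp add: vdist_def)
  show "vdist V x y = vdist V y x" for x y
    by (auto simp: vdist_def vnorm_diff_commute)
  show "vdist V x y = 0 \<longleftrightarrow> x = y" if "x \<in> carrier V" "y \<in> carrier V" for x y
    using that by (simp add: vdist_def vnorm_eq_0 diff_eq_zero_iff)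
  show "vdist V x z \<le> vdist V x y + vdist V y z"
    if "x \<in> carrier V" "y \<in> carrier V" "z \<in> carrier V" for x y z
    using that by (simp add: vdist_def vnorm_diff_triangle)
qed

lemma limits_unique:
  assumes "\<And>k. s k \<in> carrier V" "x \<in> carrier V" "y \<in> carrier V"
    and "(\<lambda>k. vnorm V (s k \<ominus> x)) \<longlonglongrightarrow> 0" "(\<lambda>k. vnorm V (s k \<ominus> y)) \<longlonglongrightarrow> 0"
  shows "x = y"
proof -
  have "(\<lambda>k. vnorm V (s k \<ominus> x) + vnorm V (s k \<ominus> y)) \<longlonglongrightarrow> 0 + 0"
    by (intro tendsto_add assms)
  moreover have "vnorm V (x \<ominus> y) \<le> vnorm V (s k \<ominus> x) + vnorm V (s k \<ominus> y)" for k
    using vnorm_diff_triangle[of x "s k" y] assms by (simp add: vnorm_diff_commute)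
  ultimately have "vnorm V (x \<ominus> y) \<le> 0"
    by (intro LIMSEQ_le_const[where a = "vnorm V (x \<ominus> y)"]) auto
  then show ?thesis
    using assms by (metis vnorm_eq_0 diff_eq_zero_iff vnorm_nonneg M.minus_closed order_antisym)
qed

end

subsection \<open>Rectangular matrices\<close>

definition rowcat :: "nat \<Rightarrow> (nat \<Rightarrow> nat \<Rightarrow> 'a) \<Rightarrow> (nat \<Rightarrow> nat \<Rightarrow> 'a) \<Rightarrow> nat \<Rightarrow> nat \<Rightarrow> 'a" where
  "rowcat p x x' i j = (if j < p then x i j else x' i (j - p))"

definition colcat :: "nat \<Rightarrow> (nat \<Rightarrow> nat \<Rightarrow> 'a) \<Rightarrow> (nat \<Rightarrow> nat \<Rightarrow> 'a) \<Rightarrow> nat \<Rightarrow> nat \<Rightarrow> 'a" where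
  "colcat p y y' i j = (if i < p then y i j else y' (i - p) j)"

lemma rowcat_mats: "x \<in> mats V n p \<Longrightarrow> x' \<in> mats V n p' \<Longrightarrow> rowcat p x x' \<in> mats V n (p + p')"
  by (auto simp: mats_def rowcat_def)

lemma colcat_mats: "y \<in> mats V p n \<Longrightarrow> y' \<in> mats V p' n \<Longrightarrow> colcat p y y' \<in> mats V (p + p') n"
  by (auto simp: mats_def colcat_def)

context normed_matrices begin

lemma rect_norm_nonneg: "x \<in> mats V m n \<Longrightarrow> 0 \<le> rect_norm V m n x"
  unfolding rect_norm_def by (intro nm_nonneg) (auto simp: mats_def)

lemma rect_norm_scale:
  assumes "x \<in> mats V m n"
  shows "rect_norm V m n (\<lambda>i j. c \<odot> x i j) = cmod c * rect_norm V m n x"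
proof -
  have "rect_norm V m n (\<lambda>i j. c \<odot> x i j)
      = mnorm V (max m n) (\<lambda>i j. c \<odot> (if i < m \<and> j < n then x i j else \<zero>))"
    unfolding rect_norm_def using assms by (intro nm_cong) (auto simp: mats_def)
  also have "\<dots> = cmod c * rect_norm V m n x"
    unfolding rect_norm_def using assms by (intro nm_scale) (auto simp: mats_def)
  finally show ?thesis .
qed

lemma rect_norm_square: "x \<in> mats V n n \<Longrightarrow> rect_norm V n n x = mnorm V n x"
  unfolding rect_norm_def by (simp, intro nm_cong) (auto simp: mats_def)

lemma rect_norm_le_mnorm:
  assumes "x \<in> mats V (max m n) (max m n)"
  shows "rect_norm V m n x \<le> mnorm V (max m n) x"
  unfolding rect_norm_def
  using nm_partial_reindex[of x "max m n" "max m n" "\<lambda>i. i < m" "\<lambda>i. i" "\<lambda>j. j < n" "\<lambda>j. j"] assms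
  by auto

lemma rect_norm_single_row:
  assumes "x \<in> mats V 1 p"
  shows "rect_norm V n p (\<lambda>i k. if i = i0 then x 0 k else \<zero>) \<le> rect_norm V 1 p x"
proof -
  have m: "(\<lambda>i j. if i < 1 \<and> j < p then x i j else \<zero>) \<in> mats V (max 1 p) (max 1 p)"
    using assms by (auto simp: mats_def)
  have "rect_norm V n p (\<lambda>i k. if i = i0 then x 0 k else \<zero>) = mnorm V (max n p)
      (\<lambda>i j. if (i < n \<and> i = i0) \<and> j < p then (if 0 < (1::nat) \<and> j < p then x 0 j else \<zero>) else \<zero>)"
    unfolding rect_norm_def by (rule arg_cong[where f = "mnorm V (max n p)"]) (auto simp: fun_eq_iff)
  also have "\<dots> \<le> rect_norm V 1 p x"
    unfolding rect_norm_def
    by (rule nm_partial_reindex[OF m, of "max n p" "\<lambda>i. i < n \<and> i = i0" "\<lambda>_. 0" "\<lambda>j. j < p" "\<lambda>j. j"])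
      (auto simp: inj_on_def)
  finally show ?thesis .
qed

text \<open>The row \<open>[x, x']\<close> is \<open>[t I, s I]\<close> times the block diagonal matrix of \<open>x / t\<close> and
  \<open>x' / s\<close>, and the scalar row has norm \<open>sqrt (t\<^sup>2 + s\<^sup>2)\<close>.\<close>

lemma rect_norm_rowcat_le:
  assumes x: "x \<in> mats V n p" "rect_norm V n p x \<le> t" and t: "0 < t"
    and x': "x' \<in> mats V n p'" "rect_norm V n p' x' \<le> s" and s: "0 < s"
  shows "rect_norm V n (p + p') (rowcat p x x') \<le> sqrt (t\<^sup>2 + s\<^sup>2)"
proof -
  define N N' M where "N = max n p" and "N' = max n p'" and "M = max n (p + p')"
  define X where "X i j = complex_of_real (1 / t) \<odot> (if i < n \<and> j < p then x i j else \<zero>)" for i j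
  define X' where "X' i j = complex_of_real (1 / s) \<odot> (if i < n \<and> j < p' then x' i j else \<zero>)" for i j
  have Xm: "X \<in> mats V N N" and X'm: "X' \<in> mats V N' N'"
    using x(1) x'(1) by (auto simp: X_def X'_def mats_def)
  have "mnorm V N X = (1 / t) * rect_norm V n p x"
    unfolding X_def rect_norm_def N_def using x t by (subst nm_scale) (auto simp: mats_def norm_divide)
  then have X1: "mnorm V N X \<le> 1" using x t by simp
  have "mnorm V N' X' = (1 / s) * rect_norm V n p' x'"
    unfolding X'_def rect_norm_def N'_def using x' s by (subst nm_scale) (auto simp: mats_def norm_divide)
  then have X'1: "mnorm V N' X' \<le> 1" using x' s by simp
  define D where "D = diag_sum V N N' X X'"
  have Dm: "D \<in> mats V (N + N') (N + N')"
    using Xm X'm by (auto simp: D_def diag_sum_def mats_def)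
  have D1: "mnorm V (N + N') D \<le> 1"
    unfolding D_def using X1 X'1 by (subst nm_diag[OF Xm X'm]) auto
  define \<alpha> :: "nat \<Rightarrow> nat \<Rightarrow> complex" where
    "\<alpha> i k = (if i < n \<and> k = i then t else if i < n \<and> k = N + i then s else 0)" for i k
  define \<beta> :: "nat \<Rightarrow> nat \<Rightarrow> complex" where
    "\<beta> l j = of_bool (j < p \<and> l = j \<or> p \<le> j \<and> j < p + p' \<and> l = N + (j - p))" for l j
  have nN: "n \<le> N" "n \<le> N'" "p \<le> N" "p' \<le> N'" by (auto simp: N_def N'_def)
  have "scalar_norm M (N + N') \<alpha> \<le> sqrt (t\<^sup>2 + s\<^sup>2)"
  proof (rule scalar_norm_le_disjoint_rows)
    fix i i' j assume "\<alpha> i j \<noteq> 0" "\<alpha> i' j \<noteq> 0"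
    then show "i = i'" using nN by (auto simp: \<alpha>_def split: if_splits)
  next
    fix i assume "i < M"
    have "(\<Sum>k<N + N'. (cmod (\<alpha> i k))\<^sup>2) \<le>
        (\<Sum>k<N + N'. (if k = i then t\<^sup>2 else 0) + (if k = N + i then s\<^sup>2 else 0))"
      by (intro sum_mono) (auto simp: \<alpha>_def)
    also have "\<dots> \<le> t\<^sup>2 + s\<^sup>2"
      by (simp add: sum.distrib)
    finally show "(\<Sum>k<N + N'. (cmod (\<alpha> i k))\<^sup>2) \<le> (sqrt (t\<^sup>2 + s\<^sup>2))\<^sup>2" by simp
  qed auto
  moreover have "scalar_norm (N + N') M \<beta> \<le> 1"
  proof (rule scalar_norm_le_disjoint_rows)
    fix l
    define J where "J = {j. j < M \<and> \<beta> l j \<noteq> 0}"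
    have "card J \<le> 1"
      using nN by (subst card_le_Suc0_iff_eq[unfolded One_nat_def[symmetric]]) (auto simp: J_def \<beta>_def)
    moreover have "(\<Sum>j<M. (cmod (\<beta> l j))\<^sup>2) = (\<Sum>j\<in>J. 1)"
      by (intro sum.mono_neutral_cong_right) (auto simp: \<beta>_def J_def)
    ultimately show "(\<Sum>j<M. (cmod (\<beta> l j))\<^sup>2) \<le> 1\<^sup>2" by simp
  qed (use nN in \<open>auto simp: \<beta>_def\<close>)
  ultimately have "mnorm V M (sandwich V (N + N') \<alpha> D \<beta>) \<le> sqrt (t\<^sup>2 + s\<^sup>2) * mnorm V (N + N') D * 1"
    by (rule nm_sandwich_le[OF Dm])
  also have "\<dots> \<le> sqrt (t\<^sup>2 + s\<^sup>2)"
    using D1 by (simp add: mult_left_le)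
  also have "mnorm V M (sandwich V (N + N') \<alpha> D \<beta>) = rect_norm V n (p + p') (rowcat p x x')"
    unfolding rect_norm_def M_def[symmetric]
  proof (rule nm_cong)
    fix i j
    consider (l) "i < n" "j < p" | (r) "i < n" "p \<le> j" "j < p + p'" | (z) "\<not> (i < n \<and> j < p + p')"
      by linarith
    then show "sandwich V (N + N') \<alpha> D \<beta> i j = (if i < n \<and> j < p + p' then rowcat p x x' i j else \<zero>)"
    proof cases
      case l
      then have xij: "x i j \<in> carrier V" using x(1) by (auto simp: mats_def)
      have "sandwich V (N + N') \<alpha> D \<beta> i j = (\<alpha> i i * \<beta> j j) \<odot> D i j"
        using l nN by (intro sandwich_single[OF Dm]) (auto simp: \<alpha>_def \<beta>_def D_def diag_sum_def)
      also have "\<dots> = x i j"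
        using l nN t xij by (simp add: \<alpha>_def \<beta>_def D_def diag_sum_def X_def smult_smult)
      finally show ?thesis using l by (simp add: rowcat_def)
    next
      case r
      then obtain q where q: "j = p + q" "q < p'" by (metis le_add_diff_inverse nat_add_left_cancel_less)
      then have xij: "x' i (j - p) \<in> carrier V" using r x'(1) by (auto simp: mats_def)
      have "sandwich V (N + N') \<alpha> D \<beta> i j = (\<alpha> i (N + i) * \<beta> (N + (j - p)) j) \<odot> D (N + i) (N + (j - p))"
        using r nN by (intro sandwich_single[OF Dm]) (auto simp: \<alpha>_def \<beta>_def D_def diag_sum_def)
      also have "\<dots> = x' i (j - p)"
        using r q nN s xij by (simp add: \<alpha>_def \<beta>_def D_def diag_sum_def X'_def smult_smult)
      finally show ?thesis using r by (simp add: rowcat_def)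
    next
      case z
      then show ?thesis
        by (subst sandwich_zero[OF Dm]) (auto simp: \<alpha>_def \<beta>_def)
    qed
  qed (use Dm in auto)
  finally show ?thesis .
qed

end

definition seq_complete :: "('u, 'z) opspace_scheme \<Rightarrow> bool" where
  "seq_complete V \<longleftrightarrow>
     (\<forall>s\<in>cauchy_seqs V. \<exists>x\<in>carrier V. (\<lambda>k. vnorm V (s k \<ominus>\<^bsub>V\<^esub> x)) \<longlonglongrightarrow> 0)"

lemma (in normed_matrices) mcomplete_iff_seq_complete:
  "Metric_space.mcomplete (carrier V) (vdist V) \<longleftrightarrow> seq_complete V"
proof -
  interpret D: Metric_space "carrier V" "vdist V" by (rule Metric_space_vdist)
  have cauchy: "D.MCauchy s \<longleftrightarrow> s \<in> cauchy_seqs V" for s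
    unfolding D.MCauchy_def cauchy_seqs_def vdist_def by (auto simp: image_subset_iff)
  have lim: "limitin D.mtopology s x sequentially \<longleftrightarrow> x \<in> carrier V \<and> (\<lambda>k. vnorm V (s k \<ominus> x)) \<longlonglongrightarrow> 0"
    if "\<And>k. s k \<in> carrier V" for s x
    using that by (simp add: D.limit_metric_sequentially LIMSEQ_def vdist_def cong: conj_cong)
  have "(\<exists>x. limitin D.mtopology s x sequentially) \<longleftrightarrow>
      (\<exists>x\<in>carrier V. (\<lambda>k. vnorm V (s k \<ominus> x)) \<longlonglongrightarrow> 0)" if "s \<in> cauchy_seqs V" for s
    using lim[of s] that by (auto simp: cauchy_seqs_def)
  then show ?thesis
    by (simp add: D.mcomplete_def seq_complete_def cauchy Ball_def)
qed

sublocale operator_space \<subseteq> normed_matrices V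
  by unfold_locales (fact mnorm_cong mnorm_nonneg mnorm_eq_0 mnorm_scale mnorm_triangle ruan_diag ruan_sandwich)+

lemma (in operator_space) seq_complete: "seq_complete V"
  using complete mcomplete_iff_seq_complete by simp

lemma operator_spaceI:
  assumes "normed_matrices V" "seq_complete V"
  shows "operator_space V"
proof -
  interpret normed_matrices V by fact
  show ?thesis
    by unfold_locales
      (fact nm_cong nm_nonneg nm_eq_0 nm_scale nm_triangle nm_diag nm_sandwich
        assms(2)[folded mcomplete_iff_seq_complete])+
qed

section \<open>Completely contractive maps out of a completion\<close>

lemma null_squeeze_eventually:
  fixes f g :: "'i \<Rightarrow> real"
  assumes "(g \<longlongrightarrow> 0) F" "\<forall>\<^sub>F k in F. 0 \<le> f k \<and> f k \<le> g k"
  shows "(f \<longlongrightarrow> 0) F"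
  by (rule tendsto_sandwich[OF _ _ tendsto_const assms(1)])
    (use assms(2) in \<open>auto elim: eventually_mono\<close>)

lemma null_squeeze:
  fixes f g :: "'i \<Rightarrow> real"
  assumes "(g \<longlongrightarrow> 0) F" "\<And>k. 0 \<le> f k" "\<And>k. f k \<le> g k"
  shows "(f \<longlongrightarrow> 0) F"
  by (rule null_squeeze_eventually[OF assms(1)]) (simp add: assms)

lemma mult_divide_less:
  fixes a e :: real
  assumes "0 < e" "0 \<le> a"
  shows "a * (e / (a + 1)) < e"
proof -
  have "a * (e / (a + 1)) = e * (a / (a + 1))" by simp
  also have "\<dots> < e * 1"
    using assms by (intro mult_strict_left_mono) auto
  finally show ?thesis by simp
qed

context matrix_seminormed begin

lemma cauchy_seqs_closed: "s \<in> cauchy_seqs V \<Longrightarrow> s k \<in> carrier V"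
  by (simp add: cauchy_seqs_def)

lemma cauchy_seqs_iff:
  "s \<in> cauchy_seqs V \<longleftrightarrow> (\<forall>k. s k \<in> carrier V) \<and>
     (\<forall>e>0. \<forall>\<^sub>F N in sequentially. \<forall>k\<ge>N. \<forall>l\<ge>N. vnorm V (s k \<ominus> s l) < e)"
proof -
  have "(\<exists>N. \<forall>k\<ge>N. \<forall>l\<ge>N. vnorm V (s k \<ominus> s l) < e) \<longleftrightarrow>
      (\<forall>\<^sub>F N in sequentially. \<forall>k\<ge>N. \<forall>l\<ge>N. vnorm V (s k \<ominus> s l) < e)" for e
    unfolding eventually_sequentially by (meson order_trans)
  then show ?thesis
    by (simp add: cauchy_seqs_def)
qed

lemma cauchy_const: "x \<in> carrier V \<Longrightarrow> (\<lambda>_. x) \<in> cauchy_seqs V"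
  by (auto simp: cauchy_seqs_def)

lemma cauchy_add:
  assumes s: "s \<in> cauchy_seqs V" and t: "t \<in> cauchy_seqs V"
  shows "(\<lambda>k. s k \<oplus> t k) \<in> cauchy_seqs V"
  unfolding cauchy_seqs_iff
proof (intro conjI allI impI)
  show "s k \<oplus> t k \<in> carrier V" for k
    using cauchy_seqs_closed s t by simp
  fix e :: real assume "0 < e"
  then have "0 < e / 2" by simp
  with s t have "\<forall>\<^sub>F N in sequentially. \<forall>k\<ge>N. \<forall>l\<ge>N. vnorm V (s k \<ominus> s l) < e / 2"
    "\<forall>\<^sub>F N in sequentially. \<forall>k\<ge>N. \<forall>l\<ge>N. vnorm V (t k \<ominus> t l) < e / 2"
    unfolding cauchy_seqs_iff by blast+
  then show "\<forall>\<^sub>F N in sequentially. \<forall>k\<ge>N. \<forall>l\<ge>N. vnorm V ((s k \<oplus> t k) \<ominus> (s l \<oplus> t l)) < e"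
  proof eventually_elim
    case (elim N)
    show ?case
    proof (intro allI impI)
      fix k l assume kl: "N \<le> k" "N \<le> l"
      have "vnorm V ((s k \<oplus> t k) \<ominus> (s l \<oplus> t l)) \<le> vnorm V (s k \<ominus> s l) + vnorm V (t k \<ominus> t l)"
        using cauchy_seqs_closed[OF s] cauchy_seqs_closed[OF t] by (simp add: add_diff_add vnorm_triangle)
      also have "\<dots> < e / 2 + e / 2"
        using elim kl by (intro add_strict_mono) auto
      finally show "vnorm V ((s k \<oplus> t k) \<ominus> (s l \<oplus> t l)) < e" by simp
    qed
  qed
qed

lemma cauchy_smult:
  assumes s: "s \<in> cauchy_seqs V"
  shows "(\<lambda>k. c \<odot> s k) \<in> cauchy_seqs V"
  unfolding cauchy_seqs_iff
proof (intro conjI allI impI)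
  show "c \<odot> s k \<in> carrier V" for k
    using cauchy_seqs_closed s by simp
  fix e :: real assume e: "0 < e"
  then have "0 < e / (cmod c + 1)" by (simp add: add_nonneg_pos)
  with s have "\<forall>\<^sub>F N in sequentially. \<forall>k\<ge>N. \<forall>l\<ge>N. vnorm V (s k \<ominus> s l) < e / (cmod c + 1)"
    unfolding cauchy_seqs_iff by blast
  then show "\<forall>\<^sub>F N in sequentially. \<forall>k\<ge>N. \<forall>l\<ge>N. vnorm V (c \<odot> s k \<ominus> c \<odot> s l) < e"
  proof eventually_elim
    case (elim N)
    show ?case
    proof (intro allI impI)
      fix k l assume kl: "N \<le> k" "N \<le> l"
      have "vnorm V (c \<odot> s k \<ominus> c \<odot> s l) \<le> cmod c * vnorm V (s k \<ominus> s l)"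
        using cauchy_seqs_closed[OF s] vnorm_scale[of "s k \<ominus> s l" c] by (simp add: smult_diff)
      also have "\<dots> \<le> cmod c * (e / (cmod c + 1))"
        using elim kl by (intro mult_left_mono) (auto intro: less_imp_le)
      also have "\<dots> < e"
        using e by (intro mult_divide_less) auto
      finally show "vnorm V (c \<odot> s k \<ominus> c \<odot> s l) < e" .
    qed
  qed
qed

lemma equiv_null_rel: "equiv (cauchy_seqs V) (null_rel V)"
proof (rule equivI)
  show "refl_on (cauchy_seqs V) (null_rel V)"
    using cauchy_seqs_closed by (auto simp: refl_on_def null_rel_def)
  show "sym (null_rel V)"
    using cauchy_seqs_closed by (auto simp: sym_def null_rel_def vnorm_diff_commute)
  show "trans (null_rel V)"
  proof (rule transI)
    fix s t u assume "(s, t) \<in> null_rel V" "(t, u) \<in> null_rel V"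
    then have c: "s \<in> cauchy_seqs V" "t \<in> cauchy_seqs V" "u \<in> cauchy_seqs V"
      and l: "(\<lambda>k. vnorm V (s k \<ominus> t k)) \<longlonglongrightarrow> 0" "(\<lambda>k. vnorm V (t k \<ominus> u k)) \<longlonglongrightarrow> 0"
      by (auto simp: null_rel_def)
    have "(\<lambda>k. vnorm V (s k \<ominus> u k)) \<longlonglongrightarrow> 0"
    proof (rule null_squeeze)
      show "(\<lambda>k. vnorm V (s k \<ominus> t k) + vnorm V (t k \<ominus> u k)) \<longlonglongrightarrow> 0"
        using tendsto_add[OF l] by simp
    qed (use c cauchy_seqs_closed vnorm_diff_triangle in auto)
    with c show "(s, u) \<in> null_rel V" by (simp add: null_rel_def)
  qed
qed (auto simp: null_rel_def)

lemma lim_class_eq_iff: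
  "s \<in> cauchy_seqs V \<Longrightarrow> t \<in> cauchy_seqs V \<Longrightarrow> lim_class V s = lim_class V t \<longleftrightarrow> (s, t) \<in> null_rel V"
  unfolding lim_class_def by (rule eq_equiv_class_iff[OF equiv_null_rel])

lemma carrier_completion: "carrier (completion V) = lim_class V ` cauchy_seqs V"
  by (auto simp: completion_def quotient_def lim_class_def)

lemma rep_lim_class: "s \<in> cauchy_seqs V \<Longrightarrow> (s, rep (lim_class V s)) \<in> null_rel V"
  using equiv_class_self[OF equiv_null_rel, of s]
  unfolding rep_def lim_class_def by (metis Image_singleton_iff someI)

lemma rep_closed: "X \<in> carrier (completion V) \<Longrightarrow> rep X \<in> cauchy_seqs V"
  using rep_lim_class by (auto simp: carrier_completion null_rel_def)

lemma lim_class_rep: "X \<in> carrier (completion V) \<Longrightarrow> lim_class V (rep X) = X"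
  using rep_lim_class lim_class_eq_iff by (auto simp: carrier_completion null_rel_def)

text \<open>The operations are defined by means of an arbitrary representative of each class. They may be computed
  with any other one, because the two differ by a null sequence.\<close>

lemma completion_add:
  assumes s: "s \<in> cauchy_seqs V" and t: "t \<in> cauchy_seqs V"
  shows "lim_class V s \<oplus>\<^bsub>completion V\<^esub> lim_class V t = lim_class V (\<lambda>k. s k \<oplus> t k)"
proof -
  define s' t' where "s' = rep (lim_class V s)" and "t' = rep (lim_class V t)"
  have l: "(\<lambda>k. vnorm V (s k \<ominus> s' k)) \<longlonglongrightarrow> 0" "(\<lambda>k. vnorm V (t k \<ominus> t' k)) \<longlonglongrightarrow> 0"
    and c: "s' \<in> cauchy_seqs V" "t' \<in> cauchy_seqs V"
    using rep_lim_class[OF s] rep_lim_class[OF t] by (auto simp: null_rel_def s'_def t'_def)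
  note cl = cauchy_seqs_closed[OF s] cauchy_seqs_closed[OF t] cauchy_seqs_closed[OF c(1)] cauchy_seqs_closed[OF c(2)]
  have "(\<lambda>k. vnorm V ((s k \<oplus> t k) \<ominus> (s' k \<oplus> t' k))) \<longlonglongrightarrow> 0"
  proof (rule null_squeeze)
    show "(\<lambda>k. vnorm V (s k \<ominus> s' k) + vnorm V (t k \<ominus> t' k)) \<longlonglongrightarrow> 0"
      using tendsto_add[OF l] by simp
  qed (use cl vnorm_triangle in \<open>auto simp: add_diff_add\<close>)
  then have "lim_class V (\<lambda>k. s k \<oplus> t k) = lim_class V (\<lambda>k. s' k \<oplus> t' k)"
    by (subst lim_class_eq_iff) (auto simp: null_rel_def cauchy_add s t c)
  then show ?thesis
    by (simp add: completion_def s'_def t'_def)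
qed

lemma completion_smult:
  assumes s: "s \<in> cauchy_seqs V"
  shows "c \<odot>\<^bsub>completion V\<^esub> lim_class V s = lim_class V (\<lambda>k. c \<odot> s k)"
proof -
  define s' where "s' = rep (lim_class V s)"
  have l: "(\<lambda>k. vnorm V (s k \<ominus> s' k)) \<longlonglongrightarrow> 0" and c: "s' \<in> cauchy_seqs V"
    using rep_lim_class[OF s] by (auto simp: null_rel_def s'_def)
  note cl = cauchy_seqs_closed[OF s] cauchy_seqs_closed[OF c]
  have "(\<lambda>k. vnorm V (c \<odot> s k \<ominus> c \<odot> s' k)) \<longlonglongrightarrow> 0"
  proof (rule null_squeeze)
    show "(\<lambda>k. cmod c * vnorm V (s k \<ominus> s' k)) \<longlonglongrightarrow> 0"
      using tendsto_mult_right_zero[OF l] by simp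
    show "vnorm V (c \<odot> s k \<ominus> c \<odot> s' k) \<le> cmod c * vnorm V (s k \<ominus> s' k)" for k
      using cl by (simp add: smult_diff[symmetric] vnorm_scale)
  qed (use cl in auto)
  then have "lim_class V (\<lambda>k. c \<odot> s k) = lim_class V (\<lambda>k. c \<odot> s' k)"
    by (subst lim_class_eq_iff) (auto simp: null_rel_def cauchy_smult s \<open>s' \<in> cauchy_seqs V\<close>)
  then show ?thesis
    by (simp add: completion_def s'_def)
qed

text \<open>The norm of a matrix in the completion is given as a limit, which has to be shown to exist: norms of
  matrices differ by at most the sum of the norms of the differences of the entries.\<close>

lemma convergent_mnorm:
  assumes s: "\<And>i j. i < n \<Longrightarrow> j < n \<Longrightarrow> s i j \<in> cauchy_seqs V"
  shows "convergent (\<lambda>k. mnorm V n (\<lambda>i j. s i j k))"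
proof (intro Cauchy_convergent metric_CauchyI)
  fix e :: real assume e: "0 < e"
  define d where "d = e / (real n * real n + 1)"
  have d: "d > 0" using e by (simp add: d_def add_nonneg_pos)
  have m: "(\<lambda>i j. s i j k) \<in> mats V n n" for k
    using s cauchy_seqs_closed by (intro matsI) blast
  have "\<forall>\<^sub>F N in sequentially. \<forall>p\<in>{..<n} \<times> {..<n}. \<forall>k\<ge>N. \<forall>l\<ge>N. vnorm V (s (fst p) (snd p) k \<ominus> s (fst p) (snd p) l) < d"
    using s d by (intro eventually_ball_finite ballI) (auto simp: cauchy_seqs_iff)
  then obtain N where N: "vnorm V (s i j k \<ominus> s i j l) < d" if "i < n" "j < n" "k \<ge> N" "l \<ge> N" for i j k l
    unfolding eventually_sequentially by fastforce
  show "\<exists>M. \<forall>k\<ge>M. \<forall>l\<ge>M. dist (mnorm V n (\<lambda>i j. s i j k)) (mnorm V n (\<lambda>i j. s i j l)) < e"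
  proof (intro exI allI impI)
    fix k l assume kl: "k \<ge> N" "l \<ge> N"
    have "dist (mnorm V n (\<lambda>i j. s i j k)) (mnorm V n (\<lambda>i j. s i j l)) \<le> (\<Sum>i<n. \<Sum>j<n. vnorm V (s i j k \<ominus> s i j l))"
      using sn_diff_le_sum[OF m m] by (simp add: dist_real_def)
    also have "\<dots> \<le> (\<Sum>i<n. \<Sum>j<n. d)"
      using N kl by (intro sum_mono) (auto intro: less_imp_le)
    also have "\<dots> < e"
      using mult_divide_less[OF e, of "real n * real n"] by (simp add: d_def)
    finally show "dist (mnorm V n (\<lambda>i j. s i j k)) (mnorm V n (\<lambda>i j. s i j l)) < e" .
  qed
qed

lemma completion_mnorm:
  assumes s: "\<And>i j. i < n \<Longrightarrow> j < n \<Longrightarrow> s i j \<in> cauchy_seqs V"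
  shows "(\<lambda>k. mnorm V n (\<lambda>i j. s i j k)) \<longlonglongrightarrow> mnorm (completion V) n (\<lambda>i j. lim_class V (s i j))"
proof -
  define r where "r i j = rep (lim_class V (s i j))" for i j
  have l: "(\<lambda>k. vnorm V (r i j k \<ominus> s i j k)) \<longlonglongrightarrow> 0" and c: "r i j \<in> cauchy_seqs V" if "i < n" "j < n" for i j
    using rep_lim_class[OF s[OF that]] symD[OF equivE[OF equiv_null_rel]] 
    by (auto simp: null_rel_def r_def vnorm_diff_commute cauchy_seqs_closed)
  have m: "(\<lambda>i j. s i j k) \<in> mats V n n" "(\<lambda>i j. r i j k) \<in> mats V n n" for k
    using s c cauchy_seqs_closed by (auto simp: mats_def)
  have "(\<lambda>k. mnorm V n (\<lambda>i j. r i j k)) \<longlonglongrightarrow> lim (\<lambda>k. mnorm V n (\<lambda>i j. r i j k))"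
    using convergent_mnorm[OF c] by (simp add: convergent_LIMSEQ_iff)
  moreover have "(\<lambda>k. mnorm V n (\<lambda>i j. s i j k) - mnorm V n (\<lambda>i j. r i j k)) \<longlonglongrightarrow> 0"
  proof (rule Lim_null_comparison)
    show "\<forall>\<^sub>F k in sequentially. norm (mnorm V n (\<lambda>i j. s i j k) - mnorm V n (\<lambda>i j. r i j k))
        \<le> (\<Sum>i<n. \<Sum>j<n. vnorm V (r i j k \<ominus> s i j k))"
      using sn_diff_le_sum[OF m(2,1)] by (simp add: abs_minus_commute)
    show "(\<lambda>k. \<Sum>i<n. \<Sum>j<n. vnorm V (r i j k \<ominus> s i j k)) \<longlonglongrightarrow> 0"
      using l by (intro tendsto_null_sum) auto
  qed
  ultimately have "(\<lambda>k. mnorm V n (\<lambda>i j. s i j k)) \<longlonglongrightarrow> lim (\<lambda>k. mnorm V n (\<lambda>i j. r i j k))"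
    by (rule Lim_transform)
  then show ?thesis
    by (simp add: completion_def r_def)
qed

text \<open>A Cauchy sequence is sent to the limit of its image, which is unchanged by null sequences; the norm
  inequalities pass to the limit entry by entry.\<close>

lemma completely_contractive_extend:
  fixes W :: "('v, 'y) opspace_scheme"
  assumes W: "operator_space W" and \<mu>: "completely_contractive V W \<mu>"
  shows "\<exists>m. completely_contractive (completion V) W m \<and>
    (\<forall>x\<in>carrier V. m (lim_class V (\<lambda>_. x)) = \<mu> x)"
proof -
  interpret W: operator_space W by fact
  interpret \<mu>: linear_between V W \<mu>
    by unfold_locales (use \<mu> in \<open>simp add: completely_contractive_def\<close>)
  have bound: "mnorm W n (\<lambda>i j. \<mu> (x i j)) \<le> mnorm V n x" if "x \<in> mats V n n" for n x
    using \<mu> that by (simp add: completely_contractive_def)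
  have vbound: "vnorm W (\<mu> x) \<le> vnorm V x" if "x \<in> carrier V" for x
    unfolding vnorm_def by (rule bound) (use that in auto)
  have dbound: "vnorm W (\<mu> x \<ominus>\<^bsub>W\<^esub> \<mu> y) \<le> vnorm V (x \<ominus> y)" if "x \<in> carrier V" "y \<in> carrier V" for x y
    using vbound[of "x \<ominus> y"] that by (simp add: \<mu>.diff)
  define L where "L s y \<longleftrightarrow> y \<in> carrier W \<and> (\<lambda>k. vnorm W (\<mu> (s k) \<ominus>\<^bsub>W\<^esub> y)) \<longlonglongrightarrow> 0" for s y
  have L_ex: "\<exists>y. L s y" if s: "s \<in> cauchy_seqs V" for s
  proof -
    have "(\<lambda>k. \<mu> (s k)) \<in> cauchy_seqs W"
      using s dbound cauchy_seqs_closed[OF s] unfolding cauchy_seqs_def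
      by (auto, meson le_less_trans)
    then show ?thesis
      using W.seq_complete by (auto simp: seq_complete_def L_def)
  qed
  have L_unique: "y = z" if "s \<in> cauchy_seqs V" "L s y" "L s z" for s y z
    using that cauchy_seqs_closed by (intro W.limits_unique[of "\<lambda>k. \<mu> (s k)"]) (auto simp: L_def)
  have L_null: "L t y" if st: "(s, t) \<in> null_rel V" and y: "L s y" for s t y
  proof -
    have c: "s k \<in> carrier V" "t k \<in> carrier V" for k
      using st cauchy_seqs_closed by (auto simp: null_rel_def)
    have l: "(\<lambda>k. vnorm V (s k \<ominus> t k)) \<longlonglongrightarrow> 0" "(\<lambda>k. vnorm W (\<mu> (s k) \<ominus>\<^bsub>W\<^esub> y)) \<longlonglongrightarrow> 0"
      using st y by (auto simp: null_rel_def L_def)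
    have yc: "y \<in> carrier W" using y by (simp add: L_def)
    have "(\<lambda>k. vnorm W (\<mu> (t k) \<ominus>\<^bsub>W\<^esub> y)) \<longlonglongrightarrow> 0"
    proof (rule null_squeeze)
      show "(\<lambda>k. vnorm V (s k \<ominus> t k) + vnorm W (\<mu> (s k) \<ominus>\<^bsub>W\<^esub> y)) \<longlonglongrightarrow> 0"
        using tendsto_add[OF l] by simp
      show "vnorm W (\<mu> (t k) \<ominus>\<^bsub>W\<^esub> y) \<le> vnorm V (s k \<ominus> t k) + vnorm W (\<mu> (s k) \<ominus>\<^bsub>W\<^esub> y)" for k
        using W.vnorm_diff_triangle[of "\<mu> (t k)" "\<mu> (s k)" y] dbound[of "t k" "s k"] c yc
        by (simp add: vnorm_diff_commute[of "t k" "s k"])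
    qed (use c yc in auto)
    with yc show ?thesis by (simp add: L_def)
  qed
  define m where "m X = (SOME y. L (rep X) y)" for X
  have L_m: "L (rep X) (m X)" if "X \<in> carrier (completion V)" for X
    unfolding m_def by (rule someI_ex) (use L_ex rep_closed that in blast)
  have m_eq: "m (lim_class V s) = y" if s: "s \<in> cauchy_seqs V" and y: "L s y" for s y
  proof -
    have "lim_class V s \<in> carrier (completion V)" using s by (simp add: carrier_completion)
    then show ?thesis
      using L_m L_null[OF rep_lim_class[OF s] y] L_unique rep_closed by blast
  qed
  have m_closed: "m X \<in> carrier W" if "X \<in> carrier (completion V)" for X
    using L_m[OF that] by (simp add: L_def)
  have L_add: "L (\<lambda>k. s k \<oplus> t k) (x \<oplus>\<^bsub>W\<^esub> y)" if "s \<in> cauchy_seqs V" "t \<in> cauchy_seqs V" "L s x" "L t y" for s t x y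
  proof -
    have c: "s k \<in> carrier V" "t k \<in> carrier V" "x \<in> carrier W" "y \<in> carrier W" for k
      using that cauchy_seqs_closed by (auto simp: L_def)
    have "(\<lambda>k. vnorm W (\<mu> (s k \<oplus> t k) \<ominus>\<^bsub>W\<^esub> (x \<oplus>\<^bsub>W\<^esub> y))) \<longlonglongrightarrow> 0"
    proof (rule null_squeeze)
      show "(\<lambda>k. vnorm W (\<mu> (s k) \<ominus>\<^bsub>W\<^esub> x) + vnorm W (\<mu> (t k) \<ominus>\<^bsub>W\<^esub> y)) \<longlonglongrightarrow> 0"
        using tendsto_add[of _ 0 _ _ 0] that by (auto simp: L_def)
      show "vnorm W (\<mu> (s k \<oplus> t k) \<ominus>\<^bsub>W\<^esub> (x \<oplus>\<^bsub>W\<^esub> y))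
          \<le> vnorm W (\<mu> (s k) \<ominus>\<^bsub>W\<^esub> x) + vnorm W (\<mu> (t k) \<ominus>\<^bsub>W\<^esub> y)" for k
        using c by (simp add: \<mu>.add W.add_diff_add W.vnorm_triangle)
    qed (use c in auto)
    with c show ?thesis by (simp add: L_def)
  qed
  have L_smult: "L (\<lambda>k. a \<odot> s k) (a \<odot>\<^bsub>W\<^esub> x)" if "s \<in> cauchy_seqs V" "L s x" for s x a
  proof -
    have c: "s k \<in> carrier V" "x \<in> carrier W" for k
      using that cauchy_seqs_closed by (auto simp: L_def)
    have "(\<lambda>k. vnorm W (\<mu> (a \<odot> s k) \<ominus>\<^bsub>W\<^esub> (a \<odot>\<^bsub>W\<^esub> x))) \<longlonglongrightarrow> 0"
    proof (rule null_squeeze)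
      show "(\<lambda>k. cmod a * vnorm W (\<mu> (s k) \<ominus>\<^bsub>W\<^esub> x)) \<longlonglongrightarrow> 0"
        using that by (intro tendsto_mult_right_zero) (auto simp: L_def)
      show "vnorm W (\<mu> (a \<odot> s k) \<ominus>\<^bsub>W\<^esub> (a \<odot>\<^bsub>W\<^esub> x)) \<le> cmod a * vnorm W (\<mu> (s k) \<ominus>\<^bsub>W\<^esub> x)" for k
        using c by (simp add: \<mu>.smult W.smult_diff[symmetric] W.vnorm_scale)
    qed (use c in auto)
    with c show ?thesis by (simp add: L_def)
  qed
  have "linear_map (completion V) W m"
    unfolding linear_map_def
  proof (intro conjI ballI allI Pi_I)
    fix X Y c assume X: "X \<in> carrier (completion V)"
    then show "m X \<in> carrier W" by (rule m_closed)
    have "m (c \<odot>\<^bsub>completion V\<^esub> lim_class V (rep X)) = c \<odot>\<^bsub>W\<^esub> m X"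
      using X by (simp add: completion_smult rep_closed m_eq cauchy_smult L_smult L_m)
    then show "m (c \<odot>\<^bsub>completion V\<^esub> X) = c \<odot>\<^bsub>W\<^esub> m X"
      using X by (simp add: lim_class_rep)
    assume Y: "Y \<in> carrier (completion V)"
    have "m (lim_class V (rep X) \<oplus>\<^bsub>completion V\<^esub> lim_class V (rep Y)) = m X \<oplus>\<^bsub>W\<^esub> m Y"
      using X Y by (simp add: completion_add rep_closed m_eq cauchy_add L_add L_m)
    then show "m (X \<oplus>\<^bsub>completion V\<^esub> Y) = m X \<oplus>\<^bsub>W\<^esub> m Y"
      using X Y by (simp add: lim_class_rep)
  qed
  moreover have "mnorm W n (\<lambda>i j. m (X i j)) \<le> mnorm (completion V) n X" if X: "X \<in> mats (completion V) n n" for n X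
  proof -
    have Xc: "X i j \<in> carrier (completion V)" if "i < n" "j < n" for i j
      using X that by (simp add: mats_def)
    have rm: "(\<lambda>i j. rep (X i j) k) \<in> mats V n n" for k
      using Xc rep_closed cauchy_seqs_closed by (intro matsI) blast
    have mm: "(\<lambda>i j. m (X i j)) \<in> mats W n n"
      using Xc m_closed by (intro matsI) blast
    have 1: "(\<lambda>k. mnorm V n (\<lambda>i j. rep (X i j) k)) \<longlonglongrightarrow> mnorm (completion V) n X"
    proof -
      have "mnorm (completion V) n X = lim (\<lambda>k. mnorm V n (\<lambda>i j. rep (X i j) k))"
        by (simp add: completion_def)
      then show ?thesis
        using convergent_mnorm[of n "\<lambda>i j. rep (X i j)"] Xc rep_closed by (simp add: convergent_LIMSEQ_iff)
    qed
    have "(\<lambda>k. mnorm W n (\<lambda>i j. m (X i j)) - mnorm W n (\<lambda>i j. \<mu> (rep (X i j) k))) \<longlonglongrightarrow> 0"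
    proof (rule Lim_null_comparison)
      show "\<forall>\<^sub>F k in sequentially. norm (mnorm W n (\<lambda>i j. m (X i j)) - mnorm W n (\<lambda>i j. \<mu> (rep (X i j) k)))
          \<le> (\<Sum>i<n. \<Sum>j<n. vnorm W (\<mu> (rep (X i j) k) \<ominus>\<^bsub>W\<^esub> m (X i j)))"
        using W.sn_diff_le_sum[OF \<mu>.mats[OF rm] mm] by (simp add: abs_minus_commute)
      show "(\<lambda>k. \<Sum>i<n. \<Sum>j<n. vnorm W (\<mu> (rep (X i j) k) \<ominus>\<^bsub>W\<^esub> m (X i j))) \<longlonglongrightarrow> 0"
        using L_m Xc by (intro tendsto_null_sum) (auto simp: L_def)
    qed
    from tendsto_add[OF this 1]
    have "(\<lambda>k. mnorm W n (\<lambda>i j. m (X i j)) - mnorm W n (\<lambda>i j. \<mu> (rep (X i j) k)) + mnorm V n (\<lambda>i j. rep (X i j) k))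
        \<longlonglongrightarrow> mnorm (completion V) n X" by simp
    moreover have "mnorm W n (\<lambda>i j. m (X i j)) \<le> mnorm W n (\<lambda>i j. m (X i j)) - mnorm W n (\<lambda>i j. \<mu> (rep (X i j) k)) + mnorm V n (\<lambda>i j. rep (X i j) k)" for k
      using bound[OF rm[of k]] by simp
    ultimately show ?thesis
      by (intro LIMSEQ_le_const[where a = "mnorm W n (\<lambda>i j. m (X i j))"]) auto
  qed
  moreover have "m (lim_class V (\<lambda>_. x)) = \<mu> x" if "x \<in> carrier V" for x
    using that by (intro m_eq cauchy_const) (auto simp: L_def)
  ultimately show ?thesis
    unfolding completely_contractive_def by blast
qed

text \<open>Constant sequences embed the space isometrically into its completion.\<close>

lemma completely_contractive_restrict:
  assumes m: "completely_contractive (completion V) W m"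
  shows "completely_contractive V W (\<lambda>x. m (lim_class V (\<lambda>_. x)))"
proof -
  have lc: "lim_class V (\<lambda>_. x) \<in> carrier (completion V)" if "x \<in> carrier V" for x
    using that by (auto simp: carrier_completion cauchy_const)
  have "mnorm W n (\<lambda>i j. m (lim_class V (\<lambda>_. x i j))) \<le> mnorm V n x" if x: "x \<in> mats V n n" for n x
  proof -
    have "(\<lambda>i j. lim_class V (\<lambda>_. x i j)) \<in> mats (completion V) n n"
      using x lc by (auto simp: mats_def)
    then have "mnorm W n (\<lambda>i j. m (lim_class V (\<lambda>_. x i j))) \<le> mnorm (completion V) n (\<lambda>i j. lim_class V (\<lambda>_. x i j))"
      using m by (simp add: completely_contractive_def)
    also have "\<dots> = mnorm V n x"
      using LIMSEQ_unique[OF completion_mnorm[of n "\<lambda>i j _. x i j"] tendsto_const] x cauchy_const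
      by (auto simp: mats_def)
    finally show ?thesis .
  qed
  then show ?thesis
    using m lc completion_add[OF cauchy_const cauchy_const] completion_smult[OF cauchy_const]
    by (simp add: completely_contractive_def linear_map_def Pi_iff) (metis (no_types, lifting))
qed

end

section \<open>Operator algebras as spaces of coefficients\<close>

lemma cscale_1 [simp]: "cscale 1 (x::'h::chilbert_space) = x"
  using cscale_of_real[of 1 x] by simp

lemma norm_cscale: "norm (cscale c (x::'h::chilbert_space)) = cmod c * norm x"
proof -
  have "cinner (cscale c x) (cscale c x) = c * (cnj c * cnj (cinner x x))"
    by (metis cinner_commute cinner_scale_left complex_cnj_mult)
  also have "\<dots> = complex_of_real ((cmod c)\<^sup>2) * cnj (cinner x x)"
    by (simp add: complex_norm_square[symmetric] mult.assoc[symmetric] del: of_real_power)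
  finally have "inner (cscale c x) (cscale c x) = (cmod c)\<^sup>2 * inner x x"
    by (simp add: inner_eq_Re_cinner del: of_real_power)
  then show ?thesis
    by (simp add: norm_eq_sqrt_inner real_sqrt_mult)
qed

lemma bounded_linear_cscale: "bounded_linear (cscale c :: 'h::chilbert_space \<Rightarrow> 'h)"
proof (rule bounded_linear_intro[where K = "cmod c"])
  show "cscale c (r *\<^sub>R x) = r *\<^sub>R cscale c x" for r and x :: 'h
    by (simp add: cscale_of_real[symmetric] cscale_cscale mult.commute)
qed (auto simp: cscale_add_right norm_cscale)

lemma cscale_op_apply [simp]: "blinfun_apply (cscale_op c T) x = cscale c (blinfun_apply T x)"
  unfolding cscale_op_def
  by (subst bounded_linear_Blinfun_apply)
    (auto intro: bounded_linear_compose[OF bounded_linear_cscale] blinfun.bounded_linear_right)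

lemma opspace_of_simps [simp]:
  "carrier (opspace_of A) = A" "\<zero>\<^bsub>opspace_of A\<^esub> = 0"
  "a \<oplus>\<^bsub>opspace_of A\<^esub> b = a + b" "c \<odot>\<^bsub>opspace_of A\<^esub> a = cscale_op c a"
  "mnorm (opspace_of A) n x = amp_norm n n (\<lambda>i j. blinfun_apply (x i j))"
  by (simp_all add: opspace_of_def)

text \<open>Padding a matrix of operators with zeros changes neither the vectors in its range nor what it does to
  vectors supported on the original columns.\<close>

lemma rect_norm_opspace_of:
  fixes A :: "('h::chilbert_space \<Rightarrow>\<^sub>L 'h) set"
  shows "rect_norm (opspace_of A) p n y = amp_norm p n (\<lambda>i j. blinfun_apply (y i j))"
proof -
  define M where "M = max p n"
  define T where "T i j = blinfun_apply (if i < p \<and> j < n then y i j else 0)" for i j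
  have r: "rect_norm (opspace_of A) p n y = amp_norm M M T"
    by (simp add: rect_norm_def M_def T_def[abs_def] cong: if_cong)
  have pM: "{..<p} \<subseteq> {..<M}" "{..<n} \<subseteq> {..<M}" by (auto simp: M_def)
  have blT: "bounded_linear (T i j)" for i j
    unfolding T_def by (rule blinfun.bounded_linear_right)
  have bly: "bounded_linear (blinfun_apply (y i j))" for i j
    by (rule blinfun.bounded_linear_right)
  have T: "L2_set (\<lambda>i. norm (\<Sum>j<M. T i j (\<xi> j))) {..<M}
      = L2_set (\<lambda>i. norm (\<Sum>j<n. blinfun_apply (y i j) (\<xi> j))) {..<p}" for \<xi> :: "nat \<Rightarrow> 'h"
  proof -
    have *: "(\<Sum>j<M. T i j (\<xi> j)) = (if i < p then \<Sum>j<n. blinfun_apply (y i j) (\<xi> j) else 0)" for i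
    proof (cases "i < p")
      case True
      then have "(\<Sum>j<M. T i j (\<xi> j)) = (\<Sum>j<n. blinfun_apply (y i j) (\<xi> j))"
        using pM by (intro sum.mono_neutral_cong_right) (auto simp: T_def)
      then show ?thesis using True by simp
    qed (simp add: T_def)
    have "(\<Sum>i<M. (norm (\<Sum>j<M. T i j (\<xi> j)))\<^sup>2) = (\<Sum>i<p. (norm (\<Sum>j<n. blinfun_apply (y i j) (\<xi> j)))\<^sup>2)"
      unfolding * using pM by (intro sum.mono_neutral_cong_right) auto
    then show ?thesis by (simp add: L2_set_def)
  qed
  show ?thesis
    unfolding r
  proof (rule antisym)
    show "amp_norm M M T \<le> amp_norm p n (\<lambda>i j. blinfun_apply (y i j))"
    proof (rule amp_norm_le[OF amp_norm_nonneg[OF bly]])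
      fix \<xi> :: "nat \<Rightarrow> 'h"
      have "L2_set (\<lambda>i. norm (\<Sum>j<M. T i j (\<xi> j))) {..<M}
          \<le> amp_norm p n (\<lambda>i j. blinfun_apply (y i j)) * L2_set (\<lambda>j. norm (\<xi> j)) {..<n}"
        unfolding T by (rule amp_norm_apply[OF bly])
      also have "\<dots> \<le> amp_norm p n (\<lambda>i j. blinfun_apply (y i j)) * L2_set (\<lambda>j. norm (\<xi> j)) {..<M}"
        unfolding L2_set_def using pM
        by (intro mult_left_mono amp_norm_nonneg[OF bly] real_sqrt_le_mono sum_mono2) auto
      finally show "L2_set (\<lambda>i. norm (\<Sum>j<M. T i j (\<xi> j))) {..<M}
          \<le> amp_norm p n (\<lambda>i j. blinfun_apply (y i j)) * L2_set (\<lambda>j. norm (\<xi> j)) {..<M}" .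
    qed
    show "amp_norm p n (\<lambda>i j. blinfun_apply (y i j)) \<le> amp_norm M M T"
    proof (rule amp_norm_le[OF amp_norm_nonneg[OF blT]])
      fix \<xi> :: "nat \<Rightarrow> 'h"
      define \<xi>' where "\<xi>' j = (if j < n then \<xi> j else 0)" for j
      have "L2_set (\<lambda>i. norm (\<Sum>j<n. blinfun_apply (y i j) (\<xi> j))) {..<p}
          = L2_set (\<lambda>i. norm (\<Sum>j<n. blinfun_apply (y i j) (\<xi>' j))) {..<p}"
        by (simp add: \<xi>'_def)
      also have "\<dots> \<le> amp_norm M M T * L2_set (\<lambda>j. norm (\<xi>' j)) {..<M}"
        unfolding T[symmetric] by (rule amp_norm_apply[OF blT])
      also have "L2_set (\<lambda>j. norm (\<xi>' j)) {..<M} = L2_set (\<lambda>j. norm (\<xi> j)) {..<n}"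
        unfolding L2_set_def using pM
        by (intro arg_cong[where f = sqrt] sum.mono_neutral_cong_right) (auto simp: \<xi>'_def)
      finally show "L2_set (\<lambda>i. norm (\<Sum>j<n. blinfun_apply (y i j) (\<xi> j))) {..<p}
          \<le> amp_norm M M T * L2_set (\<lambda>j. norm (\<xi> j)) {..<n}" .
    qed
  qed
qed

lemma rect_norm_opspace_nonneg [simp]: "0 \<le> rect_norm (opspace_of A) p n y"
  unfolding rect_norm_opspace_of by (intro amp_norm_nonneg blinfun.bounded_linear_right)

lemma rect_norm_opspace_apply:
  "L2_set (\<lambda>i. norm (\<Sum>j<n. blinfun_apply (y i j) (\<xi> j))) {..<p}
     \<le> rect_norm (opspace_of A) p n y * L2_set (\<lambda>j. norm (\<xi> j)) {..<n}"
  unfolding rect_norm_opspace_of by (intro amp_norm_apply blinfun.bounded_linear_right)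

lemma rect_norm_opspace_scale_le:
  "rect_norm (opspace_of A) p n (\<lambda>i j. cscale_op c (y i j)) \<le> cmod c * rect_norm (opspace_of A) p n y"
proof (subst rect_norm_opspace_of, rule amp_norm_le)
  fix \<xi> :: "nat \<Rightarrow> 'a"
  interpret bounded_linear "cscale c :: 'a \<Rightarrow> 'a" by (rule bounded_linear_cscale)
  have "L2_set (\<lambda>i. norm (\<Sum>j<n. blinfun_apply (cscale_op c (y i j)) (\<xi> j))) {..<p}
      = cmod c * L2_set (\<lambda>i. norm (\<Sum>j<n. blinfun_apply (y i j) (\<xi> j))) {..<p}"
    by (simp add: sum[symmetric] norm_cscale L2_set_right_distrib)
  also have "\<dots> \<le> cmod c * (rect_norm (opspace_of A) p n y * L2_set (\<lambda>j. norm (\<xi> j)) {..<n})"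
    by (intro mult_left_mono rect_norm_opspace_apply) auto
  finally show "L2_set (\<lambda>i. norm (\<Sum>j<n. blinfun_apply (cscale_op c (y i j)) (\<xi> j))) {..<p}
      \<le> cmod c * rect_norm (opspace_of A) p n y * L2_set (\<lambda>j. norm (\<xi> j)) {..<n}"
    by (simp add: mult.assoc)
qed simp

lemma sum_lessThan_add:
  fixes f :: "nat \<Rightarrow> 'a::comm_monoid_add"
  shows "(\<Sum>i<p + p'. f i) = (\<Sum>i<p. f i) + (\<Sum>i<p'. f (p + i))"
  by (induction p') (simp_all add: ac_simps)

text \<open>The squared norm of the image of a vector under the column is the sum of those under its two parts.\<close>

lemma rect_norm_opspace_colcat_le:
  assumes "rect_norm (opspace_of A) p n y \<le> t" "rect_norm (opspace_of A) p' n y' \<le> s" "0 \<le> t" "0 \<le> s"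
  shows "rect_norm (opspace_of A) (p + p') n (colcat p y y') \<le> sqrt (t\<^sup>2 + s\<^sup>2)"
proof (subst rect_norm_opspace_of, rule amp_norm_le)
  fix \<xi> :: "nat \<Rightarrow> 'a"
  define S where "S = (\<Sum>j<n. (norm (\<xi> j))\<^sup>2)"
  define a where "a z i = (norm (\<Sum>j<n. blinfun_apply (z i j) (\<xi> j)))\<^sup>2" for z :: "nat \<Rightarrow> nat \<Rightarrow> 'a \<Rightarrow>\<^sub>L 'a" and i
  have bound: "(\<Sum>i<q. a z i) \<le> r\<^sup>2 * S" if "rect_norm (opspace_of A) q n z \<le> r" "0 \<le> r" for q z r
  proof -
    have "sqrt (\<Sum>i<q. a z i) \<le> r * sqrt S"
      using order_trans[OF rect_norm_opspace_apply mult_right_mono[OF that(1) L2_set_nonneg]]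
      unfolding L2_set_def a_def S_def by blast
    then have "(\<Sum>i<q. a z i) \<le> (r * sqrt S)\<^sup>2"
      by (simp add: sqrt_le_D)
    then show ?thesis
      by (simp add: power_mult_distrib S_def sum_nonneg)
  qed
  have "(\<Sum>i<p + p'. a (colcat p y y') i) = (\<Sum>i<p. a y i) + (\<Sum>i<p'. a y' i)"
    unfolding sum_lessThan_add by (simp add: a_def colcat_def)
  also have "\<dots> \<le> t\<^sup>2 * S + s\<^sup>2 * S"
    using bound[OF assms(1,3)] bound[OF assms(2,4)] by simp
  finally have "sqrt (\<Sum>i<p + p'. a (colcat p y y') i) \<le> sqrt ((t\<^sup>2 + s\<^sup>2) * S)"
    by (simp add: algebra_simps)
  then show "L2_set (\<lambda>i. norm (\<Sum>j<n. blinfun_apply (colcat p y y' i j) (\<xi> j))) {..<p + p'}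
      \<le> sqrt (t\<^sup>2 + s\<^sup>2) * L2_set (\<lambda>j. norm (\<xi> j)) {..<n}"
    by (simp add: L2_set_def a_def S_def real_sqrt_mult)
qed simp

lemma rect_norm_opspace_single_column:
  "rect_norm (opspace_of A) p n (\<lambda>k j. if j = l then y k 0 else 0) \<le> rect_norm (opspace_of A) p 1 y"
proof (subst rect_norm_opspace_of, rule amp_norm_le)
  fix \<xi> :: "nat \<Rightarrow> 'a"
  have "(\<Sum>j<n. blinfun_apply (if j = l then y k 0 else 0) (\<xi> j)) = (if l < n then blinfun_apply (y k 0) (\<xi> l) else 0)" for k
  proof -
    have "(\<Sum>j<n. blinfun_apply (if j = l then y k 0 else 0) (\<xi> j)) = (\<Sum>j<n. if j = l then blinfun_apply (y k 0) (\<xi> j) else 0)"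
      by (intro sum.cong) auto
    then show ?thesis by simp
  qed
  then have "L2_set (\<lambda>k. norm (\<Sum>j<n. blinfun_apply (if j = l then y k 0 else 0) (\<xi> j))) {..<p}
     = L2_set (\<lambda>k. norm (if l < n then blinfun_apply (y k 0) (\<xi> l) else 0)) {..<p}"
    by simp
  also have "\<dots> \<le> rect_norm (opspace_of A) p 1 y * L2_set (\<lambda>j. norm (\<xi> j)) {..<n}"
  proof (cases "l < n")
    case True
    have "L2_set (\<lambda>k. norm (blinfun_apply (y k 0) (\<xi> l))) {..<p} \<le> rect_norm (opspace_of A) p 1 y * norm (\<xi> l)"
      using rect_norm_opspace_apply[where n = 1 and y = y and \<xi> = "\<lambda>_. \<xi> l" and p = p and A = A] by (simp add: L2_set_def lessThan_Suc)
    also have "\<dots> \<le> rect_norm (opspace_of A) p 1 y * L2_set (\<lambda>j. norm (\<xi> j)) {..<n}"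
      using True by (intro mult_left_mono member_le_L2_set) auto
    finally show ?thesis using True by simp
  next
    case False
    then show ?thesis by (simp add: L2_set_def mult_nonneg_nonneg sum_nonneg)
  qed
  finally show "L2_set (\<lambda>k. norm (\<Sum>j<n. blinfun_apply (if j = l then y k 0 else 0) (\<xi> j))) {..<p}
      \<le> rect_norm (opspace_of A) p 1 y * L2_set (\<lambda>j. norm (\<xi> j)) {..<n}" .
qed simp

lemma rect_norm_opspace_1_1 [simp]: "rect_norm (opspace_of A) 1 1 (\<lambda>_ _. a) = norm a"
proof -
  have L: "L2_set f {..<Suc 0} = \<bar>f 0\<bar>" for f
    by (simp add: L2_set_def lessThan_Suc)
  show ?thesis
    unfolding rect_norm_opspace_of
  proof (rule antisym)
    show "amp_norm 1 1 (\<lambda>i j. blinfun_apply a) \<le> norm a"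
      by (rule amp_norm_le) (auto simp: L norm_blinfun)
    show "norm a \<le> amp_norm 1 1 (\<lambda>i j. blinfun_apply a)"
    proof (rule norm_blinfun_bound)
      show "0 \<le> amp_norm 1 1 (\<lambda>i j. blinfun_apply a)"
        by (intro amp_norm_nonneg blinfun.bounded_linear_right)
      show "norm (blinfun_apply a x) \<le> amp_norm 1 1 (\<lambda>i j. blinfun_apply a) * norm x" for x
        using amp_norm_apply[of 1 1 "\<lambda>_ _. blinfun_apply a" "\<lambda>_. x"]
        by (simp add: L blinfun.bounded_linear_right)
    qed
  qed
qed

lemma complex_module_opspace_of:
  assumes "operator_algebra A"
  shows "complex_module (opspace_of A)"
  unfolding complex_module_def
proof (rule moduleI[OF cring_complex_ring])
  have A: "0 \<in> A" "\<And>a b. a \<in> A \<Longrightarrow> b \<in> A \<Longrightarrow> a + b \<in> A" "\<And>c a. a \<in> A \<Longrightarrow> cscale_op c a \<in> A"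
    using assms by (auto simp: operator_algebra_def)
  have neg: "cscale_op (-1) a + a = 0" for a :: "'a \<Rightarrow>\<^sub>L 'a"
  proof (rule blinfun_eqI)
    fix x
    have "cscale (-1) (blinfun_apply a x) + cscale 1 (blinfun_apply a x) = cscale 0 (blinfun_apply a x)"
      by (subst cscale_add_left[symmetric]) simp
    also have "\<dots> = 0"
      using norm_cscale[of 0 "blinfun_apply a x"] by simp
    finally show "blinfun_apply (cscale_op (-1) a + a) x = blinfun_apply 0 x"
      by (simp add: blinfun.add_left)
  qed
  show "abelian_group (opspace_of A)"
  proof (rule abelian_groupI)
    show "\<exists>b\<in>carrier (opspace_of A). b \<oplus>\<^bsub>opspace_of A\<^esub> a = \<zero>\<^bsub>opspace_of A\<^esub>"
      if "a \<in> carrier (opspace_of A)" for a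
      using A(3) neg that by (intro bexI[of _ "cscale_op (-1) a"]) auto
  qed (use A in \<open>auto simp: algebra_simps\<close>)
qed (use assms in \<open>auto simp: operator_algebra_def blinfun.add_left cscale_add_left cscale_add_right
  cscale_cscale intro!: blinfun_eqI\<close>)

section \<open>The algebraic Haagerup tensor product\<close>

lemma free_space_simps [simp]:
  "carrier (free_space I) = {t. finite {i. t i \<noteq> 0} \<and> {i. t i \<noteq> 0} \<subseteq> I}"
  "\<zero>\<^bsub>free_space I\<^esub> = (\<lambda>_. 0)"
  "s \<oplus>\<^bsub>free_space I\<^esub> t = (\<lambda>i. s i + t i)"
  "c \<odot>\<^bsub>free_space I\<^esub> t = (\<lambda>i. c * t i)"
  by (simp_all add: free_space_def)

lemma free_space_add_closed:
  assumes "s \<in> carrier (free_space I)" "t \<in> carrier (free_space I)"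
  shows "(\<lambda>i. s i + t i) \<in> carrier (free_space I)"
proof -
  have "{i. s i + t i \<noteq> 0} \<subseteq> {i. s i \<noteq> 0} \<union> {i. t i \<noteq> 0}" by auto
  then show ?thesis
    using assms by (auto intro: finite_subset)
qed

lemma free_space_smult_closed:
  assumes "t \<in> carrier (free_space I)"
  shows "(\<lambda>i. c * t i) \<in> carrier (free_space I)"
proof -
  have "{i. c * t i \<noteq> 0} \<subseteq> {i. t i \<noteq> 0}" by auto
  then show ?thesis
    using assms by (auto intro: finite_subset)
qed

lemma free_space_extend_simps [simp]:
  "carrier (module.extend (free_space I) m) = carrier (free_space I)"
  "\<zero>\<^bsub>module.extend (free_space I) m\<^esub> = (\<lambda>_. 0)"
  "s \<oplus>\<^bsub>module.extend (free_space I) m\<^esub> t = (\<lambda>i. s i + t i)"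
  "c \<odot>\<^bsub>module.extend (free_space I) m\<^esub> t = (\<lambda>i. c * t i)"
  by (simp_all add: free_space_def module.defs)

lemma module_free_space_extend:
  "module complex_ring (module.extend (free_space I) m)"
proof (rule moduleI[OF cring_complex_ring])
  show "abelian_group (module.extend (free_space I) m)"
  proof (rule abelian_groupI)
    fix t assume "t \<in> carrier (module.extend (free_space I) m)"
    then show "\<exists>s\<in>carrier (module.extend (free_space I) m).
        s \<oplus>\<^bsub>module.extend (free_space I) m\<^esub> t = \<zero>\<^bsub>module.extend (free_space I) m\<^esub>"
      using free_space_smult_closed[of t I "-1"] by (intro bexI[of _ "\<lambda>i. (-1) * t i"]) auto
  next
    show "\<zero>\<^bsub>module.extend (free_space I) m\<^esub> \<in> carrier (module.extend (free_space I) m)"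
      by simp
  qed (use free_space_add_closed in \<open>auto simp del: free_space_simps(1) simp: algebra_simps\<close>)
qed (use free_space_add_closed free_space_smult_closed in
  \<open>auto simp del: free_space_simps(1) simp: algebra_simps\<close>)

lemma module_free_space: "module complex_ring (free_space I)"
  using module_free_space_extend[of I "()"] by (simp add: free_space_def module.defs)

lemma gen_closed: "p \<in> I \<Longrightarrow> gen p \<in> carrier (free_space I)"
  by (auto simp: gen_def)

lemma pre_haagerup_simps [simp]:
  "carrier (pre_haagerup V W) = carrier (free_space (carrier V \<times> carrier W))"
  "\<zero>\<^bsub>pre_haagerup V W\<^esub> = (\<lambda>_. 0)"
  "s \<oplus>\<^bsub>pre_haagerup V W\<^esub> t = (\<lambda>i. s i + t i)"
  "c \<odot>\<^bsub>pre_haagerup V W\<^esub> t = (\<lambda>i. c * t i)"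
  "mnorm (pre_haagerup V W) = haagerup_norm V W"
  by (simp_all add: pre_haagerup_def free_space_def module.defs)

lemma complex_module_pre_haagerup: "complex_module (pre_haagerup V W)"
  unfolding complex_module_def pre_haagerup_def by (rule module_free_space_extend)

subsection \<open>Equality of tensors\<close>

locale tensor_pair = V: complex_module V + W: complex_module W
  for V :: "('u, 'y) opspace_scheme" and W :: "('v, 'z) opspace_scheme"
begin

abbreviation "I \<equiv> carrier V \<times> carrier W"

definition same_tensor :: "('u \<times> 'v \<Rightarrow> complex) \<Rightarrow> ('u \<times> 'v \<Rightarrow> complex) \<Rightarrow> bool"  (infix \<open>\<simeq>\<close> 50) where
  "t \<simeq> u \<longleftrightarrow> (\<lambda>q. t q - u q) \<in> tensor_null V W"

lemma null_zero: "(\<lambda>_. 0) \<in> tensor_null V W"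
  and null_add: "s \<in> tensor_null V W \<Longrightarrow> t \<in> tensor_null V W \<Longrightarrow> (\<lambda>q. s q + t q) \<in> tensor_null V W"
  and null_scale: "t \<in> tensor_null V W \<Longrightarrow> (\<lambda>q. c * t q) \<in> tensor_null V W"
proof -
  interpret F: module complex_ring "free_space I" by (rule module_free_space)
  have sub: "(\<lambda>_. 0) \<in> N \<and> (\<forall>s\<in>N. \<forall>t\<in>N. (\<lambda>q. s q + t q) \<in> N) \<and> (\<forall>c. \<forall>t\<in>N. (\<lambda>q. c * t q) \<in> N)"
    if "submodule N complex_ring (free_space I)" for N
    using F.submoduleE(4,5)[OF that] subgroup.one_closed[OF submodule.axioms(1)[OF that]] by auto
  show "(\<lambda>_. 0) \<in> tensor_null V W"
    "s \<in> tensor_null V W \<Longrightarrow> t \<in> tensor_null V W \<Longrightarrow> (\<lambda>q. s q + t q) \<in> tensor_null V W"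
    "t \<in> tensor_null V W \<Longrightarrow> (\<lambda>q. c * t q) \<in> tensor_null V W"
    unfolding tensor_null_def hull_def using sub by blast+
qed

lemma same_refl [simp]: "t \<simeq> t"
  using null_zero by (simp add: same_tensor_def)

lemma same_add: "t \<simeq> t' \<Longrightarrow> u \<simeq> u' \<Longrightarrow> (\<lambda>q. t q + u q) \<simeq> (\<lambda>q. t' q + u' q)"
  unfolding same_tensor_def by (drule (1) null_add) (simp add: algebra_simps)

lemma same_scale: "t \<simeq> t' \<Longrightarrow> (\<lambda>q. c * t q) \<simeq> (\<lambda>q. c * t' q)"
  unfolding same_tensor_def by (drule null_scale[of _ c]) (simp add: algebra_simps)

lemma same_sym: "t \<simeq> u \<Longrightarrow> u \<simeq> t"
  unfolding same_tensor_def by (drule null_scale[of _ "-1"]) simp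

lemma same_trans [trans]: "t \<simeq> u \<Longrightarrow> u \<simeq> v \<Longrightarrow> t \<simeq> v"
  unfolding same_tensor_def by (drule (1) null_add) (simp add: algebra_simps)

lemma same_sum:
  assumes "finite K" "\<And>k. k \<in> K \<Longrightarrow> t k \<simeq> u k"
  shows "(\<lambda>q. \<Sum>k\<in>K. t k q) \<simeq> (\<lambda>q. \<Sum>k\<in>K. u k q)"
  using assms by (induction K rule: finite_induct) (auto intro: same_add)

lemma same_gen_scale_left: "x \<in> carrier V \<Longrightarrow> y \<in> carrier W \<Longrightarrow> gen (c \<odot>\<^bsub>V\<^esub> x, y) \<simeq> (\<lambda>q. c * gen (x, y) q)"
  unfolding same_tensor_def tensor_null_def by (rule hull_inc) blast

lemma same_gen_scale_right: "x \<in> carrier V \<Longrightarrow> y \<in> carrier W \<Longrightarrow> gen (x, c \<odot>\<^bsub>W\<^esub> y) \<simeq> (\<lambda>q. c * gen (x, y) q)"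
  unfolding same_tensor_def tensor_null_def by (rule hull_inc) blast

lemma same_gen_zero_left: "y \<in> carrier W \<Longrightarrow> gen (\<zero>\<^bsub>V\<^esub>, y) \<simeq> (\<lambda>_. 0)"
  using same_gen_scale_left[of "\<zero>\<^bsub>V\<^esub>" y 0] by simp

lemma same_gen_zero_right: "x \<in> carrier V \<Longrightarrow> gen (x, \<zero>\<^bsub>W\<^esub>) \<simeq> (\<lambda>_. 0)"
  using same_gen_scale_right[of x "\<zero>\<^bsub>W\<^esub>" 0] by simp

lemma same_gen_rescale:
  assumes "x \<in> carrier V" "y \<in> carrier W" "c \<noteq> 0"
  shows "gen (c \<odot>\<^bsub>V\<^esub> x, inverse c \<odot>\<^bsub>W\<^esub> y) \<simeq> gen (x, y)"
proof -
  have "gen (c \<odot>\<^bsub>V\<^esub> x, inverse c \<odot>\<^bsub>W\<^esub> y) \<simeq> (\<lambda>q. c * gen (x, inverse c \<odot>\<^bsub>W\<^esub> y) q)"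
    using assms by (intro same_gen_scale_left) auto
  also have "\<dots> \<simeq> (\<lambda>q. c * (inverse c * gen (x, y) q))"
    using assms by (intro same_scale same_gen_scale_right) auto
  also have "\<dots> = gen (x, y)"
    using assms by (simp add: mult.assoc[symmetric])
  finally show ?thesis .
qed

subsection \<open>Factorisations of matrices of tensors\<close>

definition factorises where
  "factorises n u p x y \<longleftrightarrow> x \<in> mats V n p \<and> y \<in> mats W p n \<and>
     (\<forall>i<n. \<forall>j<n. u i j \<simeq> (\<lambda>q. \<Sum>k<p. gen (x i k, y k j) q))"

lemma haagerup_norm_alt:
  "haagerup_norm V W n u = Inf {rect_norm V n p x * rect_norm W p n y | p x y. factorises n u p x y}"
  by (simp add: haagerup_norm_def factorises_def same_tensor_def)

lemma factorises_cong:
  assumes "factorises n u p x y" "\<And>i j. i < n \<Longrightarrow> j < n \<Longrightarrow> u i j = u' i j"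
  shows "factorises n u' p x y"
  using assms by (simp add: factorises_def)

text \<open>A sum of two products is the product of a row and a column. This is where the Haagerup norm gets its
  subadditivity from.\<close>

lemma factorises_add:
  assumes u: "factorises n u p x y" and u': "factorises n u' p' x' y'"
  shows "factorises n (\<lambda>i j q. u i j q + u' i j q) (p + p') (rowcat p x x') (colcat p y y')"
  unfolding factorises_def
proof (intro conjI allI impI)
  fix i j assume ij: "i < n" "j < n"
  have "(\<lambda>q. \<Sum>k<p + p'. gen (rowcat p x x' i k, colcat p y y' k j) q)
      = (\<lambda>q. (\<Sum>k<p. gen (x i k, y k j) q) + (\<Sum>k<p'. gen (x' i k, y' k j) q))"
    by (rule ext, subst sum_lessThan_add) (simp add: rowcat_def colcat_def)
  then show "(\<lambda>q. u i j q + u' i j q) \<simeq> (\<lambda>q. \<Sum>k<p + p'. gen (rowcat p x x' i k, colcat p y y' k j) q)"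
    using u u' ij by (simp add: factorises_def same_add)
qed (use u u' in \<open>simp_all add: factorises_def rowcat_mats colcat_mats\<close>)

lemma factorises_scale:
  assumes u: "factorises n u p x y"
  shows "factorises n (\<lambda>i j q. c * u i j q) p (\<lambda>i k. c \<odot>\<^bsub>V\<^esub> x i k) y"
  unfolding factorises_def
proof (intro conjI allI impI)
  fix i j assume ij: "i < n" "j < n"
  have "(\<lambda>q. c * u i j q) \<simeq> (\<lambda>q. c * (\<Sum>k<p. gen (x i k, y k j) q))"
    using u ij by (intro same_scale) (simp add: factorises_def)
  also have "\<dots> = (\<lambda>q. \<Sum>k<p. c * gen (x i k, y k j) q)"
    by (simp add: sum_distrib_left)
  also have "\<dots> \<simeq> (\<lambda>q. \<Sum>k<p. gen (c \<odot>\<^bsub>V\<^esub> x i k, y k j) q)"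
    using u ij by (intro same_sum same_sym[OF same_gen_scale_left]) (auto simp: factorises_def mats_def)
  finally show "(\<lambda>q. c * u i j q) \<simeq> (\<lambda>q. \<Sum>k<p. gen (c \<odot>\<^bsub>V\<^esub> x i k, y k j) q)" .
qed (use u in \<open>auto simp: factorises_def mats_def\<close>)

lemma factorises_rescale:
  assumes u: "factorises n u p x y" and c: "c \<noteq> 0"
  shows "factorises n u p (\<lambda>i k. c \<odot>\<^bsub>V\<^esub> x i k) (\<lambda>k j. inverse c \<odot>\<^bsub>W\<^esub> y k j)"
  unfolding factorises_def
proof (intro conjI allI impI)
  fix i j assume ij: "i < n" "j < n"
  have "u i j \<simeq> (\<lambda>q. \<Sum>k<p. gen (x i k, y k j) q)"
    using u ij by (simp add: factorises_def)
  also have "\<dots> \<simeq> (\<lambda>q. \<Sum>k<p. gen (c \<odot>\<^bsub>V\<^esub> x i k, inverse c \<odot>\<^bsub>W\<^esub> y k j) q)"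
    using u ij c by (intro same_sum same_sym[OF same_gen_rescale]) (auto simp: factorises_def mats_def)
  finally show "u i j \<simeq> (\<lambda>q. \<Sum>k<p. gen (c \<odot>\<^bsub>V\<^esub> x i k, inverse c \<odot>\<^bsub>W\<^esub> y k j) q)" .
qed (use u in \<open>auto simp: factorises_def mats_def\<close>)

lemma factorises_zero: "factorises n (\<lambda>_ _ _. 0) 0 x y"
  by (simp add: factorises_def mats_def)

text \<open>Outside the marked entry all elementary tensors have a factor that is zero.\<close>

lemma factorises_unit_matrix:
  assumes v: "factorises 1 (\<lambda>_ _. v) p x y"
  shows "factorises n (\<lambda>i j. if i = a \<and> j = b then v else (\<lambda>_. 0)) p
    (\<lambda>i k. if i = a then x 0 k else \<zero>\<^bsub>V\<^esub>) (\<lambda>k j. if j = b then y k 0 else \<zero>\<^bsub>W\<^esub>)"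
  unfolding factorises_def
proof (intro conjI allI impI)
  have c: "x 0 k \<in> carrier V" "y k 0 \<in> carrier W" if "k < p" for k
    using v that by (auto simp: factorises_def mats_def)
  fix i j assume ij: "i < n" "j < n"
  have "(\<lambda>_. 0) \<simeq> (\<lambda>q. \<Sum>k<p. gen (if i = a then x 0 k else \<zero>\<^bsub>V\<^esub>, if j = b then y k 0 else \<zero>\<^bsub>W\<^esub>) q)"
    if "\<not> (i = a \<and> j = b)"
  proof -
    have "(\<lambda>q. \<Sum>k<p. gen (if i = a then x 0 k else \<zero>\<^bsub>V\<^esub>, if j = b then y k 0 else \<zero>\<^bsub>W\<^esub>) q) \<simeq> (\<lambda>q. \<Sum>k<p. 0)"
      using that c by (intro same_sum) (auto intro: same_gen_zero_left same_gen_zero_right)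
    then show ?thesis by (simp add: same_sym)
  qed
  then show "(if i = a \<and> j = b then v else (\<lambda>_. 0)) \<simeq>
      (\<lambda>q. \<Sum>k<p. gen (if i = a then x 0 k else \<zero>\<^bsub>V\<^esub>, if j = b then y k 0 else \<zero>\<^bsub>W\<^esub>) q)"
    using v by (cases "i = a \<and> j = b") (auto simp: factorises_def)
qed (use v in \<open>auto simp: factorises_def mats_def\<close>)

text \<open>A matrix of tensors is a finite sum of matrices with one entry, which is a multiple of an elementary
  tensor. Hence the infimum in the definition of the Haagerup norm is taken over a nonempty set.\<close>

lemma factorises_exists:
  assumes u: "u \<in> mats (pre_haagerup V W) n n"
  shows "\<exists>p x y. factorises n u p x y"
proof -
  define S where "S = (SIGMA ij:{..<n} \<times> {..<n}. {q. u (fst ij) (snd ij) q \<noteq> 0})"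
  have supp: "finite {q. u i j q \<noteq> 0}" "{q. u i j q \<noteq> 0} \<subseteq> I" if "i < n" "j < n" for i j
    using u that by (auto simp: mats_def)
  have "finite S"
    unfolding S_def using supp by (intro finite_SigmaI) auto
  have "\<exists>p x y. factorises n (\<lambda>i j q. if ((i, j), q) \<in> T then u i j q else 0) p x y" if "finite T" "T \<subseteq> S" for T
    using that
  proof (induction T rule: finite_induct)
    case empty
    show ?case by (intro exI[of _ 0] exI) (simp add: factorises_zero)
  next
    case (insert s T)
    obtain a b w z where s: "s = ((a, b), (w, z))" by (metis surj_pair)
    with insert.prems have ab: "a < n" "b < n" and "u a b (w, z) \<noteq> 0"
      by (auto simp: S_def)
    then have "(w, z) \<in> I"
      using supp(2)[OF ab] by blast
    then have wz: "w \<in> carrier V" "z \<in> carrier W" by auto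
    define c where "c = u a b (w, z)"
    have "gen (c \<odot>\<^bsub>V\<^esub> w, z) \<simeq> (\<lambda>q. c * gen (w, z) q)"
      using wz by (rule same_gen_scale_left)
    then have "factorises 1 (\<lambda>_ _ q. c * gen (w, z) q) 1 (\<lambda>_ _. c \<odot>\<^bsub>V\<^esub> w) (\<lambda>_ _. z)"
      using wz by (simp add: factorises_def mats_def same_sym)
    from factorises_unit_matrix[OF this, of n a b] insert.IH insert.prems
    obtain p x y p' x' y' where
      "factorises n (\<lambda>i j. if i = a \<and> j = b then \<lambda>q. c * gen (w, z) q else (\<lambda>_. 0)) p x y"
      "factorises n (\<lambda>i j q. if ((i, j), q) \<in> T then u i j q else 0) p' x' y'"
      by auto
    from factorises_add[OF this]
    have "factorises n (\<lambda>i j q. if ((i, j), q) \<in> insert s T then u i j q else 0) (p + p') (rowcat p x x') (colcat p y y')"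
      by (rule factorises_cong) (use insert.hyps in \<open>auto simp: s c_def gen_def fun_eq_iff\<close>)
    then show ?case by blast
  qed
  from this[OF \<open>finite S\<close>] obtain p x y where
    "factorises n (\<lambda>i j q. if ((i, j), q) \<in> S then u i j q else 0) p x y" by auto
  then have "factorises n u p x y"
    by (rule factorises_cong) (auto simp: S_def)
  then show ?thesis by blast
qed

end

text \<open>A scalar can be moved from one factor of a product to the other, until neither norm exceeds the
  square root of the bound for the product.\<close>

lemma balance_product:
  fixes a b c :: real
  assumes "0 \<le> a" "0 \<le> b" "a * b < c"
  shows "\<exists>r>0. r * a \<le> sqrt c \<and> inverse r * b \<le> sqrt c"
proof (cases "a = 0")
  case True
  have c: "0 < c" using assms True by simp
  have r: "0 < b / sqrt c + 1"
    using assms c by (intro add_nonneg_pos) auto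
  have "b \<le> sqrt c * (b / sqrt c + 1)"
    using c by (simp add: distrib_left)
  then have "b / (b / sqrt c + 1) \<le> sqrt c"
    using r by (subst pos_divide_le_eq)
  then have "inverse (b / sqrt c + 1) * b \<le> sqrt c"
    by (simp only: divide_inverse[of b "b / sqrt c + 1"] mult.commute)
  then show ?thesis
    using True c r by (intro exI[of _ "b / sqrt c + 1"]) auto
next
  case False
  then have a: "0 < a" using assms by simp
  have c: "0 < c" using assms by (meson mult_nonneg_nonneg order_le_less_trans)
  have "a * b \<le> sqrt c * sqrt c" using assms c by simp
  then have "inverse (sqrt c / a) * b \<le> sqrt c"
    using a c by (simp add: divide_simps)
  then show ?thesis
    using a c by (intro exI[of _ "sqrt c / a"]) auto
qed

section \<open>Operator modules through matrix products\<close>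

locale coefficient_pair = normed_matrices E for E :: "('u, 'z) opspace_scheme" +
  fixes A :: "('h::chilbert_space \<Rightarrow>\<^sub>L 'h) set"
  assumes A: "operator_algebra A"

sublocale coefficient_pair \<subseteq> tensor_pair E "opspace_of A"
  by (intro tensor_pair.intro complex_module_axioms complex_module_opspace_of A)

context coefficient_pair begin

abbreviation "B \<equiv> opspace_of A"

lemma factorises_norm_nonneg:
  "factorises n u p x y \<Longrightarrow> 0 \<le> rect_norm E n p x * rect_norm B p n y"
  by (intro mult_nonneg_nonneg rect_norm_nonneg) (auto simp: factorises_def)

lemma haagerup_norm_le:
  "factorises n u p x y \<Longrightarrow> haagerup_norm E B n u \<le> rect_norm E n p x * rect_norm B p n y"
  unfolding haagerup_norm_alt
  by (rule cInf_lower) (auto intro!: bdd_belowI[of _ 0] factorises_norm_nonneg)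

lemma haagerup_norm_ge:
  assumes "u \<in> mats (pre_haagerup E B) n n"
    and "\<And>p x y. factorises n u p x y \<Longrightarrow> c \<le> rect_norm E n p x * rect_norm B p n y"
  shows "c \<le> haagerup_norm E B n u"
  unfolding haagerup_norm_alt using factorises_exists[OF assms(1)] assms(2)
  by (intro cInf_greatest) auto

lemma haagerup_norm_nonneg: "u \<in> mats (pre_haagerup E B) n n \<Longrightarrow> 0 \<le> haagerup_norm E B n u"
  by (rule haagerup_norm_ge) (auto intro: factorises_norm_nonneg)

lemma haagerup_norm_lessD:
  assumes u: "u \<in> mats (pre_haagerup E B) n n" and c: "haagerup_norm E B n u < c"
  obtains p x y where "factorises n u p x y" "rect_norm E n p x \<le> sqrt c" "rect_norm B p n y \<le> sqrt c"
proof -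
  obtain p x y where f: "factorises n u p x y" and lt: "rect_norm E n p x * rect_norm B p n y < c"
    using haagerup_norm_ge[OF u, of c] c by (meson not_le)
  have x: "x \<in> mats E n p" using f by (simp add: factorises_def)
  obtain r where r: "0 < r" "r * rect_norm E n p x \<le> sqrt c" "inverse r * rect_norm B p n y \<le> sqrt c"
    using balance_product[OF rect_norm_nonneg[OF x] rect_norm_opspace_nonneg lt] by blast
  have "factorises n u p (\<lambda>i k. complex_of_real r \<odot>\<^bsub>E\<^esub> x i k) (\<lambda>k j. inverse (complex_of_real r) \<odot>\<^bsub>B\<^esub> y k j)"
    using r by (intro factorises_rescale f) auto
  moreover have "rect_norm E n p (\<lambda>i k. complex_of_real r \<odot>\<^bsub>E\<^esub> x i k) \<le> sqrt c"
    using r by (simp add: rect_norm_scale[OF x])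
  moreover have "rect_norm B p n (\<lambda>k j. inverse (complex_of_real r) \<odot>\<^bsub>B\<^esub> y k j) \<le> sqrt c"
    using rect_norm_opspace_scale_le[of A p n "inverse (complex_of_real r)" y] r
    by (simp add: norm_inverse)
  ultimately show ?thesis using that by blast
qed

text \<open>Factorisations of two summands, balanced to norms \<open>sqrt c\<close> and \<open>sqrt d\<close>, are placed side by
  side; both concatenations have norm \<open>sqrt (c + d)\<close>.\<close>

lemma haagerup_norm_triangle:
  assumes u: "u \<in> mats (pre_haagerup E B) n n" and v: "v \<in> mats (pre_haagerup E B) n n"
  shows "haagerup_norm E B n (\<lambda>i j q. u i j q + v i j q) \<le> haagerup_norm E B n u + haagerup_norm E B n v"
proof (rule field_le_epsilon)
  fix e :: real assume e: "0 < e"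
  define c d where "c = haagerup_norm E B n u + e / 2" and "d = haagerup_norm E B n v + e / 2"
  have cd: "0 < c" "0 < d"
    using haagerup_norm_nonneg[OF u] haagerup_norm_nonneg[OF v] e by (auto simp: c_def d_def)
  obtain p x y where 1: "factorises n u p x y" "rect_norm E n p x \<le> sqrt c" "rect_norm B p n y \<le> sqrt c"
    using haagerup_norm_lessD[OF u, of c] e by (auto simp: c_def)
  obtain p' x' y' where 2: "factorises n v p' x' y'" "rect_norm E n p' x' \<le> sqrt d" "rect_norm B p' n y' \<le> sqrt d"
    using haagerup_norm_lessD[OF v, of d] e by (auto simp: d_def)
  have "haagerup_norm E B n (\<lambda>i j q. u i j q + v i j q)
      \<le> rect_norm E n (p + p') (rowcat p x x') * rect_norm B (p + p') n (colcat p y y')"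
    by (rule haagerup_norm_le[OF factorises_add[OF 1(1) 2(1)]])
  also have "\<dots> \<le> sqrt ((sqrt c)\<^sup>2 + (sqrt d)\<^sup>2) * sqrt ((sqrt c)\<^sup>2 + (sqrt d)\<^sup>2)"
    using 1 2 cd by (intro mult_mono rect_norm_rowcat_le rect_norm_opspace_colcat_le)
      (auto simp: factorises_def)
  also have "\<dots> = haagerup_norm E B n u + haagerup_norm E B n v + e"
    using cd by (simp add: c_def d_def)
  finally show "haagerup_norm E B n (\<lambda>i j q. u i j q + v i j q) \<le> haagerup_norm E B n u + haagerup_norm E B n v + e" .
qed

lemma haagerup_norm_scale_le:
  assumes u: "u \<in> mats (pre_haagerup E B) n n"
  shows "haagerup_norm E B n (\<lambda>i j q. c * u i j q) \<le> cmod c * haagerup_norm E B n u"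
proof -
  have *: "haagerup_norm E B n (\<lambda>i j q. c * u i j q) \<le> cmod c * (rect_norm E n p x * rect_norm B p n y)"
    if f: "factorises n u p x y" for p x y
    using haagerup_norm_le[OF factorises_scale[OF f, of c]] f
    by (simp add: factorises_def rect_norm_scale mult.assoc)
  show ?thesis
  proof (cases "c = 0")
    case True
    then show ?thesis
      using * factorises_exists[OF u] by auto
  next
    case False
    then have "haagerup_norm E B n (\<lambda>i j q. c * u i j q) / cmod c \<le> haagerup_norm E B n u"
      using * by (intro haagerup_norm_ge[OF u]) (simp add: pos_divide_le_eq mult.commute)
    then show ?thesis
      using False by (simp add: pos_divide_le_eq mult.commute)
  qed
qed

lemma haagerup_norm_unit_matrix_le:
  assumes v: "v \<in> carrier (pre_haagerup E B)"
  shows "haagerup_norm E B n (\<lambda>i j. if i = k \<and> j = l then v else (\<lambda>_. 0)) \<le> haagerup_norm E B 1 (\<lambda>_ _. v)"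
proof (rule haagerup_norm_ge)
  show "(\<lambda>_ _. v) \<in> mats (pre_haagerup E B) 1 1" using v by (rule matsI)
  fix p x y assume f: "factorises 1 (\<lambda>_ _. v) p x y"
  have "haagerup_norm E B n (\<lambda>i j. if i = k \<and> j = l then v else (\<lambda>_. 0))
      \<le> rect_norm E n p (\<lambda>i m. if i = k then x 0 m else \<zero>\<^bsub>E\<^esub>) * rect_norm B p n (\<lambda>m j. if j = l then y m 0 else \<zero>\<^bsub>B\<^esub>)"
    by (rule haagerup_norm_le[OF factorises_unit_matrix[OF f]])
  also have "\<dots> \<le> rect_norm E 1 p x * rect_norm B p 1 y"
    using f rect_norm_opspace_single_column[of A p n l y]
    by (intro mult_mono rect_norm_single_row rect_norm_nonneg) (auto simp: factorises_def mats_def cong: if_cong)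
  finally show "haagerup_norm E B n (\<lambda>i j. if i = k \<and> j = l then v else (\<lambda>_. 0)) \<le> rect_norm E 1 p x * rect_norm B p 1 y" .
qed

lemma matrix_seminormed_pre_haagerup: "matrix_seminormed (pre_haagerup E B)"
proof (intro matrix_seminormed.intro complex_module_pre_haagerup matrix_seminormed_axioms.intro)
  fix n and u v :: "nat \<Rightarrow> nat \<Rightarrow> 'u \<times> ('h \<Rightarrow>\<^sub>L 'h) \<Rightarrow> complex"
  assume u: "u \<in> mats (pre_haagerup E B) n n"
  {
    assume eq: "\<And>i j. i < n \<Longrightarrow> j < n \<Longrightarrow> u i j = v i j"
    have "factorises n u p x y \<longleftrightarrow> factorises n v p x y" for p x y
      using factorises_cong[of n u p x y v] factorises_cong[of n v p x y u] eq by auto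
    then show "mnorm (pre_haagerup E B) n u = mnorm (pre_haagerup E B) n v"
      by (simp add: haagerup_norm_alt)
  }
  show "0 \<le> mnorm (pre_haagerup E B) n u"
    using haagerup_norm_nonneg[OF u] by simp
  show "mnorm (pre_haagerup E B) n (\<lambda>i j. c \<odot>\<^bsub>pre_haagerup E B\<^esub> u i j) \<le> cmod c * mnorm (pre_haagerup E B) n u" for c
    using haagerup_norm_scale_le[OF u] by simp
  assume "v \<in> mats (pre_haagerup E B) n n"
  then show "mnorm (pre_haagerup E B) n (\<lambda>i j. u i j \<oplus>\<^bsub>pre_haagerup E B\<^esub> v i j)
      \<le> mnorm (pre_haagerup E B) n u + mnorm (pre_haagerup E B) n v"
    using haagerup_norm_triangle[OF u] by simp
next
  fix v n and k l :: nat assume that: "v \<in> carrier (pre_haagerup E B)"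
  show "mnorm (pre_haagerup E B) n (\<lambda>i j. if i = k \<and> j = l then v else \<zero>\<^bsub>pre_haagerup E B\<^esub>)
      \<le> vnorm (pre_haagerup E B) v"
    using haagerup_norm_unit_matrix_le[OF that] by (simp add: vnorm_def cong: if_cong)
qed

end

definition contractive_action ::
  "('h::chilbert_space \<Rightarrow>\<^sub>L 'h) set \<Rightarrow> ('u, 'h \<Rightarrow>\<^sub>L 'h) opmod \<Rightarrow> bool" where
  "contractive_action A E \<longleftrightarrow> (\<forall>n p. \<forall>x\<in>mats E n p. \<forall>a\<in>mats (opspace_of A) p n.
     mnorm E n (\<lambda>i j. \<Oplus>\<^bsub>E\<^esub>k\<in>{..<p}. act E (x i k) (a k j)) \<le> rect_norm E n p x * rect_norm (opspace_of A) p n a)"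

locale coefficient_module = coefficient_pair E A
  for E :: "('u, 'h::chilbert_space \<Rightarrow>\<^sub>L 'h) opmod" and A :: "('h \<Rightarrow>\<^sub>L 'h) set" +
  assumes right_module: "right_module A E"
begin

lemma act_closed [simp, intro]: "x \<in> carrier E \<Longrightarrow> a \<in> A \<Longrightarrow> act E x a \<in> carrier E"
  using right_module by (simp add: right_module_def)

definition lin_act :: "('u \<times> ('h \<Rightarrow>\<^sub>L 'h) \<Rightarrow> complex) \<Rightarrow> 'u" where
  "lin_act t = (\<Oplus>\<^bsub>E\<^esub>q\<in>{q. t q \<noteq> 0}. t q \<odot>\<^bsub>E\<^esub> act E (fst q) (snd q))"

lemma term_closed: "q \<in> I \<Longrightarrow> c \<odot>\<^bsub>E\<^esub> act E (fst q) (snd q) \<in> carrier E"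
  by auto

lemma lin_act_superset:
  assumes "finite S" "{q. t q \<noteq> 0} \<subseteq> S" "S \<subseteq> I"
  shows "lin_act t = (\<Oplus>\<^bsub>E\<^esub>q\<in>S. t q \<odot>\<^bsub>E\<^esub> act E (fst q) (snd q))"
  unfolding lin_act_def
  using assms term_closed by (intro M.add.finprod_mono_neutral_cong_left) auto

lemma linear_lin_act: "linear_map (pre_haagerup E B) E lin_act"
  unfolding linear_map_def
proof (intro conjI ballI allI Pi_I)
  fix s t c
  assume s: "s \<in> carrier (pre_haagerup E B)"
  then have s': "finite {q. s q \<noteq> 0}" "{q. s q \<noteq> 0} \<subseteq> I" by auto
  show "lin_act s \<in> carrier E"
    unfolding lin_act_def using s' term_closed by (intro M.finsum_closed) blast
  have "lin_act (c \<odot>\<^bsub>pre_haagerup E B\<^esub> s) = (\<Oplus>\<^bsub>E\<^esub>q\<in>{q. s q \<noteq> 0}. (c * s q) \<odot>\<^bsub>E\<^esub> act E (fst q) (snd q))"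
    using s' by (subst lin_act_superset[of "{q. s q \<noteq> 0}"]) auto
  also have "\<dots> = (\<Oplus>\<^bsub>E\<^esub>q\<in>{q. s q \<noteq> 0}. c \<odot>\<^bsub>E\<^esub> (s q \<odot>\<^bsub>E\<^esub> act E (fst q) (snd q)))"
    using s' by (intro M.finsum_cong') (auto simp: smult_smult)
  also have "\<dots> = c \<odot>\<^bsub>E\<^esub> lin_act s"
    unfolding lin_act_def using s' term_closed by (intro finsum_smult_ldistr[symmetric]) auto
  finally show "lin_act (c \<odot>\<^bsub>pre_haagerup E B\<^esub> s) = c \<odot>\<^bsub>E\<^esub> lin_act s" .
  assume "t \<in> carrier (pre_haagerup E B)"
  then have t': "finite {q. t q \<noteq> 0}" "{q. t q \<noteq> 0} \<subseteq> I" by auto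
  define S where "S = {q. s q \<noteq> 0} \<union> {q. t q \<noteq> 0}"
  have S: "finite S" "S \<subseteq> I" using s' t' by (auto simp: S_def)
  have "lin_act (s \<oplus>\<^bsub>pre_haagerup E B\<^esub> t) = (\<Oplus>\<^bsub>E\<^esub>q\<in>S. (s q + t q) \<odot>\<^bsub>E\<^esub> act E (fst q) (snd q))"
    using S by (subst lin_act_superset[of S]) (auto simp: S_def)
  also have "\<dots> = (\<Oplus>\<^bsub>E\<^esub>q\<in>S. s q \<odot>\<^bsub>E\<^esub> act E (fst q) (snd q) \<oplus>\<^bsub>E\<^esub> t q \<odot>\<^bsub>E\<^esub> act E (fst q) (snd q))"
    using S by (intro M.finsum_cong') (auto simp: smult_add_left)
  also have "\<dots> = (\<Oplus>\<^bsub>E\<^esub>q\<in>S. s q \<odot>\<^bsub>E\<^esub> act E (fst q) (snd q)) \<oplus>\<^bsub>E\<^esub> (\<Oplus>\<^bsub>E\<^esub>q\<in>S. t q \<odot>\<^bsub>E\<^esub> act E (fst q) (snd q))"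
    using S term_closed by (intro M.finsum_addf) auto
  also have "\<dots> = lin_act s \<oplus>\<^bsub>E\<^esub> lin_act t"
    using S by (subst (1 2) lin_act_superset[of S]) (auto simp: S_def)
  finally show "lin_act (s \<oplus>\<^bsub>pre_haagerup E B\<^esub> t) = lin_act s \<oplus>\<^bsub>E\<^esub> lin_act t" .
qed

sublocale lin: linear_between "pre_haagerup E B" E lin_act
  by (intro linear_between.intro linear_between_axioms.intro complex_module_pre_haagerup
    complex_module_axioms linear_lin_act)

lemma gen_carrier: "x \<in> carrier E \<Longrightarrow> a \<in> A \<Longrightarrow> gen (x, a) \<in> carrier (pre_haagerup E B)"
  using gen_closed[of "(x, a)" I] by simp

lemma lin_act_gen:
  assumes "x \<in> carrier E" "a \<in> A" shows "lin_act (gen (x, a)) = act E x a"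
proof -
  have "lin_act (gen (x, a)) = (\<Oplus>\<^bsub>E\<^esub>q\<in>{(x, a)}. gen (x, a) q \<odot>\<^bsub>E\<^esub> act E (fst q) (snd q))"
    using assms by (intro lin_act_superset) (auto simp: gen_def)
  also have "\<dots> = act E x a"
    using assms by (subst finsum_single[of "(x, a)"]) (auto simp: gen_def)
  finally show ?thesis .
qed

lemma sum_gen_carrier:
  fixes p :: nat
  assumes "\<And>k. k < p \<Longrightarrow> x k \<in> carrier E" "\<And>k. k < p \<Longrightarrow> a k \<in> A"
  shows "(\<lambda>q. \<Sum>k<p. gen (x k, a k) q) \<in> carrier (pre_haagerup E B)"
  using assms
proof (induction p)
  case (Suc p)
  then show ?case
    using lin.V.M.a_closed[of "\<lambda>q. \<Sum>k<p. gen (x k, a k) q" "gen (x p, a p)"] gen_carrier by simp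
qed simp

text \<open>This is used for the linear extension of the action as well as for the map that a module structure
  provides on the tensor product.\<close>

lemma linear_map_sum_gen:
  fixes p :: nat
  assumes \<mu>: "linear_map (pre_haagerup E B) E \<mu>" "\<And>x a. x \<in> carrier E \<Longrightarrow> a \<in> A \<Longrightarrow> \<mu> (gen (x, a)) = act E x a"
    and xa: "\<And>k. k < p \<Longrightarrow> x k \<in> carrier E" "\<And>k. k < p \<Longrightarrow> a k \<in> A"
  shows "\<mu> (\<lambda>q. \<Sum>k<p. gen (x k, a k) q) = (\<Oplus>\<^bsub>E\<^esub>k\<in>{..<p}. act E (x k) (a k))"
proof -
  interpret m: linear_between "pre_haagerup E B" E \<mu>
    by (intro linear_between.intro linear_between_axioms.intro complex_module_pre_haagerup
      complex_module_axioms \<mu>)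
  show ?thesis
    using xa
  proof (induction p)
    case 0
    show ?case using m.zero by simp
  next
    case (Suc p)
    have "\<mu> (\<lambda>q. \<Sum>k<Suc p. gen (x k, a k) q) = \<mu> ((\<lambda>q. \<Sum>k<p. gen (x k, a k) q) \<oplus>\<^bsub>pre_haagerup E B\<^esub> gen (x p, a p))"
      by simp
    also have "\<dots> = (\<Oplus>\<^bsub>E\<^esub>k\<in>{..<p}. act E (x k) (a k)) \<oplus>\<^bsub>E\<^esub> act E (x p) (a p)"
      using Suc sum_gen_carrier[of p x a] gen_carrier[of "x p" "a p"] \<mu>(2) by (subst m.add) auto
    also have "\<dots> = (\<Oplus>\<^bsub>E\<^esub>k\<in>{..<Suc p}. act E (x k) (a k))"
      unfolding lessThan_Suc using Suc.prems
      by (subst M.finsum_insert) (auto simp: M.a_comm intro!: M.finsum_closed)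
    finally show ?case .
  qed
qed

text \<open>The action is bilinear, so that the kernel of its linear extension is a submodule which contains the
  defining relations of the tensor product.\<close>

lemma lin_act_null:
  assumes "t \<in> tensor_null E B" shows "lin_act t = \<zero>\<^bsub>E\<^esub>"
proof -
  interpret F: module complex_ring "free_space I" by (rule module_free_space)
  define K where "K = {t \<in> carrier (free_space I). lin_act t = \<zero>\<^bsub>E\<^esub>}"
  note l = lin.add[simplified pre_haagerup_simps] lin.smult[simplified pre_haagerup_simps]
  have neg: "\<ominus>\<^bsub>free_space I\<^esub> t = (\<lambda>q. (-1) * t q)" if "t \<in> carrier (free_space I)" for t
    using that free_space_smult_closed[OF that, of "-1"] by (intro F.M.minus_equality) auto
  have sub: "submodule K complex_ring (free_space I)"
  proof (rule F.submoduleI)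
    show "\<zero>\<^bsub>free_space I\<^esub> \<in> K"
      using lin.zero by (simp add: K_def)
    show "K \<subseteq> carrier (free_space I)"
      by (auto simp: K_def)
  next
    fix s t c assume s: "s \<in> K"
    then have sc: "s \<in> carrier (free_space I)" "lin_act s = \<zero>\<^bsub>E\<^esub>" by (auto simp: K_def)
    show sm: "c \<odot>\<^bsub>free_space I\<^esub> s \<in> K" for c
      using l(2)[of s c] sc free_space_smult_closed[OF sc(1), of c] by (simp add: K_def del: free_space_simps(1))
    show "\<ominus>\<^bsub>free_space I\<^esub> s \<in> K"
      using sm[of "-1"] neg[OF sc(1)] by simp
    assume t: "t \<in> K"
    then have tc: "t \<in> carrier (free_space I)" "lin_act t = \<zero>\<^bsub>E\<^esub>" by (auto simp: K_def)
    show "s \<oplus>\<^bsub>free_space I\<^esub> t \<in> K"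
      using l(1)[of s t] sc tc free_space_add_closed[OF sc(1) tc(1)] by (simp add: K_def del: free_space_simps(1))
  qed
  have diff: "(\<lambda>q. s q - t q) \<in> K"
    if "s \<in> carrier (free_space I)" "t \<in> carrier (free_space I)" "lin_act s = lin_act t" for s t
  proof -
    have eq: "(\<lambda>q. s q - t q) = s \<oplus>\<^bsub>pre_haagerup E B\<^esub> ((-1) \<odot>\<^bsub>pre_haagerup E B\<^esub> t)" by simp
    have c: "s \<in> carrier (pre_haagerup E B)" "t \<in> carrier (pre_haagerup E B)"
      using that by (simp_all del: free_space_simps(1))
    have "lin_act (\<lambda>q. s q - t q) = lin_act s \<oplus>\<^bsub>E\<^esub> (-1) \<odot>\<^bsub>E\<^esub> lin_act t"
      unfolding eq using c by (subst lin.add) (auto simp: lin.smult simp del: pre_haagerup_simps)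
    also have "\<dots> = \<zero>\<^bsub>E\<^esub>"
      using lin.closed[OF c(2)] that(3) by (simp add: minus_one_smult M.r_neg)
    finally have "lin_act (\<lambda>q. s q - t q) = \<zero>\<^bsub>E\<^esub>" .
    moreover have "(\<lambda>q. s q - t q) \<in> carrier (free_space I)"
      unfolding eq using free_space_add_closed[OF that(1) free_space_smult_closed[OF that(2), of "-1"]]
      by (simp del: free_space_simps(1))
    ultimately show ?thesis by (simp add: K_def del: free_space_simps(1))
  qed
  have gc: "gen (x, a) \<in> carrier (free_space I)" if "x \<in> carrier E" "a \<in> A" for x a
    using gen_carrier[OF that] by simp
  have sum: "(\<lambda>q. gen (x, a) q + gen (y, b) q) \<in> carrier (free_space I)"
      "lin_act (\<lambda>q. gen (x, a) q + gen (y, b) q) = act E x a \<oplus>\<^bsub>E\<^esub> act E y b"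
    if "x \<in> carrier E" "a \<in> A" "y \<in> carrier E" "b \<in> A" for x a y b
    using that l(1)[OF gc gc, of x a y b] free_space_add_closed[OF gc gc, of x a y b] by (simp_all add: lin_act_gen)
  have scl: "(\<lambda>q. c * gen (x, a) q) \<in> carrier (free_space I)"
      "lin_act (\<lambda>q. c * gen (x, a) q) = c \<odot>\<^bsub>E\<^esub> act E x a"
    if "x \<in> carrier E" "a \<in> A" for x a c
    using that l(2)[OF gc, of x a c] free_space_smult_closed[OF gc, of x a c] by (simp_all add: lin_act_gen)
  have diff2: "(\<lambda>q. s q - t q - u q) \<in> K"
    if "s \<in> carrier (free_space I)" "(\<lambda>q. t q + u q) \<in> carrier (free_space I)"
      "lin_act s = lin_act (\<lambda>q. t q + u q)" for s t u
    using diff[OF that] by (simp add: diff_diff_eq)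
  note rm = right_module[unfolded right_module_def]
  have Ac: "a + b \<in> A" "cscale_op c a \<in> A" if "a \<in> A" "b \<in> A" for a b c
    using A that by (auto simp: operator_algebra_def)
  have "tensor_null E B \<subseteq> K"
    unfolding tensor_null_def
  proof (rule hull_minimal[where S = "\<lambda>N. submodule N complex_ring (free_space I)", OF _ sub], safe)
    fix x x' y assume c: "x \<in> carrier E" "x' \<in> carrier E" "y \<in> carrier B"
    then show "(\<lambda>q. gen (x \<oplus>\<^bsub>E\<^esub> x', y) q - gen (x, y) q - gen (x', y) q) \<in> K"
      using rm by (intro diff2 gc sum) (simp_all add: sum lin_act_gen)
  next
    fix x y y' assume c: "x \<in> carrier E" "y \<in> carrier B" "y' \<in> carrier B"
    then show "(\<lambda>q. gen (x, y \<oplus>\<^bsub>B\<^esub> y') q - gen (x, y) q - gen (x, y') q) \<in> K"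
      using rm Ac(1) by (intro diff2 gc sum) (simp_all add: sum lin_act_gen)
  next
    fix c x y assume c: "x \<in> carrier E" "y \<in> carrier B"
    then show "(\<lambda>q. gen (c \<odot>\<^bsub>E\<^esub> x, y) q - c * gen (x, y) q) \<in> K"
      using rm by (intro diff gc scl) (simp_all add: scl lin_act_gen)
  next
    fix c x y assume c: "x \<in> carrier E" "y \<in> carrier B"
    then show "(\<lambda>q. gen (x, c \<odot>\<^bsub>B\<^esub> y) q - c * gen (x, y) q) \<in> K"
      using rm Ac(2) by (intro diff gc scl) (simp_all add: scl lin_act_gen)
  qed
  then show ?thesis
    using assms by (auto simp: K_def)
qed

lemma lin_act_same:
  assumes "s \<in> carrier (pre_haagerup E B)" "t \<in> carrier (pre_haagerup E B)" "same_tensor s t"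
  shows "lin_act s = lin_act t"
proof -
  have c: "s \<in> carrier (free_space I)" "t \<in> carrier (free_space I)"
    using assms(1,2) by (simp_all del: free_space_simps(1))
  have "(\<lambda>q. s q + (-1) * t q) \<in> carrier (free_space I)"
    by (intro free_space_add_closed free_space_smult_closed c)
  then have d: "(\<lambda>q. s q - t q) \<in> carrier (pre_haagerup E B)"
    by (simp del: free_space_simps(1))
  have "lin_act s = lin_act ((\<lambda>q. s q - t q) \<oplus>\<^bsub>pre_haagerup E B\<^esub> t)"
    by simp
  also have "\<dots> = lin_act (\<lambda>q. s q - t q) \<oplus>\<^bsub>E\<^esub> lin_act t"
    by (rule lin.add[OF d assms(2)])
  also have "lin_act (\<lambda>q. s q - t q) = \<zero>\<^bsub>E\<^esub>"
    using assms(3) by (intro lin_act_null) (simp add: same_tensor_def)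
  finally show ?thesis
    using lin.closed[OF assms(2)] by simp
qed

lemma lin_act_completely_contractive:
  assumes "contractive_action A E"
  shows "completely_contractive (pre_haagerup E B) E lin_act"
  unfolding completely_contractive_def
proof (intro conjI allI ballI linear_lin_act)
  fix n u assume u: "u \<in> mats (pre_haagerup E B) n n"
  have "mnorm E n (\<lambda>i j. lin_act (u i j)) \<le> haagerup_norm E B n u"
  proof (rule haagerup_norm_ge[OF u])
    fix p x y assume f: "factorises n u p x y"
    then have xy: "x \<in> mats E n p" "y \<in> mats B p n" by (auto simp: factorises_def)
    have "mnorm E n (\<lambda>i j. lin_act (u i j)) = mnorm E n (\<lambda>i j. \<Oplus>\<^bsub>E\<^esub>k\<in>{..<p}. act E (x i k) (y k j))"
    proof (rule nm_cong[OF lin.mats[OF u]])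
      fix i j assume ij: "i < n" "j < n"
      have c: "k < p \<Longrightarrow> x i k \<in> carrier E" "k < p \<Longrightarrow> y k j \<in> A" for k
        using xy ij by (auto simp: mats_def)
      have "lin_act (u i j) = lin_act (\<lambda>q. \<Sum>k<p. gen (x i k, y k j) q)"
        using f ij by (intro lin_act_same matsD[OF u] sum_gen_carrier c) (auto simp: factorises_def)
      also have "\<dots> = (\<Oplus>\<^bsub>E\<^esub>k\<in>{..<p}. act E (x i k) (y k j))"
        using c by (intro linear_map_sum_gen linear_lin_act lin_act_gen) auto
      finally show "lin_act (u i j) = (\<Oplus>\<^bsub>E\<^esub>k\<in>{..<p}. act E (x i k) (y k j))" .
    qed
    also have "\<dots> \<le> rect_norm E n p x * rect_norm B p n y"
      using assms xy by (simp add: contractive_action_def)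
    finally show "mnorm E n (\<lambda>i j. lin_act (u i j)) \<le> rect_norm E n p x * rect_norm B p n y" .
  qed
  then show "mnorm E n (\<lambda>i j. lin_act (u i j)) \<le> mnorm (pre_haagerup E B) n u" by simp
qed

lemma contractive_actionI:
  assumes \<mu>: "completely_contractive (pre_haagerup E B) E \<mu>"
    and gen: "\<And>x a. x \<in> carrier E \<Longrightarrow> a \<in> A \<Longrightarrow> \<mu> (gen (x, a)) = act E x a"
  shows "contractive_action A E"
  unfolding contractive_action_def
proof (intro allI ballI)
  fix n p x a assume x: "x \<in> mats E n p" and a: "a \<in> mats B p n"
  have c: "k < p \<Longrightarrow> i < n \<Longrightarrow> x i k \<in> carrier E" "k < p \<Longrightarrow> j < n \<Longrightarrow> a k j \<in> A" for i j k
    using x a by (auto simp: mats_def)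
  define u where "u i j = (\<lambda>q. \<Sum>k<p. gen (x i k, a k j) q)" for i j
  have um: "u \<in> mats (pre_haagerup E B) n n"
    unfolding u_def using c by (intro matsI sum_gen_carrier) auto
  have f: "factorises n u p x a"
    using x a by (simp add: factorises_def u_def)
  have \<mu>l: "linear_map (pre_haagerup E B) E \<mu>"
    and \<mu>c: "mnorm E n (\<lambda>i j. \<mu> (u i j)) \<le> haagerup_norm E B n u"
    using \<mu> um by (auto simp: completely_contractive_def)
  have "mnorm E n (\<lambda>i j. \<Oplus>\<^bsub>E\<^esub>k\<in>{..<p}. act E (x i k) (a k j)) = mnorm E n (\<lambda>i j. \<mu> (u i j))"
  proof (rule nm_cong)
    show "(\<lambda>i j. \<Oplus>\<^bsub>E\<^esub>k\<in>{..<p}. act E (x i k) (a k j)) \<in> mats E n n"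
      using c by (intro matsI M.finsum_closed) auto
    show "(\<Oplus>\<^bsub>E\<^esub>k\<in>{..<p}. act E (x i k) (a k j)) = \<mu> (u i j)" if "i < n" "j < n" for i j
      unfolding u_def using c that by (intro linear_map_sum_gen[OF \<mu>l gen, symmetric]) auto
  qed
  also have "\<dots> \<le> haagerup_norm E B n u" by (rule \<mu>c)
  also have "\<dots> \<le> rect_norm E n p x * rect_norm B p n a" by (rule haagerup_norm_le[OF f])
  finally show "mnorm E n (\<lambda>i j. \<Oplus>\<^bsub>E\<^esub>k\<in>{..<p}. act E (x i k) (a k j)) \<le> rect_norm E n p x * rect_norm B p n a" .
qed

end

text \<open>The completed Haagerup tensor product disappears from the picture: that it admits a completely
  contractive map induced by the action is an inequality between norms of matrices.\<close>

lemma operator_module_iff: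
  fixes A :: "('h::chilbert_space \<Rightarrow>\<^sub>L 'h) set" and E :: "('u, 'h \<Rightarrow>\<^sub>L 'h) opmod"
  assumes A: "operator_algebra A"
  shows "operator_module A E \<longleftrightarrow> operator_space E \<and> right_module A E \<and> contractive_action A E"
proof (cases "operator_space E \<and> right_module A E")
  case True
  then interpret E: operator_space E by blast
  interpret coefficient_module E A
    by unfold_locales (use True A in auto)
  interpret P: matrix_seminormed "pre_haagerup E B" by (rule matrix_seminormed_pre_haagerup)
  have "contractive_action A E"
    if "completely_contractive (haagerup E B) E m" "\<forall>x\<in>carrier E. \<forall>a\<in>A. m (elem_tensor E B x a) = act E x a" for m
    by (rule contractive_actionI[OF P.completely_contractive_restrict])
      (use that in \<open>auto simp: haagerup_def elem_tensor_def\<close>)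
  moreover have "\<exists>m. completely_contractive (haagerup E B) E m \<and>
      (\<forall>x\<in>carrier E. \<forall>a\<in>A. m (elem_tensor E B x a) = act E x a)" if contractive: "contractive_action A E"
  proof -
    obtain m where m: "completely_contractive (completion (pre_haagerup E B)) E m"
      "\<And>t. t \<in> carrier (pre_haagerup E B) \<Longrightarrow> m (lim_class (pre_haagerup E B) (\<lambda>_. t)) = lin_act t"
      using P.completely_contractive_extend[OF E.operator_space_axioms lin_act_completely_contractive[OF contractive]] by blast
    then show ?thesis
      using gen_carrier lin_act_gen by (intro exI[of _ m]) (auto simp: haagerup_def elem_tensor_def)
  qed
  ultimately show ?thesis
    using True by (auto simp: operator_module_def)
qed (auto simp: operator_module_def)

section \<open>Nondegenerate modules and the approximate identity\<close>

definition nd_module :: "('h::chilbert_space \<Rightarrow>\<^sub>L 'h) set \<Rightarrow> ('u, 'h \<Rightarrow>\<^sub>L 'h) opmod \<Rightarrow> bool" where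
  "nd_module A E \<longleftrightarrow> operator_module A E \<and> nondegenerate A E"

text \<open>A single approximate identity is fixed, as nondegeneracy of a direct sum requires approximation in
  both summands by the same elements.\<close>

locale operator_algebra_with_unit =
  fixes A :: "('h::chilbert_space \<Rightarrow>\<^sub>L 'h) set" and F :: "('h \<Rightarrow>\<^sub>L 'h) filter"
  assumes A: "operator_algebra A"
    and F_proper: "F \<noteq> bot"
    and F_contractive: "\<forall>\<^sub>F e in F. e \<in> A \<and> norm e \<le> 1"
    and F_right_unit: "a \<in> A \<Longrightarrow> ((\<lambda>e. a o\<^sub>L e) \<longlongrightarrow> a) F"
begin

lemma A_closed [simp, intro]:
  "0 \<in> A" "a \<in> A \<Longrightarrow> b \<in> A \<Longrightarrow> a + b \<in> A" "a \<in> A \<Longrightarrow> b \<in> A \<Longrightarrow> a o\<^sub>L b \<in> A"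
  "a \<in> A \<Longrightarrow> cscale_op c a \<in> A"
  using A by (auto simp: operator_algebra_def)

lemma A_diff_closed [simp, intro]:
  assumes "a \<in> A" "b \<in> A" shows "a - b \<in> A"
proof -
  have "cscale (-1) x = - x" for x :: 'h
    using cscale_of_real[of "-1" x] by simp
  then have eq: "a - b = a + cscale_op (-1) b"
    by (intro blinfun_eqI) (simp add: blinfun.add_left blinfun.diff_left)
  show ?thesis
    unfolding eq using assms by (intro A_closed)
qed

end

locale module_with_unit = operator_algebra_with_unit A F + operator_space E
  for A :: "('h::chilbert_space \<Rightarrow>\<^sub>L 'h) set" and F and E :: "('u, 'h \<Rightarrow>\<^sub>L 'h) opmod" +
  assumes right_module: "right_module A E"
    and contractive_action: "contractive_action A E"
begin

lemma act_closed [simp, intro]: "x \<in> carrier E \<Longrightarrow> a \<in> A \<Longrightarrow> act E x a \<in> carrier E"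
  using right_module by (simp add: right_module_def)

lemma act_add: "x \<in> carrier E \<Longrightarrow> y \<in> carrier E \<Longrightarrow> a \<in> A \<Longrightarrow> act E (x \<oplus>\<^bsub>E\<^esub> y) a = act E x a \<oplus>\<^bsub>E\<^esub> act E y a"
  using right_module by (simp add: right_module_def)

lemma act_smult: "x \<in> carrier E \<Longrightarrow> a \<in> A \<Longrightarrow> act E (c \<odot>\<^bsub>E\<^esub> x) a = c \<odot>\<^bsub>E\<^esub> act E x a"
  using right_module by (simp add: right_module_def)

lemma act_zero: "a \<in> A \<Longrightarrow> act E \<zero>\<^bsub>E\<^esub> a = \<zero>\<^bsub>E\<^esub>"
  using act_smult[of "\<zero>\<^bsub>E\<^esub>" a 0] by simp

lemma act_diff: "x \<in> carrier E \<Longrightarrow> y \<in> carrier E \<Longrightarrow> a \<in> A \<Longrightarrow> act E (x \<ominus>\<^bsub>E\<^esub> y) a = act E x a \<ominus>\<^bsub>E\<^esub> act E y a"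
  using act_add[of "x \<ominus>\<^bsub>E\<^esub> y" y a] add_diff_cancel[of "act E (x \<ominus>\<^bsub>E\<^esub> y) a" "act E y a"] by simp

lemma act_add_right: "x \<in> carrier E \<Longrightarrow> a \<in> A \<Longrightarrow> b \<in> A \<Longrightarrow> act E x (a + b) = act E x a \<oplus>\<^bsub>E\<^esub> act E x b"
  and act_cscale_op: "x \<in> carrier E \<Longrightarrow> a \<in> A \<Longrightarrow> act E x (cscale_op c a) = c \<odot>\<^bsub>E\<^esub> act E x a"
  and act_act: "x \<in> carrier E \<Longrightarrow> a \<in> A \<Longrightarrow> b \<in> A \<Longrightarrow> act E (act E x a) b = act E x (a o\<^sub>L b)"
  using right_module by (simp_all add: right_module_def)

lemma mnorm_act_le:
  "x \<in> mats E n p \<Longrightarrow> a \<in> mats (opspace_of A) p n \<Longrightarrow>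
   mnorm E n (\<lambda>i j. \<Oplus>\<^bsub>E\<^esub>k\<in>{..<p}. act E (x i k) (a k j)) \<le> rect_norm E n p x * rect_norm (opspace_of A) p n a"
  using contractive_action by (simp add: contractive_action_def)

lemma act_diff_right: "x \<in> carrier E \<Longrightarrow> a \<in> A \<Longrightarrow> b \<in> A \<Longrightarrow> act E x (a - b) = act E x a \<ominus>\<^bsub>E\<^esub> act E x b"
proof -
  assume *: "x \<in> carrier E" "a \<in> A" "b \<in> A"
  then have "act E x ((a - b) + b) = act E x (a - b) \<oplus>\<^bsub>E\<^esub> act E x b"
    using right_module A_diff_closed unfolding right_module_def by blast
  then show ?thesis
    using add_diff_cancel[of "act E x (a - b)" "act E x b"] * by simp
qed

lemma vnorm_act_le:
  assumes "x \<in> carrier E" "a \<in> A"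
  shows "vnorm E (act E x a) \<le> vnorm E x * norm a"
proof -
  have "mnorm E 1 (\<lambda>i j. \<Oplus>\<^bsub>E\<^esub>k\<in>{..<1::nat}. act E x a) \<le> rect_norm E 1 1 (\<lambda>_ _. x) * rect_norm (opspace_of A) 1 1 (\<lambda>_ _. a)"
    using contractive_action[unfolded contractive_action_def, rule_format, of "\<lambda>_ _. x" 1 1 "\<lambda>_ _. a"] assms
    by (auto simp: mats_def)
  moreover have "(\<Oplus>\<^bsub>E\<^esub>k\<in>{..<1::nat}. act E x a) = act E x a"
    using assms by (subst finsum_single[of 0]) auto
  moreover have "rect_norm E 1 1 (\<lambda>_ _. x) = vnorm E x"
    using assms by (subst rect_norm_square) (auto simp: vnorm_def mats_def)
  ultimately show ?thesis
    unfolding rect_norm_opspace_1_1 by (simp add: vnorm_def)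
qed

definition unit_limit :: "'u \<Rightarrow> bool" where
  "unit_limit x \<longleftrightarrow> ((\<lambda>e. vnorm E (act E x e \<ominus>\<^bsub>E\<^esub> x)) \<longlongrightarrow> 0) F"

text \<open>The difference \<open>(x a) e - x a\<close> equals \<open>x (a e - a)\<close>.\<close>

lemma unit_limit_act:
  assumes x: "x \<in> carrier E" and a: "a \<in> A"
  shows "unit_limit (act E x a)"
  unfolding unit_limit_def
proof (rule null_squeeze_eventually)
  have "((\<lambda>e. norm ((a o\<^sub>L e) - a)) \<longlongrightarrow> 0) F"
    using F_right_unit[OF a] by (intro tendsto_norm_zero LIM_zero)
  then show "((\<lambda>e. vnorm E x * norm ((a o\<^sub>L e) - a)) \<longlongrightarrow> 0) F"
    by (rule tendsto_mult_right_zero)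
  show "\<forall>\<^sub>F e in F. 0 \<le> vnorm E (act E (act E x a) e \<ominus>\<^bsub>E\<^esub> act E x a) \<and>
      vnorm E (act E (act E x a) e \<ominus>\<^bsub>E\<^esub> act E x a) \<le> vnorm E x * norm ((a o\<^sub>L e) - a)"
    using F_contractive
  proof eventually_elim
    case (elim e)
    then have "act E (act E x a) e \<ominus>\<^bsub>E\<^esub> act E x a = act E x ((a o\<^sub>L e) - a)"
      using right_module x a by (simp add: act_diff_right right_module_def)
    then show ?case using vnorm_act_le[OF x, of "(a o\<^sub>L e) - a"] elim x a by auto
  qed
qed

lemma submodule_unit_limit: "submodule {x \<in> carrier E. unit_limit x} complex_ring E"
proof -
  have smult: "unit_limit (c \<odot>\<^bsub>E\<^esub> x)" if x: "x \<in> carrier E" "unit_limit x" for c x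
    unfolding unit_limit_def
  proof (rule null_squeeze_eventually)
    show "((\<lambda>e. cmod c * vnorm E (act E x e \<ominus>\<^bsub>E\<^esub> x)) \<longlongrightarrow> 0) F"
      using x by (intro tendsto_mult_right_zero) (simp add: unit_limit_def)
    show "\<forall>\<^sub>F e in F. 0 \<le> vnorm E (act E (c \<odot>\<^bsub>E\<^esub> x) e \<ominus>\<^bsub>E\<^esub> c \<odot>\<^bsub>E\<^esub> x) \<and>
        vnorm E (act E (c \<odot>\<^bsub>E\<^esub> x) e \<ominus>\<^bsub>E\<^esub> c \<odot>\<^bsub>E\<^esub> x) \<le> cmod c * vnorm E (act E x e \<ominus>\<^bsub>E\<^esub> x)"
      using F_contractive
      by eventually_elim (use x in \<open>auto simp: act_smult smult_diff[symmetric] intro!: vnorm_scale\<close>)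
  qed
  have add: "unit_limit (x \<oplus>\<^bsub>E\<^esub> y)" if x: "x \<in> carrier E" "unit_limit x" and y: "y \<in> carrier E" "unit_limit y" for x y
    unfolding unit_limit_def
  proof (rule null_squeeze_eventually)
    show "((\<lambda>e. vnorm E (act E x e \<ominus>\<^bsub>E\<^esub> x) + vnorm E (act E y e \<ominus>\<^bsub>E\<^esub> y)) \<longlongrightarrow> 0) F"
      using tendsto_add[of _ 0 F _ 0] x y by (auto simp: unit_limit_def)
    show "\<forall>\<^sub>F e in F. 0 \<le> vnorm E (act E (x \<oplus>\<^bsub>E\<^esub> y) e \<ominus>\<^bsub>E\<^esub> (x \<oplus>\<^bsub>E\<^esub> y)) \<and>
        vnorm E (act E (x \<oplus>\<^bsub>E\<^esub> y) e \<ominus>\<^bsub>E\<^esub> (x \<oplus>\<^bsub>E\<^esub> y)) \<le> vnorm E (act E x e \<ominus>\<^bsub>E\<^esub> x) + vnorm E (act E y e \<ominus>\<^bsub>E\<^esub> y)"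
      using F_contractive
      by eventually_elim (use x y in \<open>auto simp: act_add add_diff_add intro!: vnorm_triangle\<close>)
  qed
  show ?thesis
  proof (rule submoduleI)
    have "unit_limit (0 \<odot>\<^bsub>E\<^esub> x)" if "x \<in> carrier E" for x
      unfolding unit_limit_def
      by (rule null_squeeze_eventually[OF tendsto_const])
        (use F_contractive that in \<open>auto elim!: eventually_mono simp: act_zero\<close>)
    from this[of "\<zero>\<^bsub>E\<^esub>"] show "\<zero>\<^bsub>E\<^esub> \<in> {x \<in> carrier E. unit_limit x}" by simp
    show "\<ominus>\<^bsub>E\<^esub> x \<in> {x \<in> carrier E. unit_limit x}" if "x \<in> {x \<in> carrier E. unit_limit x}" for x
      using smult[of x "-1"] that by (simp add: minus_one_smult)
  qed (use add smult in auto)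
qed

text \<open>Along the approximate identity \<open>x e\<close> tends to \<open>x\<close> for \<open>x\<close> of the form \<open>y a\<close>, hence on their
  span and, the maps \<open>x \<mapsto> x e\<close> being contractive, on its closure. In this form nondegeneracy
  visibly passes to closed submodules, quotients and direct sums.\<close>

lemma nondegenerate_iff: "nondegenerate A E \<longleftrightarrow> (\<forall>x\<in>carrier E. unit_limit x)"
proof -
  interpret D: Metric_space "carrier E" "vdist E" by (rule Metric_space_vdist)
  define G where "G = {act E x a | x a. x \<in> carrier E \<and> a \<in> A}"
  define H where "H = (\<lambda>N. submodule N complex_ring E) hull G"
  have H: "H \<subseteq> {x \<in> carrier E. unit_limit x}"
    unfolding H_def by (rule hull_minimal[where S = "\<lambda>N. submodule N complex_ring E", OF _ submodule_unit_limit])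
      (auto simp: G_def unit_limit_act)
  have nd: "nondegenerate A E \<longleftrightarrow> (\<forall>x\<in>carrier E. \<forall>r>0. \<exists>y\<in>H. vnorm E (x \<ominus>\<^bsub>E\<^esub> y) < r)"
  proof -
    have "D.mtopology closure_of H = {x \<in> carrier E. \<forall>r>0. \<exists>y\<in>H. vnorm E (x \<ominus>\<^bsub>E\<^esub> y) < r}"
      unfolding D.metric_closure_of D.in_mball vdist_def using H by (auto 4 3 simp: subset_iff)
    then show ?thesis
      unfolding nondegenerate_def G_def[symmetric] H_def[symmetric] by blast
  qed
  show ?thesis
  proof
    assume *: "\<forall>x\<in>carrier E. unit_limit x"
    show "nondegenerate A E"
      unfolding nd
    proof (intro ballI allI impI)
      fix x r assume x: "x \<in> carrier E" and r: "(0::real) < r"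
      then have "\<forall>\<^sub>F e in F. vnorm E (act E x e \<ominus>\<^bsub>E\<^esub> x) < r"
        using * by (intro order_tendstoD(2)) (auto simp: unit_limit_def)
      with F_contractive have "\<forall>\<^sub>F e in F. e \<in> A \<and> vnorm E (act E x e \<ominus>\<^bsub>E\<^esub> x) < r"
        by eventually_elim auto
      then obtain e where e: "e \<in> A" "vnorm E (act E x e \<ominus>\<^bsub>E\<^esub> x) < r"
        using F_proper eventually_happens' by blast
      moreover have "act E x e \<in> H"
        unfolding H_def G_def using x e by (intro hull_inc) auto
      ultimately show "\<exists>y\<in>H. vnorm E (x \<ominus>\<^bsub>E\<^esub> y) < r"
        using x by (auto intro!: bexI[of _ "act E x e"] simp: vnorm_diff_commute)
    qed
  next
    assume nde: "nondegenerate A E"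
    show "\<forall>x\<in>carrier E. unit_limit x"
    proof
      fix x assume x: "x \<in> carrier E"
      show "unit_limit x"
        unfolding unit_limit_def
      proof (rule tendstoI)
        fix r :: real assume r: "0 < r"
        then have r3: "0 < r / 3" by simp
        with nde x obtain y where "y \<in> H" and xy: "vnorm E (x \<ominus>\<^bsub>E\<^esub> y) < r / 3"
          unfolding nd by blast
        then have y: "y \<in> carrier E" "unit_limit y" using H by auto
        have "\<forall>\<^sub>F e in F. vnorm E (act E y e \<ominus>\<^bsub>E\<^esub> y) < r / 3"
          using y r3 by (intro order_tendstoD(2)) (auto simp: unit_limit_def)
        with F_contractive show "\<forall>\<^sub>F e in F. dist (vnorm E (act E x e \<ominus>\<^bsub>E\<^esub> x)) 0 < r"
        proof eventually_elim
          case (elim e)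
          then have e: "e \<in> A" "norm e \<le> 1" by auto
          have "vnorm E (act E x e \<ominus>\<^bsub>E\<^esub> act E y e) \<le> vnorm E (x \<ominus>\<^bsub>E\<^esub> y) * norm e"
            using vnorm_act_le[of "x \<ominus>\<^bsub>E\<^esub> y" e] x y e by (simp add: act_diff)
          also have "\<dots> \<le> vnorm E (x \<ominus>\<^bsub>E\<^esub> y)"
            using e x y by (simp add: mult_left_le)
          finally have "vnorm E (act E x e \<ominus>\<^bsub>E\<^esub> act E y e) < r / 3" using xy by simp
          moreover have "vnorm E (act E x e \<ominus>\<^bsub>E\<^esub> x) \<le> vnorm E (act E x e \<ominus>\<^bsub>E\<^esub> act E y e) + vnorm E (act E y e \<ominus>\<^bsub>E\<^esub> x)"
            using x y e by (intro vnorm_diff_triangle) auto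
          moreover have "vnorm E (act E y e \<ominus>\<^bsub>E\<^esub> x) \<le> vnorm E (act E y e \<ominus>\<^bsub>E\<^esub> y) + vnorm E (y \<ominus>\<^bsub>E\<^esub> x)"
            using x y e by (intro vnorm_diff_triangle) auto
          ultimately have "vnorm E (act E x e \<ominus>\<^bsub>E\<^esub> x) < r"
            using elim xy vnorm_diff_commute[of x y] x y by linarith
          then show ?case using x e by simp
        qed
      qed
    qed
  qed
qed

end

locale nondegenerate_module = module_with_unit A F E
  for A :: "('h::chilbert_space \<Rightarrow>\<^sub>L 'h) set" and F and E :: "('u, 'h \<Rightarrow>\<^sub>L 'h) opmod" +
  assumes unit_limit: "x \<in> carrier E \<Longrightarrow> unit_limit x"

context operator_algebra_with_unit begin

lemma nd_module_iff: "nd_module A E \<longleftrightarrow> nondegenerate_module A F E"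
proof -
  have "module_with_unit A F E" if "operator_module A E"
    using that operator_module_iff[OF A, of E]
    by (intro module_with_unit.intro operator_algebra_with_unit_axioms module_with_unit_axioms.intro) auto
  moreover have "operator_module A E" if "module_with_unit A F E"
    using that operator_module_iff[OF A, of E]
    by (simp add: module_with_unit_def module_with_unit_axioms_def)
  ultimately show ?thesis
    unfolding nd_module_def nondegenerate_module_def nondegenerate_module_axioms_def
    using module_with_unit.nondegenerate_iff by blast
qed

end

section \<open>Closed submodules of a direct sum\<close>

lemma cauchy_seqs_dominated:
  assumes s: "s \<in> cauchy_seqs V" and t: "\<And>k. t k \<in> carrier W" and c: "0 < c"
    and le: "\<And>k l. vnorm W (t k \<ominus>\<^bsub>W\<^esub> t l) \<le> c * vnorm V (s k \<ominus>\<^bsub>V\<^esub> s l)"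
  shows "t \<in> cauchy_seqs W"
  unfolding cauchy_seqs_def mem_Collect_eq
proof (intro conjI allI impI t)
  fix e :: real assume "0 < e"
  then have "0 < e / c" using c by simp
  then obtain N where N: "\<And>k l. k \<ge> N \<Longrightarrow> l \<ge> N \<Longrightarrow> vnorm V (s k \<ominus>\<^bsub>V\<^esub> s l) < e / c"
    using s unfolding cauchy_seqs_def by blast
  show "\<exists>N. \<forall>k\<ge>N. \<forall>l\<ge>N. vnorm W (t k \<ominus>\<^bsub>W\<^esub> t l) < e"
  proof (intro exI allI impI)
    fix k l assume "N \<le> k" "N \<le> l"
    then have "c * vnorm V (s k \<ominus>\<^bsub>V\<^esub> s l) < c * (e / c)"
      using N c by (intro mult_strict_left_mono) auto
    then show "vnorm W (t k \<ominus>\<^bsub>W\<^esub> t l) < e"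
      using le[of k l] c by simp
  qed
qed

text \<open>Kernels, direct sums and pullbacks are all closed submodules of a direct sum of two modules. The
  pairs are encoded in the universe by an injection.\<close>

locale subproduct = E: nondegenerate_module A F E + G: nondegenerate_module A F G
  for A :: "('h::chilbert_space \<Rightarrow>\<^sub>L 'h) set" and F
    and E :: "('u, 'h \<Rightarrow>\<^sub>L 'h) opmod" and G :: "('u, 'h \<Rightarrow>\<^sub>L 'h) opmod" +
  fixes S :: "('u \<times> 'u) set" and \<iota> :: "'u \<times> 'u \<Rightarrow> 'u"
  assumes inj: "inj_on \<iota> (carrier E \<times> carrier G)"
    and S_subset: "S \<subseteq> carrier E \<times> carrier G"
    and S_zero: "(\<zero>\<^bsub>E\<^esub>, \<zero>\<^bsub>G\<^esub>) \<in> S"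
    and S_add: "(x, y) \<in> S \<Longrightarrow> (x', y') \<in> S \<Longrightarrow> (x \<oplus>\<^bsub>E\<^esub> x', y \<oplus>\<^bsub>G\<^esub> y') \<in> S"
    and S_smult: "(x, y) \<in> S \<Longrightarrow> (c \<odot>\<^bsub>E\<^esub> x, c \<odot>\<^bsub>G\<^esub> y) \<in> S"
    and S_act: "(x, y) \<in> S \<Longrightarrow> a \<in> A \<Longrightarrow> (act E x a, act G y a) \<in> S"
    and S_closed: "\<lbrakk>\<And>k. (s k, t k) \<in> S; x \<in> carrier E; y \<in> carrier G;
        (\<lambda>k. vnorm E (s k \<ominus>\<^bsub>E\<^esub> x)) \<longlonglongrightarrow> 0; (\<lambda>k. vnorm G (t k \<ominus>\<^bsub>G\<^esub> y)) \<longlonglongrightarrow> 0\<rbrakk> \<Longrightarrow> (x, y) \<in> S"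
begin

definition p :: "'u \<Rightarrow> 'u" where "p w = fst (inv_into S \<iota> w)"
definition q :: "'u \<Rightarrow> 'u" where "q w = snd (inv_into S \<iota> w)"

definition W :: "('u, 'h \<Rightarrow>\<^sub>L 'h) opmod" where
  "W = \<lparr>carrier = \<iota> ` S, mult = undefined, one = undefined, zero = \<iota> (\<zero>\<^bsub>E\<^esub>, \<zero>\<^bsub>G\<^esub>),
     add = (\<lambda>v w. \<iota> (p v \<oplus>\<^bsub>E\<^esub> p w, q v \<oplus>\<^bsub>G\<^esub> q w)),
     smult = (\<lambda>c v. \<iota> (c \<odot>\<^bsub>E\<^esub> p v, c \<odot>\<^bsub>G\<^esub> q v)),
     mnorm = (\<lambda>n x. max (mnorm E n (\<lambda>i j. p (x i j))) (mnorm G n (\<lambda>i j. q (x i j)))),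
     act = (\<lambda>v a. \<iota> (act E (p v) a, act G (q v) a))\<rparr>"

lemma inj_S: "inj_on \<iota> S"
  using inj S_subset by (rule inj_on_subset)

lemma p_pair [simp]: "(x, y) \<in> S \<Longrightarrow> p (\<iota> (x, y)) = x"
  and q_pair [simp]: "(x, y) \<in> S \<Longrightarrow> q (\<iota> (x, y)) = y"
  by (simp_all add: p_def q_def inv_into_f_f[OF inj_S])

lemma carrier_W: "carrier W = \<iota> ` S"
  by (simp add: W_def)

lemma mnorm_W: "mnorm W n x = max (mnorm E n (\<lambda>i j. p (x i j))) (mnorm G n (\<lambda>i j. q (x i j)))"
  by (simp add: W_def)

lemma pq_in_S: "w \<in> carrier W \<Longrightarrow> (p w, q w) \<in> S"
  by (auto simp: carrier_W)

lemma pair_in_W: "(x, y) \<in> S \<Longrightarrow> \<iota> (x, y) \<in> carrier W"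
  by (auto simp: carrier_W)

lemma p_closed [simp, intro]: "w \<in> carrier W \<Longrightarrow> p w \<in> carrier E"
  and q_closed [simp, intro]: "w \<in> carrier W \<Longrightarrow> q w \<in> carrier G"
  using pq_in_S S_subset by auto

lemma W_eqI: "\<lbrakk>v \<in> carrier W; w \<in> carrier W; p v = p w; q v = q w\<rbrakk> \<Longrightarrow> v = w"
  by (auto simp: carrier_W)

lemma bij_pq: "bij_betw (\<lambda>w. (p w, q w)) (carrier W) S"
  by (rule bij_betw_byWitness[where f' = \<iota>]) (auto simp: carrier_W)

lemma W_closed [simp, intro]:
  "\<zero>\<^bsub>W\<^esub> \<in> carrier W"
  "v \<in> carrier W \<Longrightarrow> w \<in> carrier W \<Longrightarrow> v \<oplus>\<^bsub>W\<^esub> w \<in> carrier W"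
  "v \<in> carrier W \<Longrightarrow> c \<odot>\<^bsub>W\<^esub> v \<in> carrier W"
  "v \<in> carrier W \<Longrightarrow> a \<in> A \<Longrightarrow> act W v a \<in> carrier W"
  using pair_in_W S_zero S_add[OF pq_in_S pq_in_S] S_smult[OF pq_in_S] S_act[OF pq_in_S]
  by (simp_all add: W_def)

lemma pq_simps [simp]:
  "p \<zero>\<^bsub>W\<^esub> = \<zero>\<^bsub>E\<^esub>" "q \<zero>\<^bsub>W\<^esub> = \<zero>\<^bsub>G\<^esub>"
  "v \<in> carrier W \<Longrightarrow> w \<in> carrier W \<Longrightarrow> p (v \<oplus>\<^bsub>W\<^esub> w) = p v \<oplus>\<^bsub>E\<^esub> p w"
  "v \<in> carrier W \<Longrightarrow> w \<in> carrier W \<Longrightarrow> q (v \<oplus>\<^bsub>W\<^esub> w) = q v \<oplus>\<^bsub>G\<^esub> q w"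
  "v \<in> carrier W \<Longrightarrow> p (c \<odot>\<^bsub>W\<^esub> v) = c \<odot>\<^bsub>E\<^esub> p v"
  "v \<in> carrier W \<Longrightarrow> q (c \<odot>\<^bsub>W\<^esub> v) = c \<odot>\<^bsub>G\<^esub> q v"
  "v \<in> carrier W \<Longrightarrow> a \<in> A \<Longrightarrow> p (act W v a) = act E (p v) a"
  "v \<in> carrier W \<Longrightarrow> a \<in> A \<Longrightarrow> q (act W v a) = act G (q v) a"
  using S_zero S_add[OF pq_in_S pq_in_S] S_smult[OF pq_in_S] S_act[OF pq_in_S]
  by (simp_all add: W_def)

lemma complex_module_W: "complex_module W"
  unfolding complex_module_def
proof (rule moduleI[OF cring_complex_ring])
  show "abelian_group W"
  proof (rule abelian_groupI)
    fix v assume v: "v \<in> carrier W"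
    have "(-1) \<odot>\<^bsub>W\<^esub> v \<oplus>\<^bsub>W\<^esub> v = \<zero>\<^bsub>W\<^esub>"
      by (rule W_eqI) (use v in \<open>auto simp: E.minus_one_smult G.minus_one_smult E.M.l_neg G.M.l_neg\<close>)
    with v show "\<exists>w\<in>carrier W. w \<oplus>\<^bsub>W\<^esub> v = \<zero>\<^bsub>W\<^esub>" by blast
    show "\<zero>\<^bsub>W\<^esub> \<oplus>\<^bsub>W\<^esub> v = v" by (rule W_eqI) (use v in auto)
    fix w assume w: "w \<in> carrier W"
    show "v \<oplus>\<^bsub>W\<^esub> w = w \<oplus>\<^bsub>W\<^esub> v"
      by (rule W_eqI) (use v w in \<open>auto simp: E.M.a_comm G.M.a_comm\<close>)
    fix u assume u: "u \<in> carrier W"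
    show "v \<oplus>\<^bsub>W\<^esub> w \<oplus>\<^bsub>W\<^esub> u = v \<oplus>\<^bsub>W\<^esub> (w \<oplus>\<^bsub>W\<^esub> u)"
      by (rule W_eqI) (use u v w in \<open>auto simp: E.M.a_assoc G.M.a_assoc\<close>)
  qed auto
next
  fix a b v assume v: "v \<in> carrier W"
  show "(a \<oplus>\<^bsub>complex_ring\<^esub> b) \<odot>\<^bsub>W\<^esub> v = a \<odot>\<^bsub>W\<^esub> v \<oplus>\<^bsub>W\<^esub> b \<odot>\<^bsub>W\<^esub> v"
    by (rule W_eqI) (use v in \<open>auto simp: E.smult_add_left G.smult_add_left\<close>)
  show "(a \<otimes>\<^bsub>complex_ring\<^esub> b) \<odot>\<^bsub>W\<^esub> v = a \<odot>\<^bsub>W\<^esub> (b \<odot>\<^bsub>W\<^esub> v)"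
    by (rule W_eqI) (use v in \<open>auto simp: E.smult_smult G.smult_smult\<close>)
  show "\<one>\<^bsub>complex_ring\<^esub> \<odot>\<^bsub>W\<^esub> v = v"
    by (rule W_eqI) (use v in auto)
  fix w assume w: "w \<in> carrier W"
  show "a \<odot>\<^bsub>W\<^esub> (v \<oplus>\<^bsub>W\<^esub> w) = a \<odot>\<^bsub>W\<^esub> v \<oplus>\<^bsub>W\<^esub> a \<odot>\<^bsub>W\<^esub> w"
    by (rule W_eqI) (use v w in \<open>auto simp: E.smult_add_right G.smult_add_right\<close>)
qed auto

sublocale W: complex_module W by (rule complex_module_W)

lemma linear_p: "linear_map W E p" and linear_q: "linear_map W G q"
  by (auto simp: linear_map_def)

sublocale p: linear_between W E p
  by (intro linear_between.intro complex_module_W E.complex_module_axioms linear_between_axioms.intro linear_p)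

sublocale q: linear_between W G q
  by (intro linear_between.intro complex_module_W G.complex_module_axioms linear_between_axioms.intro linear_q)

lemma normed_matrices_W: "normed_matrices W"
proof (intro normed_matrices.intro complex_module_W normed_matrices_axioms.intro)
  fix n and x y :: "nat \<Rightarrow> nat \<Rightarrow> 'u" assume x: "x \<in> mats W n n"
  note xc = matsD[OF x]
  show "mnorm W n x = mnorm W n y" if "\<And>i j. i < n \<Longrightarrow> j < n \<Longrightarrow> x i j = y i j"
  proof -
    have "mnorm E n (\<lambda>i j. p (x i j)) = mnorm E n (\<lambda>i j. p (y i j))"
      using x that by (intro E.nm_cong p.mats) auto
    moreover have "mnorm G n (\<lambda>i j. q (x i j)) = mnorm G n (\<lambda>i j. q (y i j))"
      using x that by (intro G.nm_cong q.mats) auto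
    ultimately show ?thesis by (simp add: mnorm_W)
  qed
  show "0 \<le> mnorm W n x"
    using E.nm_nonneg[OF p.mats[OF x]] by (simp add: mnorm_W)
  show "mnorm W n x = 0 \<longleftrightarrow> (\<forall>i<n. \<forall>j<n. x i j = \<zero>\<^bsub>W\<^esub>)"
  proof -
    have "mnorm W n x = 0 \<longleftrightarrow> mnorm E n (\<lambda>i j. p (x i j)) = 0 \<and> mnorm G n (\<lambda>i j. q (x i j)) = 0"
      using E.nm_nonneg[OF p.mats[OF x]] G.nm_nonneg[OF q.mats[OF x]] by (auto simp: mnorm_W max_def)
    also have "\<dots> \<longleftrightarrow> (\<forall>i<n. \<forall>j<n. p (x i j) = \<zero>\<^bsub>E\<^esub> \<and> q (x i j) = \<zero>\<^bsub>G\<^esub>)"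
      by (auto simp: E.nm_eq_0[OF p.mats[OF x]] G.nm_eq_0[OF q.mats[OF x]])
    also have "\<dots> \<longleftrightarrow> (\<forall>i<n. \<forall>j<n. x i j = \<zero>\<^bsub>W\<^esub>)"
    proof -
      have "p w = \<zero>\<^bsub>E\<^esub> \<and> q w = \<zero>\<^bsub>G\<^esub> \<longleftrightarrow> w = \<zero>\<^bsub>W\<^esub>" if "w \<in> carrier W" for w
        using W_eqI[OF that W_closed(1)] by auto
      then show ?thesis using xc by simp
    qed
    finally show ?thesis .
  qed
  show "mnorm W n (\<lambda>i j. c \<odot>\<^bsub>W\<^esub> x i j) = cmod c * mnorm W n x" for c
  proof -
    have "mnorm E n (\<lambda>i j. p (c \<odot>\<^bsub>W\<^esub> x i j)) = mnorm E n (\<lambda>i j. c \<odot>\<^bsub>E\<^esub> p (x i j))"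
      by (rule E.nm_cong) (use xc in auto)
    moreover have "mnorm G n (\<lambda>i j. q (c \<odot>\<^bsub>W\<^esub> x i j)) = mnorm G n (\<lambda>i j. c \<odot>\<^bsub>G\<^esub> q (x i j))"
      by (rule G.nm_cong) (use xc in auto)
    ultimately show ?thesis
      by (simp add: mnorm_W E.nm_scale[OF p.mats[OF x]] G.nm_scale[OF q.mats[OF x]] max_mult_distrib_left)
  qed
  show "mnorm W m (sandwich W n \<alpha> x \<beta>) \<le> scalar_norm m n \<alpha> * mnorm W n x * scalar_norm n m \<beta>" for m \<alpha> \<beta>
  proof -
    have "mnorm E m (\<lambda>i j. p (sandwich W n \<alpha> x \<beta> i j)) \<le> scalar_norm m n \<alpha> * mnorm W n x * scalar_norm n m \<beta>"
      using E.nm_sandwich[OF p.mats[OF x], of m \<alpha> \<beta>] unfolding p.sandwich[OF x]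
      by (rule order_trans) (intro mult_right_mono mult_left_mono, auto simp: mnorm_W)
    moreover have "mnorm G m (\<lambda>i j. q (sandwich W n \<alpha> x \<beta> i j)) \<le> scalar_norm m n \<alpha> * mnorm W n x * scalar_norm n m \<beta>"
      using G.nm_sandwich[OF q.mats[OF x], of m \<alpha> \<beta>] unfolding q.sandwich[OF x]
      by (rule order_trans) (intro mult_right_mono mult_left_mono, auto simp: mnorm_W)
    ultimately show ?thesis by (simp add: mnorm_W)
  qed
next
  fix n and x y :: "nat \<Rightarrow> nat \<Rightarrow> 'u" assume x: "x \<in> mats W n n" and y: "y \<in> mats W n n"
  note xc = matsD[OF x] matsD[OF y]
  have "mnorm E n (\<lambda>i j. p (x i j \<oplus>\<^bsub>W\<^esub> y i j)) = mnorm E n (\<lambda>i j. p (x i j) \<oplus>\<^bsub>E\<^esub> p (y i j))"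
    by (rule E.nm_cong) (use xc in auto)
  moreover have "mnorm G n (\<lambda>i j. q (x i j \<oplus>\<^bsub>W\<^esub> y i j)) = mnorm G n (\<lambda>i j. q (x i j) \<oplus>\<^bsub>G\<^esub> q (y i j))"
    by (rule G.nm_cong) (use xc in auto)
  ultimately show "mnorm W n (\<lambda>i j. x i j \<oplus>\<^bsub>W\<^esub> y i j) \<le> mnorm W n x + mnorm W n y"
    using E.nm_triangle[OF p.mats[OF x] p.mats[OF y]] G.nm_triangle[OF q.mats[OF x] q.mats[OF y]]
    by (auto simp: mnorm_W)
next
  fix m n and x y :: "nat \<Rightarrow> nat \<Rightarrow> 'u" assume x: "x \<in> mats W m m" and y: "y \<in> mats W n n"
  have "(\<lambda>i j. p (diag_sum W m n x y i j)) = diag_sum E m n (\<lambda>i j. p (x i j)) (\<lambda>i j. p (y i j))"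
    "(\<lambda>i j. q (diag_sum W m n x y i j)) = diag_sum G m n (\<lambda>i j. q (x i j)) (\<lambda>i j. q (y i j))"
    by (auto simp: diag_sum_def fun_eq_iff)
  then show "mnorm W (m + n) (diag_sum W m n x y) = max (mnorm W m x) (mnorm W n y)"
    by (simp add: mnorm_W E.nm_diag[OF p.mats[OF x] p.mats[OF y]] G.nm_diag[OF q.mats[OF x] q.mats[OF y]]
      max.assoc max.left_commute)
qed

sublocale W: normed_matrices W by (rule normed_matrices_W)

lemma vnorm_W: "vnorm W w = max (vnorm E (p w)) (vnorm G (q w))"
  by (simp add: vnorm_def mnorm_W)

lemma seq_complete_W: "seq_complete W"
  unfolding seq_complete_def
proof
  fix s assume s: "s \<in> cauchy_seqs W"
  note sc = W.cauchy_seqs_closed[OF s]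
  have pc: "(\<lambda>k. p (s k)) \<in> cauchy_seqs E"
    by (rule cauchy_seqs_dominated[OF s, where c = 1]) (use sc in \<open>simp_all add: vnorm_W p.diff\<close>)
  have qc: "(\<lambda>k. q (s k)) \<in> cauchy_seqs G"
    by (rule cauchy_seqs_dominated[OF s, where c = 1]) (use sc in \<open>simp_all add: vnorm_W q.diff\<close>)
  obtain x where x: "x \<in> carrier E" "(\<lambda>k. vnorm E (p (s k) \<ominus>\<^bsub>E\<^esub> x)) \<longlonglongrightarrow> 0"
    using bspec[OF E.seq_complete[unfolded seq_complete_def] pc] by blast
  obtain y where y: "y \<in> carrier G" "(\<lambda>k. vnorm G (q (s k) \<ominus>\<^bsub>G\<^esub> y)) \<longlonglongrightarrow> 0"
    using bspec[OF G.seq_complete[unfolded seq_complete_def] qc] by blast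
  have xy: "(x, y) \<in> S"
    by (rule S_closed[OF pq_in_S[OF sc] x(1) y(1) x(2) y(2)])
  have "(\<lambda>k. vnorm W (s k \<ominus>\<^bsub>W\<^esub> \<iota> (x, y))) = (\<lambda>k. max (vnorm E (p (s k) \<ominus>\<^bsub>E\<^esub> x)) (vnorm G (q (s k) \<ominus>\<^bsub>G\<^esub> y)))"
    using sc pair_in_W[OF xy] xy by (simp add: vnorm_W p.diff q.diff)
  also have "\<dots> \<longlonglongrightarrow> max 0 0"
    by (intro tendsto_max x y)
  finally show "\<exists>w\<in>carrier W. (\<lambda>k. vnorm W (s k \<ominus>\<^bsub>W\<^esub> w)) \<longlonglongrightarrow> 0"
    using pair_in_W[OF xy] by auto
qed

lemma rect_norm_W:
  "rect_norm W m n x = max (rect_norm E m n (\<lambda>i j. p (x i j))) (rect_norm G m n (\<lambda>i j. q (x i j)))"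
proof -
  have "(\<lambda>i j. p (if i < m \<and> j < n then x i j else \<zero>\<^bsub>W\<^esub>)) = (\<lambda>i j. if i < m \<and> j < n then p (x i j) else \<zero>\<^bsub>E\<^esub>)"
    "(\<lambda>i j. q (if i < m \<and> j < n then x i j else \<zero>\<^bsub>W\<^esub>)) = (\<lambda>i j. if i < m \<and> j < n then q (x i j) else \<zero>\<^bsub>G\<^esub>)"
    by (auto simp: fun_eq_iff)
  then show ?thesis
    by (simp add: rect_norm_def mnorm_W)
qed

lemma right_module_W: "right_module A W"
  unfolding right_module_def
proof (intro conjI ballI allI)
  fix v a assume v: "v \<in> carrier W" and a: "a \<in> A"
  then show "act W v a \<in> carrier W" by simp
  note rm = E.act_smult G.act_smult E.act_add_right G.act_add_right E.act_cscale_op G.act_cscale_op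
    E.act_act G.act_act
  fix c
  show "act W (c \<odot>\<^bsub>W\<^esub> v) a = c \<odot>\<^bsub>W\<^esub> act W v a"
    by (rule W_eqI) (use v a in \<open>auto simp: rm\<close>)
  show "act W v (cscale_op c a) = c \<odot>\<^bsub>W\<^esub> act W v a"
    by (rule W_eqI) (use v a in \<open>auto simp: rm\<close>)
  fix b assume b: "b \<in> A"
  show "act W v (a + b) = act W v a \<oplus>\<^bsub>W\<^esub> act W v b"
    by (rule W_eqI) (use v a b in \<open>auto simp: rm\<close>)
  show "act W (act W v a) b = act W v (a o\<^sub>L b)"
    by (rule W_eqI) (use v a b in \<open>auto simp: rm\<close>)
next
  fix v w a assume vw: "v \<in> carrier W" "w \<in> carrier W" "a \<in> A"
  show "act W (v \<oplus>\<^bsub>W\<^esub> w) a = act W v a \<oplus>\<^bsub>W\<^esub> act W w a"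
    by (rule W_eqI) (use vw in \<open>auto simp: E.act_add G.act_add\<close>)
qed

lemma contractive_action_W: "contractive_action A W"
  unfolding contractive_action_def
proof (intro allI ballI)
  fix n r x a assume x: "x \<in> mats W n r" and a: "a \<in> mats (opspace_of A) r n"
  define z where "z i j = (\<Oplus>\<^bsub>W\<^esub>k\<in>{..<r}. act W (x i k) (a k j))" for i j
  have c: "k < r \<Longrightarrow> i < n \<Longrightarrow> x i k \<in> carrier W" "k < r \<Longrightarrow> j < n \<Longrightarrow> a k j \<in> A" for i j k
    using x a by (auto simp: mats_def)
  have zm: "z \<in> mats W n n"
    unfolding z_def using c by (intro matsI W.M.finsum_closed) auto
  have "mnorm E n (\<lambda>i j. p (z i j)) = mnorm E n (\<lambda>i j. \<Oplus>\<^bsub>E\<^esub>k\<in>{..<r}. act E (p (x i k)) (a k j))"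
  proof (rule E.nm_cong[OF p.mats[OF zm]])
    fix i j assume ij: "i < n" "j < n"
    then have "p (z i j) = (\<Oplus>\<^bsub>E\<^esub>k\<in>{..<r}. p (act W (x i k) (a k j)))"
      unfolding z_def using c by (intro p.finsum) auto
    also have "\<dots> = (\<Oplus>\<^bsub>E\<^esub>k\<in>{..<r}. act E (p (x i k)) (a k j))"
      using c ij by (intro E.M.finsum_cong') auto
    finally show "p (z i j) = (\<Oplus>\<^bsub>E\<^esub>k\<in>{..<r}. act E (p (x i k)) (a k j))" .
  qed
  also have "\<dots> \<le> rect_norm E n r (\<lambda>i j. p (x i j)) * rect_norm (opspace_of A) r n a"
    by (rule E.mnorm_act_le[OF p.mats[OF x] a])
  also have "\<dots> \<le> rect_norm W n r x * rect_norm (opspace_of A) r n a"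
    by (intro mult_right_mono) (auto simp: rect_norm_W)
  finally have 1: "mnorm E n (\<lambda>i j. p (z i j)) \<le> rect_norm W n r x * rect_norm (opspace_of A) r n a" .
  have "mnorm G n (\<lambda>i j. q (z i j)) = mnorm G n (\<lambda>i j. \<Oplus>\<^bsub>G\<^esub>k\<in>{..<r}. act G (q (x i k)) (a k j))"
  proof (rule G.nm_cong[OF q.mats[OF zm]])
    fix i j assume ij: "i < n" "j < n"
    then have "q (z i j) = (\<Oplus>\<^bsub>G\<^esub>k\<in>{..<r}. q (act W (x i k) (a k j)))"
      unfolding z_def using c by (intro q.finsum) auto
    also have "\<dots> = (\<Oplus>\<^bsub>G\<^esub>k\<in>{..<r}. act G (q (x i k)) (a k j))"
      using c ij by (intro G.M.finsum_cong') auto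
    finally show "q (z i j) = (\<Oplus>\<^bsub>G\<^esub>k\<in>{..<r}. act G (q (x i k)) (a k j))" .
  qed
  also have "\<dots> \<le> rect_norm G n r (\<lambda>i j. q (x i j)) * rect_norm (opspace_of A) r n a"
    by (rule G.mnorm_act_le[OF q.mats[OF x] a])
  also have "\<dots> \<le> rect_norm W n r x * rect_norm (opspace_of A) r n a"
    by (intro mult_right_mono) (auto simp: rect_norm_W)
  finally have "mnorm G n (\<lambda>i j. q (z i j)) \<le> rect_norm W n r x * rect_norm (opspace_of A) r n a" .
  with 1 show "mnorm W n (\<lambda>i j. \<Oplus>\<^bsub>W\<^esub>k\<in>{..<r}. act W (x i k) (a k j)) \<le> rect_norm W n r x * rect_norm (opspace_of A) r n a"
    unfolding z_def[symmetric] by (simp add: mnorm_W)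
qed

lemma nondegenerate_module_W: "nondegenerate_module A F W"
proof -
  interpret WU: module_with_unit A F W
    by (intro module_with_unit.intro E.operator_algebra_with_unit_axioms module_with_unit_axioms.intro
      operator_spaceI normed_matrices_W seq_complete_W right_module_W contractive_action_W)
  show ?thesis
  proof (unfold_locales)
    fix w assume w: "w \<in> carrier W"
    show "WU.unit_limit w"
      unfolding WU.unit_limit_def
    proof (rule null_squeeze_eventually)
      have "((\<lambda>e. vnorm E (act E (p w) e \<ominus>\<^bsub>E\<^esub> p w)) \<longlongrightarrow> 0) F" "((\<lambda>e. vnorm G (act G (q w) e \<ominus>\<^bsub>G\<^esub> q w)) \<longlongrightarrow> 0) F"
        using E.unit_limit[OF p_closed[OF w]] G.unit_limit[OF q_closed[OF w]]
        by (simp_all add: E.unit_limit_def G.unit_limit_def)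
      then have "((\<lambda>e. max (vnorm E (act E (p w) e \<ominus>\<^bsub>E\<^esub> p w)) (vnorm G (act G (q w) e \<ominus>\<^bsub>G\<^esub> q w))) \<longlongrightarrow> max 0 0) F"
        by (rule tendsto_max)
      then show "((\<lambda>e. max (vnorm E (act E (p w) e \<ominus>\<^bsub>E\<^esub> p w)) (vnorm G (act G (q w) e \<ominus>\<^bsub>G\<^esub> q w))) \<longlongrightarrow> 0) F"
        by simp
      show "\<forall>\<^sub>F e in F. 0 \<le> vnorm W (act W w e \<ominus>\<^bsub>W\<^esub> w) \<and> vnorm W (act W w e \<ominus>\<^bsub>W\<^esub> w)
          \<le> max (vnorm E (act E (p w) e \<ominus>\<^bsub>E\<^esub> p w)) (vnorm G (act G (q w) e \<ominus>\<^bsub>G\<^esub> q w))"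
        using E.F_contractive
      proof eventually_elim
        case (elim e)
        then have "vnorm W (act W w e \<ominus>\<^bsub>W\<^esub> w) =
            max (vnorm E (act E (p w) e \<ominus>\<^bsub>E\<^esub> p w)) (vnorm G (act G (q w) e \<ominus>\<^bsub>G\<^esub> q w))"
          using w by (simp add: vnorm_W p.diff q.diff)
        then show ?case
          using W.vnorm_nonneg[of "act W w e \<ominus>\<^bsub>W\<^esub> w"] w elim by simp
      qed
    qed
  qed
qed

end

lemma nonzero_complex_module_infinite:
  assumes "complex_module V" "x \<in> carrier V" "x \<noteq> \<zero>\<^bsub>V\<^esub>"
  shows "infinite (carrier V)"
proof -
  interpret complex_module V by fact
  have "inj (\<lambda>c. c \<odot>\<^bsub>V\<^esub> x)"
  proof (rule injI, rule ccontr)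
    fix c d assume eq: "c \<odot>\<^bsub>V\<^esub> x = d \<odot>\<^bsub>V\<^esub> x" and "c \<noteq> d"
    have "(c - d) \<odot>\<^bsub>V\<^esub> x = c \<odot>\<^bsub>V\<^esub> x \<oplus>\<^bsub>V\<^esub> (- d) \<odot>\<^bsub>V\<^esub> x"
      using assms(2) smult_add_left[of x c "- d"] by simp
    also have "\<dots> = (d + (- d)) \<odot>\<^bsub>V\<^esub> x"
      using assms(2) eq smult_add_left[of x d "- d"] by simp
    finally have "(c - d) \<odot>\<^bsub>V\<^esub> x = \<zero>\<^bsub>V\<^esub>" using assms(2) by simp
    then have "(inverse (c - d) * (c - d)) \<odot>\<^bsub>V\<^esub> x = \<zero>\<^bsub>V\<^esub>"
      using assms(2) by (simp add: smult_smult[symmetric])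
    then show False using \<open>c \<noteq> d\<close> assms by simp
  qed
  moreover have "range (\<lambda>c. c \<odot>\<^bsub>V\<^esub> x) \<subseteq> carrier V" using assms(2) by auto
  moreover have "infinite (UNIV :: complex set)" by (simp add: infinite_UNIV_char_0)
  ultimately show ?thesis
    using finite_imageD finite_subset by blast
qed

text \<open>An infinite universe contains its own square. A finite one contains only zero modules, for which
  there is nothing to encode.\<close>

lemma pairing_injection:
  assumes V: "complex_module (V :: ('u, 'y) opspace_scheme)" and W: "complex_module (W :: ('u, 'z) opspace_scheme)"
  obtains \<iota> :: "'u \<times> 'u \<Rightarrow> 'u" where "inj_on \<iota> (carrier V \<times> carrier W)"
proof (cases "finite (UNIV :: 'u set)")
  case True
  then have "carrier V \<subseteq> {\<zero>\<^bsub>V\<^esub>}" "carrier W \<subseteq> {\<zero>\<^bsub>W\<^esub>}"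
    using nonzero_complex_module_infinite[OF V] nonzero_complex_module_infinite[OF W]
      finite_subset[OF subset_UNIV True] by blast+
  then have "inj_on (\<lambda>_. undefined :: 'u) (carrier V \<times> carrier W)"
    by (auto intro!: inj_onI)
  then show ?thesis by (rule that)
next
  case False
  then obtain \<iota> :: "'u \<times> 'u \<Rightarrow> 'u" where "bij_betw \<iota> (UNIV \<times> UNIV) UNIV"
    using card_of_ordIso[THEN iffD2, OF card_of_Times_same_infinite] by blast
  then have "inj_on \<iota> (carrier V \<times> carrier W)"
    by (auto simp: bij_betw_def intro: inj_on_subset)
  then show ?thesis by (rule that)
qed

section \<open>Quotients by closed submodules\<close>

text \<open>The elements of the quotient are chosen representatives of cosets, so that it lives in the same
  universe. The norm of a matrix is the infimum of the norms of its lifts.\<close>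

locale quotient_module = E: nondegenerate_module A F E
  for A :: "('h::chilbert_space \<Rightarrow>\<^sub>L 'h) set" and F and E :: "('u, 'h \<Rightarrow>\<^sub>L 'h) opmod" +
  fixes N :: "'u set"
  assumes N_subset: "N \<subseteq> carrier E"
    and N_zero [simp]: "\<zero>\<^bsub>E\<^esub> \<in> N"
    and N_add: "x \<in> N \<Longrightarrow> y \<in> N \<Longrightarrow> x \<oplus>\<^bsub>E\<^esub> y \<in> N"
    and N_smult: "x \<in> N \<Longrightarrow> c \<odot>\<^bsub>E\<^esub> x \<in> N"
    and N_act: "x \<in> N \<Longrightarrow> a \<in> A \<Longrightarrow> act E x a \<in> N"
    and N_closed: "\<lbrakk>\<And>k. s k \<in> N; x \<in> carrier E; (\<lambda>k. vnorm E (s k \<ominus>\<^bsub>E\<^esub> x)) \<longlonglongrightarrow> 0\<rbrakk> \<Longrightarrow> x \<in> N"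
begin

lemma N_carrier: "x \<in> N \<Longrightarrow> x \<in> carrier E"
  using N_subset by auto

lemma N_minus: "x \<in> N \<Longrightarrow> \<ominus>\<^bsub>E\<^esub> x \<in> N"
  using N_smult[of x "-1"] N_carrier by (simp add: E.minus_one_smult)

lemma N_diff_sym: "x \<in> carrier E \<Longrightarrow> y \<in> carrier E \<Longrightarrow> x \<ominus>\<^bsub>E\<^esub> y \<in> N \<Longrightarrow> y \<ominus>\<^bsub>E\<^esub> x \<in> N"
  using N_minus[of "x \<ominus>\<^bsub>E\<^esub> y"] by (simp add: E.diff_swap)

lemma N_diff_trans:
  "\<lbrakk>x \<in> carrier E; y \<in> carrier E; z \<in> carrier E; x \<ominus>\<^bsub>E\<^esub> y \<in> N; y \<ominus>\<^bsub>E\<^esub> z \<in> N\<rbrakk> \<Longrightarrow> x \<ominus>\<^bsub>E\<^esub> z \<in> N"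
  using N_add[of "x \<ominus>\<^bsub>E\<^esub> y" "y \<ominus>\<^bsub>E\<^esub> z"] by (simp add: E.diff_add_diff)

definition r :: "'u \<Rightarrow> 'u" where
  "r x = (SOME z. z \<in> carrier E \<and> z \<ominus>\<^bsub>E\<^esub> x \<in> N)"

lemma r_props:
  assumes "x \<in> carrier E"
  shows r_closed_E: "r x \<in> carrier E" and r_diff: "r x \<ominus>\<^bsub>E\<^esub> x \<in> N"
  using someI[of "\<lambda>z. z \<in> carrier E \<and> z \<ominus>\<^bsub>E\<^esub> x \<in> N" x] assms by (simp_all add: r_def)

lemma r_eq_iff:
  assumes "x \<in> carrier E" "y \<in> carrier E"
  shows "r x = r y \<longleftrightarrow> x \<ominus>\<^bsub>E\<^esub> y \<in> N"
proof
  assume "r x = r y"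
  then show "x \<ominus>\<^bsub>E\<^esub> y \<in> N"
    using assms r_props[OF assms(1)] r_props[OF assms(2)] by (metis N_diff_sym N_diff_trans)
next
  assume xy: "x \<ominus>\<^bsub>E\<^esub> y \<in> N"
  have "z \<ominus>\<^bsub>E\<^esub> x \<in> N \<longleftrightarrow> z \<ominus>\<^bsub>E\<^esub> y \<in> N" if "z \<in> carrier E" for z
    using N_diff_trans[OF that assms _ xy] N_diff_trans[OF that assms(2,1) _ N_diff_sym[OF assms xy]] by blast
  then have "(\<lambda>z. z \<in> carrier E \<and> z \<ominus>\<^bsub>E\<^esub> x \<in> N) = (\<lambda>z. z \<in> carrier E \<and> z \<ominus>\<^bsub>E\<^esub> y \<in> N)"
    by auto
  then show "r x = r y"
    by (simp add: r_def)
qed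

lemma r_r [simp]: "x \<in> carrier E \<Longrightarrow> r (r x) = r x"
  using r_props[of x] by (subst r_eq_iff) auto

definition lifts :: "nat \<Rightarrow> (nat \<Rightarrow> nat \<Rightarrow> 'u) \<Rightarrow> (nat \<Rightarrow> nat \<Rightarrow> 'u) \<Rightarrow> bool" where
  "lifts n y x \<longleftrightarrow> x \<in> mats E n n \<and> (\<forall>i<n. \<forall>j<n. r (x i j) = y i j)"

definition Q :: "('u, 'h \<Rightarrow>\<^sub>L 'h) opmod" where
  "Q = \<lparr>carrier = r ` carrier E, mult = undefined, one = undefined, zero = r \<zero>\<^bsub>E\<^esub>,
     add = (\<lambda>x y. r (x \<oplus>\<^bsub>E\<^esub> y)), smult = (\<lambda>c x. r (c \<odot>\<^bsub>E\<^esub> x)),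
     mnorm = (\<lambda>n y. Inf {mnorm E n x | x. lifts n y x}),
     act = (\<lambda>x a. r (act E x a))\<rparr>"

lemma carrier_Q: "carrier Q = r ` carrier E"
  and mnorm_Q: "mnorm Q n y = Inf {mnorm E n x | x. lifts n y x}"
  by (simp_all add: Q_def)

lemma r_closed [simp, intro]: "x \<in> carrier E \<Longrightarrow> r x \<in> carrier Q"
  by (simp add: carrier_Q)

lemma r_zero: "r \<zero>\<^bsub>E\<^esub> = \<zero>\<^bsub>Q\<^esub>"
  by (simp add: Q_def)

lemma r_add: "x \<in> carrier E \<Longrightarrow> y \<in> carrier E \<Longrightarrow> r (x \<oplus>\<^bsub>E\<^esub> y) = r x \<oplus>\<^bsub>Q\<^esub> r y"
proof -
  assume c: "x \<in> carrier E" "y \<in> carrier E"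
  then have "(r x \<oplus>\<^bsub>E\<^esub> r y) \<ominus>\<^bsub>E\<^esub> (x \<oplus>\<^bsub>E\<^esub> y) \<in> N"
    using r_props N_add by (simp add: E.add_diff_add)
  then have "r (r x \<oplus>\<^bsub>E\<^esub> r y) = r (x \<oplus>\<^bsub>E\<^esub> y)"
    using c r_closed_E by (subst r_eq_iff) auto
  then show ?thesis by (simp add: Q_def)
qed

lemma r_smult: "x \<in> carrier E \<Longrightarrow> r (c \<odot>\<^bsub>E\<^esub> x) = c \<odot>\<^bsub>Q\<^esub> r x"
proof -
  assume c: "x \<in> carrier E"
  then have "c \<odot>\<^bsub>E\<^esub> r x \<ominus>\<^bsub>E\<^esub> c \<odot>\<^bsub>E\<^esub> x \<in> N"
    using r_props N_smult by (simp add: E.smult_diff[symmetric])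
  then have "r (c \<odot>\<^bsub>E\<^esub> r x) = r (c \<odot>\<^bsub>E\<^esub> x)"
    using c r_closed_E by (subst r_eq_iff) auto
  then show ?thesis by (simp add: Q_def)
qed

lemma r_act: "x \<in> carrier E \<Longrightarrow> a \<in> A \<Longrightarrow> r (act E x a) = act Q (r x) a"
proof -
  assume c: "x \<in> carrier E" "a \<in> A"
  then have "act E (r x) a \<ominus>\<^bsub>E\<^esub> act E x a \<in> N"
    using r_props N_act by (simp add: E.act_diff[symmetric])
  then have "r (act E (r x) a) = r (act E x a)"
    using c r_closed_E by (subst r_eq_iff) auto
  then show ?thesis by (simp add: Q_def)
qed

lemmas Q_simps = r_add[symmetric] r_smult[symmetric] r_act[symmetric]

lemma carrier_QE: assumes "y \<in> carrier Q" obtains x where "x \<in> carrier E" "y = r x"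
  using assms by (auto simp: carrier_Q)

lemma complex_module_Q: "complex_module Q"
  unfolding complex_module_def
proof (rule moduleI[OF cring_complex_ring])
  show "abelian_group Q"
  proof (rule abelian_groupI)
    show "\<zero>\<^bsub>Q\<^esub> \<in> carrier Q" using r_zero r_closed[of "\<zero>\<^bsub>E\<^esub>"] by simp
    fix x' assume "x' \<in> carrier Q"
    then obtain x where x: "x \<in> carrier E" "x' = r x" by (rule carrier_QE)
    show "\<zero>\<^bsub>Q\<^esub> \<oplus>\<^bsub>Q\<^esub> x' = x'" using x by (simp add: r_zero[symmetric] Q_simps)
    show "\<exists>y\<in>carrier Q. y \<oplus>\<^bsub>Q\<^esub> x' = \<zero>\<^bsub>Q\<^esub>"
      using x by (intro bexI[of _ "r (\<ominus>\<^bsub>E\<^esub> x)"]) (auto simp: r_zero[symmetric] Q_simps E.M.l_neg)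
    fix y' assume "y' \<in> carrier Q"
    then obtain y where y: "y \<in> carrier E" "y' = r y" by (rule carrier_QE)
    show "x' \<oplus>\<^bsub>Q\<^esub> y' \<in> carrier Q" using x y by (simp add: Q_simps)
    show "x' \<oplus>\<^bsub>Q\<^esub> y' = y' \<oplus>\<^bsub>Q\<^esub> x'" using x y by (simp add: Q_simps E.M.a_comm)
    fix z' assume "z' \<in> carrier Q"
    then obtain z where z: "z \<in> carrier E" "z' = r z" by (rule carrier_QE)
    show "x' \<oplus>\<^bsub>Q\<^esub> y' \<oplus>\<^bsub>Q\<^esub> z' = x' \<oplus>\<^bsub>Q\<^esub> (y' \<oplus>\<^bsub>Q\<^esub> z')"
      using x y z by (simp add: Q_simps E.M.a_assoc)
  qed
next
  fix a b x' assume "x' \<in> carrier Q"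
  then obtain x where x: "x \<in> carrier E" "x' = r x" by (rule carrier_QE)
  show "a \<odot>\<^bsub>Q\<^esub> x' \<in> carrier Q" using x by (simp add: Q_simps)
  show "(a \<oplus>\<^bsub>complex_ring\<^esub> b) \<odot>\<^bsub>Q\<^esub> x' = a \<odot>\<^bsub>Q\<^esub> x' \<oplus>\<^bsub>Q\<^esub> b \<odot>\<^bsub>Q\<^esub> x'"
    using x by (simp add: Q_simps E.smult_add_left)
  show "(a \<otimes>\<^bsub>complex_ring\<^esub> b) \<odot>\<^bsub>Q\<^esub> x' = a \<odot>\<^bsub>Q\<^esub> (b \<odot>\<^bsub>Q\<^esub> x')"
    using x by (simp add: Q_simps E.smult_smult)
  show "\<one>\<^bsub>complex_ring\<^esub> \<odot>\<^bsub>Q\<^esub> x' = x'"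
    using x by (simp add: Q_simps)
  fix y' assume "y' \<in> carrier Q"
  then obtain y where y: "y \<in> carrier E" "y' = r y" by (rule carrier_QE)
  show "a \<odot>\<^bsub>Q\<^esub> (x' \<oplus>\<^bsub>Q\<^esub> y') = a \<odot>\<^bsub>Q\<^esub> x' \<oplus>\<^bsub>Q\<^esub> a \<odot>\<^bsub>Q\<^esub> y'"
    using x y by (simp add: Q_simps E.smult_add_right)
qed

sublocale Q: complex_module Q by (rule complex_module_Q)

lemma linear_r: "linear_map E Q r"
  by (simp add: linear_map_def r_add r_smult)

sublocale r: linear_between E Q r
  by (intro linear_between.intro complex_module_Q E.complex_module_axioms linear_between_axioms.intro linear_r)

lemma r_eq_zero_iff: "x \<in> carrier E \<Longrightarrow> r x = \<zero>\<^bsub>Q\<^esub> \<longleftrightarrow> x \<in> N"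
  using r_eq_iff[of x "\<zero>\<^bsub>E\<^esub>"] by (simp add: r_zero)

lemma liftsD: "lifts n y x \<Longrightarrow> x \<in> mats E n n" "lifts n y x \<Longrightarrow> i < n \<Longrightarrow> j < n \<Longrightarrow> r (x i j) = y i j"
  by (auto simp: lifts_def)

lemma carrier_Q_self: "y \<in> carrier Q \<Longrightarrow> y \<in> carrier E \<and> r y = y"
  by (elim carrier_QE) (simp add: r_closed_E)

lemma lifts_self: "y \<in> mats Q n n \<Longrightarrow> lifts n y y"
  using carrier_Q_self by (simp add: lifts_def mats_def)

lemma lifts_r: "x \<in> mats E n n \<Longrightarrow> lifts n (\<lambda>i j. r (x i j)) x"
  by (simp add: lifts_def)

lemma mnorm_Q_le: "lifts n y x \<Longrightarrow> mnorm Q n y \<le> mnorm E n x"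
  unfolding mnorm_Q by (rule cInf_lower) (auto intro!: bdd_belowI[of _ 0] E.nm_nonneg dest: liftsD)

lemma mnorm_Q_ge: "y \<in> mats Q n n \<Longrightarrow> (\<And>x. lifts n y x \<Longrightarrow> c \<le> mnorm E n x) \<Longrightarrow> c \<le> mnorm Q n y"
  unfolding mnorm_Q using lifts_self by (intro cInf_greatest) auto

lemma mnorm_Q_ge_mult:
  assumes "y \<in> mats Q n n" "0 \<le> d" "\<And>x. lifts n y x \<Longrightarrow> c \<le> d * mnorm E n x"
  shows "c \<le> d * mnorm Q n y"
proof (cases "d = 0")
  case True
  then show ?thesis using assms(3)[OF lifts_self[OF assms(1)]] by simp
next
  case False
  then have "0 < d" using assms(2) by simp
  then have "c / d \<le> mnorm Q n y"
    using assms(3) by (intro mnorm_Q_ge[OF assms(1)]) (simp add: pos_divide_le_eq mult.commute)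
  then show ?thesis using \<open>0 < d\<close> by (simp add: pos_divide_le_eq mult.commute)
qed

lemma mnorm_Q_nonneg: "y \<in> mats Q n n \<Longrightarrow> 0 \<le> mnorm Q n y"
  by (rule mnorm_Q_ge) (auto intro: E.nm_nonneg dest: liftsD)

lemma lift_less:
  assumes "y \<in> mats Q n n" "mnorm Q n y < c"
  shows "\<exists>x. lifts n y x \<and> mnorm E n x < c"
  using mnorm_Q_ge[OF assms(1), of c] assms(2) by (meson not_le)

lemma mnorm_Q_zero: "mnorm Q n (\<lambda>_ _. \<zero>\<^bsub>Q\<^esub>) = 0"
proof (rule antisym)
  have "lifts n (\<lambda>_ _. \<zero>\<^bsub>Q\<^esub>) (\<lambda>_ _. \<zero>\<^bsub>E\<^esub>)" by (simp add: lifts_def mats_def r_zero)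
  then show "mnorm Q n (\<lambda>_ _. \<zero>\<^bsub>Q\<^esub>) \<le> 0" using mnorm_Q_le E.sn_zero by metis
qed (rule mnorm_Q_nonneg, auto simp: mats_def)

lemma mnorm_Q_cong:
  assumes "\<And>i j. i < n \<Longrightarrow> j < n \<Longrightarrow> y i j = y' i j"
  shows "mnorm Q n y = mnorm Q n y'"
proof -
  have "lifts n y = lifts n y'" using assms by (auto simp: lifts_def fun_eq_iff)
  then show ?thesis by (simp add: mnorm_Q)
qed

lemma mnorm_Q_smult_le:
  assumes y: "y \<in> mats Q n n"
  shows "mnorm Q n (\<lambda>i j. c \<odot>\<^bsub>Q\<^esub> y i j) \<le> cmod c * mnorm Q n y"
proof (rule mnorm_Q_ge_mult[OF y])
  fix x assume x: "lifts n y x"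
  have "lifts n (\<lambda>i j. c \<odot>\<^bsub>Q\<^esub> y i j) (\<lambda>i j. c \<odot>\<^bsub>E\<^esub> x i j)"
    using x by (auto simp: lifts_def mats_def r_smult)
  then show "mnorm Q n (\<lambda>i j. c \<odot>\<^bsub>Q\<^esub> y i j) \<le> cmod c * mnorm E n x"
    using mnorm_Q_le E.nm_scale[OF liftsD(1)[OF x]] by metis
qed simp

text \<open>The matrix norm of a quotient separates points because the submodule is closed.\<close>

lemma mnorm_Q_eq_0:
  assumes y: "y \<in> mats Q n n"
  shows "mnorm Q n y = 0 \<longleftrightarrow> (\<forall>i<n. \<forall>j<n. y i j = \<zero>\<^bsub>Q\<^esub>)"
proof
  assume "\<forall>i<n. \<forall>j<n. y i j = \<zero>\<^bsub>Q\<^esub>"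
  then have "mnorm Q n y = mnorm Q n (\<lambda>_ _. \<zero>\<^bsub>Q\<^esub>)" by (intro mnorm_Q_cong) auto
  then show "mnorm Q n y = 0" by (simp add: mnorm_Q_zero)
next
  assume 0: "mnorm Q n y = 0"
  show "\<forall>i<n. \<forall>j<n. y i j = \<zero>\<^bsub>Q\<^esub>"
  proof (intro allI impI)
    fix i j assume ij: "i < n" "j < n"
    obtain z where z: "z \<in> carrier E" "y i j = r z"
      using matsD[OF y ij] by (rule carrier_QE)
    have "\<exists>x. lifts n y x \<and> mnorm E n x < inverse (real (Suc k))" for k
      using lift_less[OF y, of "inverse (real (Suc k))"] 0 by (metis inverse_positive_iff_positive of_nat_0_less_iff zero_less_Suc)
    then obtain x where x: "\<And>k. lifts n y (x k)" "\<And>k. mnorm E n (x k) < inverse (real (Suc k))" by metis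
    have xc: "x k i j \<in> carrier E" "r (x k i j) = r z" for k
      using liftsD[OF x(1)] ij z by (auto simp: mats_def)
    have "z \<in> N"
    proof (rule N_closed)
      show "z \<ominus>\<^bsub>E\<^esub> x k i j \<in> N" for k
        using xc[of k] z r_eq_iff[of z "x k i j"] by simp
      show "(\<lambda>k. vnorm E (z \<ominus>\<^bsub>E\<^esub> x k i j \<ominus>\<^bsub>E\<^esub> z)) \<longlonglongrightarrow> 0"
      proof (rule null_squeeze[OF LIMSEQ_inverse_real_of_nat])
        fix k
        have "z \<ominus>\<^bsub>E\<^esub> x k i j \<ominus>\<^bsub>E\<^esub> z = \<ominus>\<^bsub>E\<^esub> x k i j"
          using z xc[of k] by (simp add: E.M.minus_eq E.M.a_ac E.M.r_neg1 E.M.r_neg2 E.M.r_neg)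
        then have "vnorm E (z \<ominus>\<^bsub>E\<^esub> x k i j \<ominus>\<^bsub>E\<^esub> z) = vnorm E (x k i j)"
          using xc by (simp add: E.vnorm_uminus)
        also have "\<dots> \<le> mnorm E n (x k)"
          using liftsD(1)[OF x(1)] ij by (rule E.vnorm_entry_le)
        finally show "vnorm E (z \<ominus>\<^bsub>E\<^esub> x k i j \<ominus>\<^bsub>E\<^esub> z) \<le> inverse (real (Suc k))"
          using x(2)[of k] by simp
      qed (use z xc in auto)
    qed (use z in auto)
    then show "y i j = \<zero>\<^bsub>Q\<^esub>" using z r_eq_zero_iff by simp
  qed
qed

lemma mnorm_Q_triangle:
  assumes x: "x \<in> mats Q n n" and y: "y \<in> mats Q n n"
  shows "mnorm Q n (\<lambda>i j. x i j \<oplus>\<^bsub>Q\<^esub> y i j) \<le> mnorm Q n x + mnorm Q n y"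
proof (rule field_le_epsilon)
  fix e :: real assume "0 < e"
  then have lt: "mnorm Q n x < mnorm Q n x + e / 2" "mnorm Q n y < mnorm Q n y + e / 2" by simp_all
  obtain x' where x': "lifts n x x'" "mnorm E n x' < mnorm Q n x + e / 2"
    using lift_less[OF x lt(1)] by blast
  obtain y' where y': "lifts n y y'" "mnorm E n y' < mnorm Q n y + e / 2"
    using lift_less[OF y lt(2)] by blast
  have "lifts n (\<lambda>i j. x i j \<oplus>\<^bsub>Q\<^esub> y i j) (\<lambda>i j. x' i j \<oplus>\<^bsub>E\<^esub> y' i j)"
    using x' y' by (auto simp: lifts_def mats_def r_add)
  then have "mnorm Q n (\<lambda>i j. x i j \<oplus>\<^bsub>Q\<^esub> y i j) \<le> mnorm E n (\<lambda>i j. x' i j \<oplus>\<^bsub>E\<^esub> y' i j)"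
    by (rule mnorm_Q_le)
  also have "\<dots> \<le> mnorm E n x' + mnorm E n y'"
    using x' y' by (intro E.nm_triangle liftsD)
  finally show "mnorm Q n (\<lambda>i j. x i j \<oplus>\<^bsub>Q\<^esub> y i j) \<le> mnorm Q n x + mnorm Q n y + e"
    using x' y' by simp
qed

text \<open>Both blocks of a lift of a block diagonal matrix are lifts, and cutting out a block is contractive.\<close>

lemma mnorm_Q_diag:
  assumes x: "x \<in> mats Q m m" and y: "y \<in> mats Q n n"
  shows "mnorm Q (m + n) (diag_sum Q m n x y) = max (mnorm Q m x) (mnorm Q n y)"
proof (rule antisym)
  show "mnorm Q (m + n) (diag_sum Q m n x y) \<le> max (mnorm Q m x) (mnorm Q n y)"
  proof (rule field_le_epsilon)
    fix e :: real assume e: "0 < e"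
    obtain x' where x': "lifts m x x'" "mnorm E m x' < mnorm Q m x + e"
      using lift_less[OF x, of "mnorm Q m x + e"] e by auto
    obtain y' where y': "lifts n y y'" "mnorm E n y' < mnorm Q n y + e"
      using lift_less[OF y, of "mnorm Q n y + e"] e by auto
    have "lifts (m + n) (diag_sum Q m n x y) (diag_sum E m n x' y')"
      using x' y' by (auto simp: lifts_def mats_def diag_sum_def r_zero)
    then have "mnorm Q (m + n) (diag_sum Q m n x y) \<le> mnorm E (m + n) (diag_sum E m n x' y')"
      by (rule mnorm_Q_le)
    also have "\<dots> = max (mnorm E m x') (mnorm E n y')"
      using x' y' by (intro E.nm_diag liftsD)
    finally show "mnorm Q (m + n) (diag_sum Q m n x y) \<le> max (mnorm Q m x) (mnorm Q n y) + e"
      using x' y' by linarith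
  qed
  have dm: "diag_sum Q m n x y \<in> mats Q (m + n) (m + n)"
    using x y by (auto simp: mats_def diag_sum_def)
  show "max (mnorm Q m x) (mnorm Q n y) \<le> mnorm Q (m + n) (diag_sum Q m n x y)"
  proof (rule mnorm_Q_ge[OF dm])
    fix z assume z: "lifts (m + n) (diag_sum Q m n x y) z"
    note zm = liftsD(1)[OF z]
    have "lifts m x z"
      using z by (auto simp: lifts_def mats_def diag_sum_def)
    then have "mnorm Q m x \<le> mnorm E m z" by (rule mnorm_Q_le)
    also have "\<dots> \<le> mnorm E (m + n) z"
      using E.nm_partial_reindex[OF zm, of m "\<lambda>_. True" "\<lambda>i. i" "\<lambda>_. True" "\<lambda>i. i"] by simp
    finally have 1: "mnorm Q m x \<le> mnorm E (m + n) z" .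
    have "r (z (m + i) (m + j)) = y i j" if "i < n" "j < n" for i j
      using liftsD(2)[OF z, of "m + i" "m + j"] that by (simp add: diag_sum_def)
    then have "lifts n y (\<lambda>i j. z (m + i) (m + j))"
      using zm by (simp add: lifts_def mats_def)
    then have "mnorm Q n y \<le> mnorm E n (\<lambda>i j. z (m + i) (m + j))" by (rule mnorm_Q_le)
    also have "\<dots> \<le> mnorm E (m + n) z"
      using E.nm_partial_reindex[OF zm, of n "\<lambda>_. True" "\<lambda>i. m + i" "\<lambda>_. True" "\<lambda>i. m + i"] by simp
    finally show "max (mnorm Q m x) (mnorm Q n y) \<le> mnorm E (m + n) z" using 1 by simp
  qed
qed

lemma mnorm_Q_sandwich:
  assumes y: "y \<in> mats Q m m"
  shows "mnorm Q n (sandwich Q m \<alpha> y \<beta>) \<le> scalar_norm n m \<alpha> * mnorm Q m y * scalar_norm m n \<beta>"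
proof -
  define d where "d = scalar_norm n m \<alpha> * scalar_norm m n \<beta>"
  have d: "0 \<le> d" by (simp add: d_def)
  have le: "mnorm Q n (sandwich Q m \<alpha> y \<beta>) \<le> d * mnorm E m x" if x: "lifts m y x" for x
  proof -
    note xm = liftsD(1)[OF x]
    have "r (sandwich E m \<alpha> x \<beta> i j) = sandwich Q m \<alpha> y \<beta> i j" for i j
      unfolding r.sandwich[OF xm] by (subst Q.sandwich_cong[OF r.mats[OF xm]]) (use liftsD(2)[OF x] in auto)
    then have "lifts n (sandwich Q m \<alpha> y \<beta>) (sandwich E m \<alpha> x \<beta>)"
      using xm by (auto simp: lifts_def)
    then have "mnorm Q n (sandwich Q m \<alpha> y \<beta>) \<le> mnorm E n (sandwich E m \<alpha> x \<beta>)"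
      by (rule mnorm_Q_le)
    also have "\<dots> \<le> d * mnorm E m x"
      using E.nm_sandwich[OF xm, of n \<alpha> \<beta>] by (simp add: d_def ac_simps)
    finally show ?thesis .
  qed
  have "mnorm Q n (sandwich Q m \<alpha> y \<beta>) \<le> d * mnorm Q m y"
    by (rule mnorm_Q_ge_mult[OF y d le])
  then show ?thesis by (simp add: d_def ac_simps)
qed

lemma normed_matrices_Q: "normed_matrices Q"
proof (intro normed_matrices.intro complex_module_Q normed_matrices_axioms.intro)
  fix n y and c :: complex assume y: "y \<in> mats Q n n"
  show "mnorm Q n y = mnorm Q n y'" if "\<And>i j. i < n \<Longrightarrow> j < n \<Longrightarrow> y i j = y' i j" for y'
    using that by (rule mnorm_Q_cong)
  show "mnorm Q n (\<lambda>i j. c \<odot>\<^bsub>Q\<^esub> y i j) = cmod c * mnorm Q n y"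
  proof (rule antisym[OF mnorm_Q_smult_le[OF y]])
    show "cmod c * mnorm Q n y \<le> mnorm Q n (\<lambda>i j. c \<odot>\<^bsub>Q\<^esub> y i j)"
    proof (cases "c = 0")
      case True
      then show ?thesis using mnorm_Q_nonneg[of "\<lambda>i j. c \<odot>\<^bsub>Q\<^esub> y i j" n] y by (auto simp: mats_def)
    next
      case False
      have "mnorm Q n y = mnorm Q n (\<lambda>i j. inverse c \<odot>\<^bsub>Q\<^esub> (c \<odot>\<^bsub>Q\<^esub> y i j))"
        using y False by (intro mnorm_Q_cong) (auto simp: mats_def Q.smult_smult)
      also have "\<dots> \<le> cmod (inverse c) * mnorm Q n (\<lambda>i j. c \<odot>\<^bsub>Q\<^esub> y i j)"
        using y by (intro mnorm_Q_smult_le) (auto simp: mats_def)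
      finally have "cmod c * mnorm Q n y \<le> cmod c * (cmod (inverse c) * mnorm Q n (\<lambda>i j. c \<odot>\<^bsub>Q\<^esub> y i j))"
        by (rule mult_left_mono) simp
      also have "\<dots> = mnorm Q n (\<lambda>i j. c \<odot>\<^bsub>Q\<^esub> y i j)"
        using False by (simp add: norm_inverse)
      finally show ?thesis .
    qed
  qed
qed (fact mnorm_Q_nonneg mnorm_Q_eq_0 mnorm_Q_triangle mnorm_Q_diag mnorm_Q_sandwich)+

sublocale Q: normed_matrices Q by (rule normed_matrices_Q)

lemma vnorm_r_le: "x \<in> carrier E \<Longrightarrow> vnorm Q (r x) \<le> vnorm E x"
  unfolding vnorm_def by (rule mnorm_Q_le) (auto simp: lifts_def mats_def)

lemma vnorm_lift_less:
  assumes "y \<in> carrier Q" "vnorm Q y < c"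
  obtains x where "x \<in> carrier E" "r x = y" "vnorm E x < c"
proof -
  obtain x where x: "lifts 1 (\<lambda>_ _. y) x" "mnorm E 1 x < c"
    using lift_less[of "\<lambda>_ _. y" 1 c] assms by (auto simp: vnorm_def)
  have "vnorm E (x 0 0) \<le> mnorm E 1 x"
    using liftsD(1)[OF x(1)] by (rule E.vnorm_entry_le) auto
  then show ?thesis
    using that[of "x 0 0"] x liftsD[OF x(1)] by (auto simp: mats_def)
qed

text \<open>A rapidly converging subsequence is lifted increment by increment to a Cauchy sequence.\<close>

lemma seq_complete_Q: "seq_complete Q"
  unfolding seq_complete_def
proof
  fix s assume s: "s \<in> cauchy_seqs Q"
  note sc = Q.cauchy_seqs_closed[OF s]
  have "\<exists>N. \<forall>k\<ge>N. \<forall>l\<ge>N. vnorm Q (s k \<ominus>\<^bsub>Q\<^esub> s l) < (1 / 2) ^ m" for m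
    using s by (simp add: cauchy_seqs_def)
  then obtain N0 where N0: "\<And>m k l. k \<ge> N0 m \<Longrightarrow> l \<ge> N0 m \<Longrightarrow> vnorm Q (s k \<ominus>\<^bsub>Q\<^esub> s l) < (1 / 2) ^ m" by metis
  \<comment> \<open>A sum rather than a maximum: \<open>M\<close> dominates \<open>N0\<close>, increases and tends to infinity.\<close>
  define M where "M m = (\<Sum>i\<le>m. Suc (N0 i))" for m
  have M0: "N0 m \<le> M m" for m
    using member_le_sum[of m "{..m}" "\<lambda>i. Suc (N0 i)"] by (simp add: M_def)
  have M_ge: "m \<le> M m" for m
    by (induction m) (auto simp: M_def)
  have Mmono: "M m \<le> M (Suc m)" for m by (simp add: M_def)
  have step: "vnorm Q (s (M (Suc m)) \<ominus>\<^bsub>Q\<^esub> s (M m)) < (1 / 2) ^ m" for m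
    using M0[of m] Mmono[of m] by (intro N0) auto
  have "\<exists>x. \<forall>m. (x m \<in> carrier E \<and> r (x m) = s (M m)) \<and> vnorm E (x (Suc m) \<ominus>\<^bsub>E\<^esub> x m) < (1 / 2) ^ m"
  proof (rule dependent_nat_choice)
    show "\<exists>x. x \<in> carrier E \<and> r x = s (M 0)"
      using sc[of "M 0"] by (auto simp: carrier_Q)
    fix x m assume x: "x \<in> carrier E \<and> r x = s (M m)"
    obtain d where d: "d \<in> carrier E" "r d = s (M (Suc m)) \<ominus>\<^bsub>Q\<^esub> s (M m)" "vnorm E d < (1 / 2) ^ m"
      using vnorm_lift_less[OF _ step[of m]] sc by auto
    have "r (x \<oplus>\<^bsub>E\<^esub> d) = s (M (Suc m))"
      using x d sc by (simp add: r_add)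
    moreover have "(x \<oplus>\<^bsub>E\<^esub> d) \<ominus>\<^bsub>E\<^esub> x = d"
      using x d E.add_diff_cancel[of d x] by (simp add: E.M.a_comm)
    ultimately show "\<exists>x'. (x' \<in> carrier E \<and> r x' = s (M (Suc m))) \<and> vnorm E (x' \<ominus>\<^bsub>E\<^esub> x) < (1 / 2) ^ m"
      using x d by (intro exI[of _ "x \<oplus>\<^bsub>E\<^esub> d"]) auto
  qed
  then obtain x where xc: "\<And>m. x m \<in> carrier E" and rx: "\<And>m. r (x m) = s (M m)"
    and xs: "\<And>m. vnorm E (x (Suc m) \<ominus>\<^bsub>E\<^esub> x m) < (1 / 2) ^ m" by blast
  have geo: "vnorm E (x (m + l) \<ominus>\<^bsub>E\<^esub> x m) \<le> 2 * (1 / 2) ^ m - 2 * (1 / 2) ^ (m + l)" for m l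
  proof (induction l)
    case (Suc l)
    have "vnorm E (x (Suc (m + l)) \<ominus>\<^bsub>E\<^esub> x m) \<le> vnorm E (x (Suc (m + l)) \<ominus>\<^bsub>E\<^esub> x (m + l)) + vnorm E (x (m + l) \<ominus>\<^bsub>E\<^esub> x m)"
      by (intro E.vnorm_diff_triangle xc)
    also have "\<dots> \<le> (1 / 2) ^ (m + l) + (2 * (1 / 2) ^ m - 2 * (1 / 2) ^ (m + l))"
      using Suc xs[of "m + l"] by (intro add_mono) auto
    finally show ?case by simp
  qed (use xc in simp)
  have far: "vnorm E (x k \<ominus>\<^bsub>E\<^esub> x m) \<le> 2 * (1 / 2) ^ m" if "m \<le> k" for k m
    using geo[of m "k - m"] that by (simp add: order_trans)
  have "x \<in> cauchy_seqs E"
    unfolding cauchy_seqs_def mem_Collect_eq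
  proof (intro conjI allI impI xc)
    fix e :: real assume "0 < e"
    then obtain m where m: "(1 / 2 :: real) ^ m < e / 4"
      using real_arch_pow_inv[of "e / 4" "1 / 2"] by auto
    show "\<exists>m. \<forall>k\<ge>m. \<forall>l\<ge>m. vnorm E (x k \<ominus>\<^bsub>E\<^esub> x l) < e"
    proof (intro exI allI impI)
      fix k l assume "m \<le> k" "m \<le> l"
      then show "vnorm E (x k \<ominus>\<^bsub>E\<^esub> x l) < e"
        using E.vnorm_diff_triangle[of "x k" "x m" "x l"] xc far[of m k] far[of m l] m
          E.vnorm_diff_commute[of "x m" "x l"] by simp
    qed
  qed
  then obtain z where z: "z \<in> carrier E" and lim: "(\<lambda>k. vnorm E (x k \<ominus>\<^bsub>E\<^esub> z)) \<longlonglongrightarrow> 0"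
    using E.seq_complete unfolding seq_complete_def by blast
  have "(\<lambda>k. vnorm Q (s k \<ominus>\<^bsub>Q\<^esub> r z)) \<longlonglongrightarrow> 0"
  proof (rule LIMSEQ_I)
    fix e :: real assume e: "0 < e"
    then have "0 < e / 2" by simp
    then obtain K where K: "\<And>k l. k \<ge> K \<Longrightarrow> l \<ge> K \<Longrightarrow> vnorm Q (s k \<ominus>\<^bsub>Q\<^esub> s l) < e / 2"
      using s unfolding cauchy_seqs_def by blast
    obtain K' where K': "\<And>k. k \<ge> K' \<Longrightarrow> vnorm E (x k \<ominus>\<^bsub>E\<^esub> z) < e / 2"
      using LIMSEQ_D[OF lim, of "e / 2"] e xc z by auto
    define j where "j = max K K'"
    have j: "j \<ge> K'" "M j \<ge> K"
      using M_ge[of j] by (auto simp: j_def)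
    show "\<exists>n. \<forall>k\<ge>n. norm (vnorm Q (s k \<ominus>\<^bsub>Q\<^esub> r z) - 0) < e"
    proof (intro exI allI impI)
      fix k assume k: "K \<le> k"
      have "vnorm Q (s k \<ominus>\<^bsub>Q\<^esub> r z) \<le> vnorm Q (s k \<ominus>\<^bsub>Q\<^esub> s (M j)) + vnorm Q (s (M j) \<ominus>\<^bsub>Q\<^esub> r z)"
        using sc z by (intro Q.vnorm_diff_triangle) auto
      also have "vnorm Q (s (M j) \<ominus>\<^bsub>Q\<^esub> r z) \<le> vnorm E (x j \<ominus>\<^bsub>E\<^esub> z)"
        using vnorm_r_le[of "x j \<ominus>\<^bsub>E\<^esub> z"] xc z rx by (simp add: r.diff)
      finally have "vnorm Q (s k \<ominus>\<^bsub>Q\<^esub> r z) < e"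
        using K[OF k j(2)] K'[OF j(1)] by linarith
      then show "norm (vnorm Q (s k \<ominus>\<^bsub>Q\<^esub> r z) - 0) < e"
        using sc z by simp
    qed
  qed
  then show "\<exists>y\<in>carrier Q. (\<lambda>k. vnorm Q (s k \<ominus>\<^bsub>Q\<^esub> y)) \<longlonglongrightarrow> 0"
    using z by blast
qed

lemma right_module_Q: "right_module A Q"
  unfolding right_module_def
proof (intro conjI ballI allI)
  fix v' a assume "v' \<in> carrier Q" and a: "a \<in> A"
  then obtain v where v: "v \<in> carrier E" "v' = r v" by (auto elim: carrier_QE)
  show "act Q v' a \<in> carrier Q" using v a by (simp add: Q_simps)
  show "act Q (c \<odot>\<^bsub>Q\<^esub> v') a = c \<odot>\<^bsub>Q\<^esub> act Q v' a" for c
    using v a by (simp add: Q_simps E.act_smult)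
  show "act Q v' (cscale_op c a) = c \<odot>\<^bsub>Q\<^esub> act Q v' a" for c
    using v a by (simp add: Q_simps E.act_cscale_op)
  fix b assume b: "b \<in> A"
  show "act Q v' (a + b) = act Q v' a \<oplus>\<^bsub>Q\<^esub> act Q v' b"
    using v a b by (simp add: Q_simps E.act_add_right)
  show "act Q (act Q v' a) b = act Q v' (a o\<^sub>L b)"
    using v a b by (simp add: Q_simps E.act_act)
next
  fix v' w' a assume "v' \<in> carrier Q" "w' \<in> carrier Q" and a: "a \<in> A"
  then obtain v w where v: "v \<in> carrier E" "v' = r v" and w: "w \<in> carrier E" "w' = r w"
    by (auto elim!: carrier_QE)
  show "act Q (v' \<oplus>\<^bsub>Q\<^esub> w') a = act Q v' a \<oplus>\<^bsub>Q\<^esub> act Q w' a"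
    using v w a by (simp add: Q_simps E.act_add)
qed

text \<open>A product of a lift with a matrix over \<open>A\<close> lifts the product. Lifts of the padded matrix need not
  vanish outside the rectangle, but cutting them back to it does not increase their norm.\<close>

lemma contractive_action_Q: "contractive_action A Q"
  unfolding contractive_action_def
proof (intro allI ballI)
  fix n p y a assume y: "y \<in> mats Q n p" and a: "a \<in> mats (opspace_of A) p n"
  define d where "d = rect_norm (opspace_of A) p n a"
  define Y where "Y i j = (if i < n \<and> j < p then y i j else \<zero>\<^bsub>Q\<^esub>)" for i j
  have Ym: "Y \<in> mats Q (max n p) (max n p)"
    using y by (auto simp: Y_def mats_def)
  have "mnorm Q n (\<lambda>i j. \<Oplus>\<^bsub>Q\<^esub>k\<in>{..<p}. act Q (y i k) (a k j)) \<le> d * mnorm Q (max n p) Y"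
  proof (rule mnorm_Q_ge_mult[OF Ym])
    fix X assume X: "lifts (max n p) Y X"
    have Xy: "X i k \<in> carrier E" "r (X i k) = y i k" if "i < n" "k < p" for i k
      using liftsD(2)[OF X, of i k] liftsD(1)[OF X] that by (auto simp: mats_def Y_def)
    have ac: "k < p \<Longrightarrow> j < n \<Longrightarrow> a k j \<in> A" for k j
      using a by (auto simp: mats_def)
    have "lifts n (\<lambda>i j. \<Oplus>\<^bsub>Q\<^esub>k\<in>{..<p}. act Q (y i k) (a k j)) (\<lambda>i j. \<Oplus>\<^bsub>E\<^esub>k\<in>{..<p}. act E (X i k) (a k j))"
      unfolding lifts_def
    proof (intro conjI allI impI)
      show "(\<lambda>i j. \<Oplus>\<^bsub>E\<^esub>k\<in>{..<p}. act E (X i k) (a k j)) \<in> mats E n n"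
        using Xy ac by (intro matsI E.M.finsum_closed) auto
      fix i j assume ij: "i < n" "j < n"
      have "r (\<Oplus>\<^bsub>E\<^esub>k\<in>{..<p}. act E (X i k) (a k j)) = (\<Oplus>\<^bsub>Q\<^esub>k\<in>{..<p}. r (act E (X i k) (a k j)))"
        using Xy ac ij by (intro r.finsum) auto
      also have "\<dots> = (\<Oplus>\<^bsub>Q\<^esub>k\<in>{..<p}. act Q (y i k) (a k j))"
        using Xy ac ij right_module_Q y by (intro Q.M.finsum_cong') (auto simp: r_act right_module_def mats_def)
      finally show "r (\<Oplus>\<^bsub>E\<^esub>k\<in>{..<p}. act E (X i k) (a k j)) = (\<Oplus>\<^bsub>Q\<^esub>k\<in>{..<p}. act Q (y i k) (a k j))" .
    qed
    then have "mnorm Q n (\<lambda>i j. \<Oplus>\<^bsub>Q\<^esub>k\<in>{..<p}. act Q (y i k) (a k j)) \<le> mnorm E n (\<lambda>i j. \<Oplus>\<^bsub>E\<^esub>k\<in>{..<p}. act E (X i k) (a k j))"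
      by (rule mnorm_Q_le)
    also have "\<dots> \<le> rect_norm E n p X * d"
      unfolding d_def using Xy by (intro E.mnorm_act_le a matsI) auto
    also have "\<dots> \<le> mnorm E (max n p) X * d"
      by (intro mult_right_mono E.rect_norm_le_mnorm liftsD(1)[OF X]) (simp add: d_def)
    finally show "mnorm Q n (\<lambda>i j. \<Oplus>\<^bsub>Q\<^esub>k\<in>{..<p}. act Q (y i k) (a k j)) \<le> d * mnorm E (max n p) X"
      by (simp add: mult.commute)
  qed (simp add: d_def)
  then show "mnorm Q n (\<lambda>i j. \<Oplus>\<^bsub>Q\<^esub>k\<in>{..<p}. act Q (y i k) (a k j)) \<le> rect_norm Q n p y * rect_norm (opspace_of A) p n a"
    by (simp add: rect_norm_def[of Q] Y_def[abs_def] d_def mult.commute)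
qed

lemma nondegenerate_module_Q: "nondegenerate_module A F Q"
proof -
  interpret QU: module_with_unit A F Q
    by (intro module_with_unit.intro E.operator_algebra_with_unit_axioms module_with_unit_axioms.intro
      operator_spaceI normed_matrices_Q seq_complete_Q right_module_Q contractive_action_Q)
  show ?thesis
  proof (unfold_locales)
    fix y assume "y \<in> carrier Q"
    then obtain x where x: "x \<in> carrier E" "y = r x" by (rule carrier_QE)
    show "QU.unit_limit y"
      unfolding QU.unit_limit_def
    proof (rule null_squeeze_eventually)
      show "((\<lambda>e. vnorm E (act E x e \<ominus>\<^bsub>E\<^esub> x)) \<longlongrightarrow> 0) F"
        using E.unit_limit[OF x(1)] by (simp add: E.unit_limit_def)
      show "\<forall>\<^sub>F e in F. 0 \<le> vnorm Q (act Q y e \<ominus>\<^bsub>Q\<^esub> y) \<and> vnorm Q (act Q y e \<ominus>\<^bsub>Q\<^esub> y) \<le> vnorm E (act E x e \<ominus>\<^bsub>E\<^esub> x)"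
        using E.F_contractive
      proof eventually_elim
        case (elim e)
        then have "act Q y e \<ominus>\<^bsub>Q\<^esub> y = r (act E x e \<ominus>\<^bsub>E\<^esub> x)"
          using x by (simp add: r.diff r_act)
        then show ?case
          using vnorm_r_le[of "act E x e \<ominus>\<^bsub>E\<^esub> x"] x elim by simp
      qed
    qed
  qed
qed

text \<open>The infimum need not be attained, but a lift with at most twice the norm exists also in the case
  of norm zero.\<close>

lemma lift_double:
  assumes y: "y \<in> mats Q n n"
  shows "\<exists>x. lifts n y x \<and> mnorm E n x \<le> 2 * mnorm Q n y"
proof (cases "mnorm Q n y = 0")
  case True
  then have "lifts n y (\<lambda>_ _. \<zero>\<^bsub>E\<^esub>)"
    using mnorm_Q_eq_0[OF y] by (simp add: lifts_def mats_def r_zero)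
  then show ?thesis using True E.sn_zero by auto
next
  case False
  then have "mnorm Q n y < 2 * mnorm Q n y"
    using mnorm_Q_nonneg[OF y] by simp
  then show ?thesis using lift_less[OF y] by (metis less_imp_le)
qed

end

section \<open>Embeddings and complete quotient maps\<close>

definition cb_map ::
  "('h::chilbert_space \<Rightarrow>\<^sub>L 'h) set \<Rightarrow> ('u, 'h \<Rightarrow>\<^sub>L 'h) opmod \<Rightarrow> ('u \<Rightarrow> 'u) \<Rightarrow> ('u, 'h \<Rightarrow>\<^sub>L 'h) opmod \<Rightarrow> bool" where
  "cb_map A E f G \<longleftrightarrow> nd_module A E \<and> nd_module A G \<and> module_map A E G f \<and> completely_bounded E G f"

text \<open>For completely bounded maps this means being an isomorphism onto the range.\<close>

definition cb_embedding :: "('u, 'y) opspace_scheme \<Rightarrow> ('u \<Rightarrow> 'u) \<Rightarrow> ('u, 'z) opspace_scheme \<Rightarrow> bool" where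
  "cb_embedding E f G \<longleftrightarrow> (\<exists>c>0. \<forall>n. \<forall>x\<in>mats E n n. mnorm E n x \<le> c * mnorm G n (\<lambda>i j. f (x i j)))"

text \<open>For completely bounded maps this means inducing an isomorphism from the quotient by the kernel.\<close>

definition cb_quotient :: "('u, 'y) opspace_scheme \<Rightarrow> ('u \<Rightarrow> 'u) \<Rightarrow> ('u, 'z) opspace_scheme \<Rightarrow> bool" where
  "cb_quotient E f G \<longleftrightarrow> (\<exists>c>0. \<forall>n. \<forall>y\<in>mats G n n. \<exists>x\<in>mats E n n.
     (\<forall>i<n. \<forall>j<n. f (x i j) = y i j) \<and> mnorm E n x \<le> c * mnorm G n y)"

definition map_kernel :: "('u, 'y) opspace_scheme \<Rightarrow> ('u \<Rightarrow> 'u) \<Rightarrow> ('u, 'z) opspace_scheme \<Rightarrow> 'u set" where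
  "map_kernel E f G = {x \<in> carrier E. f x = \<zero>\<^bsub>G\<^esub>}"

lemma bound_trans:
  fixes b c :: real
  assumes "x \<le> c * y" "y \<le> b * z" "0 < c"
  shows "x \<le> (c * b) * z"
proof -
  have "c * y \<le> c * (b * z)"
    using assms by (intro mult_left_mono) auto
  with assms(1) show ?thesis by (simp only: mult.assoc)
qed

context operator_algebra_with_unit begin

lemma nd_moduleD: "nd_module A E \<Longrightarrow> nondegenerate_module A F E"
  by (simp add: nd_module_iff)

lemma cb_mapD:
  assumes "cb_map A E f G"
  shows "nondegenerate_module A F E" "nondegenerate_module A F G" "linear_between E G f"
    "\<And>x a. x \<in> carrier E \<Longrightarrow> a \<in> A \<Longrightarrow> f (act E x a) = act G (f x) a"
proof -
  show 1: "nondegenerate_module A F E" "nondegenerate_module A F G"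
    using assms nd_moduleD by (auto simp: cb_map_def)
  interpret E: nondegenerate_module A F E by fact
  interpret G: nondegenerate_module A F G by fact
  show "linear_between E G f"
    using assms by (intro linear_between.intro linear_between_axioms.intro E.complex_module_axioms
        G.complex_module_axioms) (simp add: cb_map_def completely_bounded_def)
  show "\<And>x a. x \<in> carrier E \<Longrightarrow> a \<in> A \<Longrightarrow> f (act E x a) = act G (f x) a"
    using assms by (simp add: cb_map_def module_map_def)
qed

lemma cb_map_bound:
  assumes f: "cb_map A E f G"
  obtains c where "0 < c" "\<And>n x. x \<in> mats E n n \<Longrightarrow> mnorm G n (\<lambda>i j. f (x i j)) \<le> c * mnorm E n x"
proof -
  interpret E: nondegenerate_module A F E by (rule cb_mapD[OF f])
  obtain B where B: "\<And>n x. x \<in> mats E n n \<Longrightarrow> mnorm G n (\<lambda>i j. f (x i j)) \<le> B * mnorm E n x"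
    using f by (auto simp: cb_map_def completely_bounded_def)
  have "mnorm G n (\<lambda>i j. f (x i j)) \<le> max B 1 * mnorm E n x" if "x \<in> mats E n n" for n x
    using B[OF that] mult_right_mono[OF max.cobounded1 E.nm_nonneg[OF that], of B 1] by linarith
  then show ?thesis by (intro that[of "max B 1"]) auto
qed

lemma cb_mapI:
  assumes "nondegenerate_module A F E" "nondegenerate_module A F G"
    and "linear_map E G f"
    and "\<And>x a. x \<in> carrier E \<Longrightarrow> a \<in> A \<Longrightarrow> f (act E x a) = act G (f x) a"
    and "\<And>n x. x \<in> mats E n n \<Longrightarrow> mnorm G n (\<lambda>i j. f (x i j)) \<le> c * mnorm E n x"
  shows "cb_map A E f G"
  unfolding cb_map_def nd_module_iff module_map_def completely_bounded_def
  by (intro conjI allI ballI exI[of _ c] assms)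

lemma cb_map_cong:
  assumes f: "cb_map A E f G" and eq: "\<And>x. x \<in> carrier E \<Longrightarrow> f x = g x"
  shows "cb_map A E g G"
proof -
  interpret E: nondegenerate_module A F E by (rule cb_mapD[OF f])
  interpret G: nondegenerate_module A F G by (rule cb_mapD[OF f])
  interpret f: linear_between E G f by (rule cb_mapD[OF f])
  obtain c where "0 < c" and c: "\<And>n x. x \<in> mats E n n \<Longrightarrow> mnorm G n (\<lambda>i j. f (x i j)) \<le> c * mnorm E n x"
    by (rule cb_map_bound[OF f]) blast
  show ?thesis
  proof (rule cb_mapI[OF cb_mapD(1,2)[OF f]])
    show "linear_map E G g"
      using f.closed f.add f.smult eq by (simp add: linear_map_def Pi_iff)
    show "g (act E x a) = act G (g x) a" if "x \<in> carrier E" "a \<in> A" for x a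
      using that cb_mapD(4)[OF f that] eq by simp
    fix n x assume x: "x \<in> mats E n n"
    have "mnorm G n (\<lambda>i j. f (x i j)) = mnorm G n (\<lambda>i j. g (x i j))"
      using x eq by (intro G.nm_cong f.mats) (auto simp: mats_def)
    then show "mnorm G n (\<lambda>i j. g (x i j)) \<le> c * mnorm E n x"
      using c[OF x] by simp
  qed
qed

lemma cb_map_restrict: "cb_map A E (restrict f (carrier E)) G \<longleftrightarrow> cb_map A E f G"
  using cb_map_cong[of E f G "restrict f (carrier E)"] cb_map_cong[of E "restrict f (carrier E)" G f] by auto

lemma cb_map_id: "nd_module A E \<Longrightarrow> cb_map A E (\<lambda>x. x) E"
  by (rule cb_mapI[where c = 1]) (auto simp: nd_module_iff linear_map_def)

lemma cb_map_zero:
  assumes "nd_module A E" "nd_module A G"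
  shows "cb_map A E (\<lambda>_. \<zero>\<^bsub>G\<^esub>) G"
proof -
  interpret E: nondegenerate_module A F E using assms nd_moduleD by blast
  interpret G: nondegenerate_module A F G using assms nd_moduleD by blast
  show ?thesis
    by (rule cb_mapI[where c = 0])
      (auto simp: linear_map_def G.act_zero G.sn_zero E.nondegenerate_module_axioms G.nondegenerate_module_axioms)
qed

lemma cb_map_comp:
  assumes f: "cb_map A E f G" and g: "cb_map A G g H"
  shows "cb_map A E (\<lambda>x. g (f x)) H"
proof -
  interpret E: nondegenerate_module A F E by (rule cb_mapD[OF f])
  interpret f: linear_between E G f by (rule cb_mapD[OF f])
  interpret g: linear_between G H g by (rule cb_mapD[OF g])
  obtain b where b: "0 < b" "\<And>n x. x \<in> mats E n n \<Longrightarrow> mnorm G n (\<lambda>i j. f (x i j)) \<le> b * mnorm E n x"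
    by (rule cb_map_bound[OF f]) blast
  obtain c where c: "0 < c" "\<And>n x. x \<in> mats G n n \<Longrightarrow> mnorm H n (\<lambda>i j. g (x i j)) \<le> c * mnorm G n x"
    by (rule cb_map_bound[OF g]) blast
  show ?thesis
  proof (rule cb_mapI[OF cb_mapD(1)[OF f] cb_mapD(2)[OF g]])
    show "linear_map E H (\<lambda>x. g (f x))"
      by (simp add: linear_map_def f.add g.add f.smult g.smult)
    show "g (f (act E x a)) = act H (g (f x)) a" if "x \<in> carrier E" "a \<in> A" for x a
      using that cb_mapD(4)[OF f] cb_mapD(4)[OF g] by simp
    show "mnorm H n (\<lambda>i j. g (f (x i j))) \<le> (c * b) * mnorm E n x" if x: "x \<in> mats E n n" for n x
      by (rule bound_trans[OF c(2)[OF f.mats[OF x]] b(2)[OF x] c(1)])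
  qed
qed

lemma cb_map_add:
  assumes f: "cb_map A E f G" and g: "cb_map A E g G"
  shows "cb_map A E (\<lambda>x. f x \<oplus>\<^bsub>G\<^esub> g x) G"
proof -
  interpret E: nondegenerate_module A F E by (rule cb_mapD[OF f])
  interpret G: nondegenerate_module A F G by (rule cb_mapD[OF f])
  interpret f: linear_between E G f by (rule cb_mapD[OF f])
  interpret g: linear_between E G g by (rule cb_mapD[OF g])
  obtain b where b: "0 < b" "\<And>n x. x \<in> mats E n n \<Longrightarrow> mnorm G n (\<lambda>i j. f (x i j)) \<le> b * mnorm E n x"
    by (rule cb_map_bound[OF f]) blast
  obtain c where c: "0 < c" "\<And>n x. x \<in> mats E n n \<Longrightarrow> mnorm G n (\<lambda>i j. g (x i j)) \<le> c * mnorm E n x"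
    by (rule cb_map_bound[OF g]) blast
  show ?thesis
  proof (rule cb_mapI[OF cb_mapD(1,2)[OF f]])
    show "linear_map E G (\<lambda>x. f x \<oplus>\<^bsub>G\<^esub> g x)"
      by (simp add: linear_map_def f.add g.add f.smult g.smult G.M.a_ac G.smult_add_right)
    show "f (act E x a) \<oplus>\<^bsub>G\<^esub> g (act E x a) = act G (f x \<oplus>\<^bsub>G\<^esub> g x) a" if "x \<in> carrier E" "a \<in> A" for x a
      using that cb_mapD(4)[OF f] cb_mapD(4)[OF g] by (simp add: G.act_add)
    show "mnorm G n (\<lambda>i j. f (x i j) \<oplus>\<^bsub>G\<^esub> g (x i j)) \<le> (b + c) * mnorm E n x" if x: "x \<in> mats E n n" for n x
      using G.nm_triangle[OF f.mats[OF x] g.mats[OF x]] b(2)[OF x] c(2)[OF x] by (simp add: distrib_right)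
  qed
qed

lemma cb_map_smult:
  assumes f: "cb_map A E f G"
  shows "cb_map A E (\<lambda>x. k \<odot>\<^bsub>G\<^esub> f x) G"
proof -
  interpret G: nondegenerate_module A F G by (rule cb_mapD[OF f])
  interpret f: linear_between E G f by (rule cb_mapD[OF f])
  obtain b where b: "0 < b" "\<And>n x. x \<in> mats E n n \<Longrightarrow> mnorm G n (\<lambda>i j. f (x i j)) \<le> b * mnorm E n x"
    by (rule cb_map_bound[OF f]) blast
  show ?thesis
  proof (rule cb_mapI[OF cb_mapD(1,2)[OF f]])
    show "linear_map E G (\<lambda>x. k \<odot>\<^bsub>G\<^esub> f x)"
      by (simp add: linear_map_def f.add f.smult G.smult_add_right G.smult_smult mult.commute)
    show "k \<odot>\<^bsub>G\<^esub> f (act E x a) = act G (k \<odot>\<^bsub>G\<^esub> f x) a" if "x \<in> carrier E" "a \<in> A" for x a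
      using that cb_mapD(4)[OF f] by (simp add: G.act_smult)
    show "mnorm G n (\<lambda>i j. k \<odot>\<^bsub>G\<^esub> f (x i j)) \<le> (cmod k * b) * mnorm E n x" if x: "x \<in> mats E n n" for n x
      using mult_left_mono[OF b(2)[OF x], of "cmod k"] by (simp add: G.nm_scale[OF f.mats[OF x]] mult.assoc)
  qed
qed

subsection \<open>Consequences of the bounds\<close>

lemma cb_embedding_inj:
  assumes f: "cb_map A E f G" and e: "cb_embedding E f G"
    and xy: "x \<in> carrier E" "y \<in> carrier E" "f x = f y"
  shows "x = y"
proof -
  interpret E: nondegenerate_module A F E by (rule cb_mapD[OF f])
  interpret G: nondegenerate_module A F G by (rule cb_mapD[OF f])
  interpret f: linear_between E G f by (rule cb_mapD[OF f])
  obtain c where c: "\<And>n x. x \<in> mats E n n \<Longrightarrow> mnorm E n x \<le> c * mnorm G n (\<lambda>i j. f (x i j))"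
    using e by (auto simp: cb_embedding_def)
  have "vnorm E (x \<ominus>\<^bsub>E\<^esub> y) \<le> c * vnorm G (f (x \<ominus>\<^bsub>E\<^esub> y))"
    unfolding vnorm_def using xy by (intro c) auto
  also have "\<dots> = 0"
    using xy by (simp add: f.diff)
  finally have "vnorm E (x \<ominus>\<^bsub>E\<^esub> y) = 0"
    using xy by (intro antisym E.vnorm_nonneg) auto
  then show ?thesis
    using xy by (simp add: E.vnorm_eq_0 E.diff_eq_zero_iff)
qed

lemma cb_quotient_surj:
  assumes f: "cb_map A E f G" and q: "cb_quotient E f G" and y: "y \<in> carrier G"
  shows "\<exists>x\<in>carrier E. f x = y"
proof -
  have ym: "(\<lambda>_ _. y) \<in> mats G 1 1" using y by auto
  obtain c where c: "\<forall>n. \<forall>y\<in>mats G n n. \<exists>x\<in>mats E n n.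
      (\<forall>i<n. \<forall>j<n. f (x i j) = y i j) \<and> mnorm E n x \<le> c * mnorm G n y"
    using q by (auto simp: cb_quotient_def)
  obtain x where "x \<in> mats E 1 1" "\<forall>i<1. \<forall>j<1. f (x i j) = y"
    using bspec[OF spec[OF c] ym] by auto
  then show ?thesis by (intro bexI[of _ "x 0 0"]) (auto simp: mats_def)
qed

lemma vnorm_bound:
  assumes "\<And>n x. x \<in> mats E n n \<Longrightarrow> mnorm G n (\<lambda>i j. f (x i j)) \<le> c * mnorm E n x" "x \<in> carrier E"
  shows "vnorm G (f x) \<le> c * vnorm E x"
  unfolding vnorm_def using assms(1)[of "\<lambda>_ _. x" 1] assms(2) by (simp add: mats_def)

lemma cb_map_limit:
  assumes f: "cb_map A E f G" and s: "\<And>k. s k \<in> carrier E" "x \<in> carrier E"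
    and lim: "(\<lambda>k. vnorm E (s k \<ominus>\<^bsub>E\<^esub> x)) \<longlonglongrightarrow> 0"
  shows "(\<lambda>k. vnorm G (f (s k) \<ominus>\<^bsub>G\<^esub> f x)) \<longlonglongrightarrow> 0"
proof -
  interpret E: nondegenerate_module A F E by (rule cb_mapD[OF f])
  interpret G: nondegenerate_module A F G by (rule cb_mapD[OF f])
  interpret f: linear_between E G f by (rule cb_mapD[OF f])
  obtain c where c: "0 < c" "\<And>n x. x \<in> mats E n n \<Longrightarrow> mnorm G n (\<lambda>i j. f (x i j)) \<le> c * mnorm E n x"
    by (rule cb_map_bound[OF f]) blast
  show ?thesis
  proof (rule null_squeeze[OF tendsto_mult_right_zero[OF lim, of c]])
    show "vnorm G (f (s k) \<ominus>\<^bsub>G\<^esub> f x) \<le> c * vnorm E (s k \<ominus>\<^bsub>E\<^esub> x)" for k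
      using vnorm_bound[OF c(2), of "s k \<ominus>\<^bsub>E\<^esub> x"] s by (simp add: f.diff)
  qed (use s in simp)
qed

lemma cb_embedding_comp:
  assumes f: "cb_map A E f G" "cb_embedding E f G" and g: "cb_embedding G g H"
  shows "cb_embedding E (\<lambda>x. g (f x)) H"
proof -
  interpret f: linear_between E G f by (rule cb_mapD[OF f(1)])
  obtain b where b: "0 < b" "\<And>n x. x \<in> mats E n n \<Longrightarrow> mnorm E n x \<le> b * mnorm G n (\<lambda>i j. f (x i j))"
    using f by (auto simp: cb_embedding_def)
  obtain c where c: "0 < c" "\<And>n x. x \<in> mats G n n \<Longrightarrow> mnorm G n x \<le> c * mnorm H n (\<lambda>i j. g (x i j))"
    using g by (auto simp: cb_embedding_def)
  have "mnorm E n x \<le> (b * c) * mnorm H n (\<lambda>i j. g (f (x i j)))" if x: "x \<in> mats E n n" for n x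
    by (rule bound_trans[OF b(2)[OF x] c(2)[OF f.mats[OF x]] b(1)])
  then show ?thesis
    unfolding cb_embedding_def using b(1) c(1) by (intro exI[of _ "b * c"]) auto
qed

lemma cb_quotient_comp:
  assumes f: "cb_quotient E f G" and g: "cb_quotient G g H"
  shows "cb_quotient E (\<lambda>x. g (f x)) H"
proof -
  obtain b where b: "0 < b" "\<And>n y. y \<in> mats G n n \<Longrightarrow> \<exists>x\<in>mats E n n.
      (\<forall>i<n. \<forall>j<n. f (x i j) = y i j) \<and> mnorm E n x \<le> b * mnorm G n y"
    using f unfolding cb_quotient_def by blast
  obtain c where c: "0 < c" "\<And>n z. z \<in> mats H n n \<Longrightarrow> \<exists>y\<in>mats G n n.
      (\<forall>i<n. \<forall>j<n. g (y i j) = z i j) \<and> mnorm G n y \<le> c * mnorm H n z"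
    using g unfolding cb_quotient_def by blast
  have "\<exists>x\<in>mats E n n. (\<forall>i<n. \<forall>j<n. g (f (x i j)) = z i j) \<and> mnorm E n x \<le> (b * c) * mnorm H n z"
    if z: "z \<in> mats H n n" for n z
  proof -
    obtain y where y: "y \<in> mats G n n" "\<forall>i<n. \<forall>j<n. g (y i j) = z i j" "mnorm G n y \<le> c * mnorm H n z"
      using c(2)[OF z] by blast
    obtain x where x: "x \<in> mats E n n" "\<forall>i<n. \<forall>j<n. f (x i j) = y i j" "mnorm E n x \<le> b * mnorm G n y"
      using b(2)[OF y(1)] by blast
    have "mnorm E n x \<le> (b * c) * mnorm H n z"
      by (rule bound_trans[OF x(3) y(3) b(1)])
    then show ?thesis using x y by (intro bexI[of _ x]) auto
  qed
  then show ?thesis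
    unfolding cb_quotient_def using b(1) c(1) by (intro exI[of _ "b * c"]) auto
qed

lemma cb_embedding_left_inverse:
  assumes f: "cb_map A E f G" and g: "cb_map A G g E" and gf: "\<And>x. x \<in> carrier E \<Longrightarrow> g (f x) = x"
  shows "cb_embedding E f G"
proof -
  interpret E: nondegenerate_module A F E by (rule cb_mapD[OF f])
  interpret f: linear_between E G f by (rule cb_mapD[OF f])
  obtain c where c: "0 < c" "\<And>n x. x \<in> mats G n n \<Longrightarrow> mnorm E n (\<lambda>i j. g (x i j)) \<le> c * mnorm G n x"
    by (rule cb_map_bound[OF g]) blast
  have "mnorm E n x \<le> c * mnorm G n (\<lambda>i j. f (x i j))" if x: "x \<in> mats E n n" for n x
  proof -
    have "mnorm E n x = mnorm E n (\<lambda>i j. g (f (x i j)))"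
      using x gf by (intro E.nm_cong) (auto simp: mats_def)
    then show ?thesis using c(2)[OF f.mats[OF x]] by simp
  qed
  then show ?thesis unfolding cb_embedding_def using c(1) by blast
qed

lemma cb_quotient_right_inverse:
  assumes g: "cb_map A G g E" and fg: "\<And>y. y \<in> carrier G \<Longrightarrow> f (g y) = y"
  shows "cb_quotient E f G"
proof -
  interpret g: linear_between G E g by (rule cb_mapD[OF g])
  obtain c where c: "0 < c" "\<And>n x. x \<in> mats G n n \<Longrightarrow> mnorm E n (\<lambda>i j. g (x i j)) \<le> c * mnorm G n x"
    by (rule cb_map_bound[OF g]) blast
  have "\<exists>x\<in>mats E n n. (\<forall>i<n. \<forall>j<n. f (x i j) = y i j) \<and> mnorm E n x \<le> c * mnorm G n y"
    if y: "y \<in> mats G n n" for n y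
    using c(2)[OF y] y fg by (intro bexI[of _ "\<lambda>i j. g (y i j)"]) (auto simp: mats_def)
  then show ?thesis unfolding cb_quotient_def using c(1) by blast
qed

subsection \<open>Factorisation through embeddings and quotient maps\<close>

text \<open>Injectivity determines the factor pointwise, and so makes it linear and compatible with the action; the
  lower bound makes it completely bounded.\<close>

lemma factor_through_embedding:
  assumes m: "cb_map A K m E" "cb_embedding K m E" and g: "cb_map A D g E"
    and im: "\<And>d. d \<in> carrier D \<Longrightarrow> g d \<in> m ` carrier K"
  obtains h where "cb_map A D h K" "\<And>d. d \<in> carrier D \<Longrightarrow> m (h d) = g d"
proof -
  interpret K: nondegenerate_module A F K by (rule cb_mapD[OF m(1)])
  interpret E: nondegenerate_module A F E by (rule cb_mapD[OF m(1)])
  interpret D: nondegenerate_module A F D by (rule cb_mapD[OF g])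
  interpret m: linear_between K E m by (rule cb_mapD[OF m(1)])
  interpret g: linear_between D E g by (rule cb_mapD[OF g])
  obtain h where h: "\<And>d. d \<in> carrier D \<Longrightarrow> h d \<in> carrier K" "\<And>d. d \<in> carrier D \<Longrightarrow> m (h d) = g d"
    using im unfolding image_iff by metis
  note inj = cb_embedding_inj[OF m]
  obtain b where b: "0 < b" "\<And>n x. x \<in> mats K n n \<Longrightarrow> mnorm K n x \<le> b * mnorm E n (\<lambda>i j. m (x i j))"
    using m by (auto simp: cb_embedding_def)
  obtain c where c: "0 < c" "\<And>n x. x \<in> mats D n n \<Longrightarrow> mnorm E n (\<lambda>i j. g (x i j)) \<le> c * mnorm D n x"
    by (rule cb_map_bound[OF g]) blast
  have "cb_map A D h K"
  proof (rule cb_mapI[OF cb_mapD(1)[OF g] cb_mapD(1)[OF m(1)]])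
    show "linear_map D K h"
      unfolding linear_map_def
    proof (intro conjI ballI allI Pi_I)
      fix x k assume x: "x \<in> carrier D"
      show "h x \<in> carrier K" using h x by simp
      show "h (k \<odot>\<^bsub>D\<^esub> x) = k \<odot>\<^bsub>K\<^esub> h x"
        by (rule inj) (use h x in \<open>simp_all add: m.smult g.smult\<close>)
      fix y assume y: "y \<in> carrier D"
      show "h (x \<oplus>\<^bsub>D\<^esub> y) = h x \<oplus>\<^bsub>K\<^esub> h y"
        by (rule inj) (use h x y in \<open>simp_all add: m.add g.add\<close>)
    qed
    show "h (act D x a) = act K (h x) a" if "x \<in> carrier D" "a \<in> A" for x a
      by (rule inj) (use h that cb_mapD(4)[OF m(1)] cb_mapD(4)[OF g] in simp_all)
    fix n x assume x: "x \<in> mats D n n"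
    then have hx: "(\<lambda>i j. h (x i j)) \<in> mats K n n" using h by (auto simp: mats_def)
    have "mnorm E n (\<lambda>i j. m (h (x i j))) = mnorm E n (\<lambda>i j. g (x i j))"
      using x h m.mats[OF hx] by (intro E.nm_cong) (auto simp: mats_def)
    then show "mnorm K n (\<lambda>i j. h (x i j)) \<le> (b * c) * mnorm D n x"
      by (intro bound_trans[OF b(2)[OF hx] _ b(1)]) (simp add: c(2)[OF x])
  qed
  then show ?thesis using h(2) that by blast
qed

text \<open>The factor is bounded because a matrix over the quotient has a lift of comparable norm on which it can
  be computed.\<close>

lemma factor_through_quotient:
  assumes q: "cb_map A E q Q" "cb_quotient E q Q" and g: "cb_map A E g D"
    and ker: "\<And>x. x \<in> carrier E \<Longrightarrow> q x = \<zero>\<^bsub>Q\<^esub> \<Longrightarrow> g x = \<zero>\<^bsub>D\<^esub>"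
  obtains h where "cb_map A Q h D" "\<And>x. x \<in> carrier E \<Longrightarrow> h (q x) = g x"
proof -
  interpret E: nondegenerate_module A F E by (rule cb_mapD[OF q(1)])
  interpret Q: nondegenerate_module A F Q by (rule cb_mapD[OF q(1)])
  interpret D: nondegenerate_module A F D by (rule cb_mapD[OF g])
  interpret q: linear_between E Q q by (rule cb_mapD[OF q(1)])
  interpret g: linear_between E D g by (rule cb_mapD[OF g])
  have eq: "g x = g y" if "x \<in> carrier E" "y \<in> carrier E" "q x = q y" for x y
    using ker[of "x \<ominus>\<^bsub>E\<^esub> y"] that by (simp add: q.diff g.diff D.diff_eq_zero_iff)
  define s where "s y = (SOME x. x \<in> carrier E \<and> q x = y)" for y
  have s': "s y \<in> carrier E" "q (s y) = y" if "y \<in> carrier Q" for y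
    using someI_ex[of "\<lambda>x. x \<in> carrier E \<and> q x = y"] cb_quotient_surj[OF q that] by (auto simp: s_def)
  have s: "\<exists>x. x \<in> carrier E \<and> y = q x" if "y \<in> carrier Q" for y
    using s'[OF that] by auto
  define h where "h y = g (s y)" for y
  have hq: "h (q x) = g x" if "x \<in> carrier E" for x
    unfolding h_def using that s'[OF q.closed[OF that]] by (intro eq) auto
  obtain b where b: "0 < b" "\<And>n y. y \<in> mats Q n n \<Longrightarrow> \<exists>x\<in>mats E n n.
      (\<forall>i<n. \<forall>j<n. q (x i j) = y i j) \<and> mnorm E n x \<le> b * mnorm Q n y"
    using q(2) unfolding cb_quotient_def by blast
  obtain c where c: "0 < c" "\<And>n x. x \<in> mats E n n \<Longrightarrow> mnorm D n (\<lambda>i j. g (x i j)) \<le> c * mnorm E n x"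
    by (rule cb_map_bound[OF g]) blast
  have "cb_map A Q h D"
  proof (rule cb_mapI[OF cb_mapD(2)[OF q(1)] cb_mapD(2)[OF g]])
    show "linear_map Q D h"
      unfolding linear_map_def
    proof (intro conjI ballI allI Pi_I)
      fix x' k assume "x' \<in> carrier Q"
      then obtain x where x: "x \<in> carrier E" "x' = q x" using s by blast
      show "h x' \<in> carrier D" using x hq by simp
      show "h (k \<odot>\<^bsub>Q\<^esub> x') = k \<odot>\<^bsub>D\<^esub> h x'"
        using x hq[of "k \<odot>\<^bsub>E\<^esub> x"] hq[of x] by (simp add: q.smult g.smult)
      fix y' assume "y' \<in> carrier Q"
      then obtain y where y: "y \<in> carrier E" "y' = q y" using s by blast
      show "h (x' \<oplus>\<^bsub>Q\<^esub> y') = h x' \<oplus>\<^bsub>D\<^esub> h y'"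
        using x y hq[of "x \<oplus>\<^bsub>E\<^esub> y"] hq[of x] hq[of y] by (simp add: q.add g.add)
    qed
    show "h (act Q x' a) = act D (h x') a" if x': "x' \<in> carrier Q" and a: "a \<in> A" for x' a
    proof -
      obtain x where x: "x \<in> carrier E" "x' = q x" using s[OF x'] by blast
      show ?thesis
        using x a hq[of "act E x a"] hq[of x] cb_mapD(4)[OF q(1), of x a] cb_mapD(4)[OF g, of x a] by simp
    qed
    fix n y assume y: "y \<in> mats Q n n"
    obtain x where x: "x \<in> mats E n n" "\<forall>i<n. \<forall>j<n. q (x i j) = y i j" "mnorm E n x \<le> b * mnorm Q n y"
      using b(2)[OF y] by blast
    have "mnorm D n (\<lambda>i j. g (x i j)) = mnorm D n (\<lambda>i j. h (y i j))"
    proof (rule D.nm_cong[OF g.mats[OF x(1)]])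
      show "g (x i j) = h (y i j)" if "i < n" "j < n" for i j
        using x(2) hq[OF matsD[OF x(1) that]] that by simp
    qed
    then show "mnorm D n (\<lambda>i j. h (y i j)) \<le> (c * b) * mnorm Q n y"
      using bound_trans[OF c(2)[OF x(1)] x(3) c(1)] by simp
  qed
  then show ?thesis using hq that by blast
qed

end

section \<open>Kernels, cokernels, direct sums, pushouts and pullbacks of modules\<close>

context operator_algebra_with_unit begin

definition subproduct_of ::
  "('u, 'h \<Rightarrow>\<^sub>L 'h) opmod \<Rightarrow> ('u, 'h \<Rightarrow>\<^sub>L 'h) opmod \<Rightarrow> ('u \<times> 'u) set \<Rightarrow> ('u, 'h \<Rightarrow>\<^sub>L 'h) opmod \<Rightarrow>
    ('u \<Rightarrow> 'u) \<Rightarrow> ('u \<Rightarrow> 'u) \<Rightarrow> bool" where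
  "subproduct_of E G S W p q \<longleftrightarrow> cb_map A W p E \<and> cb_map A W q G \<and>
     bij_betw (\<lambda>w. (p w, q w)) (carrier W) S \<and>
     (\<forall>n. \<forall>x\<in>mats W n n. mnorm W n x = max (mnorm E n (\<lambda>i j. p (x i j))) (mnorm G n (\<lambda>i j. q (x i j))))"

lemma subproduct_exists:
  fixes E G :: "('u, 'h \<Rightarrow>\<^sub>L 'h) opmod"
  assumes E: "nd_module A E" and G: "nd_module A G"
    and S: "S \<subseteq> carrier E \<times> carrier G" "(\<zero>\<^bsub>E\<^esub>, \<zero>\<^bsub>G\<^esub>) \<in> S"
      "\<And>x y x' y'. (x, y) \<in> S \<Longrightarrow> (x', y') \<in> S \<Longrightarrow> (x \<oplus>\<^bsub>E\<^esub> x', y \<oplus>\<^bsub>G\<^esub> y') \<in> S"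
      "\<And>x y c. (x, y) \<in> S \<Longrightarrow> (c \<odot>\<^bsub>E\<^esub> x, c \<odot>\<^bsub>G\<^esub> y) \<in> S"
      "\<And>x y a. (x, y) \<in> S \<Longrightarrow> a \<in> A \<Longrightarrow> (act E x a, act G y a) \<in> S"
      "\<And>s t x y. \<lbrakk>\<And>k. (s k, t k) \<in> S; x \<in> carrier E; y \<in> carrier G;
        (\<lambda>k. vnorm E (s k \<ominus>\<^bsub>E\<^esub> x)) \<longlonglongrightarrow> 0; (\<lambda>k. vnorm G (t k \<ominus>\<^bsub>G\<^esub> y)) \<longlonglongrightarrow> 0\<rbrakk> \<Longrightarrow> (x, y) \<in> S"
  shows "\<exists>W p q. subproduct_of E G S W p q"
proof -
  interpret E: nondegenerate_module A F E using E by (rule nd_moduleD)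
  interpret G: nondegenerate_module A F G using G by (rule nd_moduleD)
  obtain \<iota> :: "'u \<times> 'u \<Rightarrow> 'u" where \<iota>: "inj_on \<iota> (carrier E \<times> carrier G)"
    by (rule pairing_injection[OF E.complex_module_axioms G.complex_module_axioms])
  interpret S: subproduct A F E G S \<iota>
  proof (intro subproduct.intro E.nondegenerate_module_axioms G.nondegenerate_module_axioms)
    show "subproduct_axioms A E G S \<iota>"
      by (rule subproduct_axioms.intro) (fact \<iota> S)+
  qed
  have p: "cb_map A S.W S.p E"
    by (rule cb_mapI[where c = 1, OF S.nondegenerate_module_W E.nondegenerate_module_axioms S.linear_p])
      (auto simp: S.mnorm_W)
  have q: "cb_map A S.W S.q G"
    by (rule cb_mapI[where c = 1, OF S.nondegenerate_module_W G.nondegenerate_module_axioms S.linear_q])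
      (auto simp: S.mnorm_W)
  show ?thesis
    unfolding subproduct_of_def using p q S.bij_pq S.mnorm_W by blast
qed

lemma subproduct_eqI:
  assumes "subproduct_of E G S W p q" "v \<in> carrier W" "w \<in> carrier W" "p v = p w" "q v = q w"
  shows "v = w"
proof -
  have "inj_on (\<lambda>w. (p w, q w)) (carrier W)"
    using assms(1) by (simp add: subproduct_of_def bij_betw_def)
  then show ?thesis using assms(2-) by (auto dest: inj_onD)
qed

lemma subproduct_pair:
  fixes D :: "('u, 'h \<Rightarrow>\<^sub>L 'h) opmod"
  assumes W: "subproduct_of E G S W p q" and g: "cb_map A D g E" and k: "cb_map A D k G"
    and S: "\<And>d. d \<in> carrier D \<Longrightarrow> (g d, k d) \<in> S"
  shows "\<exists>h. cb_map A D h W \<and> (\<forall>d\<in>carrier D. p (h d) = g d \<and> q (h d) = k d)"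
proof -
  have p: "cb_map A W p E" and q: "cb_map A W q G" and bij: "bij_betw (\<lambda>w. (p w, q w)) (carrier W) S"
    and norm: "\<And>n x. x \<in> mats W n n \<Longrightarrow> mnorm W n x = max (mnorm E n (\<lambda>i j. p (x i j))) (mnorm G n (\<lambda>i j. q (x i j)))"
    using W by (auto simp: subproduct_of_def)
  interpret W: nondegenerate_module A F W by (rule cb_mapD[OF p])
  interpret D: nondegenerate_module A F D by (rule cb_mapD[OF g])
  interpret E: nondegenerate_module A F E by (rule cb_mapD[OF p])
  interpret G: nondegenerate_module A F G by (rule cb_mapD[OF q])
  interpret p: linear_between W E p by (rule cb_mapD[OF p])
  interpret q: linear_between W G q by (rule cb_mapD[OF q])
  interpret g: linear_between D E g by (rule cb_mapD[OF g])
  interpret k: linear_between D G k by (rule cb_mapD[OF k])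
  obtain b where b: "0 < b" "\<And>n x. x \<in> mats D n n \<Longrightarrow> mnorm E n (\<lambda>i j. g (x i j)) \<le> b * mnorm D n x"
    by (rule cb_map_bound[OF g]) blast
  obtain c where c: "0 < c" "\<And>n x. x \<in> mats D n n \<Longrightarrow> mnorm G n (\<lambda>i j. k (x i j)) \<le> c * mnorm D n x"
    by (rule cb_map_bound[OF k]) blast
  define h where "h d = inv_into (carrier W) (\<lambda>w. (p w, q w)) (g d, k d)" for d
  have im: "(\<lambda>w. (p w, q w)) ` carrier W = S"
    using bij by (simp add: bij_betw_def)
  have h: "h d \<in> carrier W" "p (h d) = g d" "q (h d) = k d" if "d \<in> carrier D" for d
  proof -
    have *: "(g d, k d) \<in> (\<lambda>w. (p w, q w)) ` carrier W" using S[OF that] im by simp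
    show "h d \<in> carrier W" unfolding h_def by (rule inv_into_into[OF *])
    show "p (h d) = g d" "q (h d) = k d" using f_inv_into_f[OF *] by (simp_all add: h_def)
  qed
  note eqI = subproduct_eqI[OF W]
  have "cb_map A D h W"
  proof (rule cb_mapI[OF cb_mapD(1)[OF g] cb_mapD(1)[OF p]])
    show "linear_map D W h"
      unfolding linear_map_def
    proof (intro conjI ballI allI Pi_I)
      fix x a assume x: "x \<in> carrier D"
      show "h x \<in> carrier W" using h x by simp
      show "h (a \<odot>\<^bsub>D\<^esub> x) = a \<odot>\<^bsub>W\<^esub> h x"
        by (rule eqI) (use h x in \<open>simp_all add: p.smult q.smult g.smult k.smult\<close>)
      fix y assume y: "y \<in> carrier D"
      show "h (x \<oplus>\<^bsub>D\<^esub> y) = h x \<oplus>\<^bsub>W\<^esub> h y"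
        by (rule eqI) (use h x y in \<open>simp_all add: p.add q.add g.add k.add\<close>)
    qed
    show "h (act D x a) = act W (h x) a" if "x \<in> carrier D" "a \<in> A" for x a
      by (rule eqI) (use h that cb_mapD(4)[OF p] cb_mapD(4)[OF q] cb_mapD(4)[OF g] cb_mapD(4)[OF k] in simp_all)
    fix n x assume x: "x \<in> mats D n n"
    then have hx: "(\<lambda>i j. h (x i j)) \<in> mats W n n" using h by (auto simp: mats_def)
    have "mnorm E n (\<lambda>i j. p (h (x i j))) = mnorm E n (\<lambda>i j. g (x i j))"
      by (rule E.nm_cong[OF p.mats[OF hx]]) (use h x in \<open>simp add: mats_def\<close>)
    moreover have "mnorm G n (\<lambda>i j. q (h (x i j))) = mnorm G n (\<lambda>i j. k (x i j))"
      by (rule G.nm_cong[OF q.mats[OF hx]]) (use h x in \<open>simp add: mats_def\<close>)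
    moreover have "0 \<le> b * mnorm D n x" "0 \<le> c * mnorm D n x"
      using b(1) c(1) D.nm_nonneg[OF x] by simp_all
    ultimately show "mnorm W n (\<lambda>i j. h (x i j)) \<le> (b + c) * mnorm D n x"
      using norm[OF hx] b(2)[OF x] c(2)[OF x] by (simp add: distrib_right)
  qed
  then show ?thesis using h by blast
qed

text \<open>The kernel is placed on the diagonal of \<open>E \<oplus> E\<close>, where the two coordinates have equal norms.\<close>

lemma kernel_exists:
  assumes \<pi>: "cb_map A E \<pi> C"
  shows "\<exists>K \<mu>. cb_map A K \<mu> E \<and> cb_embedding K \<mu> E \<and> \<mu> ` carrier K = map_kernel E \<pi> C"
proof -
  interpret E: nondegenerate_module A F E by (rule cb_mapD[OF \<pi>])
  interpret C: nondegenerate_module A F C by (rule cb_mapD[OF \<pi>])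
  interpret \<pi>: linear_between E C \<pi> by (rule cb_mapD[OF \<pi>])
  have nd: "nd_module A E" using \<pi> by (simp add: cb_map_def)
  define S where "S = (\<lambda>x. (x, x)) ` map_kernel E \<pi> C"
  have S_iff: "(x, y) \<in> S \<longleftrightarrow> x \<in> carrier E \<and> \<pi> x = \<zero>\<^bsub>C\<^esub> \<and> y = x" for x y
    by (auto simp: S_def map_kernel_def)
  have "\<exists>W p q. subproduct_of E E S W p q"
  proof (rule subproduct_exists[OF nd nd])
    show "S \<subseteq> carrier E \<times> carrier E" by (auto simp: S_def map_kernel_def)
    show "(\<zero>\<^bsub>E\<^esub>, \<zero>\<^bsub>E\<^esub>) \<in> S" by (simp add: S_iff)
    show "(x \<oplus>\<^bsub>E\<^esub> x', y \<oplus>\<^bsub>E\<^esub> y') \<in> S" if "(x, y) \<in> S" "(x', y') \<in> S" for x y x' y'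
      using that by (simp add: S_iff \<pi>.add)
    show "(c \<odot>\<^bsub>E\<^esub> x, c \<odot>\<^bsub>E\<^esub> y) \<in> S" if "(x, y) \<in> S" for x y c
      using that by (simp add: S_iff \<pi>.smult)
    show "(act E x a, act E y a) \<in> S" if "(x, y) \<in> S" "a \<in> A" for x y a
      using that cb_mapD(4)[OF \<pi>] by (simp add: S_iff C.act_zero)
    show "(x, y) \<in> S" if s: "\<And>k. (s k, t k) \<in> S" and xy: "x \<in> carrier E" "y \<in> carrier E"
      and lim: "(\<lambda>k. vnorm E (s k \<ominus>\<^bsub>E\<^esub> x)) \<longlonglongrightarrow> 0" "(\<lambda>k. vnorm E (t k \<ominus>\<^bsub>E\<^esub> y)) \<longlonglongrightarrow> 0" for s t x y
    proof -
      have s': "s k \<in> carrier E" "\<pi> (s k) = \<zero>\<^bsub>C\<^esub>" "t k = s k" for k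
        using s[of k] by (simp_all add: S_iff)
      have "x = y"
        by (rule E.limits_unique[of s]) (use s' xy lim in simp_all)
      moreover have "(\<lambda>k. vnorm C (\<pi> (s k) \<ominus>\<^bsub>C\<^esub> \<pi> x)) \<longlonglongrightarrow> 0"
        by (rule cb_map_limit[OF \<pi> s'(1) xy(1) lim(1)])
      then have "\<pi> x = \<zero>\<^bsub>C\<^esub>"
        by (intro C.limits_unique[of "\<lambda>_. \<zero>\<^bsub>C\<^esub>"]) (use s' xy in simp_all)
      ultimately show ?thesis using xy by (simp add: S_iff)
    qed
  qed
  then obtain K \<mu> q where K: "subproduct_of E E S K \<mu> q" by blast
  then have \<mu>: "cb_map A K \<mu> E" and bij: "bij_betw (\<lambda>w. (\<mu> w, q w)) (carrier K) S"
    and norm: "\<And>n x. x \<in> mats K n n \<Longrightarrow> mnorm K n x = max (mnorm E n (\<lambda>i j. \<mu> (x i j))) (mnorm E n (\<lambda>i j. q (x i j)))"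
    by (auto simp: subproduct_of_def)
  interpret \<mu>: linear_between K E \<mu> by (rule cb_mapD[OF \<mu>])
  have q\<mu>: "q w = \<mu> w" if "w \<in> carrier K" for w
    using bij_betwE[OF bij] that by (auto simp: S_iff)
  have "mnorm K n x \<le> 1 * mnorm E n (\<lambda>i j. \<mu> (x i j))" if x: "x \<in> mats K n n" for n x
  proof -
    have "mnorm E n (\<lambda>i j. \<mu> (x i j)) = mnorm E n (\<lambda>i j. q (x i j))"
      by (rule E.nm_cong[OF \<mu>.mats[OF x]]) (use q\<mu> x in \<open>simp add: mats_def\<close>)
    then show ?thesis using norm[OF x] by simp
  qed
  then have "cb_embedding K \<mu> E"
    unfolding cb_embedding_def by (intro exI[of _ 1]) auto
  moreover have "\<mu> ` carrier K = map_kernel E \<pi> C"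
  proof -
    have "fst ` (\<lambda>w. (\<mu> w, q w)) ` carrier K = fst ` S"
      using bij by (simp add: bij_betw_def)
    then show ?thesis by (simp add: image_image S_def)
  qed
  ultimately show ?thesis using \<mu> by blast
qed

text \<open>The range of an embedding is complete, hence closed.\<close>

lemma embedding_range_closed:
  assumes \<mu>: "cb_map A K \<mu> E" "cb_embedding K \<mu> E"
    and s: "\<And>k. s k \<in> \<mu> ` carrier K" and x: "x \<in> carrier E" and lim: "(\<lambda>k. vnorm E (s k \<ominus>\<^bsub>E\<^esub> x)) \<longlonglongrightarrow> 0"
  shows "x \<in> \<mu> ` carrier K"
proof -
  interpret K: nondegenerate_module A F K by (rule cb_mapD[OF \<mu>(1)])
  interpret E: nondegenerate_module A F E by (rule cb_mapD[OF \<mu>(1)])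
  interpret \<mu>: linear_between K E \<mu> by (rule cb_mapD[OF \<mu>(1)])
  obtain c where c: "0 < c" "\<And>n x. x \<in> mats K n n \<Longrightarrow> mnorm K n x \<le> c * mnorm E n (\<lambda>i j. \<mu> (x i j))"
    using \<mu>(2) by (auto simp: cb_embedding_def)
  obtain t where t: "\<And>k. t k \<in> carrier K" "\<And>k. s k = \<mu> (t k)"
    using s unfolding image_iff by metis
  have sE: "s k \<in> carrier E" for k using t by simp
  have "s \<in> cauchy_seqs E"
    unfolding cauchy_seqs_def mem_Collect_eq
  proof (intro conjI allI impI sE)
    fix e :: real assume "0 < e"
    then obtain N where N: "\<And>k. k \<ge> N \<Longrightarrow> vnorm E (s k \<ominus>\<^bsub>E\<^esub> x) < e / 2"
      using LIMSEQ_D[OF lim, of "e / 2"] sE x by auto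
    show "\<exists>N. \<forall>k\<ge>N. \<forall>l\<ge>N. vnorm E (s k \<ominus>\<^bsub>E\<^esub> s l) < e"
    proof (intro exI allI impI)
      fix k l assume "N \<le> k" "N \<le> l"
      then show "vnorm E (s k \<ominus>\<^bsub>E\<^esub> s l) < e"
        using E.vnorm_diff_triangle[OF sE[of k] x sE[of l]] E.vnorm_diff_commute[OF x sE[of l]] N[of k] N[of l]
        by linarith
    qed
  qed
  then have "t \<in> cauchy_seqs K"
  proof (rule cauchy_seqs_dominated[OF _ t(1) c(1)])
    fix k l
    have "vnorm K (t k \<ominus>\<^bsub>K\<^esub> t l) \<le> c * vnorm E (\<mu> (t k \<ominus>\<^bsub>K\<^esub> t l))"
      unfolding vnorm_def using c(2)[of "\<lambda>_ _. t k \<ominus>\<^bsub>K\<^esub> t l" 1] t by (simp add: mats_def)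
    then show "vnorm K (t k \<ominus>\<^bsub>K\<^esub> t l) \<le> c * vnorm E (s k \<ominus>\<^bsub>E\<^esub> s l)"
      using t by (simp add: \<mu>.diff)
  qed
  then obtain z where z: "z \<in> carrier K" "(\<lambda>k. vnorm K (t k \<ominus>\<^bsub>K\<^esub> z)) \<longlonglongrightarrow> 0"
    using bspec[OF K.seq_complete[unfolded seq_complete_def]] by blast
  have "(\<lambda>k. vnorm E (\<mu> (t k) \<ominus>\<^bsub>E\<^esub> \<mu> z)) \<longlonglongrightarrow> 0"
    by (rule cb_map_limit[OF \<mu>(1) t(1) z])
  then have "x = \<mu> z"
    by (intro E.limits_unique[of s]) (use sE x lim z t in simp_all)
  then show ?thesis using z by blast
qed

lemma cokernel_exists:
  assumes \<mu>: "cb_map A K \<mu> E" "cb_embedding K \<mu> E"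
  shows "\<exists>Q q. cb_map A E q Q \<and> cb_quotient E q Q \<and> map_kernel E q Q = \<mu> ` carrier K"
proof -
  interpret K: nondegenerate_module A F K by (rule cb_mapD[OF \<mu>(1)])
  interpret E: nondegenerate_module A F E by (rule cb_mapD[OF \<mu>(1)])
  interpret \<mu>: linear_between K E \<mu> by (rule cb_mapD[OF \<mu>(1)])
  interpret N: quotient_module A F E "\<mu> ` carrier K"
  proof (intro quotient_module.intro E.nondegenerate_module_axioms quotient_module_axioms.intro)
    show "\<mu> ` carrier K \<subseteq> carrier E" by auto
    show "\<zero>\<^bsub>E\<^esub> \<in> \<mu> ` carrier K" using \<mu>.zero K.M.zero_closed by (metis image_eqI)
    fix x assume "x \<in> \<mu> ` carrier K"
    then obtain k where k: "k \<in> carrier K" "x = \<mu> k" by blast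
    show "c \<odot>\<^bsub>E\<^esub> x \<in> \<mu> ` carrier K" for c
      using k by (auto simp: \<mu>.smult[symmetric])
    show "act E x a \<in> \<mu> ` carrier K" if "a \<in> A" for a
      using k that cb_mapD(4)[OF \<mu>(1), symmetric] by auto
    fix y assume "y \<in> \<mu> ` carrier K"
    then obtain l where l: "l \<in> carrier K" "y = \<mu> l" by blast
    show "x \<oplus>\<^bsub>E\<^esub> y \<in> \<mu> ` carrier K"
      using k l by (auto simp: \<mu>.add[symmetric])
  qed (rule embedding_range_closed[OF \<mu>])
  have "cb_map A E N.r N.Q"
  proof (rule cb_mapI[where c = 1, OF E.nondegenerate_module_axioms N.nondegenerate_module_Q N.linear_r])
    show "mnorm N.Q n (\<lambda>i j. N.r (x i j)) \<le> 1 * mnorm E n x" if "x \<in> mats E n n" for n x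
      using N.mnorm_Q_le[OF N.lifts_r[OF that]] by simp
  qed (rule N.r_act)
  moreover have "cb_quotient E N.r N.Q"
    unfolding cb_quotient_def
  proof (intro exI[of _ 2] conjI allI ballI)
    fix n y assume "y \<in> mats N.Q n n"
    then obtain x where "N.lifts n y x" "mnorm E n x \<le> 2 * mnorm N.Q n y"
      using N.lift_double by blast
    then show "\<exists>x\<in>mats E n n. (\<forall>i<n. \<forall>j<n. N.r (x i j) = y i j) \<and> mnorm E n x \<le> 2 * mnorm N.Q n y"
      unfolding N.lifts_def by blast
  qed simp
  moreover have "map_kernel E N.r N.Q = \<mu> ` carrier K"
    unfolding map_kernel_def using N.r_eq_zero_iff N.N_carrier by blast
  ultimately show ?thesis by blast
qed

lemma direct_sum_exists:
  assumes E: "nd_module A E" and G: "nd_module A G"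
  shows "\<exists>W p q. subproduct_of E G (carrier E \<times> carrier G) W p q"
proof -
  interpret E: nondegenerate_module A F E using E by (rule nd_moduleD)
  interpret G: nondegenerate_module A F G using G by (rule nd_moduleD)
  show ?thesis
    by (rule subproduct_exists[OF E G]) auto
qed

end

context operator_algebra_with_unit begin

text \<open>The pushout is the quotient of the direct sum by \<open>{(\<mu> k, - f k)}\<close>. If \<open>(x, y)\<close> lifts the class
  of \<open>(0, y')\<close>, then \<open>x = \<mu> k\<close> and \<open>y' = y + f k\<close> for some \<open>k\<close>, and the norm of \<open>k\<close> is
  controlled by that of \<open>x\<close>; this bounds \<open>y'\<close>.\<close>

lemma pushout_exists:
  fixes K E G :: "('u, 'h \<Rightarrow>\<^sub>L 'h) opmod"
  assumes \<mu>: "cb_map A K \<mu> E" "cb_embedding K \<mu> E" and f: "cb_map A K f G"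
  shows "\<exists>P f' m'. cb_map A E f' P \<and> cb_map A G m' P \<and> (\<forall>k\<in>carrier K. f' (\<mu> k) = m' (f k)) \<and>
    cb_embedding G m' P \<and>
    (\<forall>z\<in>carrier P. \<exists>x\<in>carrier E. \<exists>y\<in>carrier G. z = f' x \<oplus>\<^bsub>P\<^esub> m' y) \<and>
    (\<forall>Z u v. cb_map A E u Z \<longrightarrow> cb_map A G v Z \<longrightarrow> (\<forall>k\<in>carrier K. u (\<mu> k) = v (f k)) \<longrightarrow>
      (\<exists>w. cb_map A P w Z \<and> (\<forall>x\<in>carrier E. w (f' x) = u x) \<and> (\<forall>y\<in>carrier G. w (m' y) = v y)))"
proof -
  interpret K: nondegenerate_module A F K by (rule cb_mapD[OF \<mu>(1)])
  interpret E: nondegenerate_module A F E by (rule cb_mapD[OF \<mu>(1)])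
  interpret G: nondegenerate_module A F G by (rule cb_mapD[OF f])
  interpret \<mu>: linear_between K E \<mu> by (rule cb_mapD[OF \<mu>(1)])
  interpret f: linear_between K G f by (rule cb_mapD[OF f])
  have nd: "nd_module A E" "nd_module A G" using \<mu> f by (simp_all add: cb_map_def)
  obtain W p q where W: "subproduct_of E G (carrier E \<times> carrier G) W p q"
    using direct_sum_exists[OF nd] by blast
  then have p: "cb_map A W p E" and q: "cb_map A W q G"
    and norm: "\<And>n x. x \<in> mats W n n \<Longrightarrow> mnorm W n x = max (mnorm E n (\<lambda>i j. p (x i j))) (mnorm G n (\<lambda>i j. q (x i j)))"
    by (auto simp: subproduct_of_def)
  interpret W: nondegenerate_module A F W by (rule cb_mapD[OF p])
  interpret p: linear_between W E p by (rule cb_mapD[OF p])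
  interpret q: linear_between W G q by (rule cb_mapD[OF q])
  note eqI = subproduct_eqI[OF W]
  obtain \<theta> where \<theta>: "cb_map A K \<theta> W" "\<And>k. k \<in> carrier K \<Longrightarrow> p (\<theta> k) = \<mu> k"
    "\<And>k. k \<in> carrier K \<Longrightarrow> q (\<theta> k) = (-1) \<odot>\<^bsub>G\<^esub> f k"
    using subproduct_pair[OF W \<mu>(1) cb_map_smult[OF f, of "-1"]] by auto
  obtain i where i: "cb_map A E i W" "\<And>x. x \<in> carrier E \<Longrightarrow> p (i x) = x" "\<And>x. x \<in> carrier E \<Longrightarrow> q (i x) = \<zero>\<^bsub>G\<^esub>"
    using subproduct_pair[OF W cb_map_id[OF nd(1)] cb_map_zero[OF nd]] by auto
  obtain j where j: "cb_map A G j W" "\<And>y. y \<in> carrier G \<Longrightarrow> p (j y) = \<zero>\<^bsub>E\<^esub>" "\<And>y. y \<in> carrier G \<Longrightarrow> q (j y) = y"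
    using subproduct_pair[OF W cb_map_zero[OF nd(2,1)] cb_map_id[OF nd(2)]] by auto
  interpret \<theta>: linear_between K W \<theta> by (rule cb_mapD[OF \<theta>(1)])
  interpret i: linear_between E W i by (rule cb_mapD[OF i(1)])
  interpret j: linear_between G W j by (rule cb_mapD[OF j(1)])
  obtain c where c: "0 < c" "\<And>n x. x \<in> mats K n n \<Longrightarrow> mnorm K n x \<le> c * mnorm E n (\<lambda>i j. \<mu> (x i j))"
    using \<mu>(2) by (auto simp: cb_embedding_def)
  have "mnorm K n x \<le> c * mnorm W n (\<lambda>i j. \<theta> (x i j))" if x: "x \<in> mats K n n" for n x
  proof -
    have "mnorm E n (\<lambda>i j. \<mu> (x i j)) = mnorm E n (\<lambda>i j. p (\<theta> (x i j)))"
      by (rule E.nm_cong[OF \<mu>.mats[OF x]]) (use \<theta>(2) x in \<open>simp add: mats_def\<close>)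
    also have "\<dots> \<le> mnorm W n (\<lambda>i j. \<theta> (x i j))"
      using norm[OF \<theta>.mats[OF x]] by simp
    finally show ?thesis
      using c(2)[OF x] c(1) by (meson mult_left_mono order_trans less_imp_le)
  qed
  then have \<theta>e: "cb_embedding K \<theta> W"
    unfolding cb_embedding_def using c(1) by blast
  obtain P r where r: "cb_map A W r P" "cb_quotient W r P" "map_kernel W r P = \<theta> ` carrier K"
    using cokernel_exists[OF \<theta>(1) \<theta>e] by blast
  interpret P: nondegenerate_module A F P by (rule cb_mapD[OF r(1)])
  interpret r: linear_between W P r by (rule cb_mapD[OF r(1)])
  have split: "w = i (p w) \<oplus>\<^bsub>W\<^esub> j (q w)" if "w \<in> carrier W" for w
    by (rule eqI) (use that i j in \<open>simp_all add: p.add q.add\<close>)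
  have f': "cb_map A E (\<lambda>x. r (i x)) P" and m': "cb_map A G (\<lambda>y. r (j y)) P"
    by (rule cb_map_comp[OF i(1) r(1)], rule cb_map_comp[OF j(1) r(1)])
  have comm: "r (i (\<mu> k)) = r (j (f k))" if k: "k \<in> carrier K" for k
  proof -
    have "i (\<mu> k) \<ominus>\<^bsub>W\<^esub> j (f k) = \<theta> k"
      by (rule eqI) (use k i j \<theta> in \<open>simp_all add: p.diff q.diff G.minus_one_smult G.M.minus_eq\<close>)
    then have "r (i (\<mu> k) \<ominus>\<^bsub>W\<^esub> j (f k)) = \<zero>\<^bsub>P\<^esub>"
      using r(3) k by (auto simp: map_kernel_def)
    then show ?thesis
      using k by (simp add: r.diff P.diff_eq_zero_iff)
  qed
  have embed: "cb_embedding G (\<lambda>y. r (j y)) P"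
  proof -
    obtain B where B: "0 < B" "\<And>n x. x \<in> mats K n n \<Longrightarrow> mnorm G n (\<lambda>i j. f (x i j)) \<le> B * mnorm K n x"
      by (rule cb_map_bound[OF f]) blast
    obtain d where d: "0 < d" "\<And>n y. y \<in> mats P n n \<Longrightarrow> \<exists>x\<in>mats W n n.
        (\<forall>i<n. \<forall>j<n. r (x i j) = y i j) \<and> mnorm W n x \<le> d * mnorm P n y"
      using r(2) unfolding cb_quotient_def by blast
    have "mnorm G n y \<le> ((1 + B * c) * d) * mnorm P n (\<lambda>a b. r (j (y a b)))" if y: "y \<in> mats G n n" for n y
    proof -
      have Y: "(\<lambda>a b. r (j (y a b))) \<in> mats P n n"
        by (rule r.mats[OF j.mats[OF y]])
      obtain z where z: "z \<in> mats W n n" "\<forall>a<n. \<forall>b<n. r (z a b) = r (j (y a b))"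
        "mnorm W n z \<le> d * mnorm P n (\<lambda>a b. r (j (y a b)))"
        using d(2)[OF Y] by blast
      note zc = matsD[OF z(1)] and yc = matsD[OF y]
      have "\<exists>k. k \<in> carrier K \<and> z a b \<ominus>\<^bsub>W\<^esub> j (y a b) = \<theta> k" if ab: "a < n" "b < n" for a b
      proof -
        have "r (z a b \<ominus>\<^bsub>W\<^esub> j (y a b)) = \<zero>\<^bsub>P\<^esub>"
          using z(2) zc[OF ab] yc[OF ab] ab by (simp add: r.diff)
        then have "z a b \<ominus>\<^bsub>W\<^esub> j (y a b) \<in> map_kernel W r P"
          using zc[OF ab] yc[OF ab] by (simp add: map_kernel_def)
        then show ?thesis unfolding r(3) by blast
      qed
      then obtain k where k: "\<And>a b. a < n \<Longrightarrow> b < n \<Longrightarrow> k a b \<in> carrier K"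
        "\<And>a b. a < n \<Longrightarrow> b < n \<Longrightarrow> z a b \<ominus>\<^bsub>W\<^esub> j (y a b) = \<theta> (k a b)"
        by metis
      have km: "k \<in> mats K n n" using k(1) by (rule matsI)
      have pz: "p (z a b) = \<mu> (k a b)" and qz: "y a b = q (z a b) \<oplus>\<^bsub>G\<^esub> f (k a b)" if ab: "a < n" "b < n" for a b
      proof -
        have "p (z a b \<ominus>\<^bsub>W\<^esub> j (y a b)) = \<mu> (k a b)" "q (z a b \<ominus>\<^bsub>W\<^esub> j (y a b)) = (-1) \<odot>\<^bsub>G\<^esub> f (k a b)"
          using k(2)[OF ab] \<theta>(2,3)[OF k(1)[OF ab]] by simp_all
        then have 1: "p (z a b) = \<mu> (k a b)" "q (z a b) \<ominus>\<^bsub>G\<^esub> y a b = \<ominus>\<^bsub>G\<^esub> f (k a b)"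
          using zc[OF ab] yc[OF ab] k(1)[OF ab] j by (simp_all add: p.diff q.diff G.minus_one_smult)
        then show "p (z a b) = \<mu> (k a b)" by simp
        have "f (k a b) = y a b \<ominus>\<^bsub>G\<^esub> q (z a b)"
          using 1(2) zc[OF ab] yc[OF ab] k(1)[OF ab] G.diff_swap[of "q (z a b)" "y a b"] by simp
        then show "y a b = q (z a b) \<oplus>\<^bsub>G\<^esub> f (k a b)"
          using zc[OF ab] yc[OF ab] by simp
      qed
      have "mnorm G n y = mnorm G n (\<lambda>a b. q (z a b) \<oplus>\<^bsub>G\<^esub> f (k a b))"
        by (rule G.nm_cong[OF y]) (rule qz)
      also have "\<dots> \<le> mnorm G n (\<lambda>a b. q (z a b)) + mnorm G n (\<lambda>a b. f (k a b))"
        by (rule G.nm_triangle[OF q.mats[OF z(1)] f.mats[OF km]])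
      also have "\<dots> \<le> mnorm W n z + (B * c) * mnorm W n z"
      proof (rule add_mono)
        show "mnorm G n (\<lambda>a b. q (z a b)) \<le> mnorm W n z" using norm[OF z(1)] by simp
        have "mnorm E n (\<lambda>a b. \<mu> (k a b)) = mnorm E n (\<lambda>a b. p (z a b))"
          by (rule E.nm_cong[OF \<mu>.mats[OF km]]) (simp add: pz)
        also have "\<dots> \<le> 1 * mnorm W n z" using norm[OF z(1)] by simp
        finally have le: "mnorm E n (\<lambda>a b. \<mu> (k a b)) \<le> 1 * mnorm W n z" .
        show "mnorm G n (\<lambda>a b. f (k a b)) \<le> (B * c) * mnorm W n z"
          using bound_trans[OF B(2)[OF km] bound_trans[OF c(2)[OF km] le c(1)] B(1)] by simp
      qed
      also have "\<dots> = (1 + B * c) * mnorm W n z" by (simp add: distrib_right)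
      finally show ?thesis
        using B(1) c(1) by (intro bound_trans[OF _ z(3)]) (auto intro: add_pos_pos)
    qed
    moreover have "0 < (1 + B * c) * d" using B(1) c(1) d(1) by (simp add: add_pos_pos)
    ultimately show ?thesis unfolding cb_embedding_def by blast
  qed
  have span: "\<exists>x\<in>carrier E. \<exists>y\<in>carrier G. z = r (i x) \<oplus>\<^bsub>P\<^esub> r (j y)" if z: "z \<in> carrier P" for z
  proof -
    obtain w where w: "w \<in> carrier W" "r w = z"
      using cb_quotient_surj[OF r(1,2) z] by blast
    have "z = r (i (p w) \<oplus>\<^bsub>W\<^esub> j (q w))" using split[OF w(1)] w(2) by simp
    then show ?thesis
      using w by (intro bexI[of _ "p w"] bexI[of _ "q w"]) (auto simp: r.add)
  qed
  have univ: "\<exists>w. cb_map A P w Z \<and> (\<forall>x\<in>carrier E. w (r (i x)) = u x) \<and> (\<forall>y\<in>carrier G. w (r (j y)) = v y)"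
    if u: "cb_map A E u Z" and v: "cb_map A G v Z" and uv: "\<forall>k\<in>carrier K. u (\<mu> k) = v (f k)" for Z u v
  proof -
    interpret Z: nondegenerate_module A F Z by (rule cb_mapD[OF u])
    interpret u: linear_between E Z u by (rule cb_mapD[OF u])
    interpret v: linear_between G Z v by (rule cb_mapD[OF v])
    have g: "cb_map A W (\<lambda>w. u (p w) \<oplus>\<^bsub>Z\<^esub> v (q w)) Z"
      by (rule cb_map_add[OF cb_map_comp[OF p u] cb_map_comp[OF q v]])
    have ker: "u (p w) \<oplus>\<^bsub>Z\<^esub> v (q w) = \<zero>\<^bsub>Z\<^esub>" if w: "w \<in> carrier W" "r w = \<zero>\<^bsub>P\<^esub>" for w
    proof -
      have "w \<in> \<theta> ` carrier K" using w unfolding r(3)[symmetric] map_kernel_def by simp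
      then obtain k where k: "k \<in> carrier K" "w = \<theta> k" by blast
      then show ?thesis
        using \<theta>(2,3)[OF k(1)] uv by (simp add: v.smult Z.minus_one_smult Z.M.r_neg)
    qed
    obtain h where h: "cb_map A P h Z" "\<And>w. w \<in> carrier W \<Longrightarrow> h (r w) = u (p w) \<oplus>\<^bsub>Z\<^esub> v (q w)"
      using factor_through_quotient[OF r(1,2) g ker] by blast
    show ?thesis
      using h(1) by (intro exI[of _ h] conjI ballI) (simp_all add: h(2) i j)
  qed
  show ?thesis
    by (intro exI[of _ P] exI[of _ "\<lambda>x. r (i x)"] exI[of _ "\<lambda>y. r (j y)"] conjI ballI allI impI
        f' m' comm embed span univ) simp_all
qed

text \<open>A matrix \<open>d\<close> is lifted to the pullback by lifting \<open>f d\<close> along \<open>\<pi>\<close>.\<close>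

lemma pullback_exists:
  fixes E D C :: "('u, 'h \<Rightarrow>\<^sub>L 'h) opmod"
  assumes \<pi>: "cb_map A E \<pi> C" "cb_quotient E \<pi> C" and f: "cb_map A D f C"
  shows "\<exists>P f' p'. cb_map A P f' E \<and> cb_map A P p' D \<and> (\<forall>z\<in>carrier P. \<pi> (f' z) = f (p' z)) \<and>
    cb_quotient P p' D \<and>
    (\<forall>z\<in>carrier P. \<forall>z'\<in>carrier P. f' z = f' z' \<longrightarrow> p' z = p' z' \<longrightarrow> z = z') \<and>
    (\<forall>T u v. cb_map A T u E \<longrightarrow> cb_map A T v D \<longrightarrow> (\<forall>t\<in>carrier T. \<pi> (u t) = f (v t)) \<longrightarrow>
      (\<exists>w. cb_map A T w P \<and> (\<forall>t\<in>carrier T. f' (w t) = u t \<and> p' (w t) = v t)))"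
proof -
  interpret E: nondegenerate_module A F E by (rule cb_mapD[OF \<pi>(1)])
  interpret D: nondegenerate_module A F D by (rule cb_mapD[OF f])
  interpret C: nondegenerate_module A F C by (rule cb_mapD[OF f])
  interpret \<pi>: linear_between E C \<pi> by (rule cb_mapD[OF \<pi>(1)])
  interpret f: linear_between D C f by (rule cb_mapD[OF f])
  have nd: "nd_module A E" "nd_module A D" using \<pi> f by (simp_all add: cb_map_def)
  define S where "S = {(x, d). x \<in> carrier E \<and> d \<in> carrier D \<and> \<pi> x = f d}"
  have "\<exists>P p q. subproduct_of E D S P p q"
  proof (rule subproduct_exists[OF nd])
    show "S \<subseteq> carrier E \<times> carrier D" by (auto simp: S_def)
    show "(\<zero>\<^bsub>E\<^esub>, \<zero>\<^bsub>D\<^esub>) \<in> S" by (simp add: S_def)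
    show "(x \<oplus>\<^bsub>E\<^esub> x', y \<oplus>\<^bsub>D\<^esub> y') \<in> S" if "(x, y) \<in> S" "(x', y') \<in> S" for x y x' y'
      using that by (simp add: S_def \<pi>.add f.add)
    show "(c \<odot>\<^bsub>E\<^esub> x, c \<odot>\<^bsub>D\<^esub> y) \<in> S" if "(x, y) \<in> S" for x y c
      using that by (simp add: S_def \<pi>.smult f.smult)
    show "(act E x a, act D y a) \<in> S" if "(x, y) \<in> S" "a \<in> A" for x y a
      using that cb_mapD(4)[OF \<pi>(1)] cb_mapD(4)[OF f] by (simp add: S_def)
    show "(x, y) \<in> S" if s: "\<And>k. (s k, t k) \<in> S" and xy: "x \<in> carrier E" "y \<in> carrier D"
      and lim: "(\<lambda>k. vnorm E (s k \<ominus>\<^bsub>E\<^esub> x)) \<longlonglongrightarrow> 0" "(\<lambda>k. vnorm D (t k \<ominus>\<^bsub>D\<^esub> y)) \<longlonglongrightarrow> 0" for s t x y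
    proof -
      have s': "s k \<in> carrier E" "t k \<in> carrier D" "\<pi> (s k) = f (t k)" for k
        using s[of k] by (simp_all add: S_def)
      have "(\<lambda>k. vnorm C (\<pi> (s k) \<ominus>\<^bsub>C\<^esub> \<pi> x)) \<longlonglongrightarrow> 0"
        by (rule cb_map_limit[OF \<pi>(1) s'(1) xy(1) lim(1)])
      moreover have "(\<lambda>k. vnorm C (f (t k) \<ominus>\<^bsub>C\<^esub> f y)) \<longlonglongrightarrow> 0"
        by (rule cb_map_limit[OF f s'(2) xy(2) lim(2)])
      ultimately have "\<pi> x = f y"
        by (intro C.limits_unique[of "\<lambda>k. f (t k)"]) (use s' xy in simp_all)
      then show ?thesis using xy by (simp add: S_def)
    qed
  qed
  then obtain P p q where P: "subproduct_of E D S P p q" by blast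
  then have p: "cb_map A P p E" and q: "cb_map A P q D" and bij: "bij_betw (\<lambda>w. (p w, q w)) (carrier P) S"
    and norm: "\<And>n x. x \<in> mats P n n \<Longrightarrow> mnorm P n x = max (mnorm E n (\<lambda>i j. p (x i j))) (mnorm D n (\<lambda>i j. q (x i j)))"
    by (auto simp: subproduct_of_def)
  interpret p: linear_between P E p by (rule cb_mapD[OF p])
  interpret q: linear_between P D q by (rule cb_mapD[OF q])
  have comm: "\<pi> (p z) = f (q z)" if "z \<in> carrier P" for z
    using bij_betwE[OF bij] that by (auto simp: S_def)
  have ex: "\<exists>z. z \<in> carrier P \<and> p z = x \<and> q z = d" if "(x, d) \<in> S" for x d
  proof -
    have "(x, d) \<in> (\<lambda>w. (p w, q w)) ` carrier P" using bij that by (simp add: bij_betw_def)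
    then show ?thesis by auto
  qed
  have quot: "cb_quotient P q D"
  proof -
    obtain c where c: "0 < c" "\<And>n y. y \<in> mats C n n \<Longrightarrow> \<exists>x\<in>mats E n n.
        (\<forall>i<n. \<forall>j<n. \<pi> (x i j) = y i j) \<and> mnorm E n x \<le> c * mnorm C n y"
      using \<pi>(2) unfolding cb_quotient_def by blast
    obtain B where B: "0 < B" "\<And>n x. x \<in> mats D n n \<Longrightarrow> mnorm C n (\<lambda>i j. f (x i j)) \<le> B * mnorm D n x"
      by (rule cb_map_bound[OF f]) blast
    have "\<exists>z\<in>mats P n n. (\<forall>i<n. \<forall>j<n. q (z i j) = d i j) \<and> mnorm P n z \<le> (c * B + 1) * mnorm D n d"
      if d: "d \<in> mats D n n" for n d
    proof -
      obtain x where x: "x \<in> mats E n n" "\<forall>i<n. \<forall>j<n. \<pi> (x i j) = f (d i j)"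
        "mnorm E n x \<le> c * mnorm C n (\<lambda>i j. f (d i j))"
        using c(2)[OF f.mats[OF d]] by blast
      have "\<exists>z. z \<in> carrier P \<and> p z = x i j \<and> q z = d i j" if "i < n" "j < n" for i j
        using x(2) matsD[OF x(1) that] matsD[OF d that] that by (intro ex) (simp add: S_def)
      then obtain z where z: "\<And>i j. i < n \<Longrightarrow> j < n \<Longrightarrow> z i j \<in> carrier P"
        "\<And>i j. i < n \<Longrightarrow> j < n \<Longrightarrow> p (z i j) = x i j" "\<And>i j. i < n \<Longrightarrow> j < n \<Longrightarrow> q (z i j) = d i j"
        by metis
      have zm: "z \<in> mats P n n" using z(1) by (rule matsI)
      have "mnorm E n (\<lambda>i j. p (z i j)) = mnorm E n x"
        by (rule E.nm_cong[OF p.mats[OF zm]]) (rule z(2))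
      moreover have "mnorm D n (\<lambda>i j. q (z i j)) = mnorm D n d"
        by (rule D.nm_cong[OF q.mats[OF zm]]) (rule z(3))
      moreover have "mnorm E n x \<le> (c * B) * mnorm D n d"
        by (rule bound_trans[OF x(3) B(2)[OF d] c(1)])
      moreover have "0 \<le> mnorm D n d" "0 \<le> (c * B) * mnorm D n d"
        using D.nm_nonneg[OF d] c(1) B(1) by simp_all
      ultimately have "mnorm P n z \<le> (c * B + 1) * mnorm D n d"
        unfolding norm[OF zm] distrib_right by linarith
      then show ?thesis using zm z(3) by blast
    qed
    moreover have "0 < c * B + 1" using c(1) B(1) by (simp add: add_pos_pos)
    ultimately show ?thesis unfolding cb_quotient_def by blast
  qed
  have univ: "\<exists>w. cb_map A T w P \<and> (\<forall>t\<in>carrier T. p (w t) = u t \<and> q (w t) = v t)"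
    if u: "cb_map A T u E" and v: "cb_map A T v D" and uv: "\<forall>t\<in>carrier T. \<pi> (u t) = f (v t)" for T u v
  proof (rule subproduct_pair[OF P u v])
    interpret u: linear_between T E u by (rule cb_mapD[OF u])
    interpret v: linear_between T D v by (rule cb_mapD[OF v])
    show "(u t, v t) \<in> S" if "t \<in> carrier T" for t
      using that uv by (simp add: S_def)
  qed
  show ?thesis
    by (intro exI[of _ P] exI[of _ p] exI[of _ q] conjI ballI allI impI p q comm quot univ)
      (simp_all add: subproduct_eqI[OF P])
qed

lemma zero_module_exists: "\<exists>Z :: ('u, 'h \<Rightarrow>\<^sub>L 'h) opmod. nd_module A Z \<and> carrier Z = {\<zero>\<^bsub>Z\<^esub>}"
proof -
  define z :: 'u where "z = undefined"
  define Z :: "('u, 'h \<Rightarrow>\<^sub>L 'h) opmod" where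
    "Z = \<lparr>carrier = {z}, mult = undefined, one = undefined, zero = z, add = (\<lambda>_ _. z), smult = (\<lambda>_ _. z),
      mnorm = (\<lambda>_ _. 0), act = (\<lambda>_ _. z)\<rparr>"
  have simps [simp]: "carrier Z = {z}" "\<zero>\<^bsub>Z\<^esub> = z" "x \<oplus>\<^bsub>Z\<^esub> y = z" "c \<odot>\<^bsub>Z\<^esub> x = z" "mnorm Z n v = 0" "act Z x a = z"
    for x y c n v a
    by (simp_all add: Z_def)
  interpret Z: complex_module Z
    unfolding complex_module_def
    by (rule moduleI[OF cring_complex_ring]) (auto intro!: abelian_groupI)
  interpret Z: normed_matrices Z
    by unfold_locales (auto simp: mats_def)
  have complete: "seq_complete Z"
    by (simp add: seq_complete_def vnorm_def)
  interpret Z: module_with_unit A F Z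
    by (intro module_with_unit.intro operator_algebra_with_unit_axioms module_with_unit_axioms.intro
      operator_spaceI Z.normed_matrices_axioms complete)
      (auto simp: right_module_def contractive_action_def intro!: mult_nonneg_nonneg Z.rect_norm_nonneg)
  have "nondegenerate_module A F Z"
    by unfold_locales (simp add: Z.unit_limit_def vnorm_def)
  then show ?thesis
    by (intro exI[of _ Z]) (simp add: nd_module_iff)
qed

lemma cb_quotient_cong:
  assumes "cb_quotient E f G" "\<And>x. x \<in> carrier E \<Longrightarrow> f x = g x"
  shows "cb_quotient E g G"
proof -
  obtain c where c: "0 < c" "\<And>n y. y \<in> mats G n n \<Longrightarrow> \<exists>x\<in>mats E n n.
      (\<forall>i<n. \<forall>j<n. f (x i j) = y i j) \<and> mnorm E n x \<le> c * mnorm G n y"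
    using assms(1) unfolding cb_quotient_def by blast
  have "\<exists>x\<in>mats E n n. (\<forall>i<n. \<forall>j<n. g (x i j) = y i j) \<and> mnorm E n x \<le> c * mnorm G n y"
    if y: "y \<in> mats G n n" for n y
  proof -
    obtain x where "x \<in> mats E n n" "\<forall>i<n. \<forall>j<n. f (x i j) = y i j" "mnorm E n x \<le> c * mnorm G n y"
      using c(2)[OF y] by blast
    then show ?thesis using assms(2) by (intro bexI[of _ x]) (auto simp: mats_def)
  qed
  then show ?thesis unfolding cb_quotient_def using c(1) by blast
qed

lemma cb_embedding_cong:
  assumes f: "cb_map A E f G" "cb_embedding E f G" and eq: "\<And>x. x \<in> carrier E \<Longrightarrow> f x = g x"
  shows "cb_embedding E g G"
proof -
  interpret G: nondegenerate_module A F G by (rule cb_mapD[OF f(1)])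
  interpret f: linear_between E G f by (rule cb_mapD[OF f(1)])
  have "mnorm G n (\<lambda>i j. f (x i j)) = mnorm G n (\<lambda>i j. g (x i j))" if x: "x \<in> mats E n n" for n x
    by (rule G.nm_cong[OF f.mats[OF x]]) (use x eq in \<open>simp add: mats_def\<close>)
  then show ?thesis using f(2) by (simp add: cb_embedding_def)
qed

end

section \<open>The additive category of nondegenerate modules\<close>

lemma OMod_simps [simp]:
  "Obj (OMod T A) = {E. nd_module A E}"
  "Dom (OMod T A) (E, f, G) = E"
  "Cod (OMod T A) (E, f, G) = G"
  "Idn (OMod T A) E = (E, restrict (\<lambda>x. x) (carrier E), E)"
  "Cmp (OMod T A) (G', g, H) (E, f, G) = (E, compose (carrier E) g f, H)"
  "Plus (OMod T A) (E, f, G) (E', f', G') = (E, restrict (\<lambda>x. f x \<oplus>\<^bsub>G\<^esub> f' x) (carrier E), G)"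
  "Null (OMod T A) E G = (E, restrict (\<lambda>x. \<zero>\<^bsub>G\<^esub>) (carrier E), G)"
  "(E, f, G) \<in> Arr (OMod T A) \<longleftrightarrow> f \<in> extensional (carrier E) \<and> cb_map A E f G"
  by (auto simp: OMod_def nd_module_def cb_map_def)

lemma Hom_OMod [simp]:
  "(E, f, G) \<in> Hom (OMod T A) E' G' \<longleftrightarrow> E = E' \<and> G = G' \<and> f \<in> extensional (carrier E) \<and> cb_map A E f G"
  by (auto simp: Hom_def)

lemma ArrE:
  assumes "m \<in> Arr (OMod T A)"
  obtains E f G where "m = (E, f, G)" "f \<in> extensional (carrier E)" "cb_map A E f G"
  using assms by (cases m) auto

lemma HomE:
  assumes "m \<in> Hom (OMod T A) E G"
  obtains f where "m = (E, f, G)" "f \<in> extensional (carrier E)" "cb_map A E f G"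
  using assms by (cases m) auto

lemma restrict_eq_iff: "restrict f S = restrict g S \<longleftrightarrow> (\<forall>x\<in>S. f x = g x)"
  by (auto simp: restrict_def fun_eq_iff)

lemma extensional_eq_iff:
  "f \<in> extensional S \<Longrightarrow> restrict g S = f \<longleftrightarrow> (\<forall>x\<in>S. g x = f x)"
  "f \<in> extensional S \<Longrightarrow> f = restrict g S \<longleftrightarrow> (\<forall>x\<in>S. f x = g x)"
  by (auto simp: restrict_def fun_eq_iff extensional_def)

context operator_algebra_with_unit begin

lemma cb_map_closed: "cb_map A E f G \<Longrightarrow> x \<in> carrier E \<Longrightarrow> f x \<in> carrier G"
  using linear_between.closed[OF cb_mapD(3)] .

lemma cb_map_compose: "cb_map A E f G \<Longrightarrow> cb_map A G g H \<Longrightarrow> cb_map A E (compose (carrier E) g f) H"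
  unfolding compose_def by (simp add: cb_map_restrict cb_map_comp)

lemma cb_map_nd: "cb_map A E f G \<Longrightarrow> nd_module A E" "cb_map A E f G \<Longrightarrow> nd_module A G"
  by (simp_all add: cb_map_def)

lemma is_category_OMod: "is_category (OMod T A)"
  unfolding is_category_def
proof (intro conjI ballI impI)
  fix m assume "m \<in> Arr (OMod T A)"
  then obtain E f G where m: "m = (E, f, G)" "f \<in> extensional (carrier E)" "cb_map A E f G" by (rule ArrE)
  show "Dom (OMod T A) m \<in> Obj (OMod T A)" "Cod (OMod T A) m \<in> Obj (OMod T A)"
    using m by (simp_all add: cb_map_nd)
  show "Cmp (OMod T A) m (Idn (OMod T A) (Dom (OMod T A) m)) = m"
    using m by (simp add: extensional_eq_iff compose_def)
  show "Cmp (OMod T A) (Idn (OMod T A) (Cod (OMod T A) m)) m = m"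
    using m cb_map_closed[OF m(3)] by (simp add: extensional_eq_iff compose_def)
  fix m' assume "m' \<in> Arr (OMod T A)"
  then obtain E' f' G' where m': "m' = (E', f', G')" "f' \<in> extensional (carrier E')" "cb_map A E' f' G'" by (rule ArrE)
  show "Cmp (OMod T A) m' m \<in> Hom (OMod T A) (Dom (OMod T A) m) (Cod (OMod T A) m')"
    if "Cod (OMod T A) m = Dom (OMod T A) m'"
    using that m m' by (simp add: cb_map_compose)
  fix m'' assume "m'' \<in> Arr (OMod T A)"
  then obtain E'' f'' G'' where m'': "m'' = (E'', f'', G'')" by (rule ArrE)
  show "Cmp (OMod T A) m'' (Cmp (OMod T A) m' m) = Cmp (OMod T A) (Cmp (OMod T A) m'' m') m"
    if "Cod (OMod T A) m = Dom (OMod T A) m' \<and> Cod (OMod T A) m' = Dom (OMod T A) m''"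
    using that m m' m'' cb_map_closed[OF m(3)] by (simp add: compose_def restrict_eq_iff)
next
  fix E assume "E \<in> Obj (OMod T A)"
  then show "Idn (OMod T A) E \<in> Hom (OMod T A) E E"
    by (simp add: cb_map_restrict cb_map_id)
qed

lemma is_preadditive_OMod: "is_preadditive (OMod T A)"
  unfolding is_preadditive_def
proof (intro conjI ballI is_category_OMod)
  fix E G :: "('a, 'h \<Rightarrow>\<^sub>L 'h) opmod"
  assume "E \<in> Obj (OMod T A)" "G \<in> Obj (OMod T A)"
  then have nd: "nd_module A E" "nd_module A G" by simp_all
  interpret G: nondegenerate_module A F G using nd(2) by (rule nd_moduleD)
  show "comm_group \<lparr>carrier = Hom (OMod T A) E G, mult = Plus (OMod T A), one = Null (OMod T A) E G\<rparr>" (is "comm_group ?H")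
  proof (rule comm_groupI)
    show "\<one>\<^bsub>?H\<^esub> \<in> carrier ?H"
      using nd by (simp add: cb_map_restrict cb_map_zero)
  next
    fix m assume "m \<in> carrier ?H"
    then obtain f where m: "m = (E, f, G)" "f \<in> extensional (carrier E)" "cb_map A E f G" by (auto elim: HomE)
    note fc = cb_map_closed[OF m(3)]
    show "\<one>\<^bsub>?H\<^esub> \<otimes>\<^bsub>?H\<^esub> m = m"
      using m fc by (simp add: extensional_eq_iff)
    have "cb_map A E (\<lambda>x. (-1) \<odot>\<^bsub>G\<^esub> f x) G" by (rule cb_map_smult[OF m(3)])
    then show "\<exists>m'\<in>carrier ?H. m' \<otimes>\<^bsub>?H\<^esub> m = \<one>\<^bsub>?H\<^esub>"
      using m fc by (intro bexI[of _ "(E, restrict (\<lambda>x. (-1) \<odot>\<^bsub>G\<^esub> f x) (carrier E), G)"])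
        (simp_all add: cb_map_restrict restrict_eq_iff G.minus_one_smult G.M.l_neg)
    fix m' assume "m' \<in> carrier ?H"
    then obtain f' where m': "m' = (E, f', G)" "f' \<in> extensional (carrier E)" "cb_map A E f' G" by (auto elim: HomE)
    note fc' = cb_map_closed[OF m'(3)]
    show "m \<otimes>\<^bsub>?H\<^esub> m' \<in> carrier ?H"
      using m m' cb_map_add[OF m(3) m'(3)] by (simp add: cb_map_restrict)
    show "m \<otimes>\<^bsub>?H\<^esub> m' = m' \<otimes>\<^bsub>?H\<^esub> m"
      using m m' fc fc' by (simp add: restrict_eq_iff G.M.a_comm)
    fix m'' assume "m'' \<in> carrier ?H"
    then obtain f'' where m'': "m'' = (E, f'', G)" "f'' \<in> extensional (carrier E)" "cb_map A E f'' G" by (auto elim: HomE)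
    show "m \<otimes>\<^bsub>?H\<^esub> m' \<otimes>\<^bsub>?H\<^esub> m'' = m \<otimes>\<^bsub>?H\<^esub> (m' \<otimes>\<^bsub>?H\<^esub> m'')"
      using m m' m'' fc fc' cb_map_closed[OF m''(3)] by (simp add: restrict_eq_iff G.M.a_assoc)
  qed
next
  fix E G H :: "('a, 'h \<Rightarrow>\<^sub>L 'h) opmod" and m m' k k'
  assume "m \<in> Hom (OMod T A) E G" "m' \<in> Hom (OMod T A) E G" "k \<in> Hom (OMod T A) G H" "k' \<in> Hom (OMod T A) G H"
  then obtain f f' g g' where m: "m = (E, f, G)" "cb_map A E f G" "m' = (E, f', G)" "cb_map A E f' G"
    "k = (G, g, H)" "cb_map A G g H" "k' = (G, g', H)" "cb_map A G g' H"
    by (auto elim!: HomE)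
  note c = cb_map_closed[OF m(2)] cb_map_closed[OF m(4)]
  show "Cmp (OMod T A) k (Plus (OMod T A) m m') = Plus (OMod T A) (Cmp (OMod T A) k m) (Cmp (OMod T A) k m')"
    unfolding m(1,3,5,7) using c linear_between.add[OF cb_mapD(3)[OF m(6)]]
    by (simp add: compose_def restrict_eq_iff)
  show "Cmp (OMod T A) (Plus (OMod T A) k k') m = Plus (OMod T A) (Cmp (OMod T A) k m) (Cmp (OMod T A) k' m)"
    unfolding m(1,3,5,7) using c by (simp add: compose_def restrict_eq_iff)
qed

lemma is_additive_OMod: "is_additive (OMod TYPE('u) A)"
  unfolding is_additive_def
proof (intro conjI ballI is_preadditive_OMod)
  obtain Z :: "('u, 'h \<Rightarrow>\<^sub>L 'h) opmod" where "nd_module A Z \<and> carrier Z = {\<zero>\<^bsub>Z\<^esub>}"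
    using zero_module_exists ..
  then have Z: "nd_module A Z" "carrier Z = {\<zero>\<^bsub>Z\<^esub>}"
    by (rule conjunct1, rule conjunct2)
  have "is_zero_object (OMod TYPE('u) A) Z"
    unfolding is_zero_object_def
  proof (intro conjI ballI)
    show "Z \<in> Obj (OMod TYPE('u) A)" using Z by simp
    fix E :: "('u, 'h \<Rightarrow>\<^sub>L 'h) opmod" assume "E \<in> Obj (OMod TYPE('u) A)"
    then have E: "nd_module A E" by simp
    show "\<exists>!m. m \<in> Hom (OMod TYPE('u) A) Z E"
    proof (rule ex1I)
      show "(Z, restrict (\<lambda>_. \<zero>\<^bsub>E\<^esub>) (carrier Z), E) \<in> Hom (OMod TYPE('u) A) Z E"
        using E Z(1) by (simp add: cb_map_restrict cb_map_zero)
      fix m assume "m \<in> Hom (OMod TYPE('u) A) Z E"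
      then obtain f where m: "m = (Z, f, E)" "f \<in> extensional (carrier Z)" "cb_map A Z f E" by (rule HomE)
      have "f = restrict (\<lambda>_. \<zero>\<^bsub>E\<^esub>) (carrier Z)"
        unfolding extensional_eq_iff(2)[OF m(2)] using linear_between.zero[OF cb_mapD(3)[OF m(3)]] Z(2) by simp
      then show "m = (Z, restrict (\<lambda>_. \<zero>\<^bsub>E\<^esub>) (carrier Z), E)"
        using m(1) by simp
    qed
    show "\<exists>!m. m \<in> Hom (OMod TYPE('u) A) E Z"
    proof (rule ex1I)
      show "(E, restrict (\<lambda>_. \<zero>\<^bsub>Z\<^esub>) (carrier E), Z) \<in> Hom (OMod TYPE('u) A) E Z"
        using E Z(1) by (simp add: cb_map_restrict cb_map_zero)
      fix m assume "m \<in> Hom (OMod TYPE('u) A) E Z"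
      then obtain f where m: "m = (E, f, Z)" "f \<in> extensional (carrier E)" "cb_map A E f Z" by (rule HomE)
      have "f = restrict (\<lambda>_. \<zero>\<^bsub>Z\<^esub>) (carrier E)"
        unfolding extensional_eq_iff(2)[OF m(2)] using cb_map_closed[OF m(3)] Z(2) by auto
      then show "m = (E, restrict (\<lambda>_. \<zero>\<^bsub>Z\<^esub>) (carrier E), Z)"
        using m(1) by simp
    qed
  qed
  then show "\<exists>z. is_zero_object (OMod TYPE('u) A) z" ..
next
  fix E G :: "('u, 'h \<Rightarrow>\<^sub>L 'h) opmod"
  assume "E \<in> Obj (OMod TYPE('u) A)" "G \<in> Obj (OMod TYPE('u) A)"
  then have nd: "nd_module A E" "nd_module A G" by simp_all
  interpret E: nondegenerate_module A F E using nd(1) by (rule nd_moduleD)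
  interpret G: nondegenerate_module A F G using nd(2) by (rule nd_moduleD)
  obtain W p q where W: "subproduct_of E G (carrier E \<times> carrier G) W p q"
    using direct_sum_exists[OF nd] by blast
  then have p: "cb_map A W p E" and q: "cb_map A W q G"
    by (auto simp: subproduct_of_def)
  interpret W: nondegenerate_module A F W by (rule cb_mapD[OF p])
  interpret p: linear_between W E p by (rule cb_mapD[OF p])
  interpret q: linear_between W G q by (rule cb_mapD[OF q])
  obtain i where i: "cb_map A E i W" "\<And>x. x \<in> carrier E \<Longrightarrow> p (i x) = x" "\<And>x. x \<in> carrier E \<Longrightarrow> q (i x) = \<zero>\<^bsub>G\<^esub>"
    using subproduct_pair[OF W cb_map_id[OF nd(1)] cb_map_zero[OF nd]] by auto
  obtain j where j: "cb_map A G j W" "\<And>y. y \<in> carrier G \<Longrightarrow> p (j y) = \<zero>\<^bsub>E\<^esub>" "\<And>y. y \<in> carrier G \<Longrightarrow> q (j y) = y"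
    using subproduct_pair[OF W cb_map_zero[OF nd(2,1)] cb_map_id[OF nd(2)]] by auto
  note ic = cb_map_closed[OF i(1)] and jc = cb_map_closed[OF j(1)]
  have split: "i (p w) \<oplus>\<^bsub>W\<^esub> j (q w) = w" if "w \<in> carrier W" for w
    by (rule subproduct_eqI[OF W]) (use that i j ic jc in \<open>simp_all add: p.add q.add\<close>)
  have "is_biproduct (OMod TYPE('u) A) E G W (E, restrict i (carrier E), W) (G, restrict j (carrier G), W)
      (W, restrict p (carrier W), E) (W, restrict q (carrier W), G)"
    unfolding is_biproduct_def using nd cb_map_nd(1)[OF p] p q i j ic jc split
    by (simp add: cb_map_restrict compose_def restrict_eq_iff)
  then show "\<exists>s i j p q. is_biproduct (OMod TYPE('u) A) E G s i j p q" by blast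
qed

section \<open>Kernel-cokernel pairs\<close>

lemma is_kernelI:
  assumes m: "m \<in> extensional (carrier K)" "cb_map A K m E" and p: "p \<in> extensional (carrier E)" "cb_map A E p G"
    and e: "cb_embedding K m E" and im: "m ` carrier K = map_kernel E p G"
  shows "is_kernel (OMod T A) (K, m, E) (E, p, G)"
  unfolding is_kernel_def
proof (intro conjI ballI impI)
  have "p (m k) = \<zero>\<^bsub>G\<^esub>" if "k \<in> carrier K" for k
    using im that by (auto simp: map_kernel_def)
  then show "Cmp (OMod T A) (E, p, G) (K, m, E) = Null (OMod T A) (Dom (OMod T A) (K, m, E)) (Cod (OMod T A) (E, p, G))"
    by (simp add: compose_def restrict_eq_iff)
  fix n assume "n \<in> Arr (OMod T A)"
  then obtain D f E' where n: "n = (D, f, E')" "f \<in> extensional (carrier D)" "cb_map A D f E'" by (rule ArrE)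
  assume "Cod (OMod T A) n = Dom (OMod T A) (E, p, G) \<and>
    Cmp (OMod T A) (E, p, G) n = Null (OMod T A) (Dom (OMod T A) n) (Cod (OMod T A) (E, p, G))"
  with n have E': "E' = E" and pf: "\<And>d. d \<in> carrier D \<Longrightarrow> p (f d) = \<zero>\<^bsub>G\<^esub>"
    by (simp_all add: compose_def restrict_eq_iff)
  note f = n(3)[unfolded E']
  obtain h where h: "cb_map A D h K" "\<And>d. d \<in> carrier D \<Longrightarrow> m (h d) = f d"
  proof (rule factor_through_embedding[OF m(2) e f])
    show "f d \<in> m ` carrier K" if "d \<in> carrier D" for d
      using pf that cb_map_closed[OF f that] unfolding im by (simp add: map_kernel_def)
  qed blast
  show "\<exists>!g. g \<in> Hom (OMod T A) (Dom (OMod T A) n) (Dom (OMod T A) (K, m, E)) \<and> Cmp (OMod T A) (K, m, E) g = n"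
  proof (rule ex1I)
    show "(D, restrict h (carrier D), K) \<in> Hom (OMod T A) (Dom (OMod T A) n) (Dom (OMod T A) (K, m, E)) \<and>
        Cmp (OMod T A) (K, m, E) (D, restrict h (carrier D), K) = n"
      using n E' h by (simp add: cb_map_restrict compose_def extensional_eq_iff)
    fix g assume g: "g \<in> Hom (OMod T A) (Dom (OMod T A) n) (Dom (OMod T A) (K, m, E)) \<and> Cmp (OMod T A) (K, m, E) g = n"
    then have "g \<in> Hom (OMod T A) D K" using n by simp
    then obtain h' where h': "g = (D, h', K)" "h' \<in> extensional (carrier D)" "cb_map A D h' K" by (rule HomE)
    have "compose (carrier D) m h' = f" using g h' n by simp
    then have mh': "m (h' d) = f d" if "d \<in> carrier D" for d
      using that by (metis compose_eq)
    have "h' d = h d" if "d \<in> carrier D" for d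
      by (rule cb_embedding_inj[OF m(2) e cb_map_closed[OF h'(3) that] cb_map_closed[OF h(1) that]])
        (simp add: mh' h(2) that)
    then show "g = (D, restrict h (carrier D), K)"
      using h' by (simp add: extensional_eq_iff)
  qed
qed (use m p in simp_all)

lemma is_cokernelI:
  assumes m: "m \<in> extensional (carrier K)" "cb_map A K m E" and p: "p \<in> extensional (carrier E)" "cb_map A E p G"
    and q: "cb_quotient E p G" and im: "m ` carrier K = map_kernel E p G"
  shows "is_cokernel (OMod T A) (E, p, G) (K, m, E)"
  unfolding is_cokernel_def
proof (intro conjI ballI impI)
  have "p (m k) = \<zero>\<^bsub>G\<^esub>" if "k \<in> carrier K" for k
    using im that by (auto simp: map_kernel_def)
  then show "Cmp (OMod T A) (E, p, G) (K, m, E) = Null (OMod T A) (Dom (OMod T A) (K, m, E)) (Cod (OMod T A) (E, p, G))"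
    by (simp add: compose_def restrict_eq_iff)
  fix n assume "n \<in> Arr (OMod T A)"
  then obtain E' f D where n: "n = (E', f, D)" "f \<in> extensional (carrier E')" "cb_map A E' f D" by (rule ArrE)
  assume "Dom (OMod T A) n = Cod (OMod T A) (K, m, E) \<and>
    Cmp (OMod T A) n (K, m, E) = Null (OMod T A) (Dom (OMod T A) (K, m, E)) (Cod (OMod T A) n)"
  with n have E': "E' = E" and fm: "\<And>k. k \<in> carrier K \<Longrightarrow> f (m k) = \<zero>\<^bsub>D\<^esub>"
    by (simp_all add: compose_def restrict_eq_iff)
  note f = n(3)[unfolded E']
  obtain h where h: "cb_map A G h D" "\<And>x. x \<in> carrier E \<Longrightarrow> h (p x) = f x"
  proof (rule factor_through_quotient[OF p(2) q f])
    show "f x = \<zero>\<^bsub>D\<^esub>" if "x \<in> carrier E" "p x = \<zero>\<^bsub>G\<^esub>" for x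
    proof -
      have "x \<in> m ` carrier K" unfolding im using that by (simp add: map_kernel_def)
      then show ?thesis using fm by blast
    qed
  qed blast
  show "\<exists>!g. g \<in> Hom (OMod T A) (Cod (OMod T A) (E, p, G)) (Cod (OMod T A) n) \<and> Cmp (OMod T A) g (E, p, G) = n"
  proof (rule ex1I)
    show "(G, restrict h (carrier G), D) \<in> Hom (OMod T A) (Cod (OMod T A) (E, p, G)) (Cod (OMod T A) n) \<and>
        Cmp (OMod T A) (G, restrict h (carrier G), D) (E, p, G) = n"
      using n E' h cb_map_closed[OF p(2)] by (simp add: cb_map_restrict compose_def extensional_eq_iff)
    fix g assume g: "g \<in> Hom (OMod T A) (Cod (OMod T A) (E, p, G)) (Cod (OMod T A) n) \<and> Cmp (OMod T A) g (E, p, G) = n"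
    then have "g \<in> Hom (OMod T A) G D" using n by simp
    then obtain h' where h': "g = (G, h', D)" "h' \<in> extensional (carrier G)" "cb_map A G h' D" by (rule HomE)
    have "compose (carrier E) h' p = f" using g h'(1) n(1) E' by simp
    then have hp: "h' (p x) = f x" if "x \<in> carrier E" for x
      using that by (metis compose_eq)
    have "h' y = h y" if "y \<in> carrier G" for y
      using cb_quotient_surj[OF p(2) q that] hp h(2) by auto
    then show "g = (G, restrict h (carrier G), D)"
      using h' by (simp add: extensional_eq_iff)
  qed
qed (use m p in simp_all)

text \<open>A kernel of \<open>p\<close> differs from the inclusion of the set of zeros of \<open>p\<close> only by an isomorphism.\<close>

lemma is_kernelD:
  assumes "is_kernel (OMod T A) (K, m, E) (E', p, G)"
  shows "E' = E" "m \<in> extensional (carrier K)" "cb_map A K m E" "p \<in> extensional (carrier E)" "cb_map A E p G"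
    "cb_embedding K m E" "m ` carrier K = map_kernel E p G"
proof -
  let ?C = "OMod T A"
  show E': "E' = E" and m: "m \<in> extensional (carrier K)" "cb_map A K m E"
    and p: "p \<in> extensional (carrier E)" "cb_map A E p G"
    using assms by (auto simp: is_kernel_def)
  have pm: "p (m k) = \<zero>\<^bsub>G\<^esub>" if "k \<in> carrier K" for k
    using assms that by (simp add: is_kernel_def compose_def restrict_eq_iff)
  have univ: "\<exists>!g. g \<in> Hom ?C D K \<and> Cmp ?C (K, m, E) g = (D, f, E)"
    if "f \<in> extensional (carrier D)" "cb_map A D f E" "\<And>d. d \<in> carrier D \<Longrightarrow> p (f d) = \<zero>\<^bsub>G\<^esub>" for D f
    using assms[unfolded is_kernel_def E', THEN conjunct2, THEN conjunct2, THEN conjunct2, THEN conjunct2,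
      THEN bspec, of "(D, f, E)"] that by (simp add: compose_def restrict_eq_iff)
  obtain N \<iota> where \<iota>: "cb_map A N \<iota> E" "cb_embedding N \<iota> E" "\<iota> ` carrier N = map_kernel E p G"
    using kernel_exists[OF p(2)] by blast
  have p\<iota>: "p (\<iota> x) = \<zero>\<^bsub>G\<^esub>" if "x \<in> carrier N" for x
    using \<iota>(3) that by (auto simp: map_kernel_def)
  have "\<exists>!g. g \<in> Hom ?C N K \<and> Cmp ?C (K, m, E) g = (N, restrict \<iota> (carrier N), E)"
    by (rule univ) (use \<iota> p\<iota> in \<open>simp_all add: cb_map_restrict\<close>)
  then obtain g where "g \<in> Hom ?C N K" and g_eq: "Cmp ?C (K, m, E) g = (N, restrict \<iota> (carrier N), E)" by blast
  then obtain h where h: "g = (N, h, K)" "cb_map A N h K" by (auto elim: HomE)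
  have mh: "m (h x) = \<iota> x" if "x \<in> carrier N" for x
    using g_eq that unfolding h(1) by (simp add: compose_def restrict_eq_iff)
  show im: "m ` carrier K = map_kernel E p G"
  proof
    show "m ` carrier K \<subseteq> map_kernel E p G"
      using pm cb_map_closed[OF m(2)] by (auto simp: map_kernel_def)
    show "map_kernel E p G \<subseteq> m ` carrier K"
      unfolding \<iota>(3)[symmetric] using mh cb_map_closed[OF h(2)] by (metis image_eqI image_subsetI)
  qed
  obtain k where k: "cb_map A K k N" "\<And>x. x \<in> carrier K \<Longrightarrow> \<iota> (k x) = m x"
  proof (rule factor_through_embedding[OF \<iota>(1,2) m(2)])
    show "m x \<in> \<iota> ` carrier N" if "x \<in> carrier K" for x
      unfolding \<iota>(3) im[symmetric] using that by blast
  qed blast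
  have "\<exists>!g. g \<in> Hom ?C K K \<and> Cmp ?C (K, m, E) g = (K, m, E)"
    by (rule univ) (use m pm in simp_all)
  moreover have "(K, restrict (\<lambda>x. h (k x)) (carrier K), K) \<in> Hom ?C K K \<and>
      Cmp ?C (K, m, E) (K, restrict (\<lambda>x. h (k x)) (carrier K), K) = (K, m, E)"
    using m mh k cb_map_closed[OF k(1)] cb_map_comp[OF k(1) h(2)]
    by (simp add: cb_map_restrict compose_def extensional_eq_iff)
  moreover have "(K, restrict (\<lambda>x. x) (carrier K), K) \<in> Hom ?C K K \<and>
      Cmp ?C (K, m, E) (K, restrict (\<lambda>x. x) (carrier K), K) = (K, m, E)"
    using m cb_map_id[OF cb_map_nd(1)[OF m(2)]] by (simp add: cb_map_restrict compose_def extensional_eq_iff)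
  ultimately have "(K, restrict (\<lambda>x. h (k x)) (carrier K), K) = (K, restrict (\<lambda>x. x) (carrier K), K)"
    by blast
  then have hk: "h (k x) = x" if "x \<in> carrier K" for x
    using that by (simp add: restrict_eq_iff)
  have "cb_embedding K (\<lambda>x. \<iota> (k x)) E"
    by (rule cb_embedding_comp[OF k(1) cb_embedding_left_inverse[OF k(1) h(2) hk] \<iota>(2)])
  then show "cb_embedding K m E"
    by (rule cb_embedding_cong[OF cb_map_comp[OF k(1) \<iota>(1)]]) (rule k(2))
qed

text \<open>A cokernel differs from the quotient by the zeros of \<open>p\<close> only by an isomorphism.\<close>

lemma is_cokernelD:
  assumes ker: "m ` carrier K = map_kernel E p G" and m: "m \<in> extensional (carrier K)" "cb_map A K m E"
    and p: "p \<in> extensional (carrier E)" "cb_map A E p G"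
    and coker: "is_cokernel (OMod T A) (E, p, G) (K, m, E)"
  shows "cb_quotient E p G"
proof -
  let ?C = "OMod T A"
  have pm: "p (m k) = \<zero>\<^bsub>G\<^esub>" if "k \<in> carrier K" for k
    using ker that by (auto simp: map_kernel_def)
  have univ: "\<exists>!g. g \<in> Hom ?C G D \<and> Cmp ?C g (E, p, G) = (E, f, D)"
    if "f \<in> extensional (carrier E)" "cb_map A E f D" "\<And>k. k \<in> carrier K \<Longrightarrow> f (m k) = \<zero>\<^bsub>D\<^esub>" for D f
    using coker[unfolded is_cokernel_def, THEN conjunct2, THEN conjunct2, THEN conjunct2, THEN conjunct2,
      THEN bspec, of "(E, f, D)"] that by (simp add: compose_def restrict_eq_iff)
  obtain N \<iota> where \<iota>: "cb_map A N \<iota> E" "cb_embedding N \<iota> E" "\<iota> ` carrier N = map_kernel E p G"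
    using kernel_exists[OF p(2)] by blast
  obtain Q q where q: "cb_map A E q Q" "cb_quotient E q Q" "map_kernel E q Q = \<iota> ` carrier N"
    using cokernel_exists[OF \<iota>(1,2)] by blast
  have kerq: "q x = \<zero>\<^bsub>Q\<^esub> \<longleftrightarrow> p x = \<zero>\<^bsub>G\<^esub>" if "x \<in> carrier E" for x
    using q(3) that unfolding \<iota>(3) map_kernel_def by blast
  have "\<exists>!g. g \<in> Hom ?C G Q \<and> Cmp ?C g (E, p, G) = (E, restrict q (carrier E), Q)"
    by (rule univ) (use q kerq pm cb_map_closed[OF m(2)] in \<open>simp_all add: cb_map_restrict\<close>)
  then obtain g where "g \<in> Hom ?C G Q" and g_eq: "Cmp ?C g (E, p, G) = (E, restrict q (carrier E), Q)" by blast
  then obtain h where h: "g = (G, h, Q)" "cb_map A G h Q" by (auto elim: HomE)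
  have hp: "h (p x) = q x" if "x \<in> carrier E" for x
    using g_eq that unfolding h(1) by (simp add: compose_def restrict_eq_iff)
  obtain k where k: "cb_map A Q k G" "\<And>x. x \<in> carrier E \<Longrightarrow> k (q x) = p x"
    by (rule factor_through_quotient[OF q(1,2) p(2)]) (use kerq in blast)+
  have "\<exists>!g. g \<in> Hom ?C G G \<and> Cmp ?C g (E, p, G) = (E, p, G)"
    by (rule univ) (use p pm in simp_all)
  moreover have "(G, restrict (\<lambda>x. k (h x)) (carrier G), G) \<in> Hom ?C G G \<and>
      Cmp ?C (G, restrict (\<lambda>x. k (h x)) (carrier G), G) (E, p, G) = (E, p, G)"
    using p hp k cb_map_closed[OF p(2)] cb_map_comp[OF h(2) k(1)]
    by (simp add: cb_map_restrict compose_def extensional_eq_iff)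
  moreover have "(G, restrict (\<lambda>x. x) (carrier G), G) \<in> Hom ?C G G \<and>
      Cmp ?C (G, restrict (\<lambda>x. x) (carrier G), G) (E, p, G) = (E, p, G)"
    using p cb_map_id[OF cb_map_nd(2)[OF p(2)]] cb_map_closed[OF p(2)]
    by (simp add: cb_map_restrict compose_def extensional_eq_iff)
  ultimately have "(G, restrict (\<lambda>x. k (h x)) (carrier G), G) = (G, restrict (\<lambda>x. x) (carrier G), G)"
    by blast
  then have kh: "k (h y) = y" if "y \<in> carrier G" for y
    using that by (simp add: restrict_eq_iff)
  have "cb_quotient E (\<lambda>x. k (q x)) G"
    by (rule cb_quotient_comp[OF q(2) cb_quotient_right_inverse[OF h(2) kh]])
  then show ?thesis
    by (rule cb_quotient_cong) (rule k(2))
qed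

lemma kernel_cokernel_pairs_iff:
  "((K, m, E), (E', p, G)) \<in> kernel_cokernel_pairs (OMod T A) \<longleftrightarrow>
     E' = E \<and> m \<in> extensional (carrier K) \<and> cb_map A K m E \<and> p \<in> extensional (carrier E) \<and> cb_map A E p G \<and>
     cb_embedding K m E \<and> cb_quotient E p G \<and> m ` carrier K = map_kernel E p G"
proof
  assume "((K, m, E), (E', p, G)) \<in> kernel_cokernel_pairs (OMod T A)"
  then have k: "is_kernel (OMod T A) (K, m, E) (E', p, G)" and c: "is_cokernel (OMod T A) (E', p, G) (K, m, E)"
    by (auto simp: kernel_cokernel_pairs_def)
  note d = is_kernelD[OF k]
  show "E' = E \<and> m \<in> extensional (carrier K) \<and> cb_map A K m E \<and> p \<in> extensional (carrier E) \<and> cb_map A E p G \<and>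
     cb_embedding K m E \<and> cb_quotient E p G \<and> m ` carrier K = map_kernel E p G"
    using d is_cokernelD[OF d(7,2,3,4,5) c[unfolded d(1)]] by simp
qed (auto simp: kernel_cokernel_pairs_def intro: is_kernelI is_cokernelI)

lemma adm_mono_iff:
  "adm_mono (kernel_cokernel_pairs (OMod T A)) (K, m, E) \<longleftrightarrow>
     m \<in> extensional (carrier K) \<and> cb_map A K m E \<and> cb_embedding K m E"
proof
  assume "adm_mono (kernel_cokernel_pairs (OMod T A)) (K, m, E)"
  then show "m \<in> extensional (carrier K) \<and> cb_map A K m E \<and> cb_embedding K m E"
    by (auto simp: adm_mono_def kernel_cokernel_pairs_iff)
next
  assume m: "m \<in> extensional (carrier K) \<and> cb_map A K m E \<and> cb_embedding K m E"
  then obtain Q q where q: "cb_map A E q Q" "cb_quotient E q Q" "map_kernel E q Q = m ` carrier K"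
    using cokernel_exists by blast
  have "map_kernel E (restrict q (carrier E)) Q = map_kernel E q Q"
    by (auto simp: map_kernel_def)
  then have "((K, m, E), (E, restrict q (carrier E), Q)) \<in> kernel_cokernel_pairs (OMod T A)"
    using m q cb_quotient_cong[OF q(2), of "restrict q (carrier E)"]
    by (simp add: kernel_cokernel_pairs_iff cb_map_restrict)
  then show "adm_mono (kernel_cokernel_pairs (OMod T A)) (K, m, E)"
    by (auto simp: adm_mono_def)
qed

lemma adm_epi_iff:
  "adm_epi (kernel_cokernel_pairs (OMod T A)) (E, p, G) \<longleftrightarrow>
     p \<in> extensional (carrier E) \<and> cb_map A E p G \<and> cb_quotient E p G"
proof
  assume "adm_epi (kernel_cokernel_pairs (OMod T A)) (E, p, G)"
  then show "p \<in> extensional (carrier E) \<and> cb_map A E p G \<and> cb_quotient E p G"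
    by (auto simp: adm_epi_def kernel_cokernel_pairs_iff)
next
  assume p: "p \<in> extensional (carrier E) \<and> cb_map A E p G \<and> cb_quotient E p G"
  then obtain K m where m: "cb_map A K m E" "cb_embedding K m E" "m ` carrier K = map_kernel E p G"
    using kernel_exists by blast
  have "((K, restrict m (carrier K), E), (E, p, G)) \<in> kernel_cokernel_pairs (OMod T A)"
    using p m cb_embedding_cong[OF m(1,2), of "restrict m (carrier K)"]
    by (simp add: kernel_cokernel_pairs_iff cb_map_restrict)
  then show "adm_epi (kernel_cokernel_pairs (OMod T A)) (E, p, G)"
    by (auto simp: adm_epi_def)
qed

end

section \<open>The axioms of an exact structure\<close>

context operator_algebra_with_unit begin

lemma cb_embedding_of_comp:
  assumes f: "cb_map A E f G" and g: "cb_map A G g H" and e: "cb_embedding E (\<lambda>x. g (f x)) H"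
  shows "cb_embedding E f G"
proof -
  interpret f: linear_between E G f by (rule cb_mapD[OF f])
  obtain b where b: "0 < b" "\<And>n x. x \<in> mats E n n \<Longrightarrow> mnorm E n x \<le> b * mnorm H n (\<lambda>i j. g (f (x i j)))"
    using e by (auto simp: cb_embedding_def)
  obtain c where c: "0 < c" "\<And>n x. x \<in> mats G n n \<Longrightarrow> mnorm H n (\<lambda>i j. g (x i j)) \<le> c * mnorm G n x"
    by (rule cb_map_bound[OF g]) blast
  have "mnorm E n x \<le> (b * c) * mnorm G n (\<lambda>i j. f (x i j))" if x: "x \<in> mats E n n" for n x
    by (rule bound_trans[OF b(2)[OF x] c(2)[OF f.mats[OF x]] b(1)])
  then show ?thesis
    unfolding cb_embedding_def using b(1) c(1) by (intro exI[of _ "b * c"]) auto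
qed

lemma cb_quotient_of_comp:
  assumes f: "cb_map A E f G" and q: "cb_quotient E (\<lambda>x. g (f x)) H"
  shows "cb_quotient G g H"
proof -
  interpret f: linear_between E G f by (rule cb_mapD[OF f])
  obtain b where b: "0 < b" "\<And>n y. y \<in> mats H n n \<Longrightarrow> \<exists>x\<in>mats E n n.
      (\<forall>i<n. \<forall>j<n. g (f (x i j)) = y i j) \<and> mnorm E n x \<le> b * mnorm H n y"
    using q unfolding cb_quotient_def by blast
  obtain c where c: "0 < c" "\<And>n x. x \<in> mats E n n \<Longrightarrow> mnorm G n (\<lambda>i j. f (x i j)) \<le> c * mnorm E n x"
    by (rule cb_map_bound[OF f]) blast
  have "\<exists>z\<in>mats G n n. (\<forall>i<n. \<forall>j<n. g (z i j) = y i j) \<and> mnorm G n z \<le> (c * b) * mnorm H n y"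
    if y: "y \<in> mats H n n" for n y
  proof -
    obtain x where x: "x \<in> mats E n n" "\<forall>i<n. \<forall>j<n. g (f (x i j)) = y i j" "mnorm E n x \<le> b * mnorm H n y"
      using b(2)[OF y] by blast
    show ?thesis
      by (intro bexI[OF _ f.mats[OF x(1)]] conjI x(2) bound_trans[OF c(2)[OF x(1)] x(3) c(1)])
  qed
  then show ?thesis
    unfolding cb_quotient_def using b(1) c(1) by (intro exI[of _ "c * b"]) auto
qed

lemma is_isoD:
  assumes "is_iso (OMod T A) (E, f, G)"
  obtains g where "cb_map A E f G" "cb_map A G g E"
    "\<And>x. x \<in> carrier E \<Longrightarrow> g (f x) = x" "\<And>y. y \<in> carrier G \<Longrightarrow> f (g y) = y"
proof -
  obtain k where f: "cb_map A E f G" and k: "k \<in> Hom (OMod T A) G E"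
    and eq: "Cmp (OMod T A) k (E, f, G) = Idn (OMod T A) E" "Cmp (OMod T A) (E, f, G) k = Idn (OMod T A) G"
    using assms unfolding is_iso_def by auto
  obtain g where g: "k = (G, g, E)" "cb_map A G g E" using k by (rule HomE)
  have inv: "\<forall>x\<in>carrier E. g (f x) = x" "\<forall>y\<in>carrier G. f (g y) = y"
    using eq unfolding g(1) by (simp_all add: compose_def restrict_eq_iff)
  show ?thesis
    by (rule that[OF f g(2) bspec[OF inv(1)] bspec[OF inv(2)]])
qed

text \<open>Isomorphisms are embeddings as well as quotient maps, so that the maps of an isomorphic pair are
  composites of maps of the same kind.\<close>

lemma iso_closed_kernel_cokernel_pairs: "iso_closed (OMod T A) (kernel_cokernel_pairs (OMod T A))"
proof -
  let ?C = "OMod T A"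
  have "(M', P') \<in> kernel_cokernel_pairs ?C"
    if MP: "(M, P) \<in> kernel_cokernel_pairs ?C" and M': "M' \<in> Arr ?C" and P': "P' \<in> Arr ?C" and cd: "Cod ?C M' = Dom ?C P'"
      and iso: "is_iso ?C a" "is_iso ?C b" "is_iso ?C c"
      and hom: "a \<in> Hom ?C (Dom ?C M) (Dom ?C M')" "b \<in> Hom ?C (Cod ?C M) (Cod ?C M')" "c \<in> Hom ?C (Cod ?C P) (Cod ?C P')"
      and comm: "Cmp ?C b M = Cmp ?C M' a" "Cmp ?C c P = Cmp ?C P' b"
    for M P M' P' a b c
  proof -
    obtain K m E where M: "M = (K, m, E)" by (cases M)
    obtain E0 p G where P0: "P = (E0, p, G)" by (cases P)
    note MP' = MP[unfolded M P0 kernel_cokernel_pairs_iff]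
    then have P: "P = (E, p, G)" using P0 by simp
    have m: "cb_map A K m E" "cb_embedding K m E" and p: "cb_map A E p G" "cb_quotient E p G"
      and ker: "m ` carrier K = map_kernel E p G"
      using MP' by auto
    obtain K' m' E' where M'eq: "M' = (K', m', E')" and m': "m' \<in> extensional (carrier K')" "cb_map A K' m' E'"
      using M' by (rule ArrE)
    obtain E1 p' G' where P'eq0: "P' = (E1, p', G')" and p'0: "p' \<in> extensional (carrier E1)" "cb_map A E1 p' G'"
      using P' by (rule ArrE)
    have E1: "E1 = E'" using cd M'eq P'eq0 by simp
    note P'eq = P'eq0[unfolded E1] and p' = p'0[unfolded E1]
    obtain fa where a: "a = (K, fa, K')" using hom(1) M M'eq by (auto elim: HomE)
    obtain fb where b: "b = (E, fb, E')" using hom(2) M M'eq by (auto elim: HomE)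
    obtain fc where c: "c = (G, fc, G')" using hom(3) P P'eq by (auto elim: HomE)
    obtain ga where ga: "cb_map A K fa K'" "cb_map A K' ga K" "\<And>x. x \<in> carrier K \<Longrightarrow> ga (fa x) = x" "\<And>y. y \<in> carrier K' \<Longrightarrow> fa (ga y) = y"
      by (rule is_isoD[OF iso(1)[unfolded a]]) blast
    obtain gb where gb: "cb_map A E fb E'" "cb_map A E' gb E" "\<And>x. x \<in> carrier E \<Longrightarrow> gb (fb x) = x" "\<And>y. y \<in> carrier E' \<Longrightarrow> fb (gb y) = y"
      by (rule is_isoD[OF iso(2)[unfolded b]]) blast
    obtain gc where gc: "cb_map A G fc G'" "cb_map A G' gc G" "\<And>x. x \<in> carrier G \<Longrightarrow> gc (fc x) = x" "\<And>y. y \<in> carrier G' \<Longrightarrow> fc (gc y) = y"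
      by (rule is_isoD[OF iso(3)[unfolded c]]) blast
    have bm: "fb (m x) = m' (fa x)" if "x \<in> carrier K" for x
      using comm(1) that unfolding a b M M'eq by (simp add: compose_def restrict_eq_iff)
    have cp: "fc (p x) = p' (fb x)" if "x \<in> carrier E" for x
      using comm(2) that unfolding b c P P'eq by (simp add: compose_def restrict_eq_iff)
    have m'_eq: "fb (m (ga y)) = m' y" if "y \<in> carrier K'" for y
      using bm[OF cb_map_closed[OF ga(2) that]] ga(4)[OF that] by simp
    have p'_eq: "fc (p (gb y)) = p' y" if "y \<in> carrier E'" for y
      using cp[OF cb_map_closed[OF gb(2) that]] gb(4)[OF that] by simp
    have "cb_embedding K' (\<lambda>y. m (ga y)) E"
      by (rule cb_embedding_comp[OF ga(2) cb_embedding_left_inverse[OF ga(2,1,4)] m(2)])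
    then have "cb_embedding K' (\<lambda>y. fb (m (ga y))) E'"
      by (rule cb_embedding_comp[OF cb_map_comp[OF ga(2) m(1)] _ cb_embedding_left_inverse[OF gb(1,2,3)]])
    then have em: "cb_embedding K' m' E'"
      by (rule cb_embedding_cong[OF cb_map_comp[OF cb_map_comp[OF ga(2) m(1)] gb(1)]]) (rule m'_eq)
    have "cb_quotient E' (\<lambda>y. p (gb y)) G"
      by (rule cb_quotient_comp[OF cb_quotient_right_inverse[OF gb(1,3)] p(2)])
    then have "cb_quotient E' (\<lambda>y. fc (p (gb y))) G'"
      by (rule cb_quotient_comp[OF _ cb_quotient_right_inverse[OF gc(2,4)]])
    then have qp: "cb_quotient E' p' G'"
      by (rule cb_quotient_cong) (rule p'_eq)
    note zero = linear_between.zero[OF cb_mapD(3)[OF gc(1)]] linear_between.zero[OF cb_mapD(3)[OF gc(2)]]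
    have "m' ` carrier K' = map_kernel E' p' G'"
    proof (intro subset_antisym subsetI)
      fix z assume "z \<in> m' ` carrier K'"
      then obtain y where y: "y \<in> carrier K'" "z = m' y" by blast
      define k where "k = ga y"
      have k: "k \<in> carrier K" unfolding k_def by (rule cb_map_closed[OF ga(2) y(1)])
      have z: "z = fb (m k)" using m'_eq[OF y(1)] y(2) by (simp add: k_def)
      have mk: "m k \<in> carrier E" "p (m k) = \<zero>\<^bsub>G\<^esub>"
        using ker k by (auto simp: map_kernel_def)
      have "p' z = \<zero>\<^bsub>G'\<^esub>"
        using cp[OF mk(1)] mk(2) zero(1) z by simp
      then show "z \<in> map_kernel E' p' G'"
        using z cb_map_closed[OF gb(1) mk(1)] by (simp add: map_kernel_def)
    next
      fix z assume "z \<in> map_kernel E' p' G'"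
      then have z: "z \<in> carrier E'" "p' z = \<zero>\<^bsub>G'\<^esub>" by (auto simp: map_kernel_def)
      have x: "gb z \<in> carrier E" by (rule cb_map_closed[OF gb(2) z(1)])
      have "fc (p (gb z)) = \<zero>\<^bsub>G'\<^esub>" using p'_eq[OF z(1)] z(2) by simp
      then have "p (gb z) = \<zero>\<^bsub>G\<^esub>"
        using gc(3)[OF cb_map_closed[OF p(1) x]] zero(2) by simp
      then have "gb z \<in> m ` carrier K" unfolding ker using x by (simp add: map_kernel_def)
      then obtain k where k: "k \<in> carrier K" "gb z = m k" by blast
      have "z = m' (fa k)"
        using gb(4)[OF z(1)] bm[OF k(1)] k(2) by simp
      then show "z \<in> m' ` carrier K'"
        using cb_map_closed[OF ga(1) k(1)] by blast
    qed
    then show ?thesis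
      unfolding M'eq P'eq kernel_cokernel_pairs_iff using m' p' em qp by simp
  qed
  then show ?thesis
    unfolding iso_closed_def by blast
qed

lemma pushout_OMod:
  assumes m: "m \<in> extensional (carrier K)" "cb_map A K m E" "cb_embedding K m E"
    and f: "f \<in> extensional (carrier K)" "cb_map A K f G"
  obtains P f' m' where "is_pushout (OMod T A) (K, m, E) (K, f, G) (E, f', P) (G, m', P)"
    "f' \<in> extensional (carrier E)" "cb_map A E f' P"
    "m' \<in> extensional (carrier G)" "cb_map A G m' P" "cb_embedding G m' P"
proof -
  obtain P f0 m0 where f0: "cb_map A E f0 P" and m0: "cb_map A G m0 P" and comm: "\<forall>k\<in>carrier K. f0 (m k) = m0 (f k)"
    and e: "cb_embedding G m0 P" and span: "\<forall>z\<in>carrier P. \<exists>x\<in>carrier E. \<exists>y\<in>carrier G. z = f0 x \<oplus>\<^bsub>P\<^esub> m0 y"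
    and univ: "\<forall>Z u v. cb_map A E u Z \<longrightarrow> cb_map A G v Z \<longrightarrow> (\<forall>k\<in>carrier K. u (m k) = v (f k)) \<longrightarrow>
      (\<exists>w. cb_map A P w Z \<and> (\<forall>x\<in>carrier E. w (f0 x) = u x) \<and> (\<forall>y\<in>carrier G. w (m0 y) = v y))"
    using pushout_exists[OF m(2,3) f(2)] by (elim exE conjE) (rule that; assumption)
  define f' m' where "f' = restrict f0 (carrier E)" and "m' = restrict m0 (carrier G)"
  have f': "f' \<in> extensional (carrier E)" "cb_map A E f' P" and m': "m' \<in> extensional (carrier G)" "cb_map A G m' P"
    using f0 m0 by (simp_all add: f'_def m'_def cb_map_restrict)
  have e': "cb_embedding G m' P"
    by (rule cb_embedding_cong[OF m0 e]) (simp add: m'_def)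
  note mc = cb_map_closed[OF m(2)] and fc = cb_map_closed[OF f(2)]
  have "is_pushout (OMod T A) (K, m, E) (K, f, G) (E, f', P) (G, m', P)"
    unfolding is_pushout_def
  proof (intro conjI ballI impI)
    show "{(K, m, E), (K, f, G), (E, f', P), (G, m', P)} \<subseteq> Arr (OMod T A)"
      using m f f' m' by simp
    show "Cmp (OMod T A) (E, f', P) (K, m, E) = Cmp (OMod T A) (G, m', P) (K, f, G)"
      using comm mc fc by (simp add: compose_def restrict_eq_iff f'_def m'_def)
    fix U V assume "U \<in> Arr (OMod T A)" "V \<in> Arr (OMod T A)"
    then obtain E1 u Z G1 v Z1 where U0: "U = (E1, u, Z)" "u \<in> extensional (carrier E1)" "cb_map A E1 u Z"
      and V0: "V = (G1, v, Z1)" "v \<in> extensional (carrier G1)" "cb_map A G1 v Z1" by (elim ArrE) blast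
    assume *: "Dom (OMod T A) U = Cod (OMod T A) (K, m, E) \<and> Dom (OMod T A) V = Cod (OMod T A) (K, f, G) \<and>
        Cod (OMod T A) U = Cod (OMod T A) V \<and> Cmp (OMod T A) U (K, m, E) = Cmp (OMod T A) V (K, f, G)"
    then have eqs: "E1 = E" "G1 = G" "Z1 = Z" using U0 V0 by simp_all
    note U = U0[unfolded eqs] and V = V0[unfolded eqs]
    have uv: "\<forall>k\<in>carrier K. u (m k) = v (f k)"
      using * U(1) V(1) by (simp add: compose_def restrict_eq_iff)
    obtain w where w: "cb_map A P w Z" "\<forall>x\<in>carrier E. w (f0 x) = u x" "\<forall>y\<in>carrier G. w (m0 y) = v y"
      using univ[THEN spec, THEN spec, THEN spec, THEN mp, THEN mp, THEN mp, OF U(3) V(3) uv] by blast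
    note f0c = cb_map_closed[OF f0] and m0c = cb_map_closed[OF m0]
    show "\<exists>!W. W \<in> Hom (OMod T A) (Cod (OMod T A) (E, f', P)) (Cod (OMod T A) U) \<and>
        Cmp (OMod T A) W (E, f', P) = U \<and> Cmp (OMod T A) W (G, m', P) = V"
    proof (rule ex1I)
      show "(P, restrict w (carrier P), Z) \<in> Hom (OMod T A) (Cod (OMod T A) (E, f', P)) (Cod (OMod T A) U) \<and>
        Cmp (OMod T A) (P, restrict w (carrier P), Z) (E, f', P) = U \<and>
        Cmp (OMod T A) (P, restrict w (carrier P), Z) (G, m', P) = V"
        using U V w f0c m0c by (simp add: cb_map_restrict compose_def extensional_eq_iff f'_def m'_def)
      fix W assume W: "W \<in> Hom (OMod T A) (Cod (OMod T A) (E, f', P)) (Cod (OMod T A) U) \<and>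
        Cmp (OMod T A) W (E, f', P) = U \<and> Cmp (OMod T A) W (G, m', P) = V"
      then have "W \<in> Hom (OMod T A) P Z" using U(1) by simp
      then obtain w' where w': "W = (P, w', Z)" "w' \<in> extensional (carrier P)" "cb_map A P w' Z" by (rule HomE)
      have w'f: "w' (f0 x) = u x" if "x \<in> carrier E" for x
        using W that U(2) unfolding w'(1) U(1) by (simp add: compose_def extensional_eq_iff f'_def)
      have w'm: "w' (m0 y) = v y" if "y \<in> carrier G" for y
        using W that V(2) unfolding w'(1) V(1) by (simp add: compose_def extensional_eq_iff m'_def)
      have "w' z = w z" if z: "z \<in> carrier P" for z
      proof -
        obtain x y where xy: "x \<in> carrier E" "y \<in> carrier G" "z = f0 x \<oplus>\<^bsub>P\<^esub> m0 y"
          using span z by blast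
        show ?thesis
          using xy w'f[OF xy(1)] w'm[OF xy(2)] w(2,3) f0c[OF xy(1)] m0c[OF xy(2)]
            linear_between.add[OF cb_mapD(3)[OF w'(3)], of "f0 x" "m0 y"]
            linear_between.add[OF cb_mapD(3)[OF w(1)], of "f0 x" "m0 y"] by simp
      qed
      then show "W = (P, restrict w (carrier P), Z)"
        using w' by (simp add: extensional_eq_iff)
    qed
  qed simp_all
  then show ?thesis using that f' m' e' by blast
qed

lemma pullback_OMod:
  assumes p: "p \<in> extensional (carrier E)" "cb_map A E p G" "cb_quotient E p G"
    and f: "f \<in> extensional (carrier D)" "cb_map A D f G"
  obtains P f' p' where "is_pullback (OMod T A) (E, p, G) (D, f, G) (P, f', E) (P, p', D)"
    "f' \<in> extensional (carrier P)" "cb_map A P f' E"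
    "p' \<in> extensional (carrier P)" "cb_map A P p' D" "cb_quotient P p' D"
proof -
  obtain P f0 p0 where f0: "cb_map A P f0 E" and p0: "cb_map A P p0 D" and comm: "\<forall>z\<in>carrier P. p (f0 z) = f (p0 z)"
    and q: "cb_quotient P p0 D" and inj: "\<forall>z\<in>carrier P. \<forall>z'\<in>carrier P. f0 z = f0 z' \<longrightarrow> p0 z = p0 z' \<longrightarrow> z = z'"
    and univ: "\<forall>T u v. cb_map A T u E \<longrightarrow> cb_map A T v D \<longrightarrow> (\<forall>t\<in>carrier T. p (u t) = f (v t)) \<longrightarrow>
      (\<exists>w. cb_map A T w P \<and> (\<forall>t\<in>carrier T. f0 (w t) = u t \<and> p0 (w t) = v t))"
    using pullback_exists[OF p(2,3) f(2)] by (elim exE conjE) (rule that; assumption)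
  define f' p' where "f' = restrict f0 (carrier P)" and "p' = restrict p0 (carrier P)"
  have f': "f' \<in> extensional (carrier P)" "cb_map A P f' E" and p': "p' \<in> extensional (carrier P)" "cb_map A P p' D"
    using f0 p0 by (simp_all add: f'_def p'_def cb_map_restrict)
  have q': "cb_quotient P p' D"
    by (rule cb_quotient_cong[OF q]) (simp add: p'_def)
  have "is_pullback (OMod T A) (E, p, G) (D, f, G) (P, f', E) (P, p', D)"
    unfolding is_pullback_def
  proof (intro conjI ballI impI)
    show "{(E, p, G), (D, f, G), (P, f', E), (P, p', D)} \<subseteq> Arr (OMod T A)"
      using p f f' p' by simp
    show "Cmp (OMod T A) (E, p, G) (P, f', E) = Cmp (OMod T A) (D, f, G) (P, p', D)"
      using comm by (simp add: compose_def restrict_eq_iff f'_def p'_def)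
    fix U V assume "U \<in> Arr (OMod T A)" "V \<in> Arr (OMod T A)"
    then obtain Z u E1 Z1 v D1 where U0: "U = (Z, u, E1)" "u \<in> extensional (carrier Z)" "cb_map A Z u E1"
      and V0: "V = (Z1, v, D1)" "v \<in> extensional (carrier Z1)" "cb_map A Z1 v D1" by (elim ArrE) blast
    assume *: "Cod (OMod T A) U = Dom (OMod T A) (E, p, G) \<and> Cod (OMod T A) V = Dom (OMod T A) (D, f, G) \<and>
        Dom (OMod T A) U = Dom (OMod T A) V \<and> Cmp (OMod T A) (E, p, G) U = Cmp (OMod T A) (D, f, G) V"
    then have eqs: "E1 = E" "D1 = D" "Z1 = Z" using U0 V0 by simp_all
    note U = U0[unfolded eqs] and V = V0[unfolded eqs]
    have uv: "\<forall>t\<in>carrier Z. p (u t) = f (v t)"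
      using * U(1) V(1) by (simp add: compose_def restrict_eq_iff)
    obtain w where w: "cb_map A Z w P" "\<forall>t\<in>carrier Z. f0 (w t) = u t \<and> p0 (w t) = v t"
      using univ[THEN spec, THEN spec, THEN spec, THEN mp, THEN mp, THEN mp, OF U(3) V(3) uv] by blast
    note wc = cb_map_closed[OF w(1)]
    show "\<exists>!W. W \<in> Hom (OMod T A) (Dom (OMod T A) U) (Dom (OMod T A) (P, f', E)) \<and>
        Cmp (OMod T A) (P, f', E) W = U \<and> Cmp (OMod T A) (P, p', D) W = V"
    proof (rule ex1I)
      show "(Z, restrict w (carrier Z), P) \<in> Hom (OMod T A) (Dom (OMod T A) U) (Dom (OMod T A) (P, f', E)) \<and>
        Cmp (OMod T A) (P, f', E) (Z, restrict w (carrier Z), P) = U \<and>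
        Cmp (OMod T A) (P, p', D) (Z, restrict w (carrier Z), P) = V"
        using U V w wc by (simp add: cb_map_restrict compose_def extensional_eq_iff f'_def p'_def)
      fix W assume W: "W \<in> Hom (OMod T A) (Dom (OMod T A) U) (Dom (OMod T A) (P, f', E)) \<and>
        Cmp (OMod T A) (P, f', E) W = U \<and> Cmp (OMod T A) (P, p', D) W = V"
      then have "W \<in> Hom (OMod T A) Z P" using U(1) by simp
      then obtain w' where w': "W = (Z, w', P)" "w' \<in> extensional (carrier Z)" "cb_map A Z w' P" by (rule HomE)
      note w'c = cb_map_closed[OF w'(3)]
      have "f0 (w' t) = u t \<and> p0 (w' t) = v t" if "t \<in> carrier Z" for t
        using W that U(2) V(2) w'c unfolding w'(1) U(1) V(1) by (simp add: compose_def extensional_eq_iff f'_def p'_def)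
      then have "w' t = w t" if "t \<in> carrier Z" for t
        using inj w(2) wc[OF that] w'c[OF that] that by metis
      then show "W = (Z, restrict w (carrier Z), P)"
        using w' by (simp add: extensional_eq_iff)
    qed
  qed simp_all
  then show ?thesis using that f' p' q' by blast
qed

text \<open>The map into an arbitrary pushout is a first factor of the one into the pushout constructed above, and
  a first factor of an embedding is an embedding.\<close>

lemma pushout_adm_mono:
  assumes M: "adm_mono (kernel_cokernel_pairs (OMod T A)) M" and f: "f \<in> Arr (OMod T A)" "Dom (OMod T A) f = Dom (OMod T A) M"
  shows "(\<exists>f' M'. is_pushout (OMod T A) M f f' M') \<and>
    (\<forall>f' M'. is_pushout (OMod T A) M f f' M' \<longrightarrow> adm_mono (kernel_cokernel_pairs (OMod T A)) M')"
proof -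
  let ?C = "OMod T A"
  obtain K m E where M_eq: "M = (K, m, E)" by (cases M)
  then have m: "m \<in> extensional (carrier K)" "cb_map A K m E" "cb_embedding K m E"
    using M by (auto simp: adm_mono_iff)
  obtain K1 g G where f0: "f = (K1, g, G)" "g \<in> extensional (carrier K1)" "cb_map A K1 g G" using f(1) by (rule ArrE)
  have K1: "K1 = K" using f(2) f0(1) M_eq by simp
  note f_eq = f0[unfolded K1]
  obtain P f' m' where po: "is_pushout ?C (K, m, E) (K, g, G) (E, f', P) (G, m', P)"
    and f': "f' \<in> extensional (carrier E)" "cb_map A E f' P"
    and m': "m' \<in> extensional (carrier G)" "cb_map A G m' P" "cb_embedding G m' P"
    by (rule pushout_OMod[OF m f_eq(2,3)])
  have "adm_mono (kernel_cokernel_pairs ?C) M''" if po'': "is_pushout ?C M f f'' M''" for f'' M''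
  proof -
    have "M'' \<in> Arr ?C" "Dom ?C M'' = Cod ?C f" "Cod ?C f'' = Cod ?C M''"
      using po'' by (simp_all add: is_pushout_def)
    then obtain m'' P'' where M'': "M'' = (G, m'', P'')" "m'' \<in> extensional (carrier G)" "cb_map A G m'' P''"
      and cod: "Cod ?C f'' = P''"
      using f_eq(1) by (auto elim!: ArrE)
    have "(E, f', P) \<in> Arr ?C" "(G, m', P) \<in> Arr ?C" "Cmp ?C (E, f', P) M = Cmp ?C (G, m', P) f"
      using po f' m' unfolding M_eq f_eq(1) by (simp_all add: is_pushout_def)
    then have "\<exists>!w. w \<in> Hom ?C (Cod ?C f'') (Cod ?C (E, f', P)) \<and> Cmp ?C w f'' = (E, f', P) \<and> Cmp ?C w M'' = (G, m', P)"
      using po''[unfolded is_pushout_def, THEN conjunct2, THEN conjunct2, THEN conjunct2, THEN conjunct2,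
        THEN conjunct2, THEN conjunct2, THEN bspec, THEN bspec, of "(E, f', P)" "(G, m', P)"]
      by (simp add: M_eq f_eq(1))
    then obtain W where W: "W \<in> Hom ?C P'' P" "Cmp ?C W M'' = (G, m', P)"
      using cod by auto
    obtain w where w: "W = (P'', w, P)" "cb_map A P'' w P" using W(1) by (rule HomE)
    have "w (m'' y) = m' y" if "y \<in> carrier G" for y
      using W(2) that m'(1) unfolding w(1) M''(1) by (simp add: compose_def extensional_eq_iff)
    then have "cb_embedding G (\<lambda>y. w (m'' y)) P"
      using cb_embedding_cong[OF m'(2,3), of "\<lambda>y. w (m'' y)"] by simp
    then have "cb_embedding G m'' P''"
      by (rule cb_embedding_of_comp[OF M''(3) w(2)])
    then show ?thesis
      using M'' by (simp add: adm_mono_iff)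
  qed
  then show ?thesis
    using po unfolding M_eq f_eq(1) by blast
qed

text \<open>Dually, a second factor of a quotient map is a quotient map.\<close>

lemma pullback_adm_epi:
  assumes M: "adm_epi (kernel_cokernel_pairs (OMod T A)) M" and f: "f \<in> Arr (OMod T A)" "Cod (OMod T A) f = Cod (OMod T A) M"
  shows "(\<exists>f' M'. is_pullback (OMod T A) M f f' M') \<and>
    (\<forall>f' M'. is_pullback (OMod T A) M f f' M' \<longrightarrow> adm_epi (kernel_cokernel_pairs (OMod T A)) M')"
proof -
  let ?C = "OMod T A"
  obtain E p G where M_eq: "M = (E, p, G)" by (cases M)
  then have p: "p \<in> extensional (carrier E)" "cb_map A E p G" "cb_quotient E p G"
    using M by (auto simp: adm_epi_iff)
  obtain D g G1 where f0: "f = (D, g, G1)" "g \<in> extensional (carrier D)" "cb_map A D g G1" using f(1) by (rule ArrE)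
  have G1: "G1 = G" using f(2) f0(1) M_eq by simp
  note f_eq = f0[unfolded G1]
  obtain P f' p' where pb: "is_pullback ?C (E, p, G) (D, g, G) (P, f', E) (P, p', D)"
    and f': "f' \<in> extensional (carrier P)" "cb_map A P f' E"
    and p': "p' \<in> extensional (carrier P)" "cb_map A P p' D" "cb_quotient P p' D"
    by (rule pullback_OMod[OF p f_eq(2,3)])
  have "adm_epi (kernel_cokernel_pairs ?C) M''" if pb'': "is_pullback ?C M f f'' M''" for f'' M''
  proof -
    have "M'' \<in> Arr ?C" "Cod ?C M'' = Dom ?C f" "Dom ?C f'' = Dom ?C M''"
      using pb'' by (simp_all add: is_pullback_def)
    then obtain p'' P'' where M'': "M'' = (P'', p'', D)" "p'' \<in> extensional (carrier P'')" "cb_map A P'' p'' D"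
      and dom: "Dom ?C f'' = P''"
      using f_eq(1) by (auto elim!: ArrE)
    have "(P, f', E) \<in> Arr ?C" "(P, p', D) \<in> Arr ?C" "Cmp ?C M (P, f', E) = Cmp ?C f (P, p', D)"
      using pb f' p' unfolding M_eq f_eq(1) by (simp_all add: is_pullback_def)
    then have "\<exists>!w. w \<in> Hom ?C (Dom ?C (P, f', E)) (Dom ?C f'') \<and> Cmp ?C f'' w = (P, f', E) \<and> Cmp ?C M'' w = (P, p', D)"
      using pb''[unfolded is_pullback_def, THEN conjunct2, THEN conjunct2, THEN conjunct2, THEN conjunct2,
        THEN conjunct2, THEN conjunct2, THEN bspec, THEN bspec, of "(P, f', E)" "(P, p', D)"]
      by (simp add: M_eq f_eq(1))
    then obtain W where W: "W \<in> Hom ?C P P''" "Cmp ?C M'' W = (P, p', D)"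
      using dom by auto
    obtain w where w: "W = (P, w, P'')" "cb_map A P w P''" using W(1) by (rule HomE)
    have "p' z = p'' (w z)" if "z \<in> carrier P" for z
      using W(2) that p'(1) unfolding w(1) M''(1) by (simp add: compose_def extensional_eq_iff)
    then have "cb_quotient P (\<lambda>z. p'' (w z)) D"
      by (rule cb_quotient_cong[OF p'(3)])
    then have "cb_quotient P'' p'' D"
      by (rule cb_quotient_of_comp[OF w(2)])
    then show ?thesis
      using M'' by (simp add: adm_epi_iff)
  qed
  then show ?thesis
    using pb unfolding M_eq f_eq(1) by blast
qed

lemma exact_structure_OMod:
  "exact_structure (OMod TYPE('u) A) (kernel_cokernel_pairs (OMod TYPE('u) A))" (is "exact_structure ?C ?E")
  unfolding exact_structure_def
proof (intro conjI ballI allI impI is_additive_OMod subset_refl iso_closed_kernel_cokernel_pairs)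
  fix E :: "('u, 'h \<Rightarrow>\<^sub>L 'h) opmod" assume "E \<in> Obj ?C"
  then have id: "cb_map A E (restrict (\<lambda>x. x) (carrier E)) E" by (simp add: cb_map_restrict cb_map_id)
  show "adm_mono ?E (Idn ?C E)"
    using id cb_embedding_left_inverse[OF id id] by (simp add: adm_mono_iff)
  show "adm_epi ?E (Idn ?C E)"
    using id cb_quotient_right_inverse[OF id] by (simp add: adm_epi_iff)
next
  fix f g assume fg: "adm_mono ?E f \<and> adm_mono ?E g \<and> Cod ?C f = Dom ?C g"
  obtain K m E where f: "f = (K, m, E)" by (cases f)
  obtain n G where g: "g = (E, n, G)" using fg f by (cases g) auto
  have mn: "cb_map A K m E" "cb_embedding K m E" "cb_map A E n G" "cb_embedding E n G"
    using fg by (simp_all add: f g adm_mono_iff)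
  have "cb_embedding K (compose (carrier K) n m) G"
    by (rule cb_embedding_cong[OF cb_map_comp[OF mn(1,3)] cb_embedding_comp[OF mn(1,2,4)]]) (simp add: compose_eq)
  then show "adm_mono ?E (Cmp ?C g f)"
    using cb_map_compose[OF mn(1,3)] by (simp add: f g adm_mono_iff)
next
  fix f g assume fg: "adm_epi ?E f \<and> adm_epi ?E g \<and> Cod ?C f = Dom ?C g"
  obtain K m E where f: "f = (K, m, E)" by (cases f)
  obtain n G where g: "g = (E, n, G)" using fg f by (cases g) auto
  have mn: "cb_map A K m E" "cb_quotient K m E" "cb_map A E n G" "cb_quotient E n G"
    using fg by (simp_all add: f g adm_epi_iff)
  have "cb_quotient K (compose (carrier K) n m) G"
    by (rule cb_quotient_cong[OF cb_quotient_comp[OF mn(2,4)]]) (simp add: compose_eq)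
  then show "adm_epi ?E (Cmp ?C g f)"
    using cb_map_compose[OF mn(1,3)] by (simp add: f g adm_epi_iff)
next
  fix M f assume *: "adm_mono ?E M \<and> f \<in> Arr ?C \<and> Dom ?C f = Dom ?C M"
  note po = pushout_adm_mono[OF conjunct1[OF *] conjunct1[OF conjunct2[OF *]] conjunct2[OF conjunct2[OF *]]]
  show "\<exists>f' M'. is_pushout ?C M f f' M'" by (rule conjunct1[OF po])
  show "adm_mono ?E M'" if "is_pushout ?C M f f' M'" for f' M'
    using conjunct2[OF po] that by blast
next
  fix M f assume *: "adm_epi ?E M \<and> f \<in> Arr ?C \<and> Cod ?C f = Cod ?C M"
  note pb = pullback_adm_epi[OF conjunct1[OF *] conjunct1[OF conjunct2[OF *]] conjunct2[OF conjunct2[OF *]]]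
  show "\<exists>f' M'. is_pullback ?C M f f' M'" by (rule conjunct1[OF pb])
  show "adm_epi ?E M'" if "is_pullback ?C M f f' M'" for f' M'
    using conjunct2[OF pb] that by blast
qed

end

theorem theorem4p4:
  fixes A :: "('h::chilbert_space \<Rightarrow>\<^sub>L 'h) set"
  assumes "operator_algebra A"
  shows "exact_structure (OMod TYPE('u) A) (kernel_cokernel_pairs (OMod TYPE('u) A))"
proof -
  obtain F where "F \<noteq> bot" "\<forall>\<^sub>F e in F. e \<in> A \<and> norm e \<le> 1" "\<forall>a\<in>A. ((\<lambda>e. a o\<^sub>L e) \<longlongrightarrow> a) F"
    using assms unfolding operator_algebra_def has_contractive_approx_identity_def by blast
  then interpret operator_algebra_with_unit A F
    using assms by unfold_locales auto
  show ?thesis by (rule exact_structure_OMod)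
qed

end
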